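(* Let $(M,g)$ be an $n$-dimensional ($n\ge3$) Riemannian manifold of constant sectional curvature $K=c$ with a spin structure, and let $0\le j\le[n/2]$. The normalized generalized gradients on the bundles $E_j$ satisfy $$\begin{aligned}\Delta_j=&D_j^2+(T_j^-)^{*}T_j^-+\left(j(n-j)-\tfrac{n(n-1)}{8}\right)c\\ =&-\frac{n-2j+1}{n-2j-1}(T_j^+)^{*}T_j^++\frac{(n-2j+2)^2}{(n-2j)^2}D_j^2+\left((j-1)(n-j+1)-\tfrac{n(n-1)}{8}\right)c\end{aligned}$$ (the second equality being omitted when a denominator vanishes, i.e. when $n-2j\in\{0,1\}$), and $$D_jT_{j-1}^+=\frac{n-2j}{n-2j+2}T_{j-1}^+D_{j-1},\quad T_{j+1}^+T_j^+=0,\quad T_{j-1}^-T_j^-=0,\quad T_{j-1}^+=(T_j^-)^{*}$$ whenever the indices are in range.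
   Context: Notation: $(x)_k$ means $x$ repeated $k$ times. For $0\le j\le[n/2]$, $W_{\delta_j}$ is the $\mathrm{Spin}(n)$-module of highest weight $((3/2)_j,(1/2)_{m-1-j})$ if $n=2m-1$, and the sum of the two irreducibles of highest weights $((3/2)_j,(1/2)_{m-j-1},\pm1/2)$ if $n=2m$ (for $j=m$: $((3/2)_{m-1},\pm3/2)$). $E_j:=\mathrm{Spin}(M)\times_{\mathrm{Spin}(n)}W_{\delta_j}$ with its Hermitian metric. $E_0$ is the spinor bundle $S_0$. $*$ is the formal adjoint and $\nabla$ the Levi-Civita covariant derivative. Composing $\nabla:\Gamma(E_j)\to\Gamma(E_j\otimes TM^{\mathbb{C}})$ with the orthogonal projections onto the components $E_{j+1}$, $E_j$, $E_{j-1}$ gives $\tilde T_j^+,\tilde D_j,\tilde T_j^-$; set $\tilde T_0^-=0$; $\tilde D_m=0,\tilde T_m^+=0$ for $n=2m$; $\tilde T_{m-1}^+=0$ for $n=2m-1$. Normalize: $$D_j:=\sqrt{\tfrac{(n+2)(n-2j)}{n-2j+2}}\,\tilde D_j,\quad T_j^-:=2\sqrt{\tfrac{(n-2j+1)(n-j+2)}{(n-2j+3)(n-2j+2)}}\,\tilde T_j^-,\quad T_j^+:=2\sqrt{\tfrac{j+1}{n-2j}}\,\tilde T_j^+$$ ($T_m^+=0$ if $n=2m$). The projections involve identifications of components with $E_{j\pm1},E_j$, determined up to unit complex factors, which are fixed as follows: $S_0\otimes\Lambda^j(T^*M^{\mathbb{C}})=\bigoplus_{k=0}^jE_k$, with $E_j$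 the kernel of the Clifford contraction $\sum_i e_i\cdot\otimes\iota_{e_i}$, and $E_{j-1}\subset S_0\otimes\Lambda^{j-1}$ embedded isometrically in $S_0\otimes\Lambda^j$ by a positive multiple of $\sum_ie_i\cdot\otimes e_i\wedge$; then $D_j$, $T_{j-1}^+$, $T_j^-$ are the blocks $E_j\to E_j$, $E_{j-1}\to E_j$, $E_j\to E_{j-1}$ of the twisted Dirac operator $\sum_k(e_k\cdot\otimes\mathrm{id})\circ\nabla_{e_k}$ on $S_0\otimes\Lambda^j(T^*M^{\mathbb{C}})$ ($e_k\cdot e_k\cdot=-1$). Standard Laplacian: $\Delta_j=\nabla^*\nabla+\frac12R_{\delta_j}$ with $R_{\delta_j}$ the curvature endomorphism; in constant curvature $c$, $\frac12R_{\delta_j}=(j(n-j+1)+\frac{n(n-1)}{8})c$. *)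

theory Defs
  imports "HOL-Analysis.Analysis"
begin

section \<open>Manifolds\<close>

fun k_smooth_on :: "nat \<Rightarrow> 'a::euclidean_space set \<Rightarrow> ('a \<Rightarrow> 'b::real_normed_vector) \<Rightarrow> bool" where
  "k_smooth_on 0 S f = continuous_on S f"
| "k_smooth_on (Suc k) S f =
     ((\<forall>x\<in>S. f differentiable (at x)) \<and> (\<forall>v. k_smooth_on k S (\<lambda>x. frechet_derivative f (at x) v)))"

text \<open>Only used for open \<open>S\<close>.\<close>

definition smooth_on :: "'a::euclidean_space set \<Rightarrow> ('a \<Rightarrow> 'b::real_normed_vector) \<Rightarrow> bool" where
  "smooth_on S f \<longleftrightarrow> (\<forall>k. k_smooth_on k S f)"

text \<open>A manifold is a type \<open>'m\<close> with an atlas of pairs (domain, coordinate map); the coordinate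
  maps are only meaningful on their domains. The dimension is \<open>CARD('n)\<close>.\<close>

type_synonym ('m, 'n) chart = "'m set \<times> ('m \<Rightarrow> real^'n)"

definition is_atlas :: "('m::topological_space, 'n::finite) chart set \<Rightarrow> bool" where
  "is_atlas A \<longleftrightarrow>
     (\<forall>(U, \<phi>)\<in>A. open U \<and> open (\<phi> ` U) \<and> homeomorphism U (\<phi> ` U) \<phi> (inv_into U \<phi>)) \<and>
     (\<Union>(U, \<phi>)\<in>A. U) = UNIV \<and>
     (\<forall>(U, \<phi>)\<in>A. \<forall>(V, \<psi>)\<in>A. smooth_on (\<phi> ` (U \<inter> V)) (\<psi> \<circ> inv_into U \<phi>))"

definition smooth_fun ::
    "('m::topological_space, 'n::finite) chart set \<Rightarrow> 'm set \<Rightarrow> ('m \<Rightarrow> 'b::real_normed_vector) \<Rightarrow> bool" where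
  "smooth_fun A W f \<longleftrightarrow> (\<forall>(U, \<phi>)\<in>A. smooth_on (\<phi> ` (U \<inter> W)) (f \<circ> inv_into U \<phi>))"

definition smooth_near ::
    "('m::topological_space, 'n::finite) chart set \<Rightarrow> 'm \<Rightarrow> ('m \<Rightarrow> real) \<Rightarrow> bool" where
  "smooth_near A p f \<longleftrightarrow> (\<exists>W. open W \<and> p \<in> W \<and> smooth_fun A W f)"

text \<open>Tangent vectors are derivations on the functions that are smooth near the base point, with the
  value \<open>0\<close> on all other functions (so that they are determined as functionals).\<close>

type_synonym 'm tangent = "('m \<Rightarrow> real) \<Rightarrow> real"
type_synonym 'm field = "'m \<Rightarrow> 'm tangent"

definition coord_tangent ::
    "('m::topological_space, 'n::finite) chart set \<Rightarrow> ('m, 'n) chart \<Rightarrow> 'm \<Rightarrow> real^'n \<Rightarrow> 'm tangent" where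
  "coord_tangent A c p v = (\<lambda>f.
     if smooth_near A p f
     then frechet_derivative (f \<circ> inv_into (fst c) (snd c)) (at (snd c p)) v else 0)"

definition tangent_space :: "('m::topological_space, 'n::finite) chart set \<Rightarrow> 'm \<Rightarrow> 'm tangent set" where
  "tangent_space A p = {coord_tangent A c p v |c v. c \<in> A \<and> p \<in> fst c}"

text \<open>Vector fields are total functions of which only the values on the open set \<open>W\<close> matter.\<close>

definition smooth_field :: "('m::topological_space, 'n::finite) chart set \<Rightarrow> 'm set \<Rightarrow> 'm field \<Rightarrow> bool" where
  "smooth_field A W X \<longleftrightarrow> (\<forall>p\<in>W. X p \<in> tangent_space A p) \<and>
     (\<forall>V f. open V \<longrightarrow> V \<subseteq> W \<longrightarrow> smooth_fun A V f \<longrightarrow> smooth_fun A V (\<lambda>p. X p f))"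

definition lie_bracket ::
    "('m::topological_space, 'n::finite) chart set \<Rightarrow> 'm field \<Rightarrow> 'm field \<Rightarrow> 'm field" where
  "lie_bracket A X Y = (\<lambda>p f. if smooth_near A p f
     then X p (\<lambda>q. Y q f) - Y p (\<lambda>q. X q f) else 0)"

definition is_riemannian_metric ::
    "('m::topological_space, 'n::finite) chart set \<Rightarrow> ('m \<Rightarrow> 'm tangent \<Rightarrow> 'm tangent \<Rightarrow> real) \<Rightarrow> bool" where
  "is_riemannian_metric A g \<longleftrightarrow>
     (\<forall>p. \<forall>X\<in>tangent_space A p. \<forall>Y\<in>tangent_space A p.
        g p X Y = g p Y X \<and>
        (\<forall>Z\<in>tangent_space A p. g p (\<lambda>f. X f + Y f) Z = g p X Z + g p Y Z) \<and>
        (\<forall>a. g p (\<lambda>f. a * X f) Y = a * g p X Y) \<and>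
        (X \<noteq> (\<lambda>f. 0) \<longrightarrow> g p X X > 0)) \<and>
     (\<forall>W X Y. open W \<longrightarrow> smooth_field A W X \<longrightarrow> smooth_field A W Y \<longrightarrow>
        smooth_fun A W (\<lambda>p. g p (X p) (Y p)))"

definition is_levi_civita ::
    "('m::topological_space, 'n::finite) chart set \<Rightarrow> ('m \<Rightarrow> 'm tangent \<Rightarrow> 'm tangent \<Rightarrow> real) \<Rightarrow>
     ('m field \<Rightarrow> 'm field \<Rightarrow> 'm field) \<Rightarrow> bool" where
  "is_levi_civita A g nab \<longleftrightarrow>
     (\<forall>W X Y Z f. open W \<longrightarrow> smooth_field A W X \<longrightarrow> smooth_field A W Y \<longrightarrow> smooth_field A W Z \<longrightarrow>
        smooth_fun A W f \<longrightarrow>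
        smooth_field A W (nab X Y) \<and>
        (\<forall>p\<in>W.
          nab (\<lambda>q u. X q u + Z q u) Y p = (\<lambda>u. nab X Y p u + nab Z Y p u) \<and>
          nab (\<lambda>q u. f q * X q u) Y p = (\<lambda>u. f p * nab X Y p u) \<and>
          nab X (\<lambda>q u. Y q u + Z q u) p = (\<lambda>u. nab X Y p u + nab X Z p u) \<and>
          nab X (\<lambda>q u. f q * Y q u) p = (\<lambda>u. X p f * Y p u + f p * nab X Y p u) \<and>
          (\<lambda>u. nab X Y p u - nab Y X p u) = lie_bracket A X Y p \<and>
          X p (\<lambda>q. g q (Y q) (Z q)) = g p (nab X Y p) (Z p) + g p (Y p) (nab X Z p)))"

definition riem_curv ::
    "('m::topological_space, 'n::finite) chart set \<Rightarrow> ('m field \<Rightarrow> 'm field \<Rightarrow> 'm field) \<Rightarrow>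
     'm field \<Rightarrow> 'm field \<Rightarrow> 'm field \<Rightarrow> 'm field" where
  "riem_curv A nab X Y Z = (\<lambda>p f.
     nab X (nab Y Z) p f - nab Y (nab X Z) p f - nab (lie_bracket A X Y) Z p f)"

definition has_constant_curvature ::
    "('m::topological_space, 'n::finite) chart set \<Rightarrow> ('m \<Rightarrow> 'm tangent \<Rightarrow> 'm tangent \<Rightarrow> real) \<Rightarrow>
     ('m field \<Rightarrow> 'm field \<Rightarrow> 'm field) \<Rightarrow> real \<Rightarrow> bool" where
  "has_constant_curvature A g nab c \<longleftrightarrow>
     (\<forall>W X Y p. open W \<longrightarrow> smooth_field A W X \<longrightarrow> smooth_field A W Y \<longrightarrow> p \<in> W \<longrightarrow>
        g p (riem_curv A nab X Y Y p) (X p)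
          = c * (g p (X p) (X p) * g p (Y p) (Y p) - (g p (X p) (Y p))\<^sup>2))"

definition is_riemannian_volume ::
    "('m::topological_space, 'n::finite) chart set \<Rightarrow> ('m \<Rightarrow> 'm tangent \<Rightarrow> 'm tangent \<Rightarrow> real) \<Rightarrow>
     'm measure \<Rightarrow> bool" where
  "is_riemannian_volume A g \<mu> \<longleftrightarrow> sets \<mu> = sets borel \<and>
     (\<forall>c\<in>A. \<forall>B\<in>sets borel. B \<subseteq> fst c \<longrightarrow>
        emeasure \<mu> B = (\<integral>\<^sup>+x. indicator (snd c ` B) x *
          (let p = inv_into (fst c) (snd c) x in
           ennreal (sqrt (det (\<chi> i k. g p (coord_tangent A c p (axis i 1)) (coord_tangent A c p (axis k 1))))))
          \<partial>lborel))"


section \<open>Spinors with values in the exterior algebra\<close>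

text \<open>\<open>\<gamma> i\<close> is Clifford multiplication by the \<open>i\<close>-th standard basis vector on the complex spinor
  space \<open>complex^'s\<close>. For odd \<open>n\<close> this allows either of the two irreducible Clifford modules; they
  agree as \<open>Spin(n)\<close>-modules.\<close>

definition is_spinor_module :: "('n::finite \<Rightarrow> complex^'s^'s::finite) \<Rightarrow> bool" where
  "is_spinor_module \<gamma> \<longleftrightarrow>
     CARD('s) = 2 ^ (CARD('n) div 2) \<and>
     (\<forall>i k. \<gamma> i ** \<gamma> k + \<gamma> k ** \<gamma> i = (if i = k then (- 2) *\<^sub>R mat 1 else 0)) \<and>
     (\<forall>i a b. \<gamma> i $ a $ b = - cnj (\<gamma> i $ b $ a))"

text \<open>The complex spin representation is faithful (also for even \<open>n\<close>, where it is the sum of the two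
  half-spin representations), so \<open>Spin(n)\<close> is the group of its matrices: even products of unit
  vectors.\<close>

definition spin_group :: "('n::finite \<Rightarrow> complex^'s^'s::finite) \<Rightarrow> (complex^'s^'s) set" where
  "spin_group \<gamma> = {foldr (\<lambda>v h. (\<Sum>i\<in>UNIV. v $ i *\<^sub>R \<gamma> i) ** h) vs (mat 1) |vs.
     even (length vs) \<and> (\<forall>v\<in>set vs. norm (v :: real^'n) = 1)}"

text \<open>The covering map onto \<open>SO(n)\<close>: \<open>h e\<^sub>k h\<inverse> = \<Sum>\<^sub>i (Ad h)\<^sub>i\<^sub>k e\<^sub>i\<close>.\<close>

definition spin_Ad :: "('n::finite \<Rightarrow> complex^'s^'s::finite) \<Rightarrow> complex^'s^'s \<Rightarrow> real^'n^'n" where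
  "spin_Ad \<gamma> h = (THE R. \<forall>k. h ** \<gamma> k = (\<Sum>i\<in>UNIV. R $ i $ k *\<^sub>R \<gamma> i) ** h)"

text \<open>An element \<open>\<phi>\<close> of \<open>S \<otimes> \<Lambda>(\<complex>\<^sup>n)\<close> is stored by its spinor coefficients: it is the sum over
  \<open>A \<subseteq> {1..n}\<close> of \<open>\<phi> $ A \<otimes> e\<^sub>A\<close>, where \<open>e\<^sub>A\<close> is the wedge product of the \<open>e\<^sub>a\<close>, \<open>a \<in> A\<close>, in increasing
  order. The norm of this type is the Hermitian norm for which the \<open>e\<^sub>A\<close> are orthonormal.
  Elements of \<open>(S \<otimes> \<Lambda>) \<otimes> \<complex>\<^sup>n\<close> are stored by their \<open>n\<close> components.\<close>

type_synonym ('n, 's) twisted = "((complex, 's) vec, 'n set) vec"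
type_synonym ('n, 's) twisted1 = "(('n, 's) twisted, 'n) vec"

definition cliff :: "('n::finite \<Rightarrow> complex^'s^'s::finite) \<Rightarrow> 'n \<Rightarrow> ('n, 's) twisted \<Rightarrow> ('n, 's) twisted" where
  "cliff \<gamma> i \<phi> = (\<chi> A. \<gamma> i *v (\<phi> $ A))"

definition ext_sign :: "'n::{finite,linorder} \<Rightarrow> 'n set \<Rightarrow> real" where
  "ext_sign i A = (- 1) ^ card {a\<in>A. a < i}"

definition ext_mult :: "'n::{finite,linorder} \<Rightarrow> ('n, 's::finite) twisted \<Rightarrow> ('n, 's) twisted" where
  "ext_mult i \<phi> = (\<chi> A. if i \<in> A then ext_sign i A *\<^sub>R \<phi> $ (A - {i}) else 0)"

definition int_mult :: "'n::{finite,linorder} \<Rightarrow> ('n, 's::finite) twisted \<Rightarrow> ('n, 's) twisted" where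
  "int_mult i \<phi> = (\<chi> A. if i \<in> A then 0 else ext_sign i A *\<^sub>R \<phi> $ (insert i A))"

definition spinor_forms :: "nat \<Rightarrow> ('n::finite, 's::finite) twisted set" where
  "spinor_forms j = {\<phi>. \<forall>A. card A \<noteq> j \<longrightarrow> \<phi> $ A = 0}"

definition cliff_contr ::
    "('n::{finite,linorder} \<Rightarrow> complex^'s^'s::finite) \<Rightarrow> ('n, 's) twisted \<Rightarrow> ('n, 's) twisted" where
  "cliff_contr \<gamma> \<phi> = (\<Sum>i\<in>UNIV. cliff \<gamma> i (int_mult i \<phi>))"

definition cliff_wedge ::
    "('n::{finite,linorder} \<Rightarrow> complex^'s^'s::finite) \<Rightarrow> ('n, 's) twisted \<Rightarrow> ('n, 's) twisted" where
  "cliff_wedge \<gamma> \<phi> = (\<Sum>i\<in>UNIV. cliff \<gamma> i (ext_mult i \<phi>))"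

definition cliff_kernel ::
    "('n::{finite,linorder} \<Rightarrow> complex^'s^'s::finite) \<Rightarrow> nat \<Rightarrow> ('n, 's) twisted set" where
  "cliff_kernel \<gamma> j = {\<phi> \<in> spinor_forms j. cliff_contr \<gamma> \<phi> = 0}"

text \<open>\<open>Spin(n)\<close> acts by \<open>h (\<psi> \<otimes> e\<^sub>a \<and> e\<^sub>b \<and> \<dots>) = h \<psi> \<otimes> Ad h e\<^sub>a \<and> Ad h e\<^sub>b \<and> \<dots>\<close>.\<close>

definition spin_act ::
    "('n::{finite,linorder} \<Rightarrow> complex^'s^'s::finite) \<Rightarrow> complex^'s^'s \<Rightarrow> ('n, 's) twisted \<Rightarrow> ('n, 's) twisted" where
  "spin_act \<gamma> h \<phi> = (\<Sum>A\<in>UNIV.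
     foldr (\<lambda>a \<psi>. \<Sum>k\<in>UNIV. spin_Ad \<gamma> h $ k $ a *\<^sub>R ext_mult k \<psi>) (sorted_list_of_set A)
       (\<chi> B. if B = {} then h *v (\<phi> $ A) else 0))"

definition spin_act1 ::
    "('n::{finite,linorder} \<Rightarrow> complex^'s^'s::finite) \<Rightarrow> complex^'s^'s \<Rightarrow> ('n, 's) twisted1 \<Rightarrow> ('n, 's) twisted1" where
  "spin_act1 \<gamma> h x = (\<chi> k. \<Sum>l\<in>UNIV. spin_Ad \<gamma> h $ k $ l *\<^sub>R spin_act \<gamma> h (x $ l))"

text \<open>The differential of \<open>spin_act\<close>, for a skew-symmetric matrix \<open>a\<close>: the element of \<open>spin(n)\<close>
  covering \<open>a\<close> is \<open>1/4 \<Sum>\<^sub>i\<^sub>k a\<^sub>k\<^sub>i e\<^sub>i e\<^sub>k\<close>.\<close>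

definition spin_lie_act ::
    "('n::{finite,linorder} \<Rightarrow> complex^'s^'s::finite) \<Rightarrow> ((real, 'n) vec, 'n) vec \<Rightarrow> ('n, 's) twisted \<Rightarrow> ('n, 's) twisted" where
  "spin_lie_act \<gamma> a \<phi> = (\<Sum>i\<in>UNIV. \<Sum>k\<in>UNIV.
     a $ k $ i *\<^sub>R ((1/4) *\<^sub>R cliff \<gamma> i (cliff \<gamma> k \<phi>) + ext_mult k (int_mult i \<phi>)))"

text \<open>The generator of \<open>so(n)\<close> with \<open>e\<^sub>i \<mapsto> e\<^sub>k\<close>, \<open>e\<^sub>k \<mapsto> - e\<^sub>i\<close>.\<close>

definition rot_gen :: "'n::finite \<Rightarrow> 'n \<Rightarrow> real^'n^'n" where
  "rot_gen i k = (\<chi> l q. (if l = k \<and> q = i then 1 else 0) - (if l = i \<and> q = k then 1 else 0))"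

definition cscale :: "complex \<Rightarrow> ('n::finite, 's::finite) twisted \<Rightarrow> ('n, 's) twisted" where
  "cscale z \<phi> = (\<chi> A. z *s (\<phi> $ A))"

definition cscale1 :: "complex \<Rightarrow> ('n::finite, 's::finite) twisted1 \<Rightarrow> ('n, 's) twisted1" where
  "cscale1 z x = (\<chi> k. cscale z (x $ k))"

definition herm :: "('n::finite, 's::finite) twisted \<Rightarrow> ('n, 's) twisted \<Rightarrow> complex" where
  "herm \<phi> \<psi> = (\<Sum>A\<in>UNIV. \<Sum>a\<in>UNIV. \<phi> $ A $ a * cnj (\<psi> $ A $ a))"

definition herm1 :: "('n::finite, 's::finite) twisted1 \<Rightarrow> ('n, 's) twisted1 \<Rightarrow> complex" where
  "herm1 x y = (\<Sum>k\<in>UNIV. herm (x $ k) (y $ k))"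

definition csubspace :: "(complex \<Rightarrow> 'v::real_vector \<Rightarrow> 'v) \<Rightarrow> 'v set \<Rightarrow> bool" where
  "csubspace sc V \<longleftrightarrow> 0 \<in> V \<and> (\<forall>x\<in>V. \<forall>y\<in>V. x + y \<in> V) \<and> (\<forall>z. \<forall>x\<in>V. sc z x \<in> V)"


section \<open>Highest weights\<close>

definition spin_invariant ::
    "('n::{finite,linorder} \<Rightarrow> complex^'s^'s::finite) \<Rightarrow> ('n, 's) twisted set \<Rightarrow> bool" where
  "spin_invariant \<gamma> V \<longleftrightarrow> csubspace cscale V \<and> (\<forall>h\<in>spin_group \<gamma>. spin_act \<gamma> h ` V \<subseteq> V)"

definition spin_irreducible ::
    "('n::{finite,linorder} \<Rightarrow> complex^'s^'s::finite) \<Rightarrow> ('n, 's) twisted set \<Rightarrow> bool" where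
  "spin_irreducible \<gamma> V \<longleftrightarrow> spin_invariant \<gamma> V \<and> V \<noteq> {0} \<and>
     (\<forall>V'. spin_invariant \<gamma> V' \<longrightarrow> V' \<subseteq> V \<longrightarrow> V' = {0} \<or> V' = V)"

text \<open>The Cartan subalgebra is spanned by the rotations of the planes \<open>(e\<^sub>1, e\<^sub>2)\<close>, \<open>(e\<^sub>3, e\<^sub>4)\<close>, \<dots>
  A weight is given by its first \<open>[n/2]\<close> entries, indexed from \<open>0\<close>.\<close>

definition is_weight_vector ::
    "('n::{finite,linorder} \<Rightarrow> complex^'s^'s::finite) \<Rightarrow> (nat \<Rightarrow> real) \<Rightarrow> ('n, 's) twisted \<Rightarrow> bool" where
  "is_weight_vector \<gamma> \<nu> v \<longleftrightarrow> v \<noteq> 0 \<and>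
     (\<forall>k < CARD('n) div 2.
        let e = sorted_list_of_set (UNIV :: 'n set) in
        spin_lie_act \<gamma> (rot_gen (e ! (2 * k)) (e ! (2 * k + 1))) v = cscale (\<i> * of_real (\<nu> k)) v)"

text \<open>For the usual positive roots \<open>\<epsilon>\<^sub>i \<plusminus> \<epsilon>\<^sub>k\<close> (\<open>i < k\<close>) and, for odd \<open>n\<close>, \<open>\<epsilon>\<^sub>i\<close>, the highest weight is
  the lexicographically largest weight.\<close>

definition has_highest_weight ::
    "('n::{finite,linorder} \<Rightarrow> complex^'s^'s::finite) \<Rightarrow> ('n, 's) twisted set \<Rightarrow> (nat \<Rightarrow> real) \<Rightarrow> bool" where
  "has_highest_weight \<gamma> V \<nu> \<longleftrightarrow> spin_irreducible \<gamma> V \<and>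
     (\<exists>v\<in>V. is_weight_vector \<gamma> \<nu> v) \<and>
     (\<forall>\<mu>. \<forall>v\<in>V. is_weight_vector \<gamma> \<mu> v \<longrightarrow>
        (\<forall>k < CARD('n) div 2. \<mu> k = \<nu> k) \<or>
        (\<exists>k < CARD('n) div 2. \<mu> k < \<nu> k \<and> (\<forall>l < k. \<mu> l = \<nu> l)))"

text \<open>\<open>((3/2)\<^sub>j, (1/2)\<^sub>r\<^sub>-\<^sub>j)\<close> with the last of the \<open>r\<close> entries multiplied by \<open>\<sigma>\<close>.\<close>

definition delta_weight :: "nat \<Rightarrow> nat \<Rightarrow> real \<Rightarrow> nat \<Rightarrow> real" where
  "delta_weight r j \<sigma> k = (if k < j then 3/2 else 1/2) * (if k = r - 1 then \<sigma> else 1)"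

definition is_delta_module ::
    "('n::{finite,linorder} \<Rightarrow> complex^'s^'s::finite) \<Rightarrow> nat \<Rightarrow> ('n, 's) twisted set \<Rightarrow> bool" where
  "is_delta_module \<gamma> j V \<longleftrightarrow>
     (let r = CARD('n) div 2 in
      if odd CARD('n) then has_highest_weight \<gamma> V (delta_weight r j 1)
      else \<exists>V1 V2. has_highest_weight \<gamma> V1 (delta_weight r j 1) \<and>
             has_highest_weight \<gamma> V2 (delta_weight r j (- 1)) \<and>
             V1 \<inter> V2 = {0} \<and> V = {x + y |x y. x \<in> V1 \<and> y \<in> V2})"


section \<open>The projections defining the generalized gradients\<close>

text \<open>For complex subspaces, orthogonality for the real inner product (the real part of the Hermitian
  one) is the same as Hermitian orthogonality.\<close>

definition orth_proj :: "'v::real_inner set \<Rightarrow> 'v \<Rightarrow> 'v" where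
  "orth_proj V x = (THE y. y \<in> V \<and> (\<forall>v\<in>V. (x - y) \<bullet> v = 0))"

definition fibre1 :: "('n::finite, 's::finite) twisted set \<Rightarrow> ('n, 's) twisted1 set" where
  "fibre1 V = {x. \<forall>k. x $ k \<in> V}"

text \<open>\<open>P\<close> is the orthogonal projection of \<open>V \<otimes> \<complex>\<^sup>n\<close> onto an invariant subspace \<open>C\<close>, followed by
  an isometric identification \<open>\<iota>\<close> of \<open>C\<close> with the \<open>Spin(n)\<close>-module \<open>V'\<close>.\<close>

definition is_component_projection ::
    "('n::{finite,linorder} \<Rightarrow> complex^'s^'s::finite) \<Rightarrow> ('n, 's) twisted set \<Rightarrow> ('n, 's) twisted set \<Rightarrow>
     (('n, 's) twisted1 \<Rightarrow> ('n, 's) twisted) \<Rightarrow> bool" where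
  "is_component_projection \<gamma> V V' P \<longleftrightarrow>
     (\<exists>C \<iota>. csubspace cscale1 C \<and> C \<subseteq> fibre1 V \<and>
        (\<forall>h\<in>spin_group \<gamma>. spin_act1 \<gamma> h ` C \<subseteq> C) \<and>
        bij_betw \<iota> C V' \<and>
        (\<forall>x\<in>C. \<forall>y\<in>C. \<iota> (x + y) = \<iota> x + \<iota> y) \<and>
        (\<forall>z. \<forall>x\<in>C. \<iota> (cscale1 z x) = cscale z (\<iota> x)) \<and>
        (\<forall>x\<in>C. norm (\<iota> x) = norm x) \<and>
        (\<forall>h\<in>spin_group \<gamma>. \<forall>x\<in>C. \<iota> (spin_act1 \<gamma> h x) = spin_act \<gamma> h (\<iota> x)) \<and>
        (\<forall>x\<in>fibre1 V. P x = \<iota> (orth_proj C x)))"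

text \<open>Principal symbol of the twisted Dirac operator: \<open>\<Sum>\<^sub>k (e\<^sub>k \<cdot> \<otimes> id)\<close> applied to the components.\<close>

definition dirac_symbol ::
    "('n::finite \<Rightarrow> complex^'s^'s::finite) \<Rightarrow> ('n, 's) twisted1 \<Rightarrow> ('n, 's) twisted" where
  "dirac_symbol \<gamma> x = (\<Sum>k\<in>UNIV. cliff \<gamma> k (x $ k))"

text \<open>The unit factors in the identifications are fixed by requiring each projection to be a positive
  multiple of (the symbol of) the corresponding block of the twisted Dirac operator. The isometric
  embedding of \<open>W\<^sub>j\<close> into \<open>S \<otimes> \<Lambda>\<^sup>j\<^sup>+\<^sup>1\<close> is a positive multiple of \<open>cliff_wedge\<close>, and that multiple is
  absorbed in \<open>r\<close>. The ranges of \<open>j\<close> are those where the target module occurs.\<close>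

definition are_gradient_projections ::
    "('n::{finite,linorder} \<Rightarrow> complex^'s^'s::finite) \<Rightarrow> (nat \<Rightarrow> ('n, 's) twisted set) \<Rightarrow>
     (nat \<Rightarrow> ('n, 's) twisted1 \<Rightarrow> ('n, 's) twisted) \<Rightarrow>
     (nat \<Rightarrow> ('n, 's) twisted1 \<Rightarrow> ('n, 's) twisted) \<Rightarrow>
     (nat \<Rightarrow> ('n, 's) twisted1 \<Rightarrow> ('n, 's) twisted) \<Rightarrow> bool" where
  "are_gradient_projections \<gamma> W P0 Pp Pm \<longleftrightarrow>
     (\<forall>j. 2 * j < CARD('n) \<longrightarrow>
        is_component_projection \<gamma> (W j) (W j) (P0 j) \<and>
        (\<exists>r>0. \<forall>x\<in>fibre1 (W j). orth_proj (W j) (dirac_symbol \<gamma> x) = r *\<^sub>R P0 j x)) \<and>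
     (\<forall>j < CARD('n) div 2.
        is_component_projection \<gamma> (W j) (W (j + 1)) (Pp j) \<and>
        (\<exists>r>0. \<forall>x\<in>fibre1 (W j).
           orth_proj (W (j + 1)) (dirac_symbol \<gamma> (\<chi> k. cliff_wedge \<gamma> (x $ k))) = r *\<^sub>R Pp j x)) \<and>
     (\<forall>j \<in> {1..CARD('n) div 2}.
        is_component_projection \<gamma> (W j) (W (j - 1)) (Pm j) \<and>
        (\<exists>r>0. \<forall>x\<in>fibre1 (W j).
           orth_proj (cliff_wedge \<gamma> ` W (j - 1)) (dirac_symbol \<gamma> x) = r *\<^sub>R cliff_wedge \<gamma> (Pm j x)))"


section \<open>Spin manifolds and associated bundles\<close>

text \<open>The bundle \<open>Spin(M)\<close> is given by local trivializations over an open cover: over \<open>cover a\<close> it has a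
  section lying over the orthonormal frame \<open>frame a\<close>, and the section over \<open>cover b\<close> is the one over
  \<open>cover a\<close> times \<open>transition a b\<close>.\<close>

record ('m, 'n, 's, 'i) spin_manifold =
  atlas :: "('m, 'n) chart set"
  metric :: "'m \<Rightarrow> 'm tangent \<Rightarrow> 'm tangent \<Rightarrow> real"
  lc :: "'m field \<Rightarrow> 'm field \<Rightarrow> 'm field"
  vol :: "'m measure"
  gam :: "'n \<Rightarrow> ((complex, 's) vec, 's) vec"
  cover :: "'i \<Rightarrow> 'm set"
  frame :: "'i \<Rightarrow> 'n \<Rightarrow> 'm field"
  transition :: "'i \<Rightarrow> 'i \<Rightarrow> 'm \<Rightarrow> ((complex, 's) vec, 's) vec"

definition is_spin_manifold ::
    "('m::{t2_space,second_countable_topology}, 'n::{finite,linorder}, 's::finite, 'i) spin_manifold \<Rightarrow> bool" where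
  "is_spin_manifold M \<longleftrightarrow>
     is_atlas (atlas M) \<and>
     is_riemannian_metric (atlas M) (metric M) \<and>
     is_levi_civita (atlas M) (metric M) (lc M) \<and>
     is_riemannian_volume (atlas M) (metric M) (vol M) \<and>
     is_spinor_module (gam M) \<and>
     (\<forall>a. open (cover M a)) \<and> (\<Union>a. cover M a) = UNIV \<and>
     (\<forall>a k. smooth_field (atlas M) (cover M a) (frame M a k)) \<and>
     (\<forall>a. \<forall>p\<in>cover M a. \<forall>i k. metric M p (frame M a i p) (frame M a k p) = (if i = k then 1 else 0)) \<and>
     (\<forall>a b. smooth_fun (atlas M) (cover M a \<inter> cover M b) (transition M a b)) \<and>
     (\<forall>a b. \<forall>p\<in>cover M a \<inter> cover M b. transition M a b p \<in> spin_group (gam M) \<and>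
        (\<forall>k. frame M b k p = (\<lambda>f. \<Sum>i\<in>UNIV. spin_Ad (gam M) (transition M a b p) $ i $ k * frame M a i p f))) \<and>
     (\<forall>a b d. \<forall>p\<in>cover M a \<inter> cover M b \<inter> cover M d.
        transition M a b p ** transition M b d p = transition M a d p)"

text \<open>The fibre of an associated bundle: carrier, \<open>Spin(n)\<close>-action and Hermitian form.\<close>

record ('s, 'v) fibre =
  fib_set :: "'v set"
  fib_act :: "((complex, 's) vec, 's) vec \<Rightarrow> 'v \<Rightarrow> 'v"
  fib_herm :: "'v \<Rightarrow> 'v \<Rightarrow> complex"

definition bundle_E ::
    "('m, 'n::{finite,linorder}, 's::finite, 'i) spin_manifold \<Rightarrow> ('n, 's) twisted set \<Rightarrow>
     ('s, ('n, 's) twisted) fibre" where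
  "bundle_E M V = \<lparr>fib_set = V, fib_act = spin_act (gam M), fib_herm = herm\<rparr>"

text \<open>The tensor product of the previous bundle with \<open>TM\<^sup>\<complex>\<close>.\<close>

definition bundle_ET ::
    "('m, 'n::{finite,linorder}, 's::finite, 'i) spin_manifold \<Rightarrow> ('n, 's) twisted set \<Rightarrow>
     ('s, ('n, 's) twisted1) fibre" where
  "bundle_ET M V = \<lparr>fib_set = fibre1 V, fib_act = spin_act1 (gam M), fib_herm = herm1\<rparr>"

text \<open>A section is given by its local expressions \<open>s a\<close> in the trivializations. They are set to \<open>0\<close>
  outside \<open>cover a\<close>, so that equality of sections is equality of functions.\<close>

definition sections ::
    "('m::topological_space, 'n::finite, 's::finite, 'i) spin_manifold \<Rightarrow> ('s, 'v::real_normed_vector) fibre \<Rightarrow>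
     ('i \<Rightarrow> 'm \<Rightarrow> 'v) set" where
  "sections M F = {s.
     (\<forall>a. \<forall>p. p \<notin> cover M a \<longrightarrow> s a p = 0) \<and>
     (\<forall>a. smooth_fun (atlas M) (cover M a) (s a)) \<and>
     (\<forall>a. \<forall>p\<in>cover M a. s a p \<in> fib_set F) \<and>
     (\<forall>a b. \<forall>p\<in>cover M a \<inter> cover M b. s a p = fib_act F (transition M a b p) (s b p))}"

definition support :: "('i \<Rightarrow> 'm::topological_space \<Rightarrow> 'v::zero) \<Rightarrow> 'm set" where
  "support s = closure {p. \<exists>a. s a p \<noteq> 0}"

text \<open>The value at \<open>p\<close> in some trivialization around \<open>p\<close>; used only inside invariant inner products.\<close>

definition value_at :: "('m, 'n, 's, 'i) spin_manifold \<Rightarrow> ('i \<Rightarrow> 'm \<Rightarrow> 'v) \<Rightarrow> 'm \<Rightarrow> 'v" where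
  "value_at M s p = s (SOME a. p \<in> cover M a) p"

definition formal_adjoint ::
    "('m::topological_space, 'n::finite, 's::finite, 'i) spin_manifold \<Rightarrow>
     ('s, 'v::real_normed_vector) fibre \<Rightarrow> ('s, 'w::real_normed_vector) fibre \<Rightarrow>
     (('i \<Rightarrow> 'm \<Rightarrow> 'v) \<Rightarrow> ('i \<Rightarrow> 'm \<Rightarrow> 'w)) \<Rightarrow> (('i \<Rightarrow> 'm \<Rightarrow> 'w) \<Rightarrow> ('i \<Rightarrow> 'm \<Rightarrow> 'v))" where
  "formal_adjoint M F G P t = (THE u. u \<in> sections M F \<and>
     (\<forall>s\<in>sections M F. compact (support s) \<longrightarrow>
        (LINT p|vol M. fib_herm G (value_at M (P s) p) (value_at M t p)) =
        (LINT p|vol M. fib_herm F (value_at M s p) (value_at M u p))))"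

definition dir_deriv :: "'m tangent \<Rightarrow> ('m \<Rightarrow> 'v::euclidean_space) \<Rightarrow> 'v" where
  "dir_deriv X f = (\<Sum>b\<in>Basis. X (\<lambda>q. f q \<bullet> b) *\<^sub>R b)"

text \<open>The covariant derivative on \<open>S\<^sub>0 \<otimes> \<Lambda>(T\<^sup>*M\<^sup>\<complex>)\<close> and its subbundles; the \<open>k\<close>-th component is the
  derivative along \<open>frame a k\<close>.\<close>

definition nabla ::
    "('m::topological_space, 'n::{finite,linorder}, 's::finite, 'i) spin_manifold \<Rightarrow>
     ('i \<Rightarrow> 'm \<Rightarrow> ('n, 's) twisted) \<Rightarrow> ('i \<Rightarrow> 'm \<Rightarrow> ('n, 's) twisted1)" where
  "nabla M s a p = (\<chi> k. if p \<in> cover M a then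
       dir_deriv (frame M a k p) (s a) +
       spin_lie_act (gam M)
         (\<chi> l i. metric M p (lc M (frame M a k) (frame M a i) p) (frame M a l p)) (s a p)
     else 0)"

text \<open>\<open>R\<^sub>\<delta> = \<Sum>\<^sub>i\<^sub>k \<rho>\<^sub>*(e\<^sub>i \<and> e\<^sub>k) \<rho>\<^sub>*(R(e\<^sub>i, e\<^sub>k))\<close>, where \<open>e\<^sub>i \<and> e\<^sub>k\<close> denotes \<open>rot_gen i k\<close> and \<open>\<rho>\<^sub>*\<close> the
  representation of \<open>so(n)\<close>, so that \<open>\<rho>\<^sub>*(R(e\<^sub>i, e\<^sub>k))\<close> is the curvature of the bundle; for spinors this is a quarter of
  the scalar curvature.\<close>

definition curv_endo ::
    "('m::topological_space, 'n::{finite,linorder}, 's::finite, 'i) spin_manifold \<Rightarrow>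
     ('i \<Rightarrow> 'm \<Rightarrow> ('n, 's) twisted) \<Rightarrow> ('i \<Rightarrow> 'm \<Rightarrow> ('n, 's) twisted)" where
  "curv_endo M s a p = (\<Sum>i\<in>UNIV. \<Sum>k\<in>UNIV.
     spin_lie_act (gam M) (rot_gen i k)
       (spin_lie_act (gam M)
         (\<chi> l q. metric M p
            (riem_curv (atlas M) (lc M) (frame M a i) (frame M a k) (frame M a q) p) (frame M a l p))
         (s a p)))"

definition std_laplacian ::
    "('m::topological_space, 'n::{finite,linorder}, 's::finite, 'i) spin_manifold \<Rightarrow>
     (nat \<Rightarrow> ('n, 's) twisted set) \<Rightarrow> nat \<Rightarrow>
     ('i \<Rightarrow> 'm \<Rightarrow> ('n, 's) twisted) \<Rightarrow> ('i \<Rightarrow> 'm \<Rightarrow> ('n, 's) twisted)" where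
  "std_laplacian M W j s a p =
     formal_adjoint M (bundle_E M (W j)) (bundle_ET M (W j)) (nabla M) (nabla M s) a p
     + (1/2) *\<^sub>R curv_endo M s a p"


section \<open>The normalized generalized gradients\<close>

definition grad_D ::
    "('m::topological_space, 'n::{finite,linorder}, 's::finite, 'i) spin_manifold \<Rightarrow>
     (nat \<Rightarrow> ('n, 's) twisted1 \<Rightarrow> ('n, 's) twisted) \<Rightarrow> nat \<Rightarrow>
     ('i \<Rightarrow> 'm \<Rightarrow> ('n, 's) twisted) \<Rightarrow> ('i \<Rightarrow> 'm \<Rightarrow> ('n, 's) twisted)" where
  "grad_D M P0 j s a p =
     (let n = real CARD('n); x = real j in
      if 2 * j = CARD('n) then 0
      else sqrt ((n + 2) * (n - 2*x) / (n - 2*x + 2)) *\<^sub>R P0 j (nabla M s a p))"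

definition grad_Tm ::
    "('m::topological_space, 'n::{finite,linorder}, 's::finite, 'i) spin_manifold \<Rightarrow>
     (nat \<Rightarrow> ('n, 's) twisted1 \<Rightarrow> ('n, 's) twisted) \<Rightarrow> nat \<Rightarrow>
     ('i \<Rightarrow> 'm \<Rightarrow> ('n, 's) twisted) \<Rightarrow> ('i \<Rightarrow> 'm \<Rightarrow> ('n, 's) twisted)" where
  "grad_Tm M Pm j s a p =
     (let n = real CARD('n); x = real j in
      if j = 0 then 0
      else (2 * sqrt ((n - 2*x + 1) * (n - x + 2) / ((n - 2*x + 3) * (n - 2*x + 2)))) *\<^sub>R
             Pm j (nabla M s a p))"

definition grad_Tp ::
    "('m::topological_space, 'n::{finite,linorder}, 's::finite, 'i) spin_manifold \<Rightarrow>
     (nat \<Rightarrow> ('n, 's) twisted1 \<Rightarrow> ('n, 's) twisted) \<Rightarrow> nat \<Rightarrow>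
     ('i \<Rightarrow> 'm \<Rightarrow> ('n, 's) twisted) \<Rightarrow> ('i \<Rightarrow> 'm \<Rightarrow> ('n, 's) twisted)" where
  "grad_Tp M Pp j s a p =
     (let n = real CARD('n); x = real j in
      if j = CARD('n) div 2 then 0
      else (2 * sqrt ((x + 1) / (n - 2*x))) *\<^sub>R Pp j (nabla M s a p))"

end

theory Submission
  imports Defs
begin

text \<open>Write \<open>\<nabla>\<^sup>2\<^sub>l\<^sub>,\<^sub>k s\<close> for the second covariant derivative in a local orthonormal frame. Pairing a
  projection with its adjoint shows that the normalized gradients have the explicit symbols
  \<open>\<Sum>\<^sub>k e\<^sub>k \<cdot> x\<^sub>k\<close>, \<open>2 / sqrt (n - 2j + 2) \<Sum>\<^sub>k \<iota>\<^sub>k x\<^sub>k\<close> and \<open>- 2 / sqrt (n - 2j) \<Sum>\<^sub>k e\<^sub>k \<and> x\<^sub>k\<close>, each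
  followed by the projection to the kernel of the Clifford contraction. Composing two of them gives
  quadratic expressions in Clifford, exterior and interior multiplications applied to \<open>\<nabla>\<^sup>2 s\<close>. The
  part symmetric in \<open>l, k\<close> is handled by the (anti)commutation relations, and the skew part is, by the
  Ricci identity, the action of \<open>- c\<close> times the rotation generators on \<open>s\<close>, which these relations
  evaluate as well. The formal adjoints follow from the vanishing of the integral of a compactly
  supported divergence: \<open>\<nabla>\<^sup>*\<nabla> s = - \<Sum>\<^sub>k \<nabla>\<^sup>2\<^sub>k\<^sub>,\<^sub>k s\<close>, and the symbols of \<open>T\<^sub>j\<^sup>-\<close> and \<open>- T\<^sub>j\<^sub>-\<^sub>1\<^sup>+\<close> are adjoint to
  each other.\<close>

section \<open>Calculus of smooth functions\<close>

text \<open>The projections are given only up to an unknown positive factor; it is recovered from an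
  explicit adjoint, since a component projection composed with its own adjoint is the identity.
  Pointwise algebra rests on \<open>Wed\<close> being minus the adjoint of \<open>Con\<close>: an
  equation in \<open>Ker j\<close> is tested against elements of \<open>Ker j\<close>, and every
  term \<open>Wed y\<close> disappears once commutators have moved \<open>Wed\<close> outside. All
  denominators stem from \<open>Con (Wed x) = - (n - 2 j) x\<close> on \<open>Ker j\<close>. On the
  manifold there are two obstacles. The connection lives on frames while transition functions take
  values in the spin group, so the derivative of a spin-valued function must be recovered from that
  of its rotations; the even real Clifford algebra makes this possible. And
  \<open>formal_adjoint\<close> is a definite description over smooth sections, so each candidate
  must be a smooth section independent of the trivialization. For the trace of the second derivative
  this is read off from the first Weitzenboeck formula, which writes it through gradients already
  known to be sections. The volume is known only in charts, so the divergence theorem is reduced to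
  Lebesgue measure by a coordinate formula for the divergence.\<close>

lemma k_smooth_on_cong:
  assumes "open S" "\<And>x. x \<in> S \<Longrightarrow> f x = g x"
  shows "k_smooth_on k S f \<longleftrightarrow> k_smooth_on k S g"
  using assms(2)
proof (induction k arbitrary: f g)
  case 0
  then show ?case by (simp cong: continuous_on_cong)
next
  case (Suc k)
  have d: "f differentiable (at x) \<longleftrightarrow> g differentiable (at x)" if "x \<in> S" for x
    using has_derivative_transform_within_open[OF _ assms(1) that] Suc.prems
    unfolding differentiable_def by metis
  have "frechet_derivative f (at x) v = frechet_derivative g (at x) v"
    if "x \<in> S" for x v
  proof (cases "f differentiable (at x)")
    case True
    then show ?thesis
      using frechet_derivative_transform_within_open[OF True assms(1) that] Suc.prems by metis
  next
    \<comment> \<open>Where neither function is differentiable, \<open>frechet_derivative\<close> is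
      a choice from the same empty predicate, so the two values still agree.\<close>
    case False
    then have "\<not> g differentiable (at x)" using d that by blast
    with False show ?thesis unfolding frechet_derivative_def differentiable_def by simp
  qed
  then have "k_smooth_on k S (\<lambda>x. frechet_derivative f (at x) v) \<longleftrightarrow>
      k_smooth_on k S (\<lambda>x. frechet_derivative g (at x) v)" for v
    by (rule Suc.IH)
  then show ?case unfolding k_smooth_on.simps
    by (intro arg_cong2[where f = "(\<and>)"] ball_cong refl arg_cong[where f = All] ext d) auto
qed

lemma k_smooth_on_subset: "k_smooth_on k S f \<Longrightarrow> T \<subseteq> S \<Longrightarrow> k_smooth_on k T f"
  by (induction k arbitrary: f) (auto intro: continuous_on_subset)

lemma k_smooth_on_continuous: "k_smooth_on k S f \<Longrightarrow> continuous_on S f"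
  by (cases k) (auto simp: continuous_at_imp_continuous_on differentiable_imp_continuous_within)

lemma k_smooth_on_le: "k_smooth_on k S f \<Longrightarrow> l \<le> k \<Longrightarrow> k_smooth_on l S f"
proof (induction l arbitrary: f k)
  case 0
  then show ?case using k_smooth_on_continuous by simp
next
  case (Suc l)
  then obtain k' where "k = Suc k'" "l \<le> k'" using Suc_le_D by force
  with Suc show ?case by auto
qed

lemma k_smooth_on_local:
  assumes "\<And>x. x \<in> S \<Longrightarrow> \<exists>T. open T \<and> x \<in> T \<and> k_smooth_on k T f"
  shows "k_smooth_on k S f"
  using assms
proof (induction k arbitrary: f)
  case 0
  then show ?case
    by (metis at_within_open continuous_at_imp_continuous_on continuous_on_eq_continuous_within
        k_smooth_on.simps(1))
next
  case (Suc k)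
  have "k_smooth_on k S (\<lambda>x. frechet_derivative f (at x) v)" for v
    using Suc.prems by (intro Suc.IH) (metis k_smooth_on.simps(2))
  then show ?case using Suc.prems by (metis k_smooth_on.simps(2))
qed

lemma k_smooth_on_const [simp]: "k_smooth_on k S (\<lambda>x. c)"
  by (induction k arbitrary: c) auto

lemma k_smooth_on_add:
  "k_smooth_on k S f \<Longrightarrow> k_smooth_on k S g \<Longrightarrow> open S \<Longrightarrow> k_smooth_on k S (\<lambda>x. f x + g x)"
proof (induction k arbitrary: f g)
  case 0
  then show ?case by (auto intro: continuous_intros)
next
  case (Suc k)
  have D: "((\<lambda>x. f x + g x) has_derivative
      (\<lambda>v. frechet_derivative f (at x) v + frechet_derivative g (at x) v)) (at x)" if "x \<in> S" for x
    using Suc.prems that by (intro has_derivative_add) (auto simp: frechet_derivative_works[symmetric])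
  have "k_smooth_on k S (\<lambda>x. frechet_derivative (\<lambda>x. f x + g x) (at x) v)" for v
  proof (subst k_smooth_on_cong[OF Suc.prems(3), where g = "\<lambda>x. frechet_derivative f (at x) v + frechet_derivative g (at x) v"])
    show "frechet_derivative (\<lambda>x. f x + g x) (at x) v =
        frechet_derivative f (at x) v + frechet_derivative g (at x) v" if "x \<in> S" for x
      using frechet_derivative_at[OF D[OF that]] by metis
    show "k_smooth_on k S (\<lambda>x. frechet_derivative f (at x) v + frechet_derivative g (at x) v)"
      using Suc by auto
  qed
  moreover have "(\<lambda>x. f x + g x) differentiable (at x)" if "x \<in> S" for x
    using D[OF that] unfolding differentiable_def by blast
  ultimately show ?case by simp
qed

lemma k_smooth_on_bilinear:
  assumes "bounded_bilinear B" and "open S"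
  shows "k_smooth_on k S f \<Longrightarrow> k_smooth_on k S g \<Longrightarrow> k_smooth_on k S (\<lambda>x. B (f x) (g x))"
proof (induction k arbitrary: f g)
  case 0
  then show ?case using bounded_bilinear.continuous_on[OF assms(1)] by auto
next
  case (Suc k)
  have D: "((\<lambda>x. B (f x) (g x)) has_derivative
      (\<lambda>v. B (f x) (frechet_derivative g (at x) v) + B (frechet_derivative f (at x) v) (g x))) (at x)"
    if "x \<in> S" for x
    using Suc.prems that by (intro bounded_bilinear.FDERIV[OF assms(1)]) (auto simp: frechet_derivative_works[symmetric])
  have "k_smooth_on k S (\<lambda>x. frechet_derivative (\<lambda>x. B (f x) (g x)) (at x) v)" for v
  proof (subst k_smooth_on_cong[OF assms(2), where g = "\<lambda>x. B (f x) (frechet_derivative g (at x) v) + B (frechet_derivative f (at x) v) (g x)"])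
    show "frechet_derivative (\<lambda>x. B (f x) (g x)) (at x) v =
        B (f x) (frechet_derivative g (at x) v) + B (frechet_derivative f (at x) v) (g x)" if "x \<in> S" for x
      using frechet_derivative_at[OF D[OF that]] by metis
    show "k_smooth_on k S (\<lambda>x. B (f x) (frechet_derivative g (at x) v) + B (frechet_derivative f (at x) v) (g x))"
      using Suc.prems k_smooth_on_le[OF Suc.prems(1), of k] k_smooth_on_le[OF Suc.prems(2), of k]
      by (intro k_smooth_on_add Suc.IH assms(2)) auto
  qed
  moreover have "(\<lambda>x. B (f x) (g x)) differentiable (at x)" if "x \<in> S" for x
    using D[OF that] unfolding differentiable_def by blast
  ultimately show ?case by simp
qed

lemma k_smooth_on_linear:
  assumes "bounded_linear L" and "open S"
  shows "k_smooth_on k S f \<Longrightarrow> k_smooth_on k S (\<lambda>x. L (f x))"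
proof (induction k arbitrary: f)
  case 0
  then show ?case using bounded_linear.continuous_on[OF assms(1)] by auto
next
  case (Suc k)
  have D: "((\<lambda>x. L (f x)) has_derivative (\<lambda>v. L (frechet_derivative f (at x) v))) (at x)"
    if "x \<in> S" for x
    using Suc.prems that by (intro bounded_linear.has_derivative[OF assms(1)]) (auto simp: frechet_derivative_works[symmetric])
  have "k_smooth_on k S (\<lambda>x. frechet_derivative (\<lambda>x. L (f x)) (at x) v)" for v
  proof (subst k_smooth_on_cong[OF assms(2), where g = "\<lambda>x. L (frechet_derivative f (at x) v)"])
    show "frechet_derivative (\<lambda>x. L (f x)) (at x) v = L (frechet_derivative f (at x) v)" if "x \<in> S" for x
      using frechet_derivative_at[OF D[OF that]] by metis
    show "k_smooth_on k S (\<lambda>x. L (frechet_derivative f (at x) v))" using Suc by auto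
  qed
  moreover have "(\<lambda>x. L (f x)) differentiable (at x)" if "x \<in> S" for x
    using D[OF that] unfolding differentiable_def by blast
  ultimately show ?case by simp
qed

lemma k_smooth_on_sum:
  assumes "open S" "\<And>i. i \<in> I \<Longrightarrow> k_smooth_on k S (f i)"
  shows "k_smooth_on k S (\<lambda>x. \<Sum>i\<in>I. f i x)"
proof (cases "finite I")
  case True
  then show ?thesis using assms(2)
    by (induction I rule: finite_induct) (auto intro: k_smooth_on_add assms(1))
qed simp

text \<open>\<open>k_smooth_on\<close> differentiates along fixed vectors, but the chain rule
  produces a direction that depends on the point. Expanding in the basis moves that dependence into
  scalar coefficients.\<close>

lemma linear_frechet_derivative_Basis:
  fixes f :: "'a::euclidean_space \<Rightarrow> 'b::real_normed_vector"
  assumes "f differentiable (at x)"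
  shows "frechet_derivative f (at x) w = (\<Sum>b\<in>Basis. (w \<bullet> b) *\<^sub>R frechet_derivative f (at x) b)"
proof -
  have "linear (frechet_derivative f (at x))"
    using assms linear_frechet_derivative by blast
  then show ?thesis
    by (subst euclidean_representation[of w, symmetric]) (simp add: linear_sum linear_scale)
qed

lemma k_smooth_on_compose:
  fixes h :: "'a::euclidean_space \<Rightarrow> 'b::euclidean_space" and f :: "'b \<Rightarrow> 'c::real_normed_vector"
  assumes "open S" "open T" "h ` S \<subseteq> T" and "k_smooth_on k S h"
  shows "k_smooth_on k T f \<Longrightarrow> k_smooth_on k S (\<lambda>x. f (h x))"
  using assms(4)
proof (induction k arbitrary: f)
  case 0
  then show ?case using assms continuous_on_compose2 by fastforce
next
  case (Suc k)
  have hT: "h x \<in> T" if "x \<in> S" for x using assms(3) that by blast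
  have D: "((\<lambda>x. f (h x)) has_derivative
      (\<lambda>v. frechet_derivative f (at (h x)) (frechet_derivative h (at x) v))) (at x)"
    if "x \<in> S" for x
    using Suc.prems that hT[OF that]
    by (intro has_derivative_compose[of h _ x UNIV f]) (auto simp: frechet_derivative_works[symmetric])
  have "k_smooth_on k S (\<lambda>x. frechet_derivative (\<lambda>x. f (h x)) (at x) v)" for v
  proof (subst k_smooth_on_cong[OF assms(1), where g = "\<lambda>x. \<Sum>b\<in>Basis.
        (frechet_derivative h (at x) v \<bullet> b) *\<^sub>R frechet_derivative f (at (h x)) b"])
    show "frechet_derivative (\<lambda>x. f (h x)) (at x) v = (\<Sum>b\<in>Basis.
        (frechet_derivative h (at x) v \<bullet> b) *\<^sub>R frechet_derivative f (at (h x)) b)" if "x \<in> S" for x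
      using frechet_derivative_at[OF D[OF that]] linear_frechet_derivative_Basis Suc.prems(1) hT[OF that]
      by (metis k_smooth_on.simps(2))
    show "k_smooth_on k S (\<lambda>x. \<Sum>b\<in>Basis.
        (frechet_derivative h (at x) v \<bullet> b) *\<^sub>R frechet_derivative f (at (h x)) b)"
      using Suc.prems k_smooth_on_le[OF Suc.prems(2), of k]
      by (intro k_smooth_on_sum assms(1) k_smooth_on_bilinear[OF bounded_bilinear_scaleR]
          k_smooth_on_linear[OF bounded_linear_inner_left] Suc.IH) auto
  qed
  moreover have "(\<lambda>x. f (h x)) differentiable (at x)" if "x \<in> S" for x
    using D[OF that] unfolding differentiable_def by blast
  ultimately show ?case by simp
qed

lemma smooth_on_cong: "open S \<Longrightarrow> (\<And>x. x \<in> S \<Longrightarrow> f x = g x) \<Longrightarrow> smooth_on S f \<longleftrightarrow> smooth_on S g"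
  unfolding smooth_on_def using k_smooth_on_cong by blast

lemma smooth_on_subset: "smooth_on S f \<Longrightarrow> T \<subseteq> S \<Longrightarrow> smooth_on T f"
  unfolding smooth_on_def using k_smooth_on_subset by blast

lemma smooth_on_local:
  "(\<And>x. x \<in> S \<Longrightarrow> \<exists>T. open T \<and> x \<in> T \<and> smooth_on T f) \<Longrightarrow> smooth_on S f"
  unfolding smooth_on_def using k_smooth_on_local by metis

lemma smooth_on_const [simp]: "smooth_on S (\<lambda>x. c)"
  by (simp add: smooth_on_def)

lemma smooth_on_bilinear:
  "bounded_bilinear B \<Longrightarrow> open S \<Longrightarrow> smooth_on S f \<Longrightarrow> smooth_on S g \<Longrightarrow> smooth_on S (\<lambda>x. B (f x) (g x))"
  unfolding smooth_on_def using k_smooth_on_bilinear by blast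

lemma smooth_on_linear:
  "bounded_linear L \<Longrightarrow> open S \<Longrightarrow> smooth_on S f \<Longrightarrow> smooth_on S (\<lambda>x. L (f x))"
  unfolding smooth_on_def using k_smooth_on_linear by blast

lemma smooth_on_add: "open S \<Longrightarrow> smooth_on S f \<Longrightarrow> smooth_on S g \<Longrightarrow> smooth_on S (\<lambda>x. f x + g x)"
  unfolding smooth_on_def using k_smooth_on_add by blast

lemma smooth_on_compose:
  fixes h :: "'a::euclidean_space \<Rightarrow> 'b::euclidean_space"
  shows "open S \<Longrightarrow> open T \<Longrightarrow> h ` S \<subseteq> T \<Longrightarrow> smooth_on S h \<Longrightarrow> smooth_on T f \<Longrightarrow> smooth_on S (\<lambda>x. f (h x))"
  unfolding smooth_on_def using k_smooth_on_compose by blast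

lemma smooth_on_continuous: "smooth_on S f \<Longrightarrow> continuous_on S f"
  unfolding smooth_on_def using k_smooth_on_continuous by blast

lemma smooth_on_differentiable: "smooth_on S f \<Longrightarrow> x \<in> S \<Longrightarrow> f differentiable (at x)"
  unfolding smooth_on_def by (metis k_smooth_on.simps(2))

lemma smooth_on_derivative: "smooth_on S f \<Longrightarrow> smooth_on S (\<lambda>x. frechet_derivative f (at x) v)"
  unfolding smooth_on_def by (metis k_smooth_on.simps(2))

lemma smooth_on_has_derivative:
  "smooth_on S f \<Longrightarrow> x \<in> S \<Longrightarrow> (f has_derivative frechet_derivative f (at x)) (at x)"
  using smooth_on_differentiable frechet_derivative_works by blast

lemma smooth_on_ident: "smooth_on S (\<lambda>x. x)"
  unfolding smooth_on_def
proof
  fix k show "k_smooth_on k S (\<lambda>x. x)" by (cases k) auto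
qed

text \<open>The derivative is \<open>- inverse x * v * inverse x\<close>, a product of the function
  with itself, so the induction on the order closes.\<close>

lemma smooth_on_inverse: "smooth_on (- {0}) (inverse :: real \<Rightarrow> real)"
  unfolding smooth_on_def
proof
  have o: "open (- {0::real})" by auto
  have D: "(inverse has_derivative (\<lambda>v. - (inverse x * v * inverse x))) (at x)" if "x \<noteq> 0" for x :: real
    using that by (rule has_derivative_inverse')
  fix k show "k_smooth_on k (- {0}) (inverse :: real \<Rightarrow> real)"
  proof (induction k)
    case 0
    then show ?case by (auto intro: continuous_intros)
  next
    case (Suc k)
    have "k_smooth_on k (- {0}) (\<lambda>x::real. frechet_derivative inverse (at x) v)" for v
    proof (subst k_smooth_on_cong[OF o, where g = "\<lambda>x. - ((inverse x * v) * inverse x)"])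
      show "frechet_derivative inverse (at x) v = - (inverse x * v * inverse x)" if "x \<in> - {0}" for x :: real
        using frechet_derivative_at[OF D, of x] that by (metis Compl_iff singletonI)
      show "k_smooth_on k (- {0}) (\<lambda>x::real. - (inverse x * v * inverse x))"
        by (intro k_smooth_on_linear[OF bounded_linear_minus[OF bounded_linear_ident]]
            k_smooth_on_bilinear[OF bounded_bilinear_mult] o Suc k_smooth_on_const)
    qed
    then show ?case using D by (auto simp: differentiable_def)
  qed
qed

text \<open>The functions \<open>p(1/x) exp(-1/x)\<close>, extended by \<open>0\<close> to \<open>x \<le> 0\<close>, are closed under differentiation.\<close>

definition flat_exp :: "real poly \<Rightarrow> real \<Rightarrow> real" where
  "flat_exp p x = (if x > 0 then poly p (inverse x) * exp (- inverse x) else 0)"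

lemma flat_exp_tendsto_0: "((\<lambda>x. poly p (inverse x) * exp (- inverse x)) \<longlongrightarrow> 0) (at_right (0::real))"
proof -
  have "((\<lambda>y. poly p y * exp (- y)) \<longlongrightarrow> 0) at_top" for p :: "real poly"
  proof (induction p)
    case (pCons a p)
    have "((\<lambda>y. a * exp (- y) + (\<Sum>i\<le>degree p. coeff p i * (y ^ Suc i / exp y))) \<longlongrightarrow> 0 + (\<Sum>i\<le>degree p. coeff p i * 0)) at_top"
      by (intro tendsto_add tendsto_sum tendsto_mult tendsto_const tendsto_power_div_exp_0
          tendsto_mult_right_zero filterlim_compose[OF exp_at_bot] filterlim_uminus_at_bot_at_top)
    moreover have "a * exp (- y) + (\<Sum>i\<le>degree p. coeff p i * (y ^ Suc i / exp y)) = poly (pCons a p) y * exp (- y)" for y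
      by (simp add: poly_altdef[of p] sum_distrib_left sum_distrib_right algebra_simps exp_minus divide_inverse)
    ultimately show ?case by simp
  qed simp
  then show ?thesis
    by (rule filterlim_compose[OF _ filterlim_inverse_at_top_right])
qed

text \<open>With \<open>y = 1/x\<close> the derivative of \<open>p(y) exp(-y)\<close> is
  \<open>y^2 (p - p')(y) exp(-y)\<close>; the two \<open>pCons 0\<close> are the factor
  \<open>y^2\<close>, coming from \<open>dy/dx = - y^2\<close>.\<close>

lemma flat_exp_deriv:
  "(flat_exp p has_real_derivative flat_exp (pCons 0 (pCons 0 (p - pderiv p))) x) (at x)"
proof -
  consider "x > 0" | "x < 0" | "x = 0" by linarith
  then show ?thesis
  proof cases
    case 1
    have "((\<lambda>x. poly p (inverse x) * exp (- inverse x)) has_real_derivative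
        flat_exp (pCons 0 (pCons 0 (p - pderiv p))) x) (at x)"
      using 1 by (auto intro!: derivative_eq_intros DERIV_chain2[OF poly_DERIV]
          simp: flat_exp_def power2_eq_square algebra_simps)
    then show ?thesis
      by (rule DERIV_cong_ev[THEN iffD1, OF refl _ refl, rotated])
        (use 1 in \<open>auto simp: flat_exp_def eventually_nhds intro!: exI[of _ "{0<..}"]\<close>)
  next
    case 2
    have "((\<lambda>x. 0) has_real_derivative flat_exp (pCons 0 (pCons 0 (p - pderiv p))) x) (at x)"
      using 2 by (simp add: flat_exp_def)
    then show ?thesis
      by (rule DERIV_cong_ev[THEN iffD1, OF refl _ refl, rotated])
        (use 2 in \<open>auto simp: flat_exp_def eventually_nhds intro!: exI[of _ "{..<0}"]\<close>)
  next
    \<comment> \<open>On the right the division by \<open>h\<close> is absorbed by the polynomial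
      \<open>pCons 0 p\<close>, so the difference quotient is again of the form that tends to
      zero.\<close>
    case 3
    have "((\<lambda>h. flat_exp p h / h) \<longlongrightarrow> 0) (at_right 0)"
      using flat_exp_tendsto_0[of "pCons 0 p"]
      by (rule Lim_transform_eventually) (auto simp: eventually_at_right_field flat_exp_def divide_inverse mult_ac intro!: exI[of _ 1])
    moreover have "((\<lambda>h. flat_exp p h / h) \<longlongrightarrow> 0) (at_left 0)"
      by (rule Lim_transform_eventually[OF tendsto_const]) (auto simp: eventually_at_left_field flat_exp_def intro!: exI[of _ "-1"])
    ultimately have "((\<lambda>h. flat_exp p h / h) \<longlongrightarrow> 0) (at 0)"
      using filterlim_split_at by blast
    then show ?thesis using 3 by (simp add: DERIV_def flat_exp_def)
  qed
qed

lemma smooth_on_flat_exp: "smooth_on UNIV (flat_exp p)"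
  unfolding smooth_on_def
proof
  fix k show "k_smooth_on k UNIV (flat_exp p)"
  proof (induction k arbitrary: p)
    case 0
    have "isCont (flat_exp p) x" for x using flat_exp_deriv DERIV_isCont by blast
    then show ?case by (simp add: continuous_at_imp_continuous_on)
  next
    case (Suc k)
    let ?q = "pCons 0 (pCons 0 (p - pderiv p))"
    have D: "(flat_exp p has_derivative (\<lambda>v. v * flat_exp ?q x)) (at x)" for x
      using flat_exp_deriv[of p x] unfolding has_field_derivative_def
      by (rule has_derivative_eq_rhs) (auto simp: mult.commute)
    have "frechet_derivative (flat_exp p) (at x) v = v * flat_exp ?q x" for x v
      using frechet_derivative_at[OF D] by metis
    moreover have "k_smooth_on k UNIV (\<lambda>x. v * flat_exp ?q x)" for v
      by (intro k_smooth_on_bilinear[OF bounded_bilinear_mult] Suc k_smooth_on_const) auto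
    moreover have "flat_exp p differentiable (at x)" for x
      using D[of x] unfolding differentiable_def by blast
    ultimately show ?case by simp
  qed
qed

text \<open>The quotient \<open>e(u) / (e(u) + e(w))\<close>, with \<open>u\<close> positive exactly
  inside radius \<open>2 d\<close> and \<open>w\<close> positive exactly outside radius
  \<open>d\<close>. One of the two is always positive, so the denominator never vanishes.\<close>

lemma smooth_bump_exists:
  fixes x :: "'a::euclidean_space"
  assumes "0 < d"
  obtains f :: "'a \<Rightarrow> real" where "smooth_on UNIV f" "\<And>y. 0 \<le> f y"
    "\<And>y. dist x y \<ge> 2 * d \<Longrightarrow> f y = 0" "\<And>y. dist x y \<le> d \<Longrightarrow> f y = 1"
proof -
  define e where "e = flat_exp 1"
  have e: "e t > 0 \<longleftrightarrow> t > 0" "e t \<ge> 0" "e t = 0 \<longleftrightarrow> t \<le> 0" for t by (auto simp: e_def flat_exp_def)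
  define u where "u = (\<lambda>y. 4 * d\<^sup>2 - (x - y) \<bullet> (x - y))"
  define w where "w = (\<lambda>y. (x - y) \<bullet> (x - y) - d\<^sup>2)"
  define f where "f = (\<lambda>y. e (u y) * inverse (e (u y) + e (w y)))"
  have dd: "(x - y) \<bullet> (x - y) = (dist x y)\<^sup>2" for y by (simp add: dist_norm power2_norm_eq_inner)
  have pos: "e (u y) + e (w y) > 0" for y
  proof (cases "u y > 0")
    case False
    then have "(dist x y)\<^sup>2 \<ge> 4 * d\<^sup>2" by (simp add: u_def dd)
    moreover have "d\<^sup>2 > 0" using assms by simp
    ultimately have "w y > 0" unfolding w_def dd by linarith
    then show ?thesis using e by (simp add: add_nonneg_pos)
  qed (use e in \<open>simp add: add_pos_nonneg\<close>)
  have sq: "smooth_on UNIV (\<lambda>y. (x - y) \<bullet> (x - y))"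
  proof -
    have "smooth_on UNIV (\<lambda>y. x + - y)"
      by (intro smooth_on_add smooth_on_linear[OF bounded_linear_minus[OF bounded_linear_ident]] smooth_on_ident) auto
    then have "smooth_on UNIV (\<lambda>y. x - y)" by simp
    then show ?thesis by (intro smooth_on_bilinear[OF bounded_bilinear_inner]) auto
  qed
  have su: "smooth_on UNIV u"
  proof -
    have "smooth_on UNIV (\<lambda>y. 4 * d\<^sup>2 + - ((x - y) \<bullet> (x - y)))"
      by (intro smooth_on_add smooth_on_linear[OF bounded_linear_minus[OF bounded_linear_ident]] sq) auto
    then show ?thesis by (simp add: u_def)
  qed
  have sw: "smooth_on UNIV w"
  proof -
    have "smooth_on UNIV (\<lambda>y. ((x - y) \<bullet> (x - y)) + - d\<^sup>2)" by (intro smooth_on_add sq) auto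
    then show ?thesis by (simp add: w_def)
  qed
  have se: "smooth_on UNIV (\<lambda>y. e (u y))" "smooth_on UNIV (\<lambda>y. e (w y))"
    unfolding e_def by (intro smooth_on_compose[OF _ _ _ _ smooth_on_flat_exp] su sw; auto)+
  have "smooth_on UNIV f" unfolding f_def
  proof (intro smooth_on_bilinear[OF bounded_bilinear_mult] se)
    show "smooth_on UNIV (\<lambda>y. inverse (e (u y) + e (w y)))"
      using pos by (intro smooth_on_compose[OF _ _ _ _ smooth_on_inverse] smooth_on_add se)
        (auto simp: less_le)
  qed auto
  moreover have "f y = 0" if "dist x y \<ge> 2 * d" for y
  proof -
    have "(dist x y)\<^sup>2 \<ge> (2 * d)\<^sup>2" using that assms by (intro power_mono) auto
    then have "u y \<le> 0" by (simp add: u_def dd power_mult_distrib)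
    then show ?thesis using e by (simp add: f_def)
  qed
  moreover have "f y = 1" if "dist x y \<le> d" for y
  proof -
    have "(dist x y)\<^sup>2 \<le> d\<^sup>2" using that assms by (intro power_mono) auto
    then have "w y \<le> 0" by (simp add: w_def dd)
    then have "e (w y) = 0" using e by blast
    with pos[of y] show ?thesis by (simp add: f_def)
  qed
  moreover have "f y \<ge> 0" for y using e(2) pos[of y] by (simp add: f_def)
  ultimately show ?thesis using that by blast
qed

section \<open>Calculus on manifolds\<close>

locale atlas_manifold =
  fixes A :: "('m::topological_space, 'n::finite) chart set"
  assumes atlas: "is_atlas A"
begin

abbreviation chart_inv :: "('m, 'n) chart \<Rightarrow> real^'n \<Rightarrow> 'm" where
  "chart_inv c \<equiv> inv_into (fst c) (snd c)"

lemma chart: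
  assumes "c \<in> A"
  shows "open (fst c)" "open (snd c ` fst c)"
    "homeomorphism (fst c) (snd c ` fst c) (snd c) (chart_inv c)"
  using assms atlas unfolding is_atlas_def by (auto split: prod.splits simp: case_prod_beta)

lemma chart_inv [simp]: "c \<in> A \<Longrightarrow> q \<in> fst c \<Longrightarrow> chart_inv c (snd c q) = q"
  using chart(3) homeomorphism_apply1 by fastforce

lemma chart_inv_pair [simp]: "(U, \<phi>) \<in> A \<Longrightarrow> q \<in> U \<Longrightarrow> inv_into U \<phi> (\<phi> q) = q"
  using chart_inv[of "(U, \<phi>)"] by simp

lemma chart_at: obtains c where "c \<in> A" "p \<in> fst c"
proof -
  have "p \<in> (\<Union>(U, \<phi>)\<in>A. U)" using atlas unfolding is_atlas_def by simp
  then show ?thesis using that by force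
qed

lemma open_chart_image:
  assumes "c \<in> A" "open W"
  shows "open (snd c ` (fst c \<inter> W))"
proof -
  have "openin (top_of_set (snd c ` fst c)) (snd c ` (fst c \<inter> W))"
    using homeomorphism_imp_open_map[OF chart(3)[OF assms(1)]] assms(2) openin_open by blast
  then show ?thesis using chart(2)[OF assms(1)] openin_open_eq by blast
qed

lemma smooth_transition:
  "c \<in> A \<Longrightarrow> d \<in> A \<Longrightarrow> smooth_on (snd c ` (fst c \<inter> fst d)) (snd d \<circ> chart_inv c)"
  using atlas unfolding is_atlas_def by (auto simp: case_prod_beta)

lemma smooth_fun_alt:
  "smooth_fun A W f \<longleftrightarrow> (\<forall>c\<in>A. smooth_on (snd c ` (fst c \<inter> W)) (\<lambda>x. f (chart_inv c x)))"
  unfolding smooth_fun_def by (simp add: case_prod_beta o_def)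

lemma smooth_fun_cong:
  assumes "open W" "\<And>q. q \<in> W \<Longrightarrow> f q = g q"
  shows "smooth_fun A W f \<longleftrightarrow> smooth_fun A W g"
  unfolding smooth_fun_alt
  by (intro ball_cong refl smooth_on_cong open_chart_image assms) (auto simp: assms)

lemma smooth_fun_subset: "smooth_fun A W f \<Longrightarrow> V \<subseteq> W \<Longrightarrow> smooth_fun A V f"
  unfolding smooth_fun_alt by (meson Int_mono image_mono order_refl smooth_on_subset)

lemma smooth_fun_local:
  assumes "\<And>p. p \<in> W \<Longrightarrow> \<exists>V. open V \<and> p \<in> V \<and> smooth_fun A V f"
  shows "smooth_fun A W f"
  unfolding smooth_fun_alt
proof (intro ballI smooth_on_local)
  fix c x assume c: "c \<in> A" and x: "x \<in> snd c ` (fst c \<inter> W)"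
  then obtain p where p: "p \<in> fst c" "p \<in> W" "x = snd c p" by auto
  with assms obtain V where V: "open V" "p \<in> V" "smooth_fun A V f" by blast
  show "\<exists>T. open T \<and> x \<in> T \<and> smooth_on T (\<lambda>x. f (chart_inv c x))"
    using V c p by (intro exI[of _ "snd c ` (fst c \<inter> V)"]) (auto simp: smooth_fun_alt open_chart_image)
qed

lemma smooth_fun_const [simp]: "smooth_fun A W (\<lambda>p. k)"
  by (simp add: smooth_fun_alt)

lemma smooth_fun_bilinear:
  "bounded_bilinear B \<Longrightarrow> open W \<Longrightarrow> smooth_fun A W f \<Longrightarrow> smooth_fun A W g \<Longrightarrow>
    smooth_fun A W (\<lambda>p. B (f p) (g p))"
  unfolding smooth_fun_alt by (rule ballI, rule smooth_on_bilinear[where B = B]) (auto intro: open_chart_image)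

lemma smooth_fun_linear:
  "bounded_linear L \<Longrightarrow> open W \<Longrightarrow> smooth_fun A W f \<Longrightarrow> smooth_fun A W (\<lambda>p. L (f p))"
  unfolding smooth_fun_alt by (rule ballI, rule smooth_on_linear[where L = L]) (auto intro: open_chart_image)

lemma smooth_fun_add:
  "open W \<Longrightarrow> smooth_fun A W f \<Longrightarrow> smooth_fun A W g \<Longrightarrow> smooth_fun A W (\<lambda>p. f p + g p)"
  unfolding smooth_fun_alt by (rule ballI, rule smooth_on_add) (auto intro: open_chart_image)

lemma smooth_fun_minus:
  "open W \<Longrightarrow> smooth_fun A W f \<Longrightarrow> smooth_fun A W (\<lambda>p. - f p)"
  by (rule smooth_fun_linear[OF bounded_linear_minus[OF bounded_linear_ident]])

lemma smooth_fun_diff: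
  "open W \<Longrightarrow> smooth_fun A W f \<Longrightarrow> smooth_fun A W g \<Longrightarrow> smooth_fun A W (\<lambda>p. f p - g p)"
  using smooth_fun_add[of W f "\<lambda>p. - g p"] smooth_fun_minus[of W g] by simp

lemma smooth_fun_scaleR:
  "open W \<Longrightarrow> smooth_fun A W f \<Longrightarrow> smooth_fun A W g \<Longrightarrow> smooth_fun A W (\<lambda>p. f p *\<^sub>R g p)"
  by (rule smooth_fun_bilinear[OF bounded_bilinear_scaleR])

lemma smooth_fun_mult:
  fixes f :: "'m \<Rightarrow> real"
  shows "open W \<Longrightarrow> smooth_fun A W f \<Longrightarrow> smooth_fun A W g \<Longrightarrow> smooth_fun A W (\<lambda>p. f p * g p)"
  by (rule smooth_fun_bilinear[OF bounded_bilinear_mult])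

lemma smooth_fun_sum:
  assumes "open W" "\<And>i. i \<in> I \<Longrightarrow> smooth_fun A W (f i)"
  shows "smooth_fun A W (\<lambda>p. \<Sum>i\<in>I. f i p)"
proof (cases "finite I")
  case True
  then show ?thesis using assms(2)
    by (induction I rule: finite_induct) (auto intro: smooth_fun_add assms(1))
qed simp

lemma smooth_fun_vec:
  fixes f :: "'m \<Rightarrow> ('b::euclidean_space)^'k::finite"
  assumes W: "open W" and f: "\<And>i. smooth_fun A W (\<lambda>p. f p $ i)"
  shows "smooth_fun A W f"
proof -
  have "smooth_fun A W (\<lambda>p. \<Sum>i\<in>UNIV. axis i (f p $ i))"
  proof (intro smooth_fun_sum W)
    fix i :: 'k
    have "bounded_linear (axis i :: 'b \<Rightarrow> 'b^'k)"
      by (simp add: linear_conv_bounded_linear[symmetric] linear_iff vec_eq_iff axis_def)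
    then show "smooth_fun A W (\<lambda>p. axis i (f p $ i))" by (rule smooth_fun_linear[OF _ W f])
  qed
  moreover have "(\<Sum>i\<in>UNIV. axis i (f p $ i)) = f p" for p
    by (simp add: vec_eq_iff axis_def)
  ultimately show ?thesis by simp
qed

text \<open>\<open>smooth_fun\<close> quantifies over all charts; smoothness of the transition maps
  makes a single chart sufficient.\<close>

lemma smooth_fun_single_chart:
  assumes c: "c \<in> A" and W: "open W" "W \<subseteq> fst c" and f: "smooth_on (snd c ` W) (\<lambda>x. f (chart_inv c x))"
  shows "smooth_fun A W f"
  unfolding smooth_fun_alt
proof
  fix d assume d: "d \<in> A"
  have oW: "open (snd c ` W)" using open_chart_image[OF c W(1)] W(2) by (simp add: inf.absorb2)
  have "smooth_on (snd d ` (fst d \<inter> W)) (\<lambda>x. f (chart_inv c ((snd c \<circ> chart_inv d) x)))"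
  proof (rule smooth_on_compose[OF _ oW _ _ f])
    show "open (snd d ` (fst d \<inter> W))" using open_chart_image d W by blast
    show "(snd c \<circ> chart_inv d) ` snd d ` (fst d \<inter> W) \<subseteq> snd c ` W" using d by auto
    show "smooth_on (snd d ` (fst d \<inter> W)) (snd c \<circ> chart_inv d)"
      using smooth_transition[OF d c] W(2) by (auto intro: smooth_on_subset)
  qed
  then show "smooth_on (snd d ` (fst d \<inter> W)) (\<lambda>x. f (chart_inv d x))"
    by (rule smooth_on_cong[THEN iffD1, rotated 2])
      (use d c W in \<open>auto intro: open_chart_image\<close>)
qed

lemma smooth_fun_chart: "c \<in> A \<Longrightarrow> open W \<Longrightarrow> W \<subseteq> fst c \<Longrightarrow> smooth_fun A W (snd c)"
proof (rule smooth_fun_single_chart)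
  assume c: "c \<in> A" "open W" "W \<subseteq> fst c"
  have o: "open (snd c ` W)" using open_chart_image[OF c(1,2)] c(3) by (simp add: inf.absorb2)
  show "smooth_on (snd c ` W) (\<lambda>x. snd c (chart_inv c x))"
    by (rule smooth_on_cong[OF o, THEN iffD1, OF _ smooth_on_ident]) (use c in auto)
qed auto

lemma smooth_fun_compose_chart:
  fixes f :: "real^'n \<Rightarrow> 'b::real_normed_vector"
  assumes "c \<in> A" "open W" "W \<subseteq> fst c" "smooth_on UNIV f"
  shows "smooth_fun A W (\<lambda>q. f (snd c q))"
proof -
  have o: "open (snd d ` (fst d \<inter> W))" if "d \<in> A" for d using open_chart_image that assms by blast
  show ?thesis
    using smooth_fun_chart[OF assms(1-3)] unfolding smooth_fun_alt
    by (auto intro!: smooth_on_compose[OF o _ _ _ assms(4)])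
qed

lemma smooth_fun_continuous:
  assumes "open W" "smooth_fun A W f"
  shows "continuous_on W f"
proof -
  have "continuous_on (fst c \<inter> W) f" if c: "c \<in> A" for c
  proof -
    have "continuous_on (snd c ` (fst c \<inter> W)) (\<lambda>x. f (chart_inv c x))"
      using assms c by (auto simp: smooth_fun_alt intro: smooth_on_continuous)
    moreover have "continuous_on (fst c \<inter> W) (snd c)"
      using chart(3)[OF c] by (auto simp: homeomorphism_def intro: continuous_on_subset)
    ultimately have "continuous_on (fst c \<inter> W) (\<lambda>q. f (chart_inv c (snd c q)))"
      by (rule continuous_on_compose2) auto
    then show ?thesis
      by (rule continuous_on_cong[THEN iffD1, rotated 2]) (use c in auto)
  qed
  then have "continuous_on (\<Union>c\<in>A. fst c \<inter> W) f"
    using chart(1) assms by (intro continuous_on_open_UN) auto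
  moreover have "(\<Union>c\<in>A. fst c \<inter> W) = W" using chart_at by blast
  ultimately show ?thesis by simp
qed

subsection \<open>Tangent vectors\<close>

text \<open>The version of \<open>smooth_near\<close> for functions with values in any normed space,
  as needed for sections and matrices.\<close>

definition smooth_at :: "'m \<Rightarrow> ('m \<Rightarrow> 'b::real_normed_vector) \<Rightarrow> bool" where
  "smooth_at p f \<longleftrightarrow> (\<exists>W. open W \<and> p \<in> W \<and> smooth_fun A W f)"

lemma smooth_near_iff: "smooth_near A p f \<longleftrightarrow> smooth_at p f"
  by (simp add: smooth_near_def smooth_at_def)

lemma smooth_atI: "smooth_fun A W f \<Longrightarrow> open W \<Longrightarrow> p \<in> W \<Longrightarrow> smooth_at p f"
  by (auto simp: smooth_at_def)

lemma smooth_at_common: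
  assumes "smooth_at p f" "smooth_at p g"
  obtains W where "open W" "p \<in> W" "smooth_fun A W f" "smooth_fun A W g"
proof -
  from assms obtain V W where "open V" "p \<in> V" "smooth_fun A V f" "open W" "p \<in> W" "smooth_fun A W g"
    unfolding smooth_at_def by blast
  then show ?thesis using that[of "V \<inter> W"] by (auto intro: smooth_fun_subset)
qed

lemma smooth_at_const [simp]: "smooth_at p (\<lambda>q. k)"
  unfolding smooth_at_def by (rule exI[of _ UNIV]) simp

lemma smooth_at_bilinear:
  "bounded_bilinear B \<Longrightarrow> smooth_at p f \<Longrightarrow> smooth_at p g \<Longrightarrow> smooth_at p (\<lambda>q. B (f q) (g q))"
  by (erule smooth_at_common, assumption) (metis smooth_at_def smooth_fun_bilinear)

lemma smooth_at_linear: "bounded_linear L \<Longrightarrow> smooth_at p f \<Longrightarrow> smooth_at p (\<lambda>q. L (f q))"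
  unfolding smooth_at_def using smooth_fun_linear by blast

lemma smooth_at_add:
  assumes "smooth_at p f" "smooth_at p g"
  shows "smooth_at p (\<lambda>q. f q + g q)"
proof -
  obtain W where "open W" "p \<in> W" "smooth_fun A W f" "smooth_fun A W g"
    using smooth_at_common[OF assms] by blast
  then show ?thesis by (intro smooth_atI[OF smooth_fun_add])
qed

lemma smooth_at_sum: "(\<And>i. i \<in> I \<Longrightarrow> smooth_at p (f i)) \<Longrightarrow> smooth_at p (\<lambda>q. \<Sum>i\<in>I. f i q)"
proof (induction I rule: infinite_finite_induct)
  case (insert i I)
  have "smooth_at p (f i)" "smooth_at p (\<lambda>q. \<Sum>i\<in>I. f i q)" using insert by auto
  then have "smooth_at p (\<lambda>q. f i q + (\<Sum>i\<in>I. f i q))" by (rule smooth_at_add)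
  then show ?case using insert by simp
qed auto

lemma smooth_at_inner: "smooth_at p f \<Longrightarrow> smooth_at p (\<lambda>q. f q \<bullet> b)"
  by (rule smooth_at_linear[OF bounded_linear_inner_left])

lemma smooth_at_chart_derivative:
  assumes "c \<in> A" "p \<in> fst c" "smooth_at p f"
  shows "((\<lambda>x. f (chart_inv c x)) has_derivative
    frechet_derivative (\<lambda>x. f (chart_inv c x)) (at (snd c p))) (at (snd c p))"
proof -
  from assms(3) obtain W where W: "open W" "p \<in> W" "smooth_fun A W f" unfolding smooth_at_def by blast
  then have "smooth_on (snd c ` (fst c \<inter> W)) (\<lambda>x. f (chart_inv c x))"
    using assms by (simp add: smooth_fun_alt)
  then show ?thesis by (rule smooth_on_has_derivative) (use assms W in auto)
qed

text \<open>The bridge from derivations to Frechet derivatives: sum, product and linearity rules for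
  \<open>dir_deriv\<close> are all read off in a chart. Smoothness at \<open>p\<close> matters
  because tangent vectors take the value 0 on other functions.\<close>

lemma dir_deriv_coord:
  fixes f :: "'m \<Rightarrow> 'b::euclidean_space"
  assumes "c \<in> A" "p \<in> fst c" "smooth_at p f"
  shows "dir_deriv (coord_tangent A c p v) f = frechet_derivative (\<lambda>x. f (chart_inv c x)) (at (snd c p)) v"
proof -
  let ?D = "frechet_derivative (\<lambda>x. f (chart_inv c x)) (at (snd c p))"
  have "coord_tangent A c p v (\<lambda>q. f q \<bullet> b) = ?D v \<bullet> b" for b
  proof -
    have "((\<lambda>x. f (chart_inv c x) \<bullet> b) has_derivative (\<lambda>v. ?D v \<bullet> b)) (at (snd c p))"
      by (rule has_derivative_inner_left[OF smooth_at_chart_derivative[OF assms]])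
    then have "frechet_derivative (\<lambda>x. f (chart_inv c x) \<bullet> b) (at (snd c p)) = (\<lambda>v. ?D v \<bullet> b)"
      using frechet_derivative_at by metis
    moreover have "smooth_near A p (\<lambda>q. f q \<bullet> b)"
      using assms(3) by (simp add: smooth_near_iff smooth_at_inner)
    ultimately show ?thesis by (simp add: coord_tangent_def o_def)
  qed
  then show ?thesis by (simp add: dir_deriv_def euclidean_representation)
qed

lemma dir_deriv_real: "dir_deriv X f = X f" for f :: "'m \<Rightarrow> real"
  by (simp add: dir_deriv_def)

text \<open>\<open>tangent_space\<close> is a union over charts. By the chain rule for the
  transition map, all vectors at \<open>p\<close> can be represented in one chart, which turns their
  sums and multiples into linear algebra.\<close>

lemma tangent_in_chart:
  assumes "X \<in> tangent_space A p" "c \<in> A" "p \<in> fst c"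
  obtains v where "X = coord_tangent A c p v"
proof -
  from assms(1) obtain d w where d: "X = coord_tangent A d p w" "d \<in> A" "p \<in> fst d"
    unfolding tangent_space_def by blast
  let ?\<tau> = "snd c \<circ> chart_inv d"
  have "smooth_on (snd d ` (fst d \<inter> fst c)) ?\<tau>" by (rule smooth_transition[OF d(2) assms(2)])
  then have T: "(?\<tau> has_derivative frechet_derivative ?\<tau> (at (snd d p))) (at (snd d p))"
    by (rule smooth_on_has_derivative) (use d assms in auto)
  have "X f = coord_tangent A c p (frechet_derivative ?\<tau> (at (snd d p)) w) f" for f
  proof (cases "smooth_at p f")
    case True
    let ?D = "frechet_derivative (\<lambda>x. f (chart_inv c x)) (at (snd c p))"
    have "((\<lambda>x. f (chart_inv c x)) has_derivative ?D) (at (?\<tau> (snd d p)))"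
      using smooth_at_chart_derivative[OF assms(2,3) True] d by simp
    from has_derivative_compose[OF T this]
    have "((\<lambda>x. f (chart_inv c (?\<tau> x))) has_derivative (\<lambda>v. ?D (frechet_derivative ?\<tau> (at (snd d p)) v))) (at (snd d p))" .
    then have "((\<lambda>x. f (chart_inv d x)) has_derivative (\<lambda>v. ?D (frechet_derivative ?\<tau> (at (snd d p)) v))) (at (snd d p))"
      by (rule has_derivative_transform_within_open[where s = "snd d ` (fst d \<inter> fst c)"])
        (use d assms open_chart_image[OF d(2) chart(1)[OF assms(2)]] in auto)
    then have "frechet_derivative (\<lambda>x. f (chart_inv d x)) (at (snd d p)) w = ?D (frechet_derivative ?\<tau> (at (snd d p)) w)"
      using frechet_derivative_at by metis
    then show ?thesis using True d by (simp add: coord_tangent_def smooth_near_iff o_def)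
  next
    case False
    then show ?thesis using d by (simp add: coord_tangent_def smooth_near_iff)
  qed
  then have "X = coord_tangent A c p (frechet_derivative ?\<tau> (at (snd d p)) w)" by blast
  then show ?thesis using that by blast
qed

lemma coord_tangent_in: "c \<in> A \<Longrightarrow> p \<in> fst c \<Longrightarrow> coord_tangent A c p v \<in> tangent_space A p"
  unfolding tangent_space_def by blast

lemma dir_deriv_bilinear:
  fixes f :: "'m \<Rightarrow> 'b::euclidean_space" and g :: "'m \<Rightarrow> 'c::euclidean_space"
    and B :: "'b \<Rightarrow> 'c \<Rightarrow> 'd::euclidean_space"
  assumes "bounded_bilinear B" "X \<in> tangent_space A p" "smooth_at p f" "smooth_at p g"
  shows "dir_deriv X (\<lambda>q. B (f q) (g q)) = B (dir_deriv X f) (g p) + B (f p) (dir_deriv X g)"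
proof -
  obtain c where c: "c \<in> A" "p \<in> fst c" using chart_at by blast
  with assms(2) obtain v where v: "X = coord_tangent A c p v" using tangent_in_chart by blast
  note D = bounded_bilinear.FDERIV[OF assms(1) smooth_at_chart_derivative[OF c assms(3)] smooth_at_chart_derivative[OF c assms(4)]]
  show ?thesis
    using frechet_derivative_at[OF D] c
    by (simp add: v dir_deriv_coord c assms smooth_at_bilinear fun_eq_iff add.commute)
qed

lemma dir_deriv_linear:
  fixes f :: "'m \<Rightarrow> 'b::euclidean_space" and L :: "'b \<Rightarrow> 'c::euclidean_space"
  assumes "bounded_linear L" "X \<in> tangent_space A p" "smooth_at p f"
  shows "dir_deriv X (\<lambda>q. L (f q)) = L (dir_deriv X f)"
proof -
  obtain c where c: "c \<in> A" "p \<in> fst c" using chart_at by blast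
  with assms(2) obtain v where v: "X = coord_tangent A c p v" using tangent_in_chart by blast
  note D = bounded_linear.has_derivative[OF assms(1) smooth_at_chart_derivative[OF c assms(3)]]
  show ?thesis
    using frechet_derivative_at[OF D]
    by (simp add: v dir_deriv_coord c assms smooth_at_linear fun_eq_iff)
qed

lemma dir_deriv_const [simp]: "X \<in> tangent_space A p \<Longrightarrow> dir_deriv X (\<lambda>q. k) = 0"
  by (rule chart_at[of p], erule tangent_in_chart, assumption+) (simp add: dir_deriv_coord)

lemma dir_deriv_sum:
  assumes "X \<in> tangent_space A p" "\<And>i. i \<in> I \<Longrightarrow> smooth_at p (f i)"
  shows "dir_deriv X (\<lambda>q. \<Sum>i\<in>I. f i q) = (\<Sum>i\<in>I. dir_deriv X (f i))"
proof -
  obtain c where c: "c \<in> A" "p \<in> fst c" using chart_at by blast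
  with assms(1) obtain v where v: "X = coord_tangent A c p v" using tangent_in_chart by blast
  have D: "((\<lambda>x. \<Sum>i\<in>I. f i (chart_inv c x)) has_derivative
      (\<lambda>v. \<Sum>i\<in>I. frechet_derivative (\<lambda>x. f i (chart_inv c x)) (at (snd c p)) v)) (at (snd c p))"
    by (intro has_derivative_sum smooth_at_chart_derivative c assms)
  show ?thesis
    using frechet_derivative_at[OF D] assms(2)
    by (simp add: v dir_deriv_coord c assms smooth_at_sum fun_eq_iff)
qed

lemma dir_deriv_add:
  fixes f g :: "'m \<Rightarrow> 'b::euclidean_space"
  assumes "X \<in> tangent_space A p" "smooth_at p f" "smooth_at p g"
  shows "dir_deriv X (\<lambda>q. f q + g q) = dir_deriv X f + dir_deriv X g"
  using dir_deriv_sum[OF assms(1), of "UNIV :: bool set" "\<lambda>b. if b then f else g"] assms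
  by (simp add: UNIV_bool add.commute)

text \<open>Locality of derivations. Smoothness of \<open>f\<close> is part of the conclusion, since
  a tangent vector would otherwise send \<open>f\<close> to 0 by convention.\<close>

lemma dir_deriv_cong:
  fixes f g :: "'m \<Rightarrow> 'b::euclidean_space"
  assumes "X \<in> tangent_space A p" "open W" "p \<in> W" "\<And>q. q \<in> W \<Longrightarrow> f q = g q" "smooth_at p g"
  shows "dir_deriv X f = dir_deriv X g" and "smooth_at p f"
proof -
  obtain V where V: "open V" "p \<in> V" "smooth_fun A V g" using assms(5) unfolding smooth_at_def by blast
  then have "smooth_fun A (V \<inter> W) g" by (auto intro: smooth_fun_subset)
  then have "smooth_fun A (V \<inter> W) f"
    by (rule smooth_fun_cong[THEN iffD1, rotated 2]) (use V assms in auto)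
  then show sf: "smooth_at p f" using V assms by (auto intro: smooth_atI)
  obtain c where c: "c \<in> A" "p \<in> fst c" using chart_at by blast
  with assms(1) obtain v where v: "X = coord_tangent A c p v" using tangent_in_chart by blast
  have "((\<lambda>x. f (chart_inv c x)) has_derivative
    frechet_derivative (\<lambda>x. g (chart_inv c x)) (at (snd c p))) (at (snd c p))"
    by (rule has_derivative_transform_within_open[OF smooth_at_chart_derivative[OF c assms(5)], where s = "snd c ` (fst c \<inter> W)"])
      (use c assms open_chart_image in auto)
  from frechet_derivative_at[OF this] show "dir_deriv X f = dir_deriv X g"
    by (simp add: v dir_deriv_coord c sf assms)
qed

lemma tangent_add:
  assumes "X \<in> tangent_space A p" "Y \<in> tangent_space A p"
  shows "(\<lambda>f. X f + Y f) \<in> tangent_space A p"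
proof -
  obtain c where c: "c \<in> A" "p \<in> fst c" using chart_at by blast
  obtain v w where v: "X = coord_tangent A c p v" "Y = coord_tangent A c p w"
    using tangent_in_chart assms c by metis
  have "(\<lambda>f. X f + Y f) = coord_tangent A c p (v + w)"
  proof
    fix f show "X f + Y f = coord_tangent A c p (v + w) f"
    proof (cases "smooth_at p f")
      case True
      from smooth_at_chart_derivative[OF c True]
      have "linear (frechet_derivative (\<lambda>x. f (chart_inv c x)) (at (snd c p)))"
        by (rule has_derivative_linear)
      then show ?thesis using True by (simp add: v coord_tangent_def smooth_near_iff o_def linear_add)
    qed (simp add: v coord_tangent_def smooth_near_iff)
  qed
  then show ?thesis using c coord_tangent_in by simp
qed

lemma tangent_scale:
  assumes "X \<in> tangent_space A p"
  shows "(\<lambda>f. a * X f) \<in> tangent_space A p"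
proof -
  obtain c where c: "c \<in> A" "p \<in> fst c" using chart_at by blast
  obtain v where v: "X = coord_tangent A c p v"
    using tangent_in_chart assms c by metis
  have "(\<lambda>f. a * X f) = coord_tangent A c p (a *\<^sub>R v)"
  proof
    fix f show "a * X f = coord_tangent A c p (a *\<^sub>R v) f"
    proof (cases "smooth_at p f")
      case True
      from smooth_at_chart_derivative[OF c True]
      have "linear (frechet_derivative (\<lambda>x. f (chart_inv c x)) (at (snd c p)))"
        by (rule has_derivative_linear)
      then show ?thesis using True by (simp add: v coord_tangent_def smooth_near_iff o_def linear_scale)
    qed (simp add: v coord_tangent_def smooth_near_iff)
  qed
  then show ?thesis using c coord_tangent_in by simp
qed

lemma tangent_zero: "(\<lambda>f. 0) \<in> tangent_space A p"
proof -
  obtain c where c: "c \<in> A" "p \<in> fst c" using chart_at by blast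
  from tangent_scale[OF coord_tangent_in[OF c, of 0], of 0] show ?thesis by simp
qed

lemma smooth_field_tangent: "smooth_field A W X \<Longrightarrow> p \<in> W \<Longrightarrow> X p \<in> tangent_space A p"
  unfolding smooth_field_def by blast

lemma smooth_field_apply:
  fixes f :: "'m \<Rightarrow> real"
  shows "smooth_field A W X \<Longrightarrow> open V \<Longrightarrow> V \<subseteq> W \<Longrightarrow> smooth_fun A V f \<Longrightarrow> smooth_fun A V (\<lambda>p. X p f)"
  unfolding smooth_field_def by blast

lemma smooth_field_subset: "smooth_field A W X \<Longrightarrow> V \<subseteq> W \<Longrightarrow> smooth_field A V X"
  unfolding smooth_field_def by (meson subsetD subset_trans)

lemma smooth_field_cong:
  assumes "open W" "\<And>p. p \<in> W \<Longrightarrow> X p = Y p" "smooth_field A W X"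
  shows "smooth_field A W Y"
  unfolding smooth_field_def
proof (intro conjI ballI allI impI)
  fix p assume "p \<in> W" then show "Y p \<in> tangent_space A p" using assms smooth_field_tangent by metis
next
  fix V and f :: "'m \<Rightarrow> real" assume V: "open V" "V \<subseteq> W" "smooth_fun A V f"
  then have "smooth_fun A V (\<lambda>p. X p f)" by (rule smooth_field_apply[OF assms(3)])
  then show "smooth_fun A V (\<lambda>p. Y p f)"
    by (rule smooth_fun_cong[THEN iffD1, rotated 2]) (use V assms in auto)
qed

lemma smooth_field_add:
  "smooth_field A W X \<Longrightarrow> smooth_field A W Y \<Longrightarrow> smooth_field A W (\<lambda>p u. X p u + Y p u)"
  unfolding smooth_field_def by (auto intro!: tangent_add smooth_fun_add)

lemma smooth_field_scale:
  "smooth_field A W X \<Longrightarrow> smooth_fun A W f \<Longrightarrow> smooth_field A W (\<lambda>p u. f p * X p u)"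
  unfolding smooth_field_def by (auto intro: tangent_scale smooth_fun_mult smooth_fun_subset)

lemma smooth_field_zero: "smooth_field A W (\<lambda>p u. 0)"
  unfolding smooth_field_def by (auto intro: tangent_zero)

lemma smooth_field_sum:
  "finite I \<Longrightarrow> (\<And>i. i \<in> I \<Longrightarrow> smooth_field A W (X i)) \<Longrightarrow> smooth_field A W (\<lambda>p u. \<Sum>i\<in>I. X i p u)"
  by (induction I rule: finite_induct) (auto intro: smooth_field_zero smooth_field_add)

lemma smooth_fun_dir_deriv:
  fixes f :: "'m \<Rightarrow> 'b::euclidean_space"
  assumes "smooth_field A W X" "open W" "smooth_fun A W f"
  shows "smooth_fun A W (\<lambda>p. dir_deriv (X p) f)"
  unfolding dir_deriv_def
  by (intro smooth_fun_sum smooth_fun_scaleR smooth_field_apply[OF assms(1)] smooth_fun_linear[OF bounded_linear_inner_left]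
      assms smooth_fun_const order_refl)

end

text \<open>Closedness of compact sets is an assumption because the locale works over
  \<open>topological_space\<close>. It makes the complement of \<open>K\<close> open, so that
  extension by zero outside the chart remains smooth.\<close>

lemma (in atlas_manifold) smooth_bump_at:
  fixes p :: 'm
  assumes "open W" "p \<in> W" and t2: "\<And>K::'m set. compact K \<Longrightarrow> closed K"
  obtains \<rho> :: "'m \<Rightarrow> real" and K V c where "smooth_fun A UNIV \<rho>" "\<And>q. 0 \<le> \<rho> q" "c \<in> A" "compact K" "K \<subseteq> W \<inter> fst c"
    "\<And>q. q \<notin> K \<Longrightarrow> \<rho> q = 0" "open V" "p \<in> V" "\<And>q. q \<in> V \<Longrightarrow> \<rho> q = 1"
proof -
  obtain c where c: "c \<in> A" "p \<in> fst c" using chart_at by blast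
  have o: "open (snd c ` (fst c \<inter> W))" by (rule open_chart_image[OF c(1) assms(1)])
  moreover have "snd c p \<in> snd c ` (fst c \<inter> W)" using assms c by blast
  ultimately obtain r where r: "r > 0" "cball (snd c p) r \<subseteq> snd c ` (fst c \<inter> W)"
    using open_contains_cball by blast
  \<comment> \<open>The Euclidean bump vanishes from distance \<open>2 d = r\<close> on, which is
    the radius of the ball known to lie in the chart image.\<close>
  define d where "d = r / 2"
  have d: "d > 0" using r by (simp add: d_def)
  obtain f :: "real^'n \<Rightarrow> real" where f: "smooth_on UNIV f" "\<And>y. 0 \<le> f y" "\<And>y. dist (snd c p) y \<ge> 2 * d \<Longrightarrow> f y = 0"
    "\<And>y. dist (snd c p) y \<le> d \<Longrightarrow> f y = 1" by (rule smooth_bump_exists[OF d, of "snd c p"]) (rule that)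
  define K where "K = chart_inv c ` cball (snd c p) r"
  define \<rho> where "\<rho> = (\<lambda>q. if q \<in> fst c then f (snd c q) else 0)"
  have "continuous_on (snd c ` fst c) (chart_inv c)" using chart(3)[OF c(1)] by (simp add: homeomorphism_def)
  then have K: "compact K" unfolding K_def using r
    by (intro compact_continuous_image) (auto intro: continuous_on_subset)
  have KW: "K \<subseteq> W \<inter> fst c" unfolding K_def using r(2) c by (auto simp: subset_iff)
  have out: "\<rho> q = 0" if "q \<notin> K" for q
  proof (cases "q \<in> fst c")
    case True
    have "snd c q \<notin> cball (snd c p) r"
    proof
      assume "snd c q \<in> cball (snd c p) r"
      then have "chart_inv c (snd c q) \<in> K" unfolding K_def by blast
      then show False using that True c by simp
    qed
    then show ?thesis using f(3)[of "snd c q"] by (simp add: \<rho>_def d_def)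
  qed (simp add: \<rho>_def)
  have "smooth_fun A UNIV \<rho>"
  proof (rule smooth_fun_local)
    fix q
    show "\<exists>V. open V \<and> q \<in> V \<and> smooth_fun A V \<rho>"
    proof (cases "q \<in> K")
      case True
      have "smooth_fun A (fst c) (\<lambda>q. f (snd c q))"
        by (rule smooth_fun_compose_chart[OF c(1) chart(1)[OF c(1)] order_refl f(1)])
      then have "smooth_fun A (fst c) \<rho>"
        by (rule smooth_fun_cong[THEN iffD1, rotated 2]) (use chart(1)[OF c(1)] in \<open>auto simp: \<rho>_def\<close>)
      then show ?thesis using True KW chart(1)[OF c(1)] by blast
    next
      case False
      have "smooth_fun A (- K) (\<lambda>q. 0 :: real)" by simp
      then have "smooth_fun A (- K) \<rho>"
        by (rule smooth_fun_cong[THEN iffD1, rotated 2]) (use t2[OF K] out in auto)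
      then show ?thesis using False t2[OF K] by (intro exI[of _ "- K"]) auto
    qed
  qed
  moreover have "0 \<le> \<rho> q" for q by (simp add: \<rho>_def f(2))
  moreover define V where "V = fst c \<inter> snd c -` ball (snd c p) d"
  moreover have "open V"
    unfolding V_def using chart(1,3)[OF c(1)] by (intro continuous_open_preimage) (auto simp: homeomorphism_def)
  moreover have "p \<in> V" using c d by (simp add: V_def)
  moreover have "\<rho> q = 1" if "q \<in> V" for q using that f(4)[of "snd c q"] by (simp add: V_def \<rho>_def)
  ultimately show ?thesis using that[of \<rho> c K V] c(1) K KW out by blast
qed

section \<open>Clifford and exterior multiplication\<close>

lemma herm_eq_0: "herm 0 \<psi> = 0" "herm \<phi> 0 = 0"
  by (simp_all add: herm_def)

lemma herm_add: "herm (\<phi> + \<phi>') \<psi> = herm \<phi> \<psi> + herm \<phi>' \<psi>" "herm \<phi> (\<psi> + \<psi>') = herm \<phi> \<psi> + herm \<phi> \<psi>'"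
  by (simp_all add: herm_def algebra_simps sum.distrib)

lemma herm_scaleR: "herm (r *\<^sub>R \<phi>) \<psi> = r *\<^sub>R herm \<phi> \<psi>" "herm \<phi> (r *\<^sub>R \<psi>) = r *\<^sub>R herm \<phi> \<psi>"
  by (simp_all add: herm_def scaleR_sum_right)

lemma bounded_bilinear_herm: "bounded_bilinear (herm :: ('n::finite, 's::finite) twisted \<Rightarrow> _)"
proof -
  have "bilinear (herm :: ('n, 's) twisted \<Rightarrow> _)"
    unfolding bilinear_def by (auto intro!: linearI simp: herm_add herm_scaleR)
  then show ?thesis using bilinear_conv_bounded_bilinear by blast
qed

lemmas herm_minus = bounded_bilinear.minus_left[OF bounded_bilinear_herm] bounded_bilinear.minus_right[OF bounded_bilinear_herm]
lemmas herm_sum = bounded_bilinear.sum_left[OF bounded_bilinear_herm] bounded_bilinear.sum_right[OF bounded_bilinear_herm]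
lemmas herm_diff = bounded_bilinear.diff_left[OF bounded_bilinear_herm] bounded_bilinear.diff_right[OF bounded_bilinear_herm]

lemma Re_herm: "Re (herm \<phi> \<psi>) = \<phi> \<bullet> \<psi>"
  by (simp add: herm_def inner_vec_def inner_complex_def)

lemma scaleR_matrix_vector: "(r *\<^sub>R (M :: complex^'a^'b)) *v x = r *\<^sub>R (M *v x)"
  by (simp add: vec_eq_iff matrix_vector_mult_def scaleR_sum_right)

lemma matrix_vector_scaleR: "(M :: complex^'a^'b) *v (r *\<^sub>R x) = r *\<^sub>R (M *v x)"
  by (simp add: vec_eq_iff matrix_vector_mult_def scaleR_sum_right)

lemma minus_matrix_vector: "(- (M :: complex^'a^'b)) *v x = - (M *v x)"
  by (simp add: vec_eq_iff matrix_vector_mult_def sum_negf)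

lemma sum_matrix_vector: "(\<Sum>i\<in>I. M i :: complex^'a^'b) *v x = (\<Sum>i\<in>I. M i *v x)"
  by (induction I rule: infinite_finite_induct) (auto simp: matrix_vector_mult_add_rdistrib)

lemma linear_cliff: "linear (cliff \<gamma> i)"
  by (rule linearI) (simp_all add: cliff_def vec_eq_iff matrix_vector_right_distrib matrix_vector_scaleR)

lemma linear_ext_mult: "linear (ext_mult i)"
  by (rule linearI) (auto simp: ext_mult_def vec_eq_iff algebra_simps)

lemma linear_int_mult: "linear (int_mult i)"
  by (rule linearI) (auto simp: int_mult_def vec_eq_iff algebra_simps)

lemma linear_cliff_contr: "linear (cliff_contr \<gamma>)"
  unfolding cliff_contr_def
  by (intro linear_compose_sum ballI linear_compose[OF linear_int_mult linear_cliff, unfolded o_def])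

lemma linear_cliff_wedge: "linear (cliff_wedge \<gamma>)"
  unfolding cliff_wedge_def
  by (intro linear_compose_sum ballI linear_compose[OF linear_ext_mult linear_cliff, unfolded o_def])

lemma linear_simps:
  assumes "linear f"
  shows "f (x + y) = f x + f y" "f (x - y) = f x - f y" "f (- x) = - f x" "f 0 = 0"
    "f (r *\<^sub>R x) = r *\<^sub>R f x" "f (\<Sum>i\<in>I. g i) = (\<Sum>i\<in>I. f (g i))"
  using assms by (simp_all add: linear_add linear_diff linear_neg linear_0 linear_scale linear_sum)

lemmas op_linear = linear_simps[OF linear_cliff] linear_simps[OF linear_ext_mult] linear_simps[OF linear_int_mult]
  linear_simps[OF linear_cliff_contr] linear_simps[OF linear_cliff_wedge]

section \<open>Anticommutation relations and degrees of forms\<close>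

lemma ext_sign_square [simp]: "ext_sign i A * ext_sign i A = 1" "ext_sign i A * (ext_sign i A * r) = r"
  by (simp_all add: ext_sign_def power2_eq_square[symmetric] power_mult[symmetric] mult.assoc[symmetric]
      flip: power_add mult_2)

lemma ext_sign_self [simp]: "ext_sign i (A - {i}) = ext_sign i A" "ext_sign i (insert i A) = ext_sign i A"
  unfolding ext_sign_def by (rule arg_cong[where f = "\<lambda>B. (- 1) ^ card B"]; auto)+

lemma ext_sign_insert:
  assumes "i \<notin> A" "i \<noteq> k"
  shows "ext_sign k (insert i A) = (if i < k then - ext_sign k A else ext_sign k (A :: 'n::{finite,linorder} set))"
proof (cases "i < k")
  case True
  then have "{a \<in> insert i A. a < k} = insert i {a \<in> A. a < k}" by auto
  then show ?thesis using assms True by (simp add: ext_sign_def)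
next
  case False
  then have "{a \<in> insert i A. a < k} = {a \<in> A. a < k}" by auto
  then show ?thesis using False by (simp add: ext_sign_def)
qed

lemma ext_sign_remove:
  assumes "i \<in> A" "i \<noteq> k"
  shows "ext_sign k (A - {i}) = (if i < k then - ext_sign k A else ext_sign k (A :: 'n::{finite,linorder} set))"
  using ext_sign_insert[of i "A - {i}" k] assms by (simp add: insert_absorb split: if_splits)

text \<open>Removing \<open>i\<close> before \<open>k\<close>, or \<open>k\<close> before
  \<open>i\<close>, changes exactly one of the two signs, namely that of the larger index. Together
  with \<open>int_int\<close> and \<open>int_ext\<close> these are the canonical anticommutation
  relations.\<close>

lemma ext_ext: "ext_mult i (ext_mult k \<phi>) = - ext_mult k (ext_mult i \<phi>)"
proof (rule iffD2[OF vec_eq_iff], rule allI)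
  fix A
  have e: "A - {i} - {k} = A - {i, k}" "A - {k} - {i} = A - {i, k}" by blast+
  show "ext_mult i (ext_mult k \<phi>) $ A = (- ext_mult k (ext_mult i \<phi>)) $ A"
    by (cases "i \<in> A"; cases "k \<in> A"; cases i k rule: linorder_cases)
      (auto simp: ext_mult_def ext_sign_remove e)
qed

lemma int_int: "int_mult i (int_mult k \<phi>) = - int_mult k (int_mult i \<phi>)"
  by (auto simp: int_mult_def vec_eq_iff ext_sign_insert insert_commute)

lemma int_ext: "int_mult i (ext_mult k \<phi>) = (if i = k then \<phi> else 0) - ext_mult k (int_mult i \<phi>)"
proof (cases "i = k")
  case True
  have "(int_mult k (ext_mult k \<phi>)) $ A = \<phi> $ A - ext_mult k (int_mult k \<phi>) $ A" for A
    by (cases "k \<in> A") (auto simp: int_mult_def ext_mult_def insert_absorb)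
  with True show ?thesis by (simp add: vec_eq_iff)
next
  case False
  have "int_mult i (ext_mult k \<phi>) $ A = - (ext_mult k (int_mult i \<phi>) $ A)" for A
  proof -
    have e: "insert i A - {k} = insert i (A - {k})" using False by blast
    show ?thesis using False
      by (cases "i \<in> A"; cases "k \<in> A"; cases i k rule: linorder_cases)
        (auto simp: int_mult_def ext_mult_def ext_sign_insert ext_sign_remove e)
  qed
  with False show ?thesis by (simp add: vec_eq_iff)
qed

lemma cliff_ext: "cliff \<gamma> i (ext_mult k \<phi>) = ext_mult k (cliff \<gamma> i \<phi>)"
  by (simp add: cliff_def ext_mult_def vec_eq_iff matrix_vector_scaleR)

lemma cliff_int: "cliff \<gamma> i (int_mult k \<phi>) = int_mult k (cliff \<gamma> i \<phi>)"
  by (simp add: cliff_def int_mult_def vec_eq_iff matrix_vector_scaleR)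

lemma herm_ext: "herm (ext_mult k \<phi>) \<psi> = herm \<phi> (int_mult k \<psi>)"
proof -
  have "herm (ext_mult k \<phi>) \<psi> = (\<Sum>A\<in>{A. k \<in> A}. \<Sum>a\<in>UNIV. ext_sign k A *\<^sub>R (\<phi> $ (A - {k}) $ a * cnj (\<psi> $ A $ a)))"
    unfolding herm_def by (rule sum.mono_neutral_cong_right) (auto simp: ext_mult_def)
  also have "\<dots> = (\<Sum>A\<in>{A. k \<notin> A}. \<Sum>a\<in>UNIV. ext_sign k A *\<^sub>R (\<phi> $ A $ a * cnj (\<psi> $ insert k A $ a)))"
    by (rule sum.reindex_bij_witness[where i = "insert k" and j = "\<lambda>A. A - {k}"])
      (auto simp: insert_absorb)
  also have "\<dots> = herm \<phi> (int_mult k \<psi>)"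
    unfolding herm_def by (rule sum.mono_neutral_cong_left) (auto simp: int_mult_def)
  finally show ?thesis .
qed

lemma herm_int: "herm (int_mult k \<phi>) \<psi> = herm \<phi> (ext_mult k \<psi>)"
proof -
  have c: "herm \<phi> \<psi> = cnj (herm \<psi> \<phi>)" for \<phi> \<psi> :: "('n::{finite,linorder}, 's::finite) twisted"
    by (simp add: herm_def mult.commute)
  show ?thesis by (subst (1 2) c) (simp add: herm_ext)
qed

lemma spinor_forms_scale:
  "0 \<in> spinor_forms j" "\<phi> \<in> spinor_forms j \<Longrightarrow> r *\<^sub>R \<phi> \<in> spinor_forms j"
  "\<phi> \<in> spinor_forms j \<Longrightarrow> \<psi> \<in> spinor_forms j \<Longrightarrow> \<phi> + \<psi> \<in> spinor_forms j"
  "\<phi> \<in> spinor_forms j \<Longrightarrow> \<psi> \<in> spinor_forms j \<Longrightarrow> \<phi> - \<psi> \<in> spinor_forms j"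
  "(\<And>i. i \<in> I \<Longrightarrow> f i \<in> spinor_forms j) \<Longrightarrow> (\<Sum>i\<in>I. f i) \<in> spinor_forms j"
  by (auto simp: spinor_forms_def sum_component)

lemma spinor_forms_ops:
  "\<phi> \<in> spinor_forms j \<Longrightarrow> cliff \<gamma> i \<phi> \<in> spinor_forms j"
  "\<phi> \<in> spinor_forms j \<Longrightarrow> ext_mult i \<phi> \<in> spinor_forms (Suc j)"
  "\<phi> \<in> spinor_forms (Suc j) \<Longrightarrow> int_mult i \<phi> \<in> spinor_forms j"
  "\<phi> \<in> spinor_forms 0 \<Longrightarrow> int_mult i \<phi> = 0"
proof -
  show "\<phi> \<in> spinor_forms j \<Longrightarrow> cliff \<gamma> i \<phi> \<in> spinor_forms j"
    by (simp add: spinor_forms_def cliff_def)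
  show "\<phi> \<in> spinor_forms j \<Longrightarrow> ext_mult i \<phi> \<in> spinor_forms (Suc j)"
    unfolding spinor_forms_def ext_mult_def
    by (auto simp: card_Diff_singleton_if split: if_splits) (metis card_Suc_Diff1 finite)
  show "\<phi> \<in> spinor_forms (Suc j) \<Longrightarrow> int_mult i \<phi> \<in> spinor_forms j"
    by (simp add: spinor_forms_def int_mult_def)
  show "\<phi> \<in> spinor_forms 0 \<Longrightarrow> int_mult i \<phi> = 0"
    unfolding spinor_forms_def int_mult_def by (rule iffD2[OF vec_eq_iff]) simp
qed

lemma spinor_forms_wedge: "\<phi> \<in> spinor_forms j \<Longrightarrow> cliff_wedge \<gamma> \<phi> \<in> spinor_forms (Suc j)"
  unfolding cliff_wedge_def by (intro spinor_forms_scale spinor_forms_ops)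

text \<open>Each \<open>k\<close> in \<open>A\<close> contributes the coefficient at
  \<open>A\<close> once, so the sum counts the elements of \<open>A\<close>. It is the source of
  every occurrence of the degree in the constants below.\<close>

lemma number_operator:
  assumes "\<phi> \<in> spinor_forms j"
  shows "(\<Sum>k\<in>UNIV. ext_mult k (int_mult k \<phi>)) = real j *\<^sub>R \<phi>"
proof -
  have "(\<Sum>k\<in>UNIV. ext_mult k (int_mult k \<phi>)) $ A = (\<Sum>k\<in>UNIV. if k \<in> A then \<phi> $ A else 0)" for A
    unfolding sum_component
    by (rule sum.cong) (auto simp: ext_mult_def int_mult_def insert_absorb)
  moreover have "(\<Sum>k\<in>UNIV. if k \<in> A then \<phi> $ A else 0) = real (card A) *\<^sub>R \<phi> $ A" for A
    using sum_constant_scaleR[of "\<phi> $ A" A] by (simp add: sum.If_cases del: sum_constant)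
  ultimately have "(\<Sum>k\<in>UNIV. ext_mult k (int_mult k \<phi>)) $ A = real (card A) *\<^sub>R \<phi> $ A" for A
    by simp
  moreover have "real (card A) *\<^sub>R \<phi> $ A = real j *\<^sub>R \<phi> $ A" for A
    using assms by (cases "card A = j") (auto simp: spinor_forms_def)
  ultimately show ?thesis by (simp add: vec_eq_iff)
qed

section \<open>Clifford relations, Clifford contraction and Clifford wedge\<close>

locale spinor_module =
  fixes \<gamma> :: "'n::{finite,linorder} \<Rightarrow> complex^'s^'s::finite"
  assumes spinor_module: "is_spinor_module \<gamma>"
begin

abbreviation "\<G> \<equiv> cliff \<gamma>"
abbreviation "\<E> \<equiv> ext_mult :: 'n \<Rightarrow> ('n, 's) twisted \<Rightarrow> _"
abbreviation "\<I> \<equiv> int_mult :: 'n \<Rightarrow> ('n, 's) twisted \<Rightarrow> _"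
abbreviation "Con \<equiv> cliff_contr \<gamma>"
abbreviation "Wed \<equiv> cliff_wedge \<gamma>"

lemma gamma_gamma: "\<gamma> i ** \<gamma> k = (if i = k then (- 2) *\<^sub>R mat 1 else 0) - \<gamma> k ** \<gamma> i"
  using spinor_module unfolding is_spinor_module_def by (simp add: eq_diff_eq)

lemma gamma_adjoint: "cnj (\<gamma> i $ b $ a) = - (\<gamma> i $ a $ b)"
proof -
  have "\<gamma> i $ a $ b = - cnj (\<gamma> i $ b $ a)"
    using spinor_module unfolding is_spinor_module_def by blast
  then show ?thesis by (metis minus_minus)
qed

lemma cliff_cliff: "\<G> i (\<G> k \<phi>) = - \<G> k (\<G> i \<phi>) + (if i = k then (- 2) *\<^sub>R \<phi> else 0)"
proof (rule iffD2[OF vec_eq_iff], rule allI)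
  fix A
  have "(\<gamma> i ** \<gamma> k) *v (\<phi> $ A) = - ((\<gamma> k ** \<gamma> i) *v (\<phi> $ A)) + (if i = k then (- 2) *\<^sub>R \<phi> $ A else 0)"
    unfolding gamma_gamma[of i k]
    by (simp only: diff_conv_add_uminus matrix_vector_mult_add_rdistrib minus_matrix_vector) (simp add: scaleR_matrix_vector minus_matrix_vector)
  then show "\<G> i (\<G> k \<phi>) $ A = (- \<G> k (\<G> i \<phi>) + (if i = k then (- 2) *\<^sub>R \<phi> else 0)) $ A"
    by (simp add: cliff_def matrix_vector_mul_assoc)
qed

lemma cliff_self: "\<G> i (\<G> i \<phi>) = - \<phi>"
proof -
  have "2 *\<^sub>R \<G> i (\<G> i \<phi>) = 2 *\<^sub>R (- \<phi>)" using cliff_cliff[of i i \<phi>] by (simp add: scaleR_2)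
  then show ?thesis by (simp only: scaleR_cancel_left) simp
qed

lemma herm_cliff: "herm (\<G> k \<phi>) \<psi> = - herm \<phi> (\<G> k \<psi>)"
proof -
  have "(\<Sum>a\<in>UNIV. (\<gamma> k *v \<phi> $ A) $ a * cnj (\<psi> $ A $ a)) = - (\<Sum>a\<in>UNIV. \<phi> $ A $ a * cnj ((\<gamma> k *v \<psi> $ A) $ a))" for A
    unfolding matrix_vector_mult_def
    by (simp add: sum_distrib_right sum_distrib_left gamma_adjoint sum_negf)
      (subst sum.swap, simp add: mult_ac)
  then show ?thesis by (simp add: herm_def cliff_def sum_negf)
qed

lemma inner_cliff: "\<G> k \<phi> \<bullet> \<psi> = - (\<phi> \<bullet> \<G> k \<psi>)"
  by (simp add: Re_herm[symmetric] herm_cliff)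

lemma inner_ext: "\<E> k \<phi> \<bullet> \<psi> = \<phi> \<bullet> \<I> k \<psi>"
  by (simp add: Re_herm[symmetric] herm_ext)

lemma inner_int: "\<I> k \<phi> \<bullet> \<psi> = \<phi> \<bullet> \<E> k \<psi>"
  by (simp add: Re_herm[symmetric] herm_int)

text \<open>Clifford multiplication is skew, and exterior and interior multiplication are mutually
  adjoint. Consequently the image of \<open>Wed\<close> is orthogonal to the kernel of
  \<open>Con\<close>.\<close>

lemma herm_wedge: "herm (Wed \<phi>) \<psi> = - herm \<phi> (Con \<psi>)"
  by (simp add: cliff_wedge_def cliff_contr_def herm_sum herm_cliff herm_ext cliff_int sum_negf)

lemma inner_wedge: "Wed \<phi> \<bullet> \<psi> = - (\<phi> \<bullet> Con \<psi>)"
  by (simp add: Re_herm[symmetric] herm_wedge)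

lemma contr_cliff: "Con (\<G> k \<phi>) = - \<G> k (Con \<phi>) - 2 *\<^sub>R \<I> k \<phi>"
proof -
  have "Con (\<G> k \<phi>) = (\<Sum>i\<in>UNIV. - \<G> k (\<G> i (\<I> i \<phi>)) + (if i = k then (- 2) *\<^sub>R \<I> i \<phi> else 0))"
    unfolding cliff_contr_def by (simp add: cliff_int[symmetric] cliff_cliff[of _ k])
  then show ?thesis by (simp add: cliff_contr_def sum.distrib op_linear sum_negf sum_subtractf)
qed

lemma contr_int: "Con (\<I> k \<phi>) = - \<I> k (Con \<phi>)"
  by (simp add: cliff_contr_def int_int[of _ k] op_linear sum_negf cliff_int)

lemma contr_ext: "Con (\<E> k \<phi>) = \<G> k \<phi> - \<E> k (Con \<phi>)"
proof -
  have "Con (\<E> k \<phi>) = (\<Sum>i\<in>UNIV. (if i = k then \<G> i \<phi> else 0) - \<E> k (\<G> i (\<I> i \<phi>)))"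
    unfolding cliff_contr_def by (intro sum.cong refl) (simp add: int_ext op_linear cliff_ext)
  then show ?thesis by (simp add: cliff_contr_def sum_subtractf op_linear)
qed

lemma cliff_wedge_comm: "\<G> k (Wed \<phi>) = - Wed (\<G> k \<phi>) - 2 *\<^sub>R \<E> k \<phi>"
proof -
  have "\<G> k (Wed \<phi>) = (\<Sum>i\<in>UNIV. - \<G> i (\<E> i (\<G> k \<phi>)) + (if k = i then (- 2) *\<^sub>R \<E> i \<phi> else 0))"
    unfolding cliff_wedge_def by (simp add: op_linear cliff_cliff[of k] cliff_ext[of _ k])
  then show ?thesis by (simp add: cliff_wedge_def sum.distrib op_linear sum_negf sum_subtractf)
qed

lemma wedge_ext: "Wed (\<E> k \<phi>) = - \<E> k (Wed \<phi>)"
  by (simp add: cliff_wedge_def ext_ext[of _ k] op_linear sum_negf cliff_ext)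

lemma int_wedge: "\<I> k (Wed \<phi>) = \<G> k \<phi> - Wed (\<I> k \<phi>)"
proof -
  have "\<I> k (Wed \<phi>) = (\<Sum>i\<in>UNIV. (if k = i then \<G> i \<phi> else 0) - \<G> i (\<E> i (\<I> k \<phi>)))"
    unfolding cliff_wedge_def op_linear
    by (intro sum.cong refl) (simp add: int_ext op_linear cliff_int[symmetric])
  then show ?thesis by (simp add: cliff_wedge_def sum_subtractf op_linear)
qed

text \<open>The commutator of \<open>Con\<close> and \<open>Wed\<close> is a scalar in each degree:
  the squares \<open>e_k e_k = -1\<close> give \<open>- n\<close>, the commutators of
  \<open>e_k\<close> with \<open>Wed\<close> give twice the degree. On \<open>Ker j\<close> this
  makes \<open>Wed\<close> injective for \<open>2 j < n\<close>, with
  \<open>|Wed x|^2 = (n - 2 j) |x|^2\<close>.\<close>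

lemma contr_wedge:
  assumes "\<phi> \<in> spinor_forms j"
  shows "Con (Wed \<phi>) = Wed (Con \<phi>) + (2 * real j - real CARD('n)) *\<^sub>R \<phi>"
proof -
  have "Con (Wed \<phi>) = (\<Sum>k\<in>UNIV. \<G> k (\<G> k \<phi>) - \<G> k (Wed (\<I> k \<phi>)))"
    by (simp add: cliff_contr_def int_wedge op_linear)
  also have "\<dots> = (\<Sum>k\<in>UNIV. - \<phi> + Wed (\<G> k (\<I> k \<phi>)) + 2 *\<^sub>R \<E> k (\<I> k \<phi>))"
    by (simp add: cliff_self cliff_wedge_comm algebra_simps)
  also have "\<dots> = - (real CARD('n) *\<^sub>R \<phi>) + Wed (Con \<phi>) + 2 *\<^sub>R (\<Sum>k\<in>UNIV. \<E> k (\<I> k \<phi>))"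
    by (simp add: sum.distrib sum_subtractf cliff_contr_def op_linear scaleR_sum_right sum_negf sum_constant_scaleR del: sum_constant)
  finally show ?thesis by (simp add: number_operator[OF assms] algebra_simps)
qed

end

section \<open>The spin representation of so(n) and the algebra of second-order symbols\<close>

lemma ext_sq: "ext_mult k (ext_mult k \<phi>) = 0"
proof -
  have "2 *\<^sub>R ext_mult k (ext_mult k \<phi>) = 0"
    unfolding scaleR_2 by (rule eq_neg_iff_add_eq_0[THEN iffD1, OF ext_ext])
  then show ?thesis by (simp only: scaleR_eq_0_iff) simp
qed

lemma int_sq: "int_mult k (int_mult k \<phi>) = 0"
proof -
  have "2 *\<^sub>R int_mult k (int_mult k \<phi>) = 0"
    unfolding scaleR_2 by (rule eq_neg_iff_add_eq_0[THEN iffD1, OF int_int])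
  then show ?thesis by (simp only: scaleR_eq_0_iff) simp
qed

context spinor_module
begin

abbreviation "\<rho> \<equiv> spin_lie_act \<gamma>"

lemma linear_lie: "linear (\<rho> a)"
  unfolding spin_lie_act_def
  by (rule linearI) (simp_all add: op_linear algebra_simps sum.distrib scaleR_sum_right)

lemmas lie_linear = linear_simps[OF linear_lie]

lemma linear_lie_matrix: "linear (\<lambda>a. \<rho> a \<phi>)"
  unfolding spin_lie_act_def
  by (rule linearI) (simp_all add: algebra_simps sum.distrib scaleR_sum_right)

lemmas lie_matrix_linear = linear_simps[OF linear_lie_matrix]

text \<open>The two orders of \<open>l\<close> and \<open>k\<close> combine by the Clifford
  relation. The correction for \<open>l = k\<close> cancels \<open>e_l e_l / 2\<close>, so the
  formula also gives 0 on the diagonal and can be used in unrestricted double sums.\<close>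

lemma lie_rot_gen:
  "\<rho> (rot_gen l k) \<phi> = (1/2) *\<^sub>R \<G> l (\<G> k \<phi>) + (if l = k then (1/2) *\<^sub>R \<phi> else 0) + \<E> k (\<I> l \<phi>) - \<E> l (\<I> k \<phi>)"
proof -
  have ind: "((if P then 1 else 0) - (if Q then 1 else (0 :: real))) *\<^sub>R x = (if P then x else 0) - (if Q then x else 0)"
    for P Q and x :: "('n, 's) twisted" by simp
  define f where "f = (\<lambda>i m. (1/4) *\<^sub>R \<G> i (\<G> m \<phi>) + \<E> m (\<I> i \<phi>))"
  have "\<rho> (rot_gen l k) \<phi> = (\<Sum>i\<in>UNIV. \<Sum>m\<in>UNIV. (if m = k \<and> i = l then f i m else 0) - (if m = l \<and> i = k then f i m else 0))"
    unfolding spin_lie_act_def rot_gen_def f_def vec_lambda_beta ind ..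
  also have "\<dots> = f l k - f k l"
  proof -
    have "(\<Sum>i\<in>UNIV. \<Sum>m\<in>UNIV. (if m = b \<and> i = a then f i m else 0)) = f a b" for a b
    proof -
      have "(\<Sum>i\<in>UNIV. \<Sum>m\<in>UNIV. (if m = b \<and> i = a then f i m else 0)) =
          (\<Sum>i\<in>UNIV. if i = a then f i b else 0)"
      proof (intro sum.cong refl)
        show "(\<Sum>m\<in>UNIV. if m = b \<and> i = a then f i m else 0) = (if i = a then f i b else 0)" for i
          by (cases "i = a") simp_all
      qed
      then show ?thesis by simp
    qed
    then show ?thesis by (simp add: sum_subtractf)
  qed
  finally show ?thesis
    by (auto simp: f_def cliff_cliff[of k l] cliff_self algebra_simps simp flip: scaleR_add_left)
qed

text \<open>Infinitesimal equivariance: the family \<open>\<E> k\<close> transforms like the basis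
  vectors. \<open>lie_int\<close> and \<open>lie_cliff\<close> say the same of the other two
  families; skewness there identifies vectors with covectors.\<close>

lemma lie_ext: "\<rho> a (\<E> k \<phi>) = \<E> k (\<rho> a \<phi>) + (\<Sum>l\<in>UNIV. a $ l $ k *\<^sub>R \<E> l \<phi>)"
proof -
  have "\<E> m (\<I> i (\<E> k \<phi>)) = \<E> k (\<E> m (\<I> i \<phi>)) + (if i = k then \<E> m \<phi> else 0)" for m i
    by (simp add: int_ext ext_ext[of k m] op_linear)
  then have "\<rho> a (\<E> k \<phi>) = \<E> k (\<rho> a \<phi>) + (\<Sum>i\<in>UNIV. \<Sum>m\<in>UNIV. if i = k then a $ m $ i *\<^sub>R \<E> m \<phi> else 0)"
    by (simp add: spin_lie_act_def op_linear cliff_ext scaleR_add_right sum.distrib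
        if_distrib[where f = "\<lambda>x. _ *\<^sub>R x"] cong: if_cong)
  moreover have "(\<Sum>i\<in>UNIV. \<Sum>m\<in>UNIV. if i = k then a $ m $ i *\<^sub>R \<E> m \<phi> else 0) = (\<Sum>l\<in>UNIV. a $ l $ k *\<^sub>R \<E> l \<phi>)"
    by (subst sum.swap) simp
  ultimately show ?thesis by simp
qed

definition skew :: "((real, 'n) vec, 'n) vec \<Rightarrow> bool" where "skew a \<longleftrightarrow> (\<forall>i k. a $ i $ k = - a $ k $ i)"

lemma skewD: "skew a \<Longrightarrow> a $ i $ k = - a $ k $ i"
  unfolding skew_def by blast

lemma lie_int:
  assumes "skew a"
  shows "\<rho> a (\<I> k \<phi>) = \<I> k (\<rho> a \<phi>) + (\<Sum>l\<in>UNIV. a $ l $ k *\<^sub>R \<I> l \<phi>)"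
proof -
  have "\<E> m (\<I> i (\<I> k \<phi>)) = \<I> k (\<E> m (\<I> i \<phi>)) - (if m = k then \<I> i \<phi> else 0)" for m i
    by (simp add: int_ext int_int[of i k] op_linear)
  then have "\<rho> a (\<I> k \<phi>) = \<I> k (\<rho> a \<phi>) - (\<Sum>i\<in>UNIV. \<Sum>m\<in>UNIV. if m = k then a $ m $ i *\<^sub>R \<I> i \<phi> else 0)"
    by (simp add: spin_lie_act_def op_linear cliff_int scaleR_add_right scaleR_diff_right sum.distrib sum_subtractf
        if_distrib[where f = "\<lambda>x. _ *\<^sub>R x"] cong: if_cong)
  then have "\<rho> a (\<I> k \<phi>) = \<I> k (\<rho> a \<phi>) - (\<Sum>i\<in>UNIV. a $ k $ i *\<^sub>R \<I> i \<phi>)" by simp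
  then show ?thesis by (simp add: skewD[OF assms, of k] sum_negf)
qed

lemma lie_cliff:
  assumes "skew a"
  shows "\<rho> a (\<G> k \<phi>) = \<G> k (\<rho> a \<phi>) + (\<Sum>l\<in>UNIV. a $ l $ k *\<^sub>R \<G> l \<phi>)"
proof -
  have "\<G> i (\<G> m (\<G> k \<phi>)) = \<G> k (\<G> i (\<G> m \<phi>)) + (if i = k then 2 *\<^sub>R \<G> m \<phi> else 0) - (if m = k then 2 *\<^sub>R \<G> i \<phi> else 0)" for m i
    by (simp add: cliff_cliff[of m k] cliff_cliff[of i k "\<G> m \<phi>"] op_linear)
  then have "\<rho> a (\<G> k \<phi>) = \<G> k (\<rho> a \<phi>) + (\<Sum>i\<in>UNIV. \<Sum>m\<in>UNIV. if i = k then (a $ m $ i / 2) *\<^sub>R \<G> m \<phi> else 0)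
      - (\<Sum>i\<in>UNIV. \<Sum>m\<in>UNIV. if m = k then (a $ m $ i / 2) *\<^sub>R \<G> i \<phi> else 0)"
    by (simp add: spin_lie_act_def op_linear cliff_int[symmetric] cliff_ext[symmetric] scaleR_add_right scaleR_diff_right
        sum.distrib sum_subtractf if_distrib[where f = "\<lambda>x. _ *\<^sub>R x"] cong: if_cong)
  also have "(\<Sum>i\<in>UNIV. \<Sum>m\<in>UNIV. if i = k then (a $ m $ i / 2) *\<^sub>R \<G> m \<phi> else 0) = (\<Sum>l\<in>UNIV. (a $ l $ k / 2) *\<^sub>R \<G> l \<phi>)"
    by (subst sum.swap) simp
  also have "(\<Sum>i\<in>UNIV. \<Sum>m\<in>UNIV. if m = k then (a $ m $ i / 2) *\<^sub>R \<G> i \<phi> else 0) = - (\<Sum>l\<in>UNIV. (a $ l $ k / 2) *\<^sub>R \<G> l \<phi>)"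
    by (simp add: skewD[OF assms, of k] sum_negf)
  finally show ?thesis
    unfolding diff_minus_eq_add add.assoc sum.distrib[symmetric] scaleR_add_left[symmetric] by simp
qed

text \<open>\<open>Wed\<close> contracts two families that both transform as vectors, so the two
  correction sums differ by exchanging the indices of \<open>a\<close> and cancel by skewness. The
  same applies to \<open>lie_contr\<close>.\<close>

lemma lie_wedge:
  assumes "skew a"
  shows "\<rho> a (Wed \<phi>) = Wed (\<rho> a \<phi>)"
proof -
  have "\<rho> a (Wed \<phi>) = Wed (\<rho> a \<phi>) + (\<Sum>k\<in>UNIV. \<Sum>l\<in>UNIV. a $ l $ k *\<^sub>R \<G> k (\<E> l \<phi>)) + (\<Sum>k\<in>UNIV. \<Sum>l\<in>UNIV. a $ l $ k *\<^sub>R \<G> l (\<E> k \<phi>))"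
    by (simp add: cliff_wedge_def lie_linear lie_cliff[OF assms] lie_ext op_linear sum.distrib)
  also have "(\<Sum>k\<in>UNIV. \<Sum>l\<in>UNIV. a $ l $ k *\<^sub>R \<G> l (\<E> k \<phi>)) = - (\<Sum>k\<in>UNIV. \<Sum>l\<in>UNIV. a $ l $ k *\<^sub>R \<G> k (\<E> l \<phi>))"
  proof -
    have "(\<Sum>k\<in>UNIV. \<Sum>l\<in>UNIV. a $ l $ k *\<^sub>R \<G> l (\<E> k \<phi>)) = (\<Sum>k\<in>UNIV. \<Sum>l\<in>UNIV. a $ k $ l *\<^sub>R \<G> k (\<E> l \<phi>))"
      by (rule sum.swap)
    also have "\<dots> = (\<Sum>k\<in>UNIV. \<Sum>l\<in>UNIV. (- a $ l $ k) *\<^sub>R \<G> k (\<E> l \<phi>))"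
      by (intro sum.cong refl arg_cong2[where f = scaleR] skewD[OF assms])
    finally show ?thesis by (simp add: sum_negf)
  qed
  finally show ?thesis by simp
qed

lemma lie_contr:
  assumes "skew a"
  shows "\<rho> a (Con \<phi>) = Con (\<rho> a \<phi>)"
proof -
  have "\<rho> a (Con \<phi>) = Con (\<rho> a \<phi>) + (\<Sum>k\<in>UNIV. \<Sum>l\<in>UNIV. a $ l $ k *\<^sub>R \<G> k (\<I> l \<phi>)) + (\<Sum>k\<in>UNIV. \<Sum>l\<in>UNIV. a $ l $ k *\<^sub>R \<G> l (\<I> k \<phi>))"
    by (simp add: cliff_contr_def lie_linear lie_cliff[OF assms] lie_int[OF assms] op_linear sum.distrib)
  also have "(\<Sum>k\<in>UNIV. \<Sum>l\<in>UNIV. a $ l $ k *\<^sub>R \<G> l (\<I> k \<phi>)) = - (\<Sum>k\<in>UNIV. \<Sum>l\<in>UNIV. a $ l $ k *\<^sub>R \<G> k (\<I> l \<phi>))"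
  proof -
    have "(\<Sum>k\<in>UNIV. \<Sum>l\<in>UNIV. a $ l $ k *\<^sub>R \<G> l (\<I> k \<phi>)) = (\<Sum>k\<in>UNIV. \<Sum>l\<in>UNIV. a $ k $ l *\<^sub>R \<G> k (\<I> l \<phi>))"
      by (rule sum.swap)
    also have "\<dots> = (\<Sum>k\<in>UNIV. \<Sum>l\<in>UNIV. (- a $ l $ k) *\<^sub>R \<G> k (\<I> l \<phi>))"
      by (intro sum.cong refl arg_cong2[where f = scaleR] skewD[OF assms])
    finally show ?thesis by (simp add: sum_negf)
  qed
  finally show ?thesis by simp
qed

lemma spinor_forms_lie: "\<phi> \<in> spinor_forms j \<Longrightarrow> \<rho> a \<phi> \<in> spinor_forms j"
proof -
  assume \<phi>: "\<phi> \<in> spinor_forms j"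
  then have "\<E> k (\<I> i \<phi>) \<in> spinor_forms j" for i k
    by (cases j) (auto simp: spinor_forms_ops op_linear spinor_forms_scale)
  with \<phi> show ?thesis unfolding spin_lie_act_def
    by (intro spinor_forms_scale spinor_forms_ops)
qed

section \<open>The kernel of the Clifford contraction\<close>

abbreviation "Ker \<equiv> cliff_kernel \<gamma>"

lemma KerD: "\<phi> \<in> Ker j \<Longrightarrow> \<phi> \<in> spinor_forms j" "\<phi> \<in> Ker j \<Longrightarrow> Con \<phi> = 0"
  by (simp_all add: cliff_kernel_def)

lemma KerI: "\<phi> \<in> spinor_forms j \<Longrightarrow> Con \<phi> = 0 \<Longrightarrow> \<phi> \<in> Ker j"
  by (simp add: cliff_kernel_def)

lemma Ker_scale:
  "0 \<in> Ker j" "\<phi> \<in> Ker j \<Longrightarrow> r *\<^sub>R \<phi> \<in> Ker j"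
  "\<phi> \<in> Ker j \<Longrightarrow> \<psi> \<in> Ker j \<Longrightarrow> \<phi> + \<psi> \<in> Ker j"
  "\<phi> \<in> Ker j \<Longrightarrow> \<psi> \<in> Ker j \<Longrightarrow> \<phi> - \<psi> \<in> Ker j"
  "(\<And>i. i \<in> I \<Longrightarrow> f i \<in> Ker j) \<Longrightarrow> (\<Sum>i\<in>I. f i) \<in> Ker j"
  by (auto simp: cliff_kernel_def spinor_forms_scale op_linear)

lemma Ker_lie: "skew a \<Longrightarrow> \<phi> \<in> Ker j \<Longrightarrow> \<rho> a \<phi> \<in> Ker j"
  by (simp add: cliff_kernel_def spinor_forms_lie lie_contr[symmetric] lie_linear)

text \<open>Testing against the kernel alone suffices, because the difference itself lies there.
  This is what permits discarding all components in the image of \<open>Wed\<close>.\<close>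

lemma Ker_eqI:
  assumes "x \<in> Ker j" "y \<in> Ker j" "\<And>w. w \<in> Ker j \<Longrightarrow> x \<bullet> w = y \<bullet> w"
  shows "x = y"
proof -
  have "(x - y) \<bullet> (x - y) = 0" using assms Ker_scale(4)[OF assms(1,2)] by (simp add: inner_diff_left)
  then show ?thesis by simp
qed

lemma wedge_inner_Ker [simp]: "w \<in> Ker j \<Longrightarrow> Wed y \<bullet> w = 0"
  by (simp add: inner_wedge KerD)

text \<open>Commuting \<open>Wed\<close> to the outside leaves a term orthogonal to the kernel; only
  the commutator survives.\<close>

lemma op_wedge_inner_Ker:
  assumes "w \<in> Ker j"
  shows "\<G> l (Wed y) \<bullet> w = - 2 * (\<E> l y \<bullet> w)" "\<E> l (Wed y) \<bullet> w = 0" "\<I> l (Wed y) \<bullet> w = \<G> l y \<bullet> w"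
proof -
  show "\<G> l (Wed y) \<bullet> w = - 2 * (\<E> l y \<bullet> w)"
    using assms by (simp add: cliff_wedge_comm inner_diff_left)
  have "\<E> l (Wed y) = - Wed (\<E> l y)" by (simp add: wedge_ext)
  then show "\<E> l (Wed y) \<bullet> w = 0" using assms by simp
  show "\<I> l (Wed y) \<bullet> w = \<G> l y \<bullet> w"
    using assms by (simp add: int_wedge inner_diff_left)
qed

subsection \<open>Curvature sums\<close>

text \<open>The summand is \<open>e_l\<close> for each of the \<open>n - 1\<close> indices
  \<open>k\<close> different from \<open>l\<close>, and \<open>- e_l\<close> for
  \<open>k = l\<close>.\<close>

lemma cliff_sandwich: "(\<Sum>k\<in>UNIV. \<G> k (\<G> l (\<G> k \<phi>))) = (real CARD('n) - 2) *\<^sub>R \<G> l \<phi>"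
proof -
  have "\<G> k (\<G> l (\<G> k \<phi>)) = \<G> l \<phi> + (if k = l then (- 2) *\<^sub>R \<G> k \<phi> else 0)" for k
    using cliff_cliff[of k l "\<G> k \<phi>"] by (simp add: cliff_self op_linear)
  then show ?thesis by (simp add: sum.distrib sum_constant_scaleR scaleR_diff_left del: sum_constant)
qed

text \<open>The spinor part of the rotations gives \<open>- n (n - 2) / 2 - n / 2\<close> by the
  sandwich formula; in the form part one term contains \<open>Con s = 0\<close> and the other yields
  \<open>- 2 j\<close> through the commutator of \<open>e_l\<close> with \<open>Wed\<close>.\<close>

lemma rot_sum_cliff_cliff:
  assumes "s \<in> Ker j"
  shows "(\<Sum>l\<in>UNIV. \<Sum>k\<in>UNIV. \<G> l (\<G> k (\<rho> (rot_gen l k) s))) =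
    - (real CARD('n) * (real CARD('n) - 1) / 2 + 2 * real j) *\<^sub>R s"
proof -
  let ?n = "real CARD('n)"
  have "(\<Sum>l\<in>UNIV. \<Sum>k\<in>UNIV. \<G> l (\<G> k (\<rho> (rot_gen l k) s))) =
     (\<Sum>l\<in>UNIV. (1/2) *\<^sub>R \<G> l (\<Sum>k\<in>UNIV. \<G> k (\<G> l (\<G> k s))))
     + (\<Sum>l\<in>UNIV. (1/2) *\<^sub>R \<G> l (\<G> l s))
     + (\<Sum>l\<in>UNIV. \<G> l (Wed (\<I> l s)))
     - (\<Sum>l\<in>UNIV. \<G> l (\<E> l (Con s)))"
    by (simp add: lie_rot_gen op_linear if_distrib[where f = "\<G> _"] sum.distrib sum_subtractf scaleR_sum_right
        cliff_wedge_def cliff_contr_def cliff_ext cong: if_cong)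
  also have "(\<Sum>l\<in>UNIV. \<G> l (Wed (\<I> l s))) = - Wed (Con s) - 2 *\<^sub>R (\<Sum>l\<in>UNIV. \<E> l (\<I> l s))"
    by (simp add: cliff_wedge_comm sum_subtractf sum_negf cliff_contr_def op_linear scaleR_sum_right)
  finally show ?thesis
    by (simp add: cliff_sandwich cliff_self op_linear KerD[OF assms] number_operator[OF KerD(1)[OF assms]]
        sum_negf sum_constant_scaleR scaleR_sum_right[symmetric] del: sum_constant flip: scaleR_minus_left scaleR_add_left scaleR_diff_left)
      (simp add: field_simps flip: scaleR_minus_left scaleR_add_left scaleR_diff_left)
qed

text \<open>The spinor part contributes \<open>j / 2\<close>, from the diagonal correction, as
  \<open>Con s = 0\<close>. In the form part \<open>int_N\<close> in degree \<open>j - 1\<close>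
  gives \<open>j (n - j + 1)\<close>, from which nilpotency of the exterior and interior
  multiplications leaves \<open>j\<close> to subtract.\<close>

lemma rot_sum_ext_int:
  assumes "s \<in> Ker j"
  shows "(\<Sum>l\<in>UNIV. \<Sum>k\<in>UNIV. \<E> l (\<I> k (\<rho> (rot_gen l k) s))) =
    (real j / 2 + real j * (real CARD('n) - real j)) *\<^sub>R s"
proof -
  let ?n = "real CARD('n)"
  have N: "(\<Sum>k\<in>UNIV. \<E> k (\<I> k s)) = real j *\<^sub>R s" by (rule number_operator[OF KerD(1)[OF assms]])
  have int_N: "(\<Sum>k\<in>UNIV. \<I> k (\<E> k \<phi>)) = ?n *\<^sub>R \<phi> - (\<Sum>k\<in>UNIV. \<E> k (\<I> k \<phi>))" for \<phi>
    by (simp add: int_ext sum_subtractf sum_constant_scaleR del: sum_constant)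
  have N': "(\<Sum>k\<in>UNIV. \<E> k (\<I> k (\<I> l s))) = (real j - 1) *\<^sub>R \<I> l s" for l
  proof (cases j)
    \<comment> \<open>There is no degree \<open>j - 1\<close> here, but \<open>\<I> l s\<close>
      vanishes, so the factor \<open>real j - 1\<close> is harmless.\<close>
    case 0
    then show ?thesis using KerD(1)[OF assms] by (simp add: spinor_forms_ops op_linear)
  next
    case (Suc i)
    then show ?thesis using number_operator[of "\<I> l s" i] spinor_forms_ops(3) KerD(1)[OF assms] by force
  qed
  have sq: "\<E> l (\<E> l x) = 0" "\<I> k (\<I> k x) = 0" for x l k
    by (rule ext_sq int_sq)+
  have "\<E> l (\<I> k (\<E> l (\<I> k s))) = (if k = l then \<E> l (\<I> k s) else 0)" for l k
    by (simp add: int_ext op_linear sq)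
  then have c4: "(\<Sum>k\<in>UNIV. \<E> l (\<I> k (\<E> l (\<I> k s)))) = \<E> l (\<I> l s)" for l by simp
  have "(\<Sum>l\<in>UNIV. \<Sum>k\<in>UNIV. \<E> l (\<I> k (\<rho> (rot_gen l k) s))) =
     (\<Sum>l\<in>UNIV. (1/2) *\<^sub>R \<E> l (\<G> l (Con s)))
     + (\<Sum>l\<in>UNIV. (1/2) *\<^sub>R \<E> l (\<I> l s))
     + (\<Sum>l\<in>UNIV. \<E> l (\<Sum>k\<in>UNIV. \<I> k (\<E> k (\<I> l s))))
     - (\<Sum>l\<in>UNIV. \<Sum>k\<in>UNIV. \<E> l (\<I> k (\<E> l (\<I> k s))))"
    by (simp add: lie_rot_gen op_linear if_distrib[where f = "\<E> _"] if_distrib[where f = "\<I> _"] sum.distrib sum_subtractf scaleR_sum_right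
        cliff_contr_def cliff_int cong: if_cong)
  then show ?thesis
    by (simp add: KerD[OF assms] op_linear int_N N' c4 N scaleR_sum_right[symmetric] flip: scaleR_diff_left scaleR_add_left)
      (simp add: field_simps)
qed

text \<open>The result is a multiple of \<open>Wed s\<close>: curvature does not contribute to the
  relation between \<open>D\<close> and \<open>T^+\<close>, whose values are tested against the
  kernel.\<close>

lemma rot_sum_cliff_ext:
  assumes "s \<in> Ker j"
  shows "(\<Sum>l\<in>UNIV. \<Sum>k\<in>UNIV. \<E> k (\<G> l (\<rho> (rot_gen l k) s))) = (1/2 + real j - real CARD('n) / 2) *\<^sub>R Wed s"
proof -
  have sq: "\<E> k (\<E> k x) = 0" for x k
    by (rule ext_sq)
  have N: "(\<Sum>k\<in>UNIV. \<E> k (\<I> k s)) = real j *\<^sub>R s" by (rule number_operator[OF KerD(1)[OF assms]])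
  have "\<E> k (\<G> l (\<E> l (\<I> k s))) = - \<G> l (\<E> l (\<E> k (\<I> k s)))" for k l
    by (simp add: cliff_ext ext_ext[of k l] op_linear)
  then have w: "(\<Sum>l\<in>UNIV. \<Sum>k\<in>UNIV. \<E> k (\<G> l (\<E> l (\<I> k s)))) = - (real j *\<^sub>R Wed s)"
    by (simp add: sum_negf cliff_wedge_def N op_linear flip: linear_simps(6)[OF linear_cliff] linear_simps(6)[OF linear_ext_mult])
      (simp add: scaleR_sum_right)
  have "(\<Sum>l\<in>UNIV. \<Sum>k\<in>UNIV. \<E> k (\<G> l (\<rho> (rot_gen l k) s))) =
     (\<Sum>l\<in>(UNIV :: 'n set). \<Sum>k\<in>UNIV. - ((1/2) *\<^sub>R \<G> k (\<E> k s)))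
     + (\<Sum>l\<in>UNIV. (1/2) *\<^sub>R \<G> l (\<E> l s))
     - (\<Sum>l\<in>UNIV. \<Sum>k\<in>UNIV. \<E> k (\<G> l (\<E> l (\<I> k s))))"
    by (simp add: lie_rot_gen op_linear if_distrib[where f = "\<E> _"] if_distrib[where f = "\<G> _"] sum.distrib sum_subtractf scaleR_sum_right
        cliff_self cliff_ext sq sum_negf cong: if_cong)
  then show ?thesis unfolding w
    by (simp add: sum_negf scaleR_sum_right[symmetric] cliff_wedge_def[symmetric] sum_constant_scaleR algebra_simps del: sum_constant)
qed

text \<open>Nilpotency of exterior multiplication kills the form part and the diagonal correction;
  the spinor part reassembles into \<open>Wed\<close> twice. In \<open>rot_sum_int_int\<close> the
  analogous remainder contains \<open>Con s\<close> and is zero.\<close>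

lemma rot_sum_ext_ext:
  "(\<Sum>l\<in>UNIV. \<Sum>k\<in>UNIV. \<E> l (\<E> k (\<rho> (rot_gen l k) s))) = (1/2) *\<^sub>R Wed (Wed s)"
proof -
  have sq: "\<E> k (\<E> k x) = 0" for x k
    by (rule ext_sq)
  have "\<E> l (\<E> k (\<rho> (rot_gen l k) s)) = (1/2) *\<^sub>R \<G> l (\<E> l (\<G> k (\<E> k s)))" for l k
    by (simp add: lie_rot_gen op_linear sq ext_ext[of k l] cliff_ext)
  then show ?thesis by (simp add: cliff_wedge_def op_linear scaleR_sum_right)
qed

lemma rot_sum_int_int:
  assumes "s \<in> Ker j"
  shows "(\<Sum>l\<in>UNIV. \<Sum>k\<in>UNIV. \<I> l (\<I> k (\<rho> (rot_gen l k) s))) = 0"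
proof -
  have sq: "\<I> k (\<I> k x) = 0" for x k
    by (rule int_sq)
  have "\<I> l (\<I> k (\<rho> (rot_gen l k) s)) = (1/2) *\<^sub>R \<I> l (\<G> l (\<G> k (\<I> k s)))" for l k
    by (simp add: lie_rot_gen op_linear sq int_int[of k l] int_ext cliff_int)
  then have "(\<Sum>l\<in>UNIV. \<Sum>k\<in>UNIV. \<I> l (\<I> k (\<rho> (rot_gen l k) s))) = (\<Sum>l\<in>UNIV. (1/2) *\<^sub>R \<I> l (\<G> l (Con s)))"
    by (simp add: cliff_contr_def op_linear scaleR_sum_right)
  then show ?thesis by (simp add: KerD[OF assms] op_linear)
qed

text \<open>Each plane is counted twice, so this is twice the Casimir operator up to sign. In
  curvature \<open>c\<close> it yields the stated value of the curvature endomorphism.\<close>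

lemma rot_sum_lie:
  assumes "s \<in> Ker j"
  shows "(\<Sum>l\<in>UNIV. \<Sum>k\<in>UNIV. \<rho> (rot_gen l k) (\<rho> (rot_gen l k) s)) =
    - (2 * (real j * (real CARD('n) - real j + 1) + real CARD('n) * (real CARD('n) - 1) / 8)) *\<^sub>R s"
proof -
  have "rot_gen l l = 0" for l :: 'n by (simp add: rot_gen_def vec_eq_iff)
  then have z: "\<rho> (rot_gen l l) s = 0" for l by (simp add: lie_matrix_linear)
  have r: "rot_gen k l = - rot_gen l k" for l k :: 'n by (simp add: rot_gen_def vec_eq_iff)
  have anti: "\<rho> (rot_gen k l) s = - \<rho> (rot_gen l k) s" for l k by (subst r) (rule lie_matrix_linear(3))
  let ?x = "\<lambda>l k. \<rho> (rot_gen l k) s"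
  have "(\<Sum>l\<in>UNIV. \<Sum>k\<in>UNIV. \<rho> (rot_gen l k) (?x l k)) =
     (1/2) *\<^sub>R (\<Sum>l\<in>UNIV. \<Sum>k\<in>UNIV. \<G> l (\<G> k (?x l k))) + (\<Sum>l\<in>UNIV. \<Sum>k\<in>UNIV. \<E> k (\<I> l (?x l k)))
     - (\<Sum>l\<in>UNIV. \<Sum>k\<in>UNIV. \<E> l (\<I> k (?x l k)))"
    by (subst lie_rot_gen) (simp add: sum.distrib sum_subtractf scaleR_sum_right z)
  also have "(\<Sum>l\<in>UNIV. \<Sum>k\<in>UNIV. \<E> k (\<I> l (?x l k))) = - (\<Sum>l\<in>UNIV. \<Sum>k\<in>UNIV. \<E> l (\<I> k (?x l k)))"
    by (subst sum.swap, subst anti) (simp add: op_linear sum_negf)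
  finally show ?thesis
    unfolding rot_sum_cliff_cliff[OF assms] rot_sum_ext_int[OF assms]
    by (simp flip: scaleR_minus_left scaleR_diff_left) (simp add: field_simps flip: scaleR_add_left scaleR_minus_left scaleR_diff_left)
qed

end

section \<open>The symbols of the normalized gradients\<close>

context spinor_module
begin

text \<open>The three contractions of a vector index: symbols of the Dirac operator, of the exterior
  derivative (\<open>esum\<close>) and, up to sign, of the codifferential (\<open>isum\<close>)
  twisted with spinors. Functions of the index are used so that second-order symbols can be
  nested.\<close>

definition gsum :: "('n \<Rightarrow> ('n, 's) twisted) \<Rightarrow> ('n, 's) twisted" where "gsum x = (\<Sum>k\<in>UNIV. \<G> k (x k))"
definition esum :: "('n \<Rightarrow> ('n, 's) twisted) \<Rightarrow> ('n, 's) twisted" where "esum x = (\<Sum>k\<in>UNIV. \<E> k (x k))"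
definition isum :: "('n \<Rightarrow> ('n, 's) twisted) \<Rightarrow> ('n, 's) twisted" where "isum x = (\<Sum>k\<in>UNIV. \<I> k (x k))"

text \<open>\<open>symD j\<close>, \<open>symM j\<close> and \<open>symP j\<close> are the symbols of \<open>D\<^sub>j\<close>, \<open>T\<^sub>j\<^sup>-\<close> and \<open>T\<^sub>j\<^sup>+\<close>. The \<open>Wed\<close> terms make
  them the orthogonal projections of \<open>gsum\<close> and \<open>esum\<close> to the kernel of \<open>Con\<close>.\<close>

definition symD :: "nat \<Rightarrow> ('n \<Rightarrow> ('n, 's) twisted) \<Rightarrow> ('n, 's) twisted" where
  "symD j x = gsum x - (2 / (real CARD('n) - 2 * real j + 2)) *\<^sub>R Wed (isum x)"

text \<open>The component of \<open>gsum x\<close> in the image of \<open>Wed\<close> is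
  \<open>Wed ((2/M) isum x)\<close> with \<open>M = n - 2 j + 2\<close>. Relative to the isometric
  embedding \<open>Wed / sqrt M\<close> the factor becomes \<open>2 / sqrt M\<close>.\<close>

definition symM :: "nat \<Rightarrow> ('n \<Rightarrow> ('n, 's) twisted) \<Rightarrow> ('n, 's) twisted" where
  "symM j x = (2 / sqrt (real CARD('n) - 2 * real j + 2)) *\<^sub>R isum x"

definition symE :: "nat \<Rightarrow> ('n \<Rightarrow> ('n, 's) twisted) \<Rightarrow> ('n, 's) twisted" where
  "symE j x = (let m = real CARD('n) - 2 * real j in
     esum x + (1 / m) *\<^sub>R Wed (gsum x) - (1 / (m * (m + 1))) *\<^sub>R Wed (Wed (isum x)))"

text \<open>The factor \<open>- 2\<close> arises when \<open>e_k\<close> is commuted past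
  \<open>Wed\<close>, and \<open>1 / sqrt (n - 2 j)\<close> makes the embedding \<open>Wed\<close>
  of \<open>Ker j\<close> isometric.\<close>

definition symP :: "nat \<Rightarrow> ('n \<Rightarrow> ('n, 's) twisted) \<Rightarrow> ('n, 's) twisted" where
  "symP j x = (- 2 / sqrt (real CARD('n) - 2 * real j)) *\<^sub>R symE j x"

lemma sym_forms:
  assumes "\<And>k. x k \<in> Ker j"
  shows "gsum x \<in> spinor_forms j" "esum x \<in> spinor_forms (Suc j)"
    "j = 0 \<Longrightarrow> isum x = 0" "j = Suc i \<Longrightarrow> isum x \<in> spinor_forms i"
proof -
  note x = KerD(1)[OF assms]
  show "gsum x \<in> spinor_forms j" "esum x \<in> spinor_forms (Suc j)"
    unfolding gsum_def esum_def by (intro spinor_forms_scale(5) spinor_forms_ops x)+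
  show "isum x = 0" if "j = 0"
    unfolding isum_def using x that by (simp add: spinor_forms_ops(4))
  show "isum x \<in> spinor_forms i" if "j = Suc i"
    unfolding isum_def using x that by (intro spinor_forms_scale(5) spinor_forms_ops) simp
qed

lemma contr_sym:
  assumes "\<And>k. Con (x k) = 0"
  shows "Con (gsum x) = - 2 *\<^sub>R isum x" "Con (esum x) = gsum x" "Con (isum x) = 0"
  unfolding gsum_def esum_def isum_def using assms
  by (simp_all add: op_linear contr_cliff contr_ext contr_int scaleR_sum_right sum_negf)

lemma isum_Ker: "(\<And>k. x k \<in> Ker (Suc i)) \<Longrightarrow> isum x \<in> Ker i"
  using sym_forms(4)[of x "Suc i" i] contr_sym(3)[of x] by (auto intro!: KerI dest: KerD(2))

lemma symM_Ker: "(\<And>k. x k \<in> Ker (Suc i)) \<Longrightarrow> symM (Suc i) x \<in> Ker i"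
  unfolding symM_def by (intro Ker_scale isum_Ker)

text \<open>\<open>Con\<close> sends \<open>gsum x\<close> to \<open>- 2 isum x\<close> and
  \<open>Wed (isum x)\<close> to \<open>- (n - 2 j + 2) isum x\<close>; the coefficient in
  \<open>symD\<close> balances the two.\<close>

lemma symD_Ker:
  assumes x: "\<And>k. x k \<in> Ker j" and j: "2 * j \<le> CARD('n)"
  shows "symD j x \<in> Ker j"
proof (cases j)
  case 0
  then show ?thesis unfolding symD_def using x sym_forms[OF x] contr_sym[of x] KerD[OF x]
    by (intro KerI) (simp_all add: op_linear)
next
  case (Suc i)
  let ?M = "real CARD('n) - 2 * real j + 2"
  have M: "?M > 0" using j by linarith
  have i: "isum x \<in> Ker i" using x isum_Ker unfolding Suc by blast
  show ?thesis
  proof (rule KerI)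
    show "symD j x \<in> spinor_forms j"
      using sym_forms(1)[OF x] spinor_forms_wedge[OF KerD(1)[OF i]] unfolding symD_def Suc
      by (intro spinor_forms_scale)
    have "Con (symD j x) = - 2 *\<^sub>R isum x - ((2 / ?M) * (2 * real i - real CARD('n))) *\<^sub>R isum x"
      unfolding symD_def op_linear contr_wedge[OF KerD(1)[OF i]]
      by (simp add: contr_sym KerD[OF x] KerD[OF i] op_linear)
    also have "(2 / ?M) * (2 * real i - real CARD('n)) = - 2"
      using M Suc by (simp add: field_simps)
    finally show "Con (symD j x) = 0" by simp
  qed
qed

text \<open>The coefficient \<open>1 / m\<close> cancels the multiple of \<open>gsum x\<close> in
  the contraction. It leaves \<open>- (2 / m) Wed (isum x)\<close>, since \<open>gsum x\<close>
  itself is not in the kernel, and this determines the coefficient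
  \<open>1 / (m (m + 1))\<close>.\<close>

lemma symE_Ker:
  assumes x: "\<And>k. x k \<in> Ker j" and j: "2 * j < CARD('n)"
  shows "symE j x \<in> Ker (Suc j)"
proof -
  define m where "m = real CARD('n) - 2 * real j"
  have m: "m > 0" using j by (simp add: m_def)
  \<comment> \<open>On \<open>isum x\<close>, of degree \<open>j - 1\<close>,
    \<open>contr_wedge\<close> is applied in degrees \<open>j - 1\<close> and \<open>j\<close>; the
    scalars \<open>- (m + 2)\<close> and \<open>- m\<close> add up.\<close>
  have W2: "Wed (Wed (isum x)) \<in> spinor_forms (Suc j) \<and>
      Con (Wed (Wed (isum x))) = - ((2 * (m + 1)) *\<^sub>R Wed (isum x))"
  proof (cases j)
    case 0
    then show ?thesis using sym_forms(3)[OF x] by (simp add: op_linear spinor_forms_scale)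
  next
    case (Suc i)
    have i: "isum x \<in> Ker i" using x isum_Ker unfolding Suc by blast
    have e: "2 * real i + 2 * real (Suc i) - 2 * real CARD('n) = - (2 * (m + 1))" using Suc by (simp add: m_def)
    have "Con (Wed (Wed (isum x))) = (2 * real i + 2 * real (Suc i) - 2 * real CARD('n)) *\<^sub>R Wed (isum x)"
      by (simp add: contr_wedge[OF spinor_forms_wedge[OF KerD(1)[OF i]]] contr_wedge[OF KerD(1)[OF i]] KerD[OF i] op_linear
          flip: scaleR_add_left)
    then show ?thesis using spinor_forms_wedge[OF spinor_forms_wedge[OF KerD(1)[OF i]]] unfolding e scaleR_minus_left by (simp add: Suc)
  qed
  show ?thesis
  proof (rule KerI)
    show "symE j x \<in> spinor_forms (Suc j)"
      unfolding symE_def Let_def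
      using sym_forms(2)[OF x] spinor_forms_wedge[OF sym_forms(1)[OF x]] W2 by (intro spinor_forms_scale) auto
    have c: "Con (gsum x) = - 2 *\<^sub>R isum x" "Con (esum x) = gsum x"
      using contr_sym[of x] KerD(2)[OF x] by auto
    have "Con (symE j x) = gsum x + ((1 / m) * (2 * real j - real CARD('n))) *\<^sub>R gsum x - (2 / m) *\<^sub>R Wed (isum x)
        + ((1 / (m * (m + 1))) * (2 * (m + 1))) *\<^sub>R Wed (isum x)"
      unfolding symE_def Let_def m_def[symmetric] op_linear c contr_wedge[OF sym_forms(1)[OF x]] W2[THEN conjunct2]
      by (simp add: scaleR_add_right op_linear scaleR_diff_right)
    also have "(1 / m) * (2 * real j - real CARD('n)) = - 1" using m by (simp add: m_def field_simps)
    also have "(1 / (m * (m + 1))) * (2 * (m + 1)) = 2 / m"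
      unfolding times_divide_eq_left mult_1 using m by (subst frac_eq_eq) auto
    finally have "Con (symE j x) = gsum x + (- 1) *\<^sub>R gsum x - (2 / m) *\<^sub>R Wed (isum x) + (2 / m) *\<^sub>R Wed (isum x)" .
    then show "Con (symE j x) = 0" by simp
  qed
qed

lemma symP_Ker: "(\<And>k. x k \<in> Ker j) \<Longrightarrow> 2 * j < CARD('n) \<Longrightarrow> symP j x \<in> Ker (Suc j)"
  unfolding symP_def by (intro Ker_scale symE_Ker)

lemma symD_inner: "w \<in> Ker j \<Longrightarrow> symD j x \<bullet> w = gsum x \<bullet> w"
  by (simp add: symD_def inner_diff_left)

lemma symE_inner: "w \<in> Ker i \<Longrightarrow> symE j x \<bullet> w = esum x \<bullet> w"
  by (simp add: symE_def Let_def inner_diff_left inner_add_left)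

lemma symP_inner: "w \<in> Ker i \<Longrightarrow> symP j x \<bullet> w = - 2 / sqrt (real CARD('n) - 2 * real j) * (esum x \<bullet> w)"
  by (simp add: symP_def symE_inner)

lemma lie_gsum: "skew a \<Longrightarrow> \<rho> a (gsum x) = gsum (\<lambda>k. \<rho> a (x k) + (\<Sum>l\<in>UNIV. a $ k $ l *\<^sub>R x l))"
  unfolding gsum_def by (simp add: lie_linear lie_cliff op_linear sum.distrib) (rule sum.swap)
lemma lie_esum: "\<rho> a (esum x) = esum (\<lambda>k. \<rho> a (x k) + (\<Sum>l\<in>UNIV. a $ k $ l *\<^sub>R x l))"
  unfolding esum_def by (simp add: lie_linear lie_ext op_linear sum.distrib) (rule sum.swap)
lemma lie_isum: "skew a \<Longrightarrow> \<rho> a (isum x) = isum (\<lambda>k. \<rho> a (x k) + (\<Sum>l\<in>UNIV. a $ k $ l *\<^sub>R x l))"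
  unfolding isum_def by (simp add: lie_linear lie_int op_linear sum.distrib) (rule sum.swap)

text \<open>The right-hand sides carry the action on the tensor product with the vector
  representation. This is what lets a connection matrix pass through a symbol.\<close>

lemma lie_sym:
  assumes "skew a"
  defines "y \<equiv> \<lambda>x k. \<rho> a (x k) + (\<Sum>l\<in>UNIV. a $ k $ l *\<^sub>R x l)"
  shows "\<rho> a (symD j x) = symD j (y x)" "\<rho> a (symM j x) = symM j (y x)" "\<rho> a (symP j x) = symP j (y x)"
  by (simp_all add: symD_def symM_def symP_def symE_def Let_def lie_linear lie_wedge[OF assms(1)]
      lie_gsum[OF assms(1)] lie_esum lie_isum[OF assms(1)] y_def)

subsection \<open>Second-order identities\<close>

text \<open>Exchanging the summation indices costs a curvature sum; comparing with the
  anticommutation relation solves for the sum when both operators are of the same type. The sums of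
  \<open>\<E> l (\<I> k (H l k))\<close> and \<open>\<E> l (\<G> k (H l k))\<close> remain as
  unknowns, which cancel or match in the identities.\<close>

lemma op2_sum:
  assumes "s \<in> Ker j" and R: "\<And>l k. H l k - H k l = - c *\<^sub>R \<rho> (rot_gen l k) s"
  shows sum_GG: "(\<Sum>l\<in>UNIV. \<Sum>k\<in>UNIV. \<G> l (\<G> k (H l k))) =
      - (\<Sum>k\<in>UNIV. H k k) + ((real CARD('n) * (real CARD('n) - 1) / 4 + real j) * c) *\<^sub>R s"
    and sum_IE: "(\<Sum>l\<in>UNIV. \<Sum>k\<in>UNIV. \<I> l (\<E> k (H l k))) =
      (\<Sum>k\<in>UNIV. H k k) - (\<Sum>l\<in>UNIV. \<Sum>k\<in>UNIV. \<E> l (\<I> k (H l k)))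
        - (c * (real j / 2 + real j * (real CARD('n) - real j))) *\<^sub>R s"
    and sum_EG: "(\<Sum>l\<in>UNIV. \<Sum>k\<in>UNIV. \<G> l (\<E> k (H l k))) = (\<Sum>l\<in>UNIV. \<Sum>k\<in>UNIV. \<E> l (\<G> k (H l k)))
        - (c * (1/2 + real j - real CARD('n) / 2)) *\<^sub>R Wed s"
    and sum_EE: "(\<Sum>l\<in>UNIV. \<Sum>k\<in>UNIV. \<E> l (\<E> k (H l k))) = (- c / 4) *\<^sub>R Wed (Wed s)"
    and sum_II: "(\<Sum>l\<in>UNIV. \<Sum>k\<in>UNIV. \<I> l (\<I> k (H l k))) = 0"
proof -
  have sw: "H k l = H l k + c *\<^sub>R \<rho> (rot_gen l k) s" for l k
    using R[of l k] by (simp add: algebra_simps)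
  have swap: "(\<Sum>l\<in>UNIV. \<Sum>k\<in>UNIV. P k (Q l (H l k))) =
      (\<Sum>l\<in>UNIV. \<Sum>k\<in>UNIV. P l (Q k (H l k))) + c *\<^sub>R (\<Sum>l\<in>UNIV. \<Sum>k\<in>UNIV. P l (Q k (\<rho> (rot_gen l k) s)))"
    if "\<And>k. linear (P k)" "\<And>k. linear (Q k)" for P Q :: "'n \<Rightarrow> ('n, 's) twisted \<Rightarrow> ('n, 's) twisted"
  proof -
    have "(\<Sum>l\<in>UNIV. \<Sum>k\<in>UNIV. P k (Q l (H l k))) = (\<Sum>l\<in>UNIV. \<Sum>k\<in>UNIV. P l (Q k (H k l)))"
      by (rule sum.swap)
    also have "\<dots> = (\<Sum>l\<in>UNIV. \<Sum>k\<in>UNIV. P l (Q k (H l k + c *\<^sub>R \<rho> (rot_gen l k) s)))"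
      by (intro sum.cong refl arg_cong[where f = "P _"] arg_cong[where f = "Q _"] sw)
    finally show ?thesis
      by (simp add: linear_simps[OF that(1)] linear_simps[OF that(2)] sum.distrib scaleR_sum_right)
  qed
  let ?GG = "\<Sum>l\<in>UNIV. \<Sum>k\<in>UNIV. \<G> l (\<G> k (H l k))"
  have "(\<Sum>l\<in>UNIV. \<Sum>k\<in>UNIV. \<G> k (\<G> l (H l k))) = - ?GG - 2 *\<^sub>R (\<Sum>k\<in>UNIV. H k k)"
  proof -
    have "(\<Sum>l\<in>UNIV. \<Sum>k\<in>UNIV. \<G> k (\<G> l (H l k))) =
        (\<Sum>l\<in>UNIV. \<Sum>k\<in>UNIV. - \<G> l (\<G> k (H l k)) + (if k = l then (- 2) *\<^sub>R H l k else 0))"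
      by (intro sum.cong refl cliff_cliff)
    then show ?thesis by (simp add: sum.distrib sum_negf sum_subtractf scaleR_sum_right)
  qed
  with swap[of "cliff \<gamma>" "cliff \<gamma>", OF linear_cliff linear_cliff] rot_sum_cliff_cliff[OF assms(1)]
  have e: "- ?GG - 2 *\<^sub>R (\<Sum>k\<in>UNIV. H k k) =
      ?GG + c *\<^sub>R (- (real CARD('n) * (real CARD('n) - 1) / 2 + 2 * real j) *\<^sub>R s)" by metis
  show "?GG = - (\<Sum>k\<in>UNIV. H k k) + ((real CARD('n) * (real CARD('n) - 1) / 4 + real j) * c) *\<^sub>R s"
  \<comment> \<open>The vector equation determines its unknown up to division by 2; after pairing
    with an arbitrary \<open>w\<close> it is a scalar linear equation.\<close>
  proof (rule vector_eq_rdot[THEN iffD1], rule allI)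
    fix w
    from arg_cong[OF e, of "\<lambda>x. x \<bullet> w"]
    show "?GG \<bullet> w = (- (\<Sum>k\<in>UNIV. H k k) + ((real CARD('n) * (real CARD('n) - 1) / 4 + real j) * c) *\<^sub>R s) \<bullet> w"
      by (simp only: inner_add_left inner_diff_left inner_minus_left inner_scaleR_left; simp add: field_simps)
  qed
  have "(\<Sum>l\<in>UNIV. \<Sum>k\<in>UNIV. \<I> l (\<E> k (H l k))) = (\<Sum>k\<in>UNIV. H k k) - (\<Sum>l\<in>UNIV. \<Sum>k\<in>UNIV. \<E> k (\<I> l (H l k)))"
    by (simp add: int_ext sum_subtractf)
  then show "(\<Sum>l\<in>UNIV. \<Sum>k\<in>UNIV. \<I> l (\<E> k (H l k))) =
      (\<Sum>k\<in>UNIV. H k k) - (\<Sum>l\<in>UNIV. \<Sum>k\<in>UNIV. \<E> l (\<I> k (H l k)))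
        - (c * (real j / 2 + real j * (real CARD('n) - real j))) *\<^sub>R s"
    unfolding swap[OF linear_ext_mult linear_int_mult] rot_sum_ext_int[OF assms(1)] by simp
  have "(\<Sum>l\<in>UNIV. \<Sum>k\<in>UNIV. \<G> l (\<E> k (H l k))) = (\<Sum>l\<in>UNIV. \<Sum>k\<in>UNIV. \<E> k (\<G> l (H l k)))"
    by (simp add: cliff_ext)
  also have "\<dots> = (\<Sum>l\<in>UNIV. \<Sum>k\<in>UNIV. \<E> l (\<G> k (H l k))) + c *\<^sub>R (\<Sum>l\<in>UNIV. \<Sum>k\<in>UNIV. \<E> l (\<G> k (\<rho> (rot_gen l k) s)))"
    by (rule swap[OF linear_ext_mult linear_cliff])
  also have "(\<Sum>l\<in>UNIV. \<Sum>k\<in>UNIV. \<E> l (\<G> k (\<rho> (rot_gen l k) s))) = - (\<Sum>l\<in>UNIV. \<Sum>k\<in>UNIV. \<E> k (\<G> l (\<rho> (rot_gen l k) s)))"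
  proof (subst sum.swap)
    have "\<rho> (rot_gen k l) s = - \<rho> (rot_gen l k) s" for l k
    proof -
      have r: "rot_gen k l = - rot_gen l k" by (simp add: rot_gen_def vec_eq_iff)
      show ?thesis by (subst r) (rule lie_matrix_linear(3))
    qed
    then show "(\<Sum>k\<in>UNIV. \<Sum>l\<in>UNIV. \<E> l (\<G> k (\<rho> (rot_gen l k) s))) = - (\<Sum>l\<in>UNIV. \<Sum>k\<in>UNIV. \<E> k (\<G> l (\<rho> (rot_gen l k) s)))"
      unfolding sum_negf[symmetric] by (intro sum.cong refl) (metis op_linear(3) op_linear(9))
  qed
  finally show "(\<Sum>l\<in>UNIV. \<Sum>k\<in>UNIV. \<G> l (\<E> k (H l k))) = (\<Sum>l\<in>UNIV. \<Sum>k\<in>UNIV. \<E> l (\<G> k (H l k)))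
        - (c * (1/2 + real j - real CARD('n) / 2)) *\<^sub>R Wed s"
    unfolding rot_sum_cliff_ext[OF assms(1)] by simp
  let ?EE = "\<Sum>l\<in>UNIV. \<Sum>k\<in>UNIV. \<E> l (\<E> k (H l k))"
  have "(\<Sum>l\<in>UNIV. \<Sum>k\<in>UNIV. \<E> k (\<E> l (H l k))) = - ?EE"
  proof -
    have "(\<Sum>l\<in>UNIV. \<Sum>k\<in>UNIV. \<E> k (\<E> l (H l k))) = (\<Sum>l\<in>UNIV. \<Sum>k\<in>UNIV. - \<E> l (\<E> k (H l k)))"
      by (intro sum.cong refl ext_ext)
    then show ?thesis by (simp add: sum_negf)
  qed
  with swap[of ext_mult ext_mult, OF linear_ext_mult linear_ext_mult] rot_sum_ext_ext
  have e: "- ?EE = ?EE + c *\<^sub>R ((1/2) *\<^sub>R Wed (Wed s))" by metis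
  show "?EE = (- c / 4) *\<^sub>R Wed (Wed s)"
  proof (rule vector_eq_rdot[THEN iffD1], rule allI)
    fix w
    from arg_cong[OF e, of "\<lambda>x. x \<bullet> w"]
    show "?EE \<bullet> w = ((- c / 4) *\<^sub>R Wed (Wed s)) \<bullet> w"
      by (simp only: inner_add_left inner_diff_left inner_minus_left inner_scaleR_left; simp add: field_simps)
  qed
  let ?II = "\<Sum>l\<in>UNIV. \<Sum>k\<in>UNIV. \<I> l (\<I> k (H l k))"
  have "(\<Sum>l\<in>UNIV. \<Sum>k\<in>UNIV. \<I> k (\<I> l (H l k))) = - ?II"
  proof -
    have "(\<Sum>l\<in>UNIV. \<Sum>k\<in>UNIV. \<I> k (\<I> l (H l k))) = (\<Sum>l\<in>UNIV. \<Sum>k\<in>UNIV. - \<I> l (\<I> k (H l k)))"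
      by (intro sum.cong refl int_int)
    then show ?thesis by (simp add: sum_negf)
  qed
  with swap[of int_mult int_mult, OF linear_int_mult linear_int_mult] rot_sum_int_int[OF assms(1)]
  have e: "- ?II = ?II + c *\<^sub>R 0" by metis
  show "?II = 0"
  proof (rule vector_eq_rdot[THEN iffD1], rule allI)
    fix w
    from arg_cong[OF e, of "\<lambda>x. x \<bullet> w"]
    show "?II \<bullet> w = 0 \<bullet> w"
      by (simp only: inner_add_left inner_minus_left; simp)
  qed
qed

text \<open>The outer projection is invisible to \<open>w\<close>. In the inner one
  \<open>e_l\<close> meets \<open>Wed\<close> and leaves \<open>- 2 \<E> l\<close>, which doubles
  the coefficient \<open>2 / (n - 2 j + 2)\<close> and reverses its sign.\<close>

lemma sym_DD_inner:
  assumes "w \<in> Ker j"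
  shows "symD j (\<lambda>l. symD j (H l)) \<bullet> w = (\<Sum>l\<in>UNIV. \<Sum>k\<in>UNIV. \<G> l (\<G> k (H l k))) \<bullet> w +
    (4 / (real CARD('n) - 2 * real j + 2)) * ((\<Sum>l\<in>UNIV. \<Sum>k\<in>UNIV. \<E> l (\<I> k (H l k))) \<bullet> w)"
proof -
  have "\<G> l (symD j (H l)) \<bullet> w = \<G> l (gsum (H l)) \<bullet> w + (4 / (real CARD('n) - 2 * real j + 2)) * (\<E> l (isum (H l)) \<bullet> w)" for l
    by (simp add: symD_def op_linear inner_diff_left op_wedge_inner_Ker[OF assms])
  then show ?thesis
    unfolding symD_inner[OF assms] gsum_def[of "\<lambda>l. symD j (H l)"] inner_sum_left[of _ UNIV]
    by (simp only: gsum_def isum_def op_linear inner_sum_left sum.distrib sum_distrib_left[symmetric])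
qed

text \<open>With \<open>j = Suc i\<close> this is the negative of the second term of
  \<open>sym_DD_inner\<close>, which is why the sum of the two operators contains only the Laplacian
  and curvature.\<close>

lemma sym_PM_inner:
  assumes "w \<in> Ker (Suc i)" "2 * Suc i \<le> CARD('n)"
  shows "symP i (\<lambda>l. symM (Suc i) (H l)) \<bullet> w = - (4 / (real CARD('n) - 2 * real (Suc i) + 2)) *
    ((\<Sum>l\<in>UNIV. \<Sum>k\<in>UNIV. \<E> l (\<I> k (H l k))) \<bullet> w)"
proof -
  have "2 * i + 2 \<le> CARD('n)" using assms(2) by simp
  then have m: "real CARD('n) - 2 * real i > 0" "real CARD('n) - 2 * real (Suc i) + 2 = real CARD('n) - 2 * real i"
    by simp_all
  have "esum (\<lambda>l. symM (Suc i) (H l)) = (2 / sqrt (real CARD('n) - 2 * real i)) *\<^sub>R (\<Sum>l\<in>UNIV. \<Sum>k\<in>UNIV. \<E> l (\<I> k (H l k)))"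
    unfolding esum_def symM_def isum_def m(2) by (simp only: op_linear scaleR_sum_right)
  then show ?thesis unfolding m(2) using m(1) by (simp add: symP_inner[OF assms(1)])
qed

text \<open>The three terms come from the three summands of \<open>symE\<close>: pulling
  \<open>Wed\<close> out from under \<open>\<I> l\<close> leaves \<open>\<G> l\<close>, and a second
  \<open>Wed\<close> leaves \<open>- 2 \<E> l\<close>.\<close>

lemma sym_MP_inner:
  assumes "w \<in> Ker j" "2 * j < CARD('n)"
  defines "m \<equiv> real CARD('n) - 2 * real j"
  shows "symM (Suc j) (\<lambda>l. symP j (H l)) \<bullet> w = - (4 / m) *
    ((\<Sum>l\<in>UNIV. \<Sum>k\<in>UNIV. \<I> l (\<E> k (H l k))) \<bullet> w + (1 / m) * ((\<Sum>l\<in>UNIV. \<Sum>k\<in>UNIV. \<G> l (\<G> k (H l k))) \<bullet> w)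
      + (2 / (m * (m + 1))) * ((\<Sum>l\<in>UNIV. \<Sum>k\<in>UNIV. \<E> l (\<I> k (H l k))) \<bullet> w))"
proof -
  have m: "m > 0" "real CARD('n) - 2 * real (Suc j) + 2 = m" using assms(2) by (simp_all add: m_def)
  have "\<I> l (symE j (H l)) \<bullet> w = \<I> l (esum (H l)) \<bullet> w + (1/m) * (\<G> l (gsum (H l)) \<bullet> w)
      + (2 / (m * (m + 1))) * (\<E> l (isum (H l)) \<bullet> w)" for l
    by (simp add: symE_def Let_def op_linear inner_diff_left inner_add_left op_wedge_inner_Ker[OF assms(1)] m_def[symmetric])
  then have "symM (Suc j) (\<lambda>l. symP j (H l)) \<bullet> w = (2 / sqrt m * (- 2 / sqrt m)) * (\<Sum>l\<in>UNIV. \<I> l (esum (H l)) \<bullet> w + (1/m) * (\<G> l (gsum (H l)) \<bullet> w)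
      + (2 / (m * (m + 1))) * (\<E> l (isum (H l)) \<bullet> w))"
    unfolding symM_def m(2) isum_def[of "\<lambda>l. symP j (H l)"]
    unfolding symP_def m_def[symmetric]
    by (simp add: op_linear inner_sum_left sum_distrib_left sum_negf)
  also have "2 / sqrt m * (- 2 / sqrt m) = - (4 / m)" using m by simp
  finally show ?thesis
    by (simp only: gsum_def esum_def isum_def op_linear inner_sum_left sum.distrib sum_distrib_left[symmetric])
qed

text \<open>\<open>H l k\<close> stands for the second covariant derivative \<open>\<nabla>\<^sup>2\<^sub>l\<^sub>,\<^sub>k s\<close> in an orthonormal frame; the hypothesis on
  \<open>H l k - H k l\<close> is the Ricci identity in constant curvature \<open>c\<close>.\<close>

lemma weitzenboeck1:
  assumes s: "s \<in> Ker j" and H: "\<And>l k. H l k \<in> Ker j" and R: "\<And>l k. H l k - H k l = - c *\<^sub>R \<rho> (rot_gen l k) s"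
    and j: "2 * j \<le> CARD('n)"
  shows "- (\<Sum>k\<in>UNIV. H k k) + ((real CARD('n) * (real CARD('n) - 1) / 4 + real j) * c) *\<^sub>R s =
    symD j (\<lambda>l. symD j (H l)) + (if j = 0 then 0 else symP (j - 1) (\<lambda>l. symM j (H l)))"
proof (rule Ker_eqI)
  show "- (\<Sum>k\<in>UNIV. H k k) + ((real CARD('n) * (real CARD('n) - 1) / 4 + real j) * c) *\<^sub>R s \<in> Ker j"
    using Ker_scale(2)[of "\<Sum>k\<in>UNIV. H k k" j "-1"] by (intro Ker_scale s) (auto intro: Ker_scale H)
  show "symD j (\<lambda>l. symD j (H l)) + (if j = 0 then 0 else symP (j - 1) (\<lambda>l. symM j (H l))) \<in> Ker j"
  proof (cases j)
    case 0
    then show ?thesis using H j by (auto intro!: symD_Ker)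
  next
    case (Suc i)
    have "symP i (\<lambda>l. symM (Suc i) (H l)) \<in> Ker (Suc i)"
      by (rule symP_Ker, rule symM_Ker) (use H j Suc in auto)
    then show ?thesis using H j Suc by (auto intro!: Ker_scale symD_Ker)
  qed
  fix w assume w: "w \<in> Ker j"
  show "(- (\<Sum>k\<in>UNIV. H k k) + ((real CARD('n) * (real CARD('n) - 1) / 4 + real j) * c) *\<^sub>R s) \<bullet> w =
     (symD j (\<lambda>l. symD j (H l)) + (if j = 0 then 0 else symP (j - 1) (\<lambda>l. symM j (H l)))) \<bullet> w"
  proof (cases j)
    case 0
    then have "\<I> k (H l k) = 0" for l k using KerD(1)[OF H[of l k]] by (simp add: spinor_forms_ops)
    then show ?thesis using sym_DD_inner[OF w, of H] 0
      by (simp add: sum_GG[OF s R] op_linear)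
  next
    case (Suc i)
    then show ?thesis using sym_DD_inner[OF w, of H] sym_PM_inner[of w i H] w j
      by (simp add: sum_GG[OF s R] inner_add_left)
  qed
qed

text \<open>With \<open>m = n - 2 j\<close>, the ratio of the two coefficients is forced by
  cancellation of the unknown \<open>e\<close>, because
  \<open>2 / (m (m + 1)) - 1 = - (m + 2) (m - 1) / (m (m + 1))\<close>. Their size is fixed by the
  coefficient of \<open>t\<close>: \<open>4 (m + 1) / m^2 - (m + 2)^2 / m^2 = - 1\<close>.\<close>

lemma weitzenboeck2:
  assumes s: "s \<in> Ker j" and H: "\<And>l k. H l k \<in> Ker j" and R: "\<And>l k. H l k - H k l = - c *\<^sub>R \<rho> (rot_gen l k) s"
    and j: "2 * j + 2 \<le> CARD('n)"
  defines "n \<equiv> real CARD('n)"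
  shows "- (\<Sum>k\<in>UNIV. H k k) + ((n * (n - 1) / 4 + n - real j + 1) * c) *\<^sub>R s =
    - ((n - 2 * j + 1) / (n - 2 * j - 1)) *\<^sub>R symM (Suc j) (\<lambda>l. symP j (H l))
    + ((n - 2 * j + 2)\<^sup>2 / (n - 2 * j)\<^sup>2) *\<^sub>R symD j (\<lambda>l. symD j (H l))"
proof (rule Ker_eqI)
  show "- (\<Sum>k\<in>UNIV. H k k) + ((n * (n - 1) / 4 + n - real j + 1) * c) *\<^sub>R s \<in> Ker j"
    using Ker_scale(2)[of "\<Sum>k\<in>UNIV. H k k" j "-1"] by (intro Ker_scale s) (auto intro: Ker_scale H)
  show "- ((n - 2 * j + 1) / (n - 2 * j - 1)) *\<^sub>R symM (Suc j) (\<lambda>l. symP j (H l))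
    + ((n - 2 * j + 2)\<^sup>2 / (n - 2 * j)\<^sup>2) *\<^sub>R symD j (\<lambda>l. symD j (H l)) \<in> Ker j"
    using H j by (intro Ker_scale symM_Ker symP_Ker symD_Ker) auto
  fix w assume w: "w \<in> Ker j"
  define t where "t = (\<Sum>k\<in>UNIV. H k k) \<bullet> w"
  define e where "e = (\<Sum>l\<in>UNIV. \<Sum>k\<in>UNIV. \<E> l (\<I> k (H l k))) \<bullet> w"
  define q where "q = s \<bullet> w"
  define m where "m = n - 2 * real j"
  have m: "m \<ge> 2" using j by (simp add: m_def n_def)
  have j': "real j = (n - m) / 2" by (simp add: m_def)
  have DD: "symD j (\<lambda>l. symD j (H l)) \<bullet> w = - t + (n * (n - 1) / 4 + real j) * c * q + 4 / (m + 2) * e"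
    by (simp add: sym_DD_inner[OF w] sum_GG[OF s R] t_def e_def q_def n_def m_def inner_add_left inner_diff_left)
  have MP: "symM (Suc j) (\<lambda>l. symP j (H l)) \<bullet> w = - (4 / m) *
     (t - e - c * (real j / 2 + real j * (n - real j)) * q + (1 / m) * (- t + (n * (n - 1) / 4 + real j) * c * q)
      + (2 / (m * (m + 1))) * e)"
    using j by (simp add: sym_MP_inner[OF w] sum_GG[OF s R] sum_IE[OF s R] t_def e_def q_def n_def m_def inner_add_left inner_diff_left)
  have "- t + (n * (n - 1) / 4 + n - real j + 1) * c * q = - ((m + 1) / (m - 1)) * (symM (Suc j) (\<lambda>l. symP j (H l)) \<bullet> w)
      + (m + 2)\<^sup>2 / m\<^sup>2 * (symD j (\<lambda>l. symD j (H l)) \<bullet> w)"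
    unfolding DD MP j' using m by (simp add: divide_simps) algebra
  then show "(- (\<Sum>k\<in>UNIV. H k k) + ((n * (n - 1) / 4 + n - real j + 1) * c) *\<^sub>R s) \<bullet> w =
    (- ((n - 2 * j + 1) / (n - 2 * j - 1)) *\<^sub>R symM (Suc j) (\<lambda>l. symP j (H l))
    + ((n - 2 * j + 2)\<^sup>2 / (n - 2 * j)\<^sup>2) *\<^sub>R symD j (\<lambda>l. symD j (H l))) \<bullet> w"
    by (simp add: inner_add_left inner_diff_left t_def q_def m_def)
qed

text \<open>The sum with \<open>\<G> l (\<E> k (H l k))\<close> equals the one in the opposite order
  up to a multiple of \<open>Wed s\<close>, invisible to \<open>w\<close>. The
  \<open>Wed (gsum x)\<close> part of \<open>symE\<close> subtracts \<open>2 / m\<close> of it, so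
  the factor is \<open>1 - 2 / m\<close> with \<open>m = n - 2 j\<close>.\<close>

lemma sym_DP:
  assumes s: "s \<in> Ker j" and H: "\<And>l k. H l k \<in> Ker j" and R: "\<And>l k. H l k - H k l = - c *\<^sub>R \<rho> (rot_gen l k) s"
    and j: "2 * Suc j \<le> CARD('n)"
  defines "n \<equiv> real CARD('n)"
  shows "symD (Suc j) (\<lambda>l. symP j (H l)) = ((n - 2 * real (Suc j)) / (n - 2 * real (Suc j) + 2)) *\<^sub>R symP j (\<lambda>l. symD j (H l))"
proof (rule Ker_eqI)
  show "symD (Suc j) (\<lambda>l. symP j (H l)) \<in> Ker (Suc j)"
    using H j by (intro symD_Ker symP_Ker) auto
  show "((n - 2 * real (Suc j)) / (n - 2 * real (Suc j) + 2)) *\<^sub>R symP j (\<lambda>l. symD j (H l)) \<in> Ker (Suc j)"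
    using H j by (intro Ker_scale symD_Ker symP_Ker) auto
  fix w assume w: "w \<in> Ker (Suc j)"
  define m where "m = n - 2 * real j"
  have m: "m \<ge> 2" using j by (simp add: m_def n_def)
  let ?EG = "(\<Sum>l\<in>UNIV. \<Sum>k\<in>UNIV. \<E> l (\<G> k (H l k))) \<bullet> w"
  have P: "symP j (\<lambda>l. symD j (H l)) \<bullet> w = - 2 / sqrt m * ?EG"
    by (simp add: symP_inner[OF w] esum_def symD_def op_linear inner_sum_left inner_diff_left op_wedge_inner_Ker[OF w] gsum_def
        m_def n_def)
  have "\<G> l (Wed (Wed y)) \<bullet> w = 0" for l y by (simp add: op_wedge_inner_Ker[OF w])
  then have G: "\<G> l (symP j (H l)) \<bullet> w = - 2 / sqrt m * (\<G> l (esum (H l)) \<bullet> w - (2 / m) * (\<E> l (gsum (H l)) \<bullet> w))" for l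
    by (simp add: symP_def symE_def Let_def op_linear inner_diff_left inner_add_left op_wedge_inner_Ker(1)[OF w]
        m_def n_def)
  have "symD (Suc j) (\<lambda>l. symP j (H l)) \<bullet> w =
      - 2 / sqrt m * ((\<Sum>l\<in>UNIV. \<Sum>k\<in>UNIV. \<G> l (\<E> k (H l k))) \<bullet> w - (2 / m) * ?EG)"
    unfolding symD_inner[OF w] gsum_def[of "\<lambda>l. symP j (H l)"] inner_sum_left G
    by (simp only: gsum_def esum_def op_linear inner_sum_left sum_subtractf sum_distrib_left[symmetric])
  also have "(\<Sum>l\<in>UNIV. \<Sum>k\<in>UNIV. \<G> l (\<E> k (H l k))) \<bullet> w = ?EG"
    using w by (simp add: sum_EG[OF s R] inner_diff_left)
  finally show "symD (Suc j) (\<lambda>l. symP j (H l)) \<bullet> w =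
      (((n - 2 * real (Suc j)) / (n - 2 * real (Suc j) + 2)) *\<^sub>R symP j (\<lambda>l. symD j (H l))) \<bullet> w"
    using m unfolding inner_scaleR_left P m_def by (simp add: field_simps)
qed

text \<open>Only the curvature term \<open>Wed (Wed s)\<close> is left after antisymmetrization, and
  it is orthogonal to the kernel.\<close>

lemma sym_PP:
  assumes s: "s \<in> Ker j" and H: "\<And>l k. H l k \<in> Ker j" and R: "\<And>l k. H l k - H k l = - c *\<^sub>R \<rho> (rot_gen l k) s"
    and j: "2 * Suc j < CARD('n)"
  shows "symP (Suc j) (\<lambda>l. symP j (H l)) = 0"
proof (rule Ker_eqI)
  show "symP (Suc j) (\<lambda>l. symP j (H l)) \<in> Ker (Suc (Suc j))"
    using H j by (intro symP_Ker) auto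
  fix w assume w: "w \<in> Ker (Suc (Suc j))"
  have "\<E> l (symE j (H l)) \<bullet> w = \<E> l (esum (H l)) \<bullet> w" for l
    by (simp add: symE_def Let_def op_linear inner_diff_left inner_add_left op_wedge_inner_Ker[OF w])
  then have "(\<Sum>l\<in>UNIV. \<E> l (symE j (H l))) \<bullet> w = (\<Sum>l\<in>UNIV. \<Sum>k\<in>UNIV. \<E> l (\<E> k (H l k))) \<bullet> w"
    by (simp add: inner_sum_left esum_def op_linear)
  also have "\<dots> = 0" using w by (simp add: sum_EE[OF s R])
  finally have "esum (\<lambda>l. symP j (H l)) \<bullet> w = 0"
    unfolding esum_def symP_def op_linear scaleR_sum_right[symmetric] inner_scaleR_left by simp
  then show "symP (Suc j) (\<lambda>l. symP j (H l)) \<bullet> w = 0 \<bullet> w" by (simp add: symP_inner[OF w])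
qed (rule Ker_scale)

lemma sym_MM:
  assumes "s \<in> Ker j" and "\<And>l k. H l k - H k l = - c *\<^sub>R \<rho> (rot_gen l k) s"
  shows "symM i (\<lambda>l. symM j (H l)) = 0"
  using sum_II[OF assms] by (simp add: symM_def isum_def op_linear flip: scaleR_sum_right)

end

section \<open>The normalizing constants\<close>

lemma orth_proj_eqI:
  fixes V :: "'v::real_inner set"
  assumes V: "subspace V" and y: "y \<in> V" "\<And>v. v \<in> V \<Longrightarrow> (x - y) \<bullet> v = 0"
  shows "orth_proj V x = y"
  unfolding orth_proj_def
proof (rule the_equality)
  fix z assume z: "z \<in> V \<and> (\<forall>v\<in>V. (x - z) \<bullet> v = 0)"
  then have d: "z - y \<in> V" using V y by (simp add: subspace_diff)
  have "(z - y) \<bullet> (z - y) = (x - y) \<bullet> (z - y) - (x - z) \<bullet> (z - y)" by (simp add: inner_diff_left)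
  also have "\<dots> = 0" using z y d by simp
  finally show "z = y" by simp
qed (use y in auto)

lemma orth_proj_subspace:
  fixes V :: "'v::euclidean_space set"
  assumes "subspace V"
  shows "orth_proj V x \<in> V" "v \<in> V \<Longrightarrow> (x - orth_proj V x) \<bullet> v = 0"
proof -
  obtain y z where yz: "y \<in> span V" "\<And>w. w \<in> span V \<Longrightarrow> orthogonal z w" "x = y + z"
    using orthogonal_subspace_decomp_exists[of V x] by metis
  have "span V = V" using assms by (simp add: span_eq_iff)
  then have y: "y \<in> V" "\<And>v. v \<in> V \<Longrightarrow> (x - y) \<bullet> v = 0"
    using yz unfolding orthogonal_def \<open>span V = V\<close> by auto
  then have "orth_proj V x = y" by (rule orth_proj_eqI[OF assms])
  then show "orth_proj V x \<in> V" "v \<in> V \<Longrightarrow> (x - orth_proj V x) \<bullet> v = 0" using y by auto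
qed

lemma cscale_of_real: "cscale (complex_of_real r) \<phi> = r *\<^sub>R \<phi>"
  by (simp add: cscale_def vec_eq_iff scaleR_conv_of_real[where 'a = complex])

lemma cscale1_of_real: "cscale1 (complex_of_real r) x = r *\<^sub>R x"
  by (rule iffD2[OF vec_eq_iff]) (simp add: cscale1_def cscale_of_real)

lemma csubspace_subspace:
  assumes "csubspace cscale1 C"
  shows "subspace C"
  using assms unfolding csubspace_def subspace_def by (metis cscale1_of_real)

text \<open>If a rescaled component projection \<open>A = r P\<close> has an explicit adjoint \<open>A'\<close> with \<open>A A' = \<kappa>\<close>, then \<open>r\<^sup>2 = \<kappa>\<close>,
  because a component projection is a coisometry.\<close>

lemma component_projection_constant:
  fixes P A :: "('n::{finite,linorder}, 's::finite) twisted1 \<Rightarrow> ('n, 's) twisted"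
  assumes cp: "is_component_projection \<gamma> V V' P" and V: "subspace V"
    and r: "r > 0" "\<And>x. x \<in> fibre1 V \<Longrightarrow> A x = r *\<^sub>R P x"
    and A': "\<And>w. w \<in> V' \<Longrightarrow> A' w \<in> fibre1 V" "\<And>x w. x \<in> fibre1 V \<Longrightarrow> w \<in> V' \<Longrightarrow> A x \<bullet> w = x \<bullet> A' w"
    and \<kappa>: "\<And>w. w \<in> V' \<Longrightarrow> A (A' w) = \<kappa> *\<^sub>R w"
    and x: "x \<in> fibre1 V"
  shows "sqrt \<kappa> *\<^sub>R P x = A x"
proof -
  obtain C \<iota> where C: "csubspace cscale1 C" "C \<subseteq> fibre1 V" "bij_betw \<iota> C V'"
    and add: "\<And>x y. x \<in> C \<Longrightarrow> y \<in> C \<Longrightarrow> \<iota> (x + y) = \<iota> x + \<iota> y"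
    and sc: "\<And>z x. x \<in> C \<Longrightarrow> \<iota> (cscale1 z x) = cscale z (\<iota> x)"
    and nm: "\<And>x. x \<in> C \<Longrightarrow> norm (\<iota> x) = norm x"
    and P: "\<And>x. x \<in> fibre1 V \<Longrightarrow> P x = \<iota> (orth_proj C x)"
    using cp unfolding is_component_projection_def by metis
  have sC: "subspace C" by (rule csubspace_subspace[OF C(1)])
  have sF: "subspace (fibre1 V)" using V unfolding subspace_def fibre1_def by auto
  have inn: "\<iota> x \<bullet> \<iota> y = x \<bullet> y" if "x \<in> C" "y \<in> C" for x y
    using nm[OF that(1)] nm[OF that(2)] nm[of "x + y"] that subspace_add[OF sC that] add[OF that]
    by (simp add: dot_norm)
  have opC: "orth_proj C x \<in> C" for x by (rule orth_proj_subspace[OF sC])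
  show ?thesis
  \<comment> \<open>A nonzero element of \<open>V'\<close> is needed to read off
    \<open>\<kappa>\<close>; if there is none, both sides are zero.\<close>
  proof (cases "\<exists>w\<in>V'. w \<noteq> 0")
    case True
    then obtain w where w: "w \<in> V'" "w \<noteq> 0" by blast
    then obtain c where c: "c \<in> C" "\<iota> c = w" using C(3) by (metis bij_betw_iff_bijections)
    \<comment> \<open>The adjoint of projection followed by an isometry sends \<open>w\<close> to
      its preimage \<open>c\<close>; since \<open>A\<close> is \<open>r\<close> times such a map,
      its adjoint must send \<open>w\<close> to \<open>r c\<close>.\<close>
    have "(A' w - r *\<^sub>R c) \<bullet> y = 0" if y: "y \<in> fibre1 V" for y
    proof -
      have "y \<bullet> A' w = r * (\<iota> (orth_proj C y) \<bullet> \<iota> c)"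
        using A'(2)[OF y w(1)] r(2)[OF y] P[OF y] c by simp
      also have "\<dots> = r * (orth_proj C y \<bullet> c)" using inn[OF opC c(1)] by simp
      also have "orth_proj C y \<bullet> c = y \<bullet> c"
        using orth_proj_subspace(2)[OF sC c(1), of y] by (simp add: inner_diff_left)
      finally show ?thesis by (simp add: inner_diff_left inner_diff_right inner_commute)
    qed
    moreover have "A' w - r *\<^sub>R c \<in> fibre1 V"
      using sF A'(1)[OF w(1)] c C(2) by (intro subspace_diff subspace_scale) auto
    ultimately have A'w: "A' w = r *\<^sub>R c" by (metis eq_iff_diff_eq_0 inner_eq_zero_iff)
    have rc: "r *\<^sub>R c \<in> C" using sC c by (simp add: subspace_scale)
    have "\<kappa> *\<^sub>R w = r *\<^sub>R P (r *\<^sub>R c)" using \<kappa>[OF w(1)] A'w r(2)[of "r *\<^sub>R c"] rc C(2) by auto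
    also have "P (r *\<^sub>R c) = \<iota> (r *\<^sub>R c)"
      using P[of "r *\<^sub>R c"] rc C(2) orth_proj_eqI[OF sC rc] by auto
    also have "\<dots> = r *\<^sub>R w" using sc[OF c(1), of "complex_of_real r"] c(2) by (simp add: cscale1_of_real cscale_of_real)
    finally have "\<kappa> = r * r" using w by simp
    then show ?thesis using r x by (simp add: real_sqrt_mult)
  next
    case False
    then have "P x = 0" using P[OF x] opC[of x] C(3) by (metis bij_betw_apply)
    then show ?thesis using r(2)[OF x] by simp
  qed
qed

context spinor_module
begin

section \<open>Explicit adjoints of the symbols\<close>

lemma subspace_Ker: "subspace (Ker j)"
  by (simp add: subspace_def Ker_scale)

lemma Ker_minus: "\<phi> \<in> Ker j \<Longrightarrow> - \<phi> \<in> Ker j"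
  using Ker_scale(2)[of \<phi> j "-1"] by simp

lemma vec_nth_lambda: "($) (\<chi> k. f k) = f"
  by (simp add: fun_eq_iff)

text \<open>The tensor of \<open>w\<close> with the \<open>k\<close>-th basis vector. Applying a
  symbol to it gives the projected operator with index \<open>k\<close> acting on \<open>w\<close>,
  which is the form of the components of an adjoint.\<close>

definition unit_at :: "'n \<Rightarrow> ('n, 's) twisted \<Rightarrow> 'n \<Rightarrow> ('n, 's) twisted" where
  "unit_at k w = (\<lambda>i. if i = k then w else 0)"

lemma unit_at_Ker: "w \<in> Ker j \<Longrightarrow> unit_at k w i \<in> Ker j"
  by (simp add: unit_at_def Ker_scale)

lemma sum_unit_at:
  "gsum (unit_at k w) = \<G> k w" "esum (unit_at k w) = \<E> k w" "isum (unit_at k w) = \<I> k w"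
  by (simp_all add: gsum_def esum_def isum_def unit_at_def if_distrib op_linear cong: if_cong)

lemma inner_twisted1: "(x :: ('n, 's) twisted1) \<bullet> y = (\<Sum>k\<in>UNIV. x $ k \<bullet> y $ k)"
  by (simp add: inner_vec_def)

text \<open>As \<open>e_k\<close> is skew, the adjoint has components minus the projection of
  \<open>e_k w\<close>. In \<open>\<kappa>\<close> the \<open>n\<close> comes from
  \<open>- e_k e_k = 1\<close> and \<open>4 j\<close> from the number operator;
  \<open>\<kappa>\<close> equals \<open>(n + 2) (n - 2 j) / (n - 2 j + 2)\<close>, the radicand in
  \<open>grad_D\<close>.\<close>

lemma symD_adjoint:
  assumes x: "x \<in> fibre1 (Ker j)" and w: "w \<in> Ker j" and j: "2 * j \<le> CARD('n)"
  defines "\<kappa> \<equiv> real CARD('n) - 4 * real j / (real CARD('n) - 2 * real j + 2)"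
  shows "symD j (($) x) \<bullet> w = x \<bullet> (\<chi> k. - symD j (unit_at k w))"
    and "symD j (($) (\<chi> k. - symD j (unit_at k w))) = \<kappa> *\<^sub>R w"
proof -
  let ?M = "real CARD('n) - 2 * real j + 2"
  have xk: "x $ k \<in> Ker j" for k using x by (simp add: fibre1_def)
  have "x $ k \<bullet> Wed y = 0" for k y using wedge_inner_Ker[OF xk] by (simp add: inner_commute)
  then show "symD j (($) x) \<bullet> w = x \<bullet> (\<chi> k. - symD j (unit_at k w))"
    by (simp add: symD_inner[OF w] inner_twisted1 symD_def[of _ "unit_at _ _"] sum_unit_at gsum_def[of "($) x"] inner_sum_left
        inner_diff_right inner_cliff sum_negf)
  show "symD j (($) (\<chi> k. - symD j (unit_at k w))) = \<kappa> *\<^sub>R w"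
  proof (rule Ker_eqI)
    show "symD j (($) (\<chi> k. - symD j (unit_at k w))) \<in> Ker j"
      using j w by (auto intro!: symD_Ker unit_at_Ker Ker_minus)
    show "\<kappa> *\<^sub>R w \<in> Ker j" using w by (rule Ker_scale)
    fix v assume v: "v \<in> Ker j"
    have "\<G> k (- symD j (unit_at k w)) \<bullet> v = w \<bullet> v - (4 / ?M) * (\<E> k (\<I> k w) \<bullet> v)" for k
      by (simp add: symD_def sum_unit_at op_linear op_wedge_inner_Ker[OF v] inner_diff_left inner_add_left cliff_self)
    then have "symD j (($) (\<chi> k. - symD j (unit_at k w))) \<bullet> v = (\<Sum>k\<in>UNIV. w \<bullet> v - (4 / ?M) * (\<E> k (\<I> k w) \<bullet> v))"
      by (simp add: symD_inner[OF v] gsum_def inner_sum_left)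
    also have "\<dots> = real CARD('n) * (w \<bullet> v) - (4 / ?M) * ((\<Sum>k\<in>UNIV. \<E> k (\<I> k w)) \<bullet> v)"
      by (simp add: sum_subtractf inner_sum_left sum_distrib_left)
    finally show "symD j (($) (\<chi> k. - symD j (unit_at k w))) \<bullet> v = (\<kappa> *\<^sub>R w) \<bullet> v"
      by (simp add: number_operator[OF KerD(1)[OF w]] \<kappa>_def algebra_simps)
  qed
qed

text \<open>For \<open>n = 2 j\<close> the constant \<open>\<kappa>\<close> is zero:
  \<open>symD\<close> annihilates the image of its own adjoint, so the adjoint vanishes and with it
  \<open>symD\<close>. This agrees with the convention for the middle degree.\<close>

lemma symD_middle:
  assumes x: "x \<in> fibre1 (Ker j)" and j: "2 * j = CARD('n)"
  shows "symD j (($) x) = 0"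
proof -
  let ?w = "symD j (($) x)"
  have w: "?w \<in> Ker j" using x j by (intro symD_Ker) (auto simp: fibre1_def)
  define y where "y = (\<chi> k. - symD j (unit_at k ?w))"
  have y: "y \<in> fibre1 (Ker j)"
    using j w by (auto simp: y_def fibre1_def intro!: symD_Ker unit_at_Ker Ker_minus)
  have n: "real CARD('n) = 2 * real j" using j by linarith
  have "real CARD('n) - 4 * real j / (real CARD('n) - 2 * real j + 2) = 0" unfolding n by simp
  then have "symD j (($) y) = 0"
    using symD_adjoint(2)[OF x w] j unfolding y_def by simp
  then have "y \<bullet> y = 0" using symD_adjoint(1)[OF y w] j by (simp add: y_def)
  then have "x \<bullet> y = 0" by simp
  then show ?thesis using symD_adjoint(1)[OF x w] j by (simp add: y_def)
qed

text \<open>The composite with the adjoint is the number operator in degree \<open>j + 1\<close>,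
  hence the \<open>j + 1\<close> in the normalization of \<open>T^+\<close>.\<close>

lemma symE_adjoint:
  assumes x: "x \<in> fibre1 (Ker j)" and w: "w \<in> Ker (Suc j)" and j: "2 * j < CARD('n)"
  shows "symE j (($) x) \<bullet> w = x \<bullet> (\<chi> k. \<I> k w)" and "(\<chi> k. \<I> k w) \<in> fibre1 (Ker j)"
    and "symE j (($) (\<chi> k. \<I> k w)) = (real j + 1) *\<^sub>R w"
proof -
  show "symE j (($) x) \<bullet> w = x \<bullet> (\<chi> k. \<I> k w)"
    by (simp add: symE_inner[OF w] inner_twisted1 esum_def inner_sum_left inner_ext)
  show f: "(\<chi> k. \<I> k w) \<in> fibre1 (Ker j)"
    using w by (auto simp: fibre1_def contr_int KerD op_linear intro!: KerI spinor_forms_ops)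
  show "symE j (($) (\<chi> k. \<I> k w)) = (real j + 1) *\<^sub>R w"
  proof (rule Ker_eqI)
    show "symE j (($) (\<chi> k. \<I> k w)) \<in> Ker (Suc j)" using f j by (intro symE_Ker) (auto simp: fibre1_def)
    show "(real j + 1) *\<^sub>R w \<in> Ker (Suc j)" using w by (rule Ker_scale)
    fix v assume v: "v \<in> Ker (Suc j)"
    show "symE j (($) (\<chi> k. \<I> k w)) \<bullet> v = ((real j + 1) *\<^sub>R w) \<bullet> v"
      using number_operator[OF KerD(1)[OF w]] by (simp add: symE_inner[OF v] esum_def add.commute)
  qed
qed

text \<open>The adjoint has components the projections of \<open>\<E> k w\<close>; tracing over
  \<open>k\<close> uses the number operator in degree \<open>i\<close>. Division by \<open>M\<close>
  turns the constant into the radicand in \<open>grad_Tm\<close>.\<close>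

lemma isum_adjoint:
  assumes x: "x \<in> fibre1 (Ker (Suc i))" and w: "w \<in> Ker i" and i: "2 * Suc i \<le> CARD('n)"
  defines "M \<equiv> real CARD('n) - 2 * real i"
  shows "isum (($) x) \<bullet> w = x \<bullet> (\<chi> k. symE i (unit_at k w))" and "(\<chi> k. symE i (unit_at k w)) \<in> fibre1 (Ker (Suc i))"
    and "isum (($) (\<chi> k. symE i (unit_at k w))) = ((M - 1) * (real CARD('n) - real i + 1) / (M + 1)) *\<^sub>R w"
proof -
  have xk: "x $ k \<in> Ker (Suc i)" for k using x by (simp add: fibre1_def)
  have "x $ k \<bullet> Wed y = 0" for k y using wedge_inner_Ker[OF xk] by (simp add: inner_commute)
  then show "isum (($) x) \<bullet> w = x \<bullet> (\<chi> k. symE i (unit_at k w))"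
    by (simp add: inner_twisted1 isum_def inner_sum_left inner_int symE_def Let_def sum_unit_at inner_diff_right inner_add_right)
  show f: "(\<chi> k. symE i (unit_at k w)) \<in> fibre1 (Ker (Suc i))"
    using w i by (auto simp: fibre1_def intro!: symE_Ker unit_at_Ker)
  show "isum (($) (\<chi> k. symE i (unit_at k w))) = ((M - 1) * (real CARD('n) - real i + 1) / (M + 1)) *\<^sub>R w"
  proof (rule Ker_eqI)
    show "isum (($) (\<chi> k. symE i (unit_at k w))) \<in> Ker i" using f by (intro isum_Ker) (auto simp: fibre1_def)
    show "((M - 1) * (real CARD('n) - real i + 1) / (M + 1)) *\<^sub>R w \<in> Ker i" using w by (rule Ker_scale)
    fix v assume v: "v \<in> Ker i"
    have M: "M \<ge> 2" using i by (simp add: M_def)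
    have "\<I> k (symE i (unit_at k w)) \<bullet> v = w \<bullet> v - \<E> k (\<I> k w) \<bullet> v - (1 / M) * (w \<bullet> v) + (2 / (M * (M + 1))) * (\<E> k (\<I> k w) \<bullet> v)" for k
      by (simp add: symE_def Let_def sum_unit_at op_linear op_wedge_inner_Ker[OF v] inner_diff_left inner_add_left cliff_self int_ext M_def)
    then have "isum (($) (\<chi> k. symE i (unit_at k w))) \<bullet> v =
        (\<Sum>k\<in>(UNIV :: 'n set). w \<bullet> v - \<E> k (\<I> k w) \<bullet> v - (1 / M) * (w \<bullet> v) + (2 / (M * (M + 1))) * (\<E> k (\<I> k w) \<bullet> v))"
      by (simp add: isum_def inner_sum_left)
    also have "\<dots> = real CARD('n) * (w \<bullet> v) - (\<Sum>k\<in>UNIV. \<E> k (\<I> k w)) \<bullet> v - real CARD('n) * ((1 / M) * (w \<bullet> v))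
        + (2 / (M * (M + 1))) * ((\<Sum>k\<in>UNIV. \<E> k (\<I> k w)) \<bullet> v)"
      by (simp add: sum.distrib sum_subtractf inner_sum_left sum_distrib_left)
    also have "\<dots> = (real CARD('n) - real i - real CARD('n) / M + 2 * real i / (M * (M + 1))) * (w \<bullet> v)"
      by (simp add: number_operator[OF KerD(1)[OF w]] algebra_simps)
    also have "real CARD('n) - real i - real CARD('n) / M + 2 * real i / (M * (M + 1)) = (M - 1) * (real CARD('n) - real i + 1) / (M + 1)"
    proof -
      have n: "real CARD('n) = M + 2 * real i" by (simp add: M_def)
      have "M \<noteq> 0" "M + 1 \<noteq> 0" using M by auto
      then show ?thesis unfolding n by (simp add: divide_simps) algebra
    qed
    finally show "isum (($) (\<chi> k. symE i (unit_at k w))) \<bullet> v = (((M - 1) * (real CARD('n) - real i + 1) / (M + 1)) *\<^sub>R w) \<bullet> v"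
      by (simp add: vec_nth_lambda)
  qed
qed

section \<open>The normalized projections as explicit symbols\<close>

lemma projection_symD:
  assumes cp: "is_component_projection \<gamma> (Ker j) (Ker j) P" and r: "r > 0"
    and D: "\<And>x. x \<in> fibre1 (Ker j) \<Longrightarrow> orth_proj (Ker j) (dirac_symbol \<gamma> x) = r *\<^sub>R P x"
    and j: "2 * j \<le> CARD('n)" and x: "x \<in> fibre1 (Ker j)"
  shows "sqrt ((real CARD('n) + 2) * (real CARD('n) - 2 * real j) / (real CARD('n) - 2 * real j + 2)) *\<^sub>R P x = symD j (($) x)"
proof -
  have e: "orth_proj (Ker j) (dirac_symbol \<gamma> y) = symD j (($) y)" if "y \<in> fibre1 (Ker j)" for y
  proof (rule orth_proj_eqI[OF subspace_Ker])
    show "symD j (($) y) \<in> Ker j" using that j by (intro symD_Ker) (auto simp: fibre1_def)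
    show "(dirac_symbol \<gamma> y - symD j (($) y)) \<bullet> v = 0" if "v \<in> Ker j" for v
      using that by (simp add: symD_def dirac_symbol_def gsum_def)
  qed
  have "(real CARD('n) + 2) * (real CARD('n) - 2 * real j) / (real CARD('n) - 2 * real j + 2) =
      real CARD('n) - 4 * real j / (real CARD('n) - 2 * real j + 2)"
    using j by (simp add: field_simps)
  moreover have "sqrt (real CARD('n) - 4 * real j / (real CARD('n) - 2 * real j + 2)) *\<^sub>R P x = symD j (($) x)"
  proof (rule component_projection_constant[OF cp subspace_Ker r, where A = "\<lambda>x. symD j (($) x)" and A' = "\<lambda>w. \<chi> k. - symD j (unit_at k w)"])
    show "(\<chi> k. - symD j (unit_at k w)) \<in> fibre1 (Ker j)" if "w \<in> Ker j" for w
      using j that by (auto simp: fibre1_def intro!: symD_Ker unit_at_Ker Ker_minus)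
    show "symD j (($) y) = r *\<^sub>R P y" if "y \<in> fibre1 (Ker j)" for y using D e that by simp
  qed (use symD_adjoint[OF _ _ j] x in blast)+
  ultimately show ?thesis by simp
qed

lemma projection_symP:
  assumes cp: "is_component_projection \<gamma> (Ker j) (Ker (Suc j)) P" and r: "r > 0"
    and D: "\<And>x. x \<in> fibre1 (Ker j) \<Longrightarrow> orth_proj (Ker (Suc j)) (dirac_symbol \<gamma> (\<chi> k. Wed (x $ k))) = r *\<^sub>R P x"
    and j: "2 * j < CARD('n)" and x: "x \<in> fibre1 (Ker j)"
  shows "(2 * sqrt ((real j + 1) / (real CARD('n) - 2 * real j))) *\<^sub>R P x = symP j (($) x)"
proof -
  have e: "orth_proj (Ker (Suc j)) (dirac_symbol \<gamma> (\<chi> k. Wed (y $ k))) = - 2 *\<^sub>R symE j (($) y)" if "y \<in> fibre1 (Ker j)" for y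
  proof (rule orth_proj_eqI[OF subspace_Ker])
    show "- 2 *\<^sub>R symE j (($) y) \<in> Ker (Suc j)" using that j by (intro Ker_scale symE_Ker) (auto simp: fibre1_def)
    have "dirac_symbol \<gamma> (\<chi> k. Wed (y $ k)) = - Wed (gsum (($) y)) - 2 *\<^sub>R esum (($) y)"
      by (simp add: dirac_symbol_def gsum_def esum_def cliff_wedge_comm sum_subtractf sum_negf op_linear scaleR_sum_right)
    then show "(dirac_symbol \<gamma> (\<chi> k. Wed (y $ k)) - - 2 *\<^sub>R symE j (($) y)) \<bullet> v = 0" if "v \<in> Ker (Suc j)" for v
      using that by (simp add: symE_inner inner_diff_left inner_add_left)
  qed
  have A: "(- symE j (($) y)) = (r / 2) *\<^sub>R P y" if "y \<in> fibre1 (Ker j)" for y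
  proof -
    have "(1/2) *\<^sub>R (- 2 *\<^sub>R symE j (($) y)) = (1/2) *\<^sub>R (r *\<^sub>R P y)" using e[OF that] D[OF that] by simp
    then show ?thesis by simp
  qed
  \<comment> \<open>The block of the Dirac symbol projects to \<open>- 2 symE\<close>, so
    \<open>- symE\<close>, not \<open>symE\<close>, is the positive multiple of \<open>P\<close>;
    this is the origin of the sign in \<open>symP\<close>.\<close>
  have *: "sqrt (real j + 1) *\<^sub>R P x = - symE j (($) x)"
  proof (rule component_projection_constant[OF cp subspace_Ker _ A _ _ _ x, where A' = "\<lambda>w. \<chi> k. - \<I> k w"])
    have m: "(\<chi> k. - \<I> k w) = - (\<chi> k. \<I> k w)" for w by (simp add: vec_eq_iff)
    have s: "symE j (($) (- y)) = - symE j (($) y)" for y :: "('n, 's) twisted1"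
      by (simp add: symE_def Let_def esum_def gsum_def isum_def op_linear sum_negf)
    show "0 < r / 2" using r by simp
    show "(\<chi> k. - \<I> k w) \<in> fibre1 (Ker j)" if "w \<in> Ker (Suc j)" for w
      using symE_adjoint(2)[OF x that j] by (auto simp: fibre1_def Ker_minus)
    show "- symE j (($) y) \<bullet> w = y \<bullet> (\<chi> k. - \<I> k w)" if "y \<in> fibre1 (Ker j)" "w \<in> Ker (Suc j)" for y w
      using symE_adjoint(1)[OF that j] by (simp add: m)
    show "- symE j (($) (\<chi> k. - \<I> k w)) = (real j + 1) *\<^sub>R w" if "w \<in> Ker (Suc j)" for w
      using symE_adjoint(3)[OF x that j] by (simp add: m s)
  qed
  have "symP j (($) x) = (2 / sqrt (real CARD('n) - 2 * real j)) *\<^sub>R (- symE j (($) x))"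
    by (simp add: symP_def)
  also have "\<dots> = (2 * sqrt ((real j + 1) / (real CARD('n) - 2 * real j))) *\<^sub>R P x"
    unfolding *[symmetric] by (simp add: real_sqrt_divide)
  finally show ?thesis ..
qed

lemma projection_symM:
  assumes cp: "is_component_projection \<gamma> (Ker (Suc i)) (Ker i) P" and r: "r > 0"
    and D: "\<And>x. x \<in> fibre1 (Ker (Suc i)) \<Longrightarrow> orth_proj (Wed ` Ker i) (dirac_symbol \<gamma> x) = r *\<^sub>R Wed (P x)"
    and j: "2 * Suc i \<le> CARD('n)" and x: "x \<in> fibre1 (Ker (Suc i))"
  defines "j \<equiv> real (Suc i)" and "n \<equiv> real CARD('n)"
  shows "(2 * sqrt ((n - 2 * j + 1) * (n - j + 2) / ((n - 2 * j + 3) * (n - 2 * j + 2)))) *\<^sub>R P x = symM (Suc i) (($) x)"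
proof -
  define M where "M = n - 2 * real i"
  have M: "M \<ge> 2" using assms(4) by (simp add: M_def n_def)
  have sW: "subspace (Wed ` Ker i)" by (rule linear_subspace_image[OF linear_cliff_wedge subspace_Ker])
  \<comment> \<open>The remainder of the Dirac symbol is \<open>symD\<close>, which lies in the
    kernel and is therefore orthogonal to the image of \<open>Wed\<close>.\<close>
  have e: "orth_proj (Wed ` Ker i) (dirac_symbol \<gamma> y) = Wed ((2 / M) *\<^sub>R isum (($) y))" if y: "y \<in> fibre1 (Ker (Suc i))" for y
  proof (rule orth_proj_eqI[OF sW])
    have yk: "y $ k \<in> Ker (Suc i)" for k using y by (simp add: fibre1_def)
    show "Wed ((2 / M) *\<^sub>R isum (($) y)) \<in> Wed ` Ker i"
      by (intro imageI Ker_scale isum_Ker yk)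
    show "(dirac_symbol \<gamma> y - Wed ((2 / M) *\<^sub>R isum (($) y))) \<bullet> v = 0" if "v \<in> Wed ` Ker i" for v
    proof -
      have "dirac_symbol \<gamma> y - Wed ((2 / M) *\<^sub>R isum (($) y)) = symD (Suc i) (($) y)"
        by (simp add: symD_def dirac_symbol_def gsum_def op_linear M_def n_def)
      moreover have "symD (Suc i) (($) y) \<in> Ker (Suc i)" using yk j by (intro symD_Ker)
      ultimately show ?thesis using that wedge_inner_Ker by (auto simp: inner_commute)
    qed
  qed
  have PK: "P y \<in> Ker i" if "y \<in> fibre1 (Ker (Suc i))" for y
  proof -
    obtain C \<iota> where "csubspace cscale1 C" "bij_betw \<iota> C (Ker i)" "\<forall>x\<in>fibre1 (Ker (Suc i)). P x = \<iota> (orth_proj C x)"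
      using cp unfolding is_component_projection_def by metis
    then show ?thesis using orth_proj_subspace(1)[OF csubspace_subspace] that by (metis bij_betw_apply)
  qed
  have A: "isum (($) y) = (r * M / 2) *\<^sub>R P y" if y: "y \<in> fibre1 (Ker (Suc i))" for y
  proof -
    have K: "isum (($) y) \<in> Ker i" using y by (intro isum_Ker) (auto simp: fibre1_def)
    \<comment> \<open>This makes \<open>Wed\<close> injective on the kernel, so that it can be
      removed from the equation defining \<open>P\<close>.\<close>
    have c: "Con (Wed z) = (- M) *\<^sub>R z" if "z \<in> Ker i" for z
      using that by (simp add: contr_wedge[OF KerD(1)] KerD op_linear M_def n_def)
    have "Wed ((2 / M) *\<^sub>R isum (($) y)) = Wed (r *\<^sub>R P y)"
      using e[OF y] D[OF y] by (simp add: op_linear)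
    from arg_cong[OF this, of Con] have "(- M) *\<^sub>R ((2 / M) *\<^sub>R isum (($) y)) = (- M) *\<^sub>R (r *\<^sub>R P y)"
      unfolding c[OF Ker_scale(2)[OF K]] c[OF Ker_scale(2)[OF PK[OF y]]] .
    then have "(2 / M) *\<^sub>R isum (($) y) = r *\<^sub>R P y" using M unfolding scaleR_cancel_left by simp
    from arg_cong[OF this, of "\<lambda>z. (M / 2) *\<^sub>R z"] show ?thesis using M by (simp add: mult.commute)
  qed
  have *: "sqrt ((M - 1) * (n - real i + 1) / (M + 1)) *\<^sub>R P x = isum (($) x)"
  proof (rule component_projection_constant[OF cp subspace_Ker _ A _ _ _ x, where A' = "\<lambda>w. \<chi> k. symE i (unit_at k w)"])
    show "0 < r * M / 2" using r M by simp
  qed (use isum_adjoint x assms(4) in \<open>auto simp: M_def n_def\<close>)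
  have "symM (Suc i) (($) x) = (2 / sqrt M) *\<^sub>R isum (($) x)"
    by (simp add: symM_def M_def n_def)
  also have "\<dots> = (2 * (sqrt ((M - 1) * (n - real i + 1) / (M + 1)) / sqrt M)) *\<^sub>R P x"
    unfolding *[symmetric] by simp
  also have "sqrt ((M - 1) * (n - real i + 1) / (M + 1)) / sqrt M =
      sqrt ((n - 2 * j + 1) * (n - j + 2) / ((n - 2 * j + 3) * (n - 2 * j + 2)))"
    by (simp add: real_sqrt_divide[symmetric] M_def j_def algebra_simps)
  finally show ?thesis ..
qed

end

section \<open>The spin group and its representations\<close>

lemma bounded_bilinear_matrix_mult: "bounded_bilinear ((**) :: complex^'b^'a \<Rightarrow> complex^'c^'b \<Rightarrow> complex^'c^'a)"
proof -
  have a: "(x + x') ** y = x ** y + x' ** y" for x x' :: "complex^'b^'a" and y :: "complex^'c^'b"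
    by (simp add: vec_eq_iff matrix_matrix_mult_def algebra_simps sum.distrib)
  have s: "(r *\<^sub>R x) ** y = r *\<^sub>R (x ** y)" "x ** (r *\<^sub>R y) = r *\<^sub>R (x ** y)"
    for r and x :: "complex^'b^'a" and y :: "complex^'c^'b"
    by (simp_all add: vec_eq_iff matrix_matrix_mult_def scaleR_sum_right)
  have "bilinear ((**) :: complex^'b^'a \<Rightarrow> complex^'c^'b \<Rightarrow> complex^'c^'a)"
    unfolding bilinear_def by (auto intro!: linearI simp: matrix_add_ldistrib a s)
  then show ?thesis using bilinear_conv_bounded_bilinear by blast
qed

lemmas matrix_mult_simps =
  bounded_bilinear.add_left[OF bounded_bilinear_matrix_mult] bounded_bilinear.add_right[OF bounded_bilinear_matrix_mult]
  bounded_bilinear.diff_left[OF bounded_bilinear_matrix_mult] bounded_bilinear.diff_right[OF bounded_bilinear_matrix_mult]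
  bounded_bilinear.minus_left[OF bounded_bilinear_matrix_mult] bounded_bilinear.minus_right[OF bounded_bilinear_matrix_mult]
  bounded_bilinear.scaleR_left[OF bounded_bilinear_matrix_mult] bounded_bilinear.scaleR_right[OF bounded_bilinear_matrix_mult]
  bounded_bilinear.sum_left[OF bounded_bilinear_matrix_mult] bounded_bilinear.sum_right[OF bounded_bilinear_matrix_mult]
  bounded_bilinear.zero_left[OF bounded_bilinear_matrix_mult] bounded_bilinear.zero_right[OF bounded_bilinear_matrix_mult]

definition madj :: "complex^'a^'b \<Rightarrow> complex^'b^'a" where
  "madj M = (\<chi> a b. cnj (M $ b $ a))"

lemma linear_madj: "linear madj"
  by (rule linearI) (simp_all add: madj_def vec_eq_iff)

lemmas madj_simps = linear_simps[OF linear_madj]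

lemma madj_mult: "madj (A ** B) = madj B ** madj A"
  by (simp add: madj_def vec_eq_iff matrix_matrix_mult_def mult.commute)

lemma madj_mat [simp]: "madj (mat 1) = mat 1"
  by (simp add: madj_def mat_def vec_eq_iff)

text \<open>Spinors as forms of degree 0. They are annihilated by interior multiplication and
  generate everything under exterior multiplication.\<close>

definition vac :: "complex^'s \<Rightarrow> ('n::finite, 's::finite) twisted" where
  "vac \<psi> = (\<chi> B. if B = {} then \<psi> else 0)"

lemma linear_vac: "linear vac"
  by (rule linearI) (auto simp: vac_def vec_eq_iff)

lemma int_vac [simp]: "int_mult k (vac \<psi>) = 0"
  by (rule iffD2[OF vec_eq_iff]) (simp add: int_mult_def vac_def)

lemma cliff_vac: "cliff \<gamma> k (vac \<psi>) = vac (\<gamma> k *v \<psi>)"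
  by (rule iffD2[OF vec_eq_iff]) (simp add: cliff_def vac_def)

text \<open>A coefficient at \<open>insert k A\<close> is produced by exterior multiplication from
  one at \<open>A\<close>, up to a sign put into the spinor. Equivariance statements are thus
  reduced to plain spinors and to compatibility with \<open>ext_mult\<close>.\<close>

lemma twisted_induct [case_names vac add ext]:
  fixes \<phi> :: "('n::{finite,linorder}, 's::finite) twisted"
  assumes "\<And>\<psi>. P (vac \<psi>)" "\<And>\<phi> \<phi>'. P \<phi> \<Longrightarrow> P \<phi>' \<Longrightarrow> P (\<phi> + \<phi>')" "\<And>k \<phi>. P \<phi> \<Longrightarrow> P (ext_mult k \<phi>)"
  shows "P \<phi>"
proof -
  define e where "e = (\<lambda>A (\<psi> :: complex^'s). (\<chi> B. if B = A then \<psi> else 0) :: ('n, 's) twisted)"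
  have e: "P (e A \<psi>)" for A \<psi>
  proof (induction A arbitrary: \<psi> rule: finite_induct[OF finite])
    case 1
    then show ?case using assms(1)[of \<psi>] by (simp add: e_def vac_def)
  next
    case (2 k A)
    have "e (insert k A) \<psi> = ext_mult k (e A (ext_sign k A *\<^sub>R \<psi>))"
    proof (rule iffD2[OF vec_eq_iff], rule allI)
      fix B
      have "B = insert k A \<longleftrightarrow> k \<in> B \<and> B - {k} = A" using 2(2) by auto
      then show "e (insert k A) \<psi> $ B = ext_mult k (e A (ext_sign k A *\<^sub>R \<psi>)) $ B"
        using ext_sign_self(2)[of k A] by (auto simp: e_def ext_mult_def insert_absorb)
    qed
    then show ?case using assms(3)[OF 2(3)] by simp
  qed
  have "P (\<Sum>A\<in>S. e A (\<phi> $ A))" if "finite S" for S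
    using that
  proof (induction S rule: finite_induct)
    case empty
    have "vac 0 = (0 :: ('n, 's) twisted)" by (rule linear_0[OF linear_vac])
    then show ?case using assms(1)[of 0] by simp
  qed (use assms(2) e in auto)
  moreover have "(\<Sum>A\<in>UNIV. e A (\<phi> $ A)) = \<phi>"
    by (rule iffD2[OF vec_eq_iff]) (simp add: e_def sum_component)
  ultimately show ?thesis by (metis finite)
qed

context spinor_module
begin

section \<open>Products of unit vectors and the covering map\<close>

lemma madj_gamma: "madj (\<gamma> i) = - \<gamma> i"
  by (simp add: madj_def vec_eq_iff gamma_adjoint)

definition clv :: "(real, 'n) vec \<Rightarrow> complex^'s^'s" where
  "clv v = (\<Sum>i\<in>UNIV. v $ i *\<^sub>R \<gamma> i)"

lemma linear_clv: "linear clv"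
  by (rule linearI) (simp_all add: clv_def scaleR_add_left sum.distrib scaleR_sum_right)

lemma clv_gamma: "clv v ** \<gamma> k = - (\<gamma> k ** clv v) - (2 * v $ k) *\<^sub>R mat 1"
proof -
  have "clv v ** \<gamma> k = (\<Sum>i\<in>UNIV. v $ i *\<^sub>R ((if i = k then (- 2) *\<^sub>R mat 1 else 0) - \<gamma> k ** \<gamma> i))"
    unfolding clv_def matrix_mult_simps by (intro sum.cong refl arg_cong[where f = "scaleR _"] gamma_gamma)
  also have "\<dots> = (\<Sum>i\<in>UNIV. if i = k then (- 2 * v $ i) *\<^sub>R mat 1 else 0) - \<gamma> k ** clv v"
    unfolding clv_def matrix_mult_simps sum_subtractf[symmetric]
    by (intro sum.cong refl) (simp add: scaleR_diff_right)
  finally show ?thesis by simp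
qed

lemma add_self_eq:
  fixes x y :: "'a::ab_group_add"
  assumes "x = - x - y"
  shows "x + x = - y"
  using arg_cong[OF assms, of "\<lambda>z. x + z"] by (simp add: algebra_simps)

lemma clv_clv: "clv v ** clv v = - ((v \<bullet> v) *\<^sub>R mat 1)"
proof -
  have "clv v ** clv v = (\<Sum>k\<in>UNIV. v $ k *\<^sub>R (clv v ** \<gamma> k))"
    by (simp add: clv_def[of v] matrix_mult_simps)
  also have "\<dots> = - ((\<Sum>k\<in>UNIV. v $ k *\<^sub>R \<gamma> k) ** clv v) - (\<Sum>k\<in>UNIV. (2 * (v $ k * v $ k)) *\<^sub>R mat 1)"
    by (simp only: clv_gamma scaleR_diff_right sum_subtractf matrix_mult_simps sum_negf scaleR_minus_right scaleR_scaleR)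
      (simp add: mult.left_commute)
  finally have "clv v ** clv v = - (clv v ** clv v) - (2 * (v \<bullet> v)) *\<^sub>R mat 1"
    by (simp add: clv_def[symmetric] inner_vec_def sum_distrib_left scaleR_sum_left)
  from add_self_eq[OF this] have "2 *\<^sub>R (clv v ** clv v) = 2 *\<^sub>R (- ((v \<bullet> v) *\<^sub>R mat 1))"
    unfolding scaleR_2[of "clv v ** clv v"] scaleR_minus_right scaleR_scaleR .
  then show ?thesis unfolding scaleR_cancel_left by simp
qed

lemma clv_eq_0: "clv v = 0 \<Longrightarrow> v = 0"
proof -
  assume "clv v = 0"
  then have "(v \<bullet> v) *\<^sub>R (mat 1 :: complex^'s^'s) = 0" using clv_clv[of v] by (simp add: matrix_mult_simps)
  moreover have "mat 1 \<noteq> (0 :: complex^'s^'s)" by (simp add: mat_def vec_eq_iff)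
  ultimately show "v = 0" by simp
qed

lemma madj_clv: "madj (clv v) = - clv v"
  by (simp add: clv_def madj_simps madj_gamma sum_negf)

text \<open>The relation inside the definite description \<open>spin_Ad\<close>;
  \<open>covers_unique\<close> and \<open>unit_product_covers\<close> show that it determines a
  rotation.\<close>

definition covers :: "complex^'s^'s \<Rightarrow> ((real, 'n) vec, 'n) vec \<Rightarrow> bool" where
  "covers h R \<longleftrightarrow> (\<forall>k. h ** \<gamma> k = clv (\<chi> i. R $ i $ k) ** h)"

lemma spin_group_clv:
  "spin_group \<gamma> = {foldr (\<lambda>v h. clv v ** h) vs (mat 1) |vs. even (length vs) \<and> (\<forall>v\<in>set vs. norm v = 1)}"
  by (simp add: spin_group_def clv_def)

text \<open>Products of any length are treated, so that the induction can remove one unit vector at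
  a time.\<close>

lemma unit_product_covers:
  assumes "\<forall>v\<in>set vs. norm v = 1"
  defines "h \<equiv> foldr (\<lambda>v h. clv v ** h) vs (mat 1)"
  shows "\<exists>R. covers h R \<and> transpose R ** R = mat 1" "h ** madj h = mat 1" "madj h ** h = mat 1"
proof -
  have *: "(\<exists>R. covers h R \<and> transpose R ** R = mat 1) \<and> h ** madj h = mat 1 \<and> madj h ** h = mat 1"
    unfolding h_def using assms(1)
  proof (induction vs)
    case Nil
    have "covers (mat 1) (mat 1)"
    proof -
      have "(\<chi> i. mat 1 $ i $ k) = (axis k 1 :: (real, 'n) vec)" for k by (simp add: mat_def axis_def vec_eq_iff)
      then show ?thesis unfolding covers_def clv_def
        by (simp add: axis_def if_distrib[where f = "\<lambda>r. r *\<^sub>R _"] cong: if_cong)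
    qed
    then show ?case by (auto intro!: exI[of _ "mat 1"])
  next
    case (Cons v vs)
    let ?h = "foldr (\<lambda>v h. clv v ** h) vs (mat 1)"
    from Cons obtain R where R: "covers ?h R" "transpose R ** R = mat 1"
      and u: "?h ** madj ?h = mat 1" "madj ?h ** ?h = mat 1" and v: "v \<bullet> v = 1"
      by (auto simp: norm_eq_1)
    \<comment> \<open>Conjugation by \<open>clv v\<close> for a unit vector \<open>v\<close> is
      minus the reflection in the hyperplane orthogonal to \<open>v\<close>; this matrix is
      symmetric and an involution, hence orthogonal.\<close>
    define S where "S = (\<chi> i k. 2 * v $ i * v $ k - (if i = k then 1 else 0))"
    have "clv v ** clv w = clv ((2 * (v \<bullet> w)) *\<^sub>R v - w) ** clv v" for w
    proof -
      have "clv v ** clv w = - (clv w ** clv v) - (2 * (v \<bullet> w)) *\<^sub>R mat 1"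
        by (simp add: clv_def[of w] matrix_mult_simps clv_gamma scaleR_diff_right sum_subtractf sum_negf inner_vec_def
            scaleR_sum_left sum_distrib_left mult_ac)
      then show ?thesis
        using v by (simp add: linear_simps[OF linear_clv] matrix_mult_simps clv_clv)
    qed
    moreover have "S *v w = (2 * (v \<bullet> w)) *\<^sub>R v - w" for w
    proof -
      have "(S *v w) $ i = (\<Sum>k\<in>UNIV. 2 * v $ i * (v $ k * w $ k) - (if i = k then w $ k else 0))" for i
        unfolding S_def matrix_vector_mult_def by (auto intro!: sum.cong simp: algebra_simps)
      then show ?thesis by (simp add: vec_eq_iff sum_subtractf inner_vec_def sum_distrib_left mult_ac)
    qed
    ultimately have S: "clv v ** clv w = clv (S *v w) ** clv v" for w by simp
    have "covers (clv v ** ?h) (S ** R)"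
      unfolding covers_def
    proof
      fix k
      have "clv v ** ?h ** \<gamma> k = clv v ** clv (\<chi> i. R $ i $ k) ** ?h"
        using R(1) by (simp add: covers_def flip: matrix_mul_assoc)
      also have "\<dots> = clv (S *v (\<chi> i. R $ i $ k)) ** (clv v ** ?h)" by (simp add: S matrix_mul_assoc)
      also have "S *v (\<chi> i. R $ i $ k) = (\<chi> i. (S ** R) $ i $ k)"
        by (simp add: vec_eq_iff matrix_vector_mult_def matrix_matrix_mult_def)
      finally show "clv v ** ?h ** \<gamma> k = clv (\<chi> i. (S ** R) $ i $ k) ** (clv v ** ?h)" .
    qed
    moreover have "transpose (S ** R) ** (S ** R) = mat 1"
    proof -
      have "(S ** S) *v w = w" for w
        unfolding matrix_vector_mul_assoc[symmetric] \<open>\<And>w. S *v w = (2 * (v \<bullet> w)) *\<^sub>R v - w\<close>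
        using v by (simp add: inner_diff_right algebra_simps)
      then have "S ** S = mat 1" by (simp add: matrix_eq)
      moreover have "transpose S = S" by (simp add: S_def transpose_def vec_eq_iff mult_ac)
      ultimately show ?thesis using R(2)
        by (simp add: matrix_transpose_mul) (metis matrix_mul_assoc matrix_mul_lid)
    qed
    moreover have "(clv v ** ?h) ** madj (clv v ** ?h) = mat 1"
    proof -
      have "(clv v ** ?h) ** madj (clv v ** ?h) = - (clv v ** (?h ** madj ?h) ** clv v)"
        by (simp add: madj_mult madj_clv matrix_mult_simps matrix_mul_assoc)
      then show ?thesis by (simp add: u clv_clv v)
    qed
    moreover have "madj (clv v ** ?h) ** (clv v ** ?h) = mat 1"
    proof -
      have "madj (clv v ** ?h) ** (clv v ** ?h) = - (madj ?h ** (clv v ** clv v) ** ?h)"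
        by (simp add: madj_mult madj_clv matrix_mult_simps matrix_mul_assoc)
      then show ?thesis by (simp add: u clv_clv v matrix_mult_simps)
    qed
    ultimately show ?case by auto
  qed
  then show "\<exists>R. covers h R \<and> transpose R ** R = mat 1" "h ** madj h = mat 1" "madj h ** h = mat 1" by auto
qed

lemma covers_unique:
  assumes "covers h R" "covers h R'" "h ** h' = mat 1"
  shows "R = R'"
proof -
  have "(\<chi> i. R $ i $ k) - (\<chi> i. R' $ i $ k) = 0" for k
  proof (rule clv_eq_0)
    have "clv (\<chi> i. R $ i $ k) ** h ** h' = clv (\<chi> i. R' $ i $ k) ** h ** h'"
      using assms unfolding covers_def by metis
    then show "clv ((\<chi> i. R $ i $ k) - (\<chi> i. R' $ i $ k)) = 0"
      by (simp add: linear_simps[OF linear_clv] assms(3) flip: matrix_mul_assoc)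
  qed
  then show ?thesis by (auto simp: vec_eq_iff)
qed

lemma spin_group_props:
  assumes "h \<in> spin_group \<gamma>"
  shows "covers h (spin_Ad \<gamma> h)" "transpose (spin_Ad \<gamma> h) ** spin_Ad \<gamma> h = mat 1"
    "spin_Ad \<gamma> h ** transpose (spin_Ad \<gamma> h) = mat 1"
    "h ** madj h = mat 1" "madj h ** h = mat 1"
proof -
  obtain vs where vs: "\<forall>v\<in>set vs. norm v = 1" "h = foldr (\<lambda>v h. clv v ** h) vs (mat 1)"
    using assms unfolding spin_group_clv by blast
  note u = unit_product_covers[OF vs(1), folded vs(2)]
  obtain R where R: "covers h R" "transpose R ** R = mat 1" using u(1) by blast
  have "spin_Ad \<gamma> h = R"
    unfolding spin_Ad_def
  proof (rule the_equality)
    show "\<forall>k. h ** \<gamma> k = (\<Sum>i\<in>UNIV. R $ i $ k *\<^sub>R \<gamma> i) ** h"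
      using R(1) by (simp add: covers_def clv_def)
    show "R' = R" if "\<forall>k. h ** \<gamma> k = (\<Sum>i\<in>UNIV. R' $ i $ k *\<^sub>R \<gamma> i) ** h" for R'
      using covers_unique[OF _ R(1) u(2), of R'] that by (simp add: covers_def clv_def)
  qed
  then show "covers h (spin_Ad \<gamma> h)" "transpose (spin_Ad \<gamma> h) ** spin_Ad \<gamma> h = mat 1" using R by auto
  then show "spin_Ad \<gamma> h ** transpose (spin_Ad \<gamma> h) = mat 1" using matrix_left_right_inverse by blast
  show "h ** madj h = mat 1" "madj h ** h = mat 1" by (fact u)+
qed

subsection \<open>The action on spinor-valued forms\<close>

definition rot_ext :: "((real, 'n) vec, 'n) vec \<Rightarrow> 'n \<Rightarrow> ('n, 's) twisted \<Rightarrow> ('n, 's) twisted" where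
  "rot_ext R a \<psi> = (\<Sum>k\<in>UNIV. R $ k $ a *\<^sub>R \<E> k \<psi>)"

lemma linear_rot_ext: "linear (rot_ext R a)"
  by (rule linearI) (simp_all add: rot_ext_def op_linear scaleR_add_right sum.distrib scaleR_sum_right mult.commute)

lemma rot_ext_anti: "rot_ext R a (rot_ext R b \<psi>) = - rot_ext R b (rot_ext R a \<psi>)"
proof -
  have "rot_ext R a (rot_ext R b \<psi>) = (\<Sum>k\<in>UNIV. \<Sum>l\<in>UNIV. (R $ k $ a * R $ l $ b) *\<^sub>R \<E> k (\<E> l \<psi>))"
    by (simp add: rot_ext_def op_linear scaleR_sum_right)
  also have "\<dots> = (\<Sum>k\<in>UNIV. \<Sum>l\<in>UNIV. (R $ k $ a * R $ l $ b) *\<^sub>R (- \<E> l (\<E> k \<psi>)))"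
    by (intro sum.cong refl arg_cong[where f = "scaleR _"] ext_ext)
  also have "\<dots> = - (\<Sum>l\<in>UNIV. \<Sum>k\<in>UNIV. (R $ k $ a * R $ l $ b) *\<^sub>R \<E> l (\<E> k \<psi>))"
    by (subst sum.swap) (simp add: sum_negf)
  also have "\<dots> = - rot_ext R b (rot_ext R a \<psi>)"
    by (simp add: rot_ext_def op_linear scaleR_sum_right mult.commute)
  finally show ?thesis .
qed

lemma rot_ext_sq: "rot_ext R a (rot_ext R a \<psi>) = 0"
proof -
  have "2 *\<^sub>R rot_ext R a (rot_ext R a \<psi>) = 0"
    unfolding scaleR_2 by (rule eq_neg_iff_add_eq_0[THEN iffD1, OF rot_ext_anti])
  then show ?thesis by (simp only: scaleR_eq_0_iff) simp
qed

lemma linear_foldr_rot_ext: "linear (foldr (rot_ext R) xs)"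
proof (induction xs)
  case Nil
  then show ?case by (simp add: linear_iff)
next
  case (Cons x xs)
  then show ?case unfolding foldr.simps by (rule linear_compose[OF _ linear_rot_ext])
qed

text \<open>Moving a factor to its sorted place passes the smaller indices, each at the cost of a
  sign, and \<open>ext_sign\<close> counts exactly these. This matches the ordered products in
  \<open>spin_act\<close> with the signs in \<open>ext_mult\<close>.\<close>

lemma foldr_rot_ext_insort:
  assumes "sorted xs" "distinct xs"
  shows "i \<notin> set xs \<Longrightarrow> rot_ext R i (foldr (rot_ext R) xs \<psi>) = ext_sign i (set xs) *\<^sub>R foldr (rot_ext R) (insort i xs) \<psi>"
    and "i \<in> set xs \<Longrightarrow> rot_ext R i (foldr (rot_ext R) xs \<psi>) = 0"
proof -
  show "i \<notin> set xs \<Longrightarrow> rot_ext R i (foldr (rot_ext R) xs \<psi>) = ext_sign i (set xs) *\<^sub>R foldr (rot_ext R) (insort i xs) \<psi>"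
    using assms
  proof (induction xs)
    case Nil
    then show ?case by (simp add: ext_sign_def)
  next
    case (Cons x xs)
    then have IH: "rot_ext R i (foldr (rot_ext R) xs \<psi>) = ext_sign i (set xs) *\<^sub>R foldr (rot_ext R) (insort i xs) \<psi>" by simp
    show ?case
    proof (cases "i \<le> x")
      case True
      then have "{a \<in> set (x # xs). a < i} = {}" using Cons.prems by auto
      then have "ext_sign i (set (x # xs)) = 1" unfolding ext_sign_def by (simp only: card.empty power_0)
      then show ?thesis using True by simp
    next
      case False
      then have "ext_sign i (set (x # xs)) = - ext_sign i (set xs)"
        using Cons.prems ext_sign_insert[of x "set xs" i] by auto
      then show ?thesis using False
        by (simp add: rot_ext_anti[of R i x] IH linear_simps[OF linear_rot_ext])
    qed
  qed
  show "i \<in> set xs \<Longrightarrow> rot_ext R i (foldr (rot_ext R) xs \<psi>) = 0"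
  proof (induction xs)
    case (Cons x xs)
    then show ?case
      by (cases "x = i") (simp_all add: rot_ext_sq rot_ext_anti[of R i x] linear_simps[OF linear_rot_ext])
  qed simp
qed

abbreviation "act \<equiv> spin_act \<gamma>"

lemma act_alt: "act h \<phi> = (\<Sum>A\<in>UNIV. foldr (rot_ext (spin_Ad \<gamma> h)) (sorted_list_of_set A) (vac (h *v (\<phi> $ A))))"
  unfolding spin_act_def vac_def rot_ext_def ..

lemma linear_act: "linear (act h)"
proof -
  have "linear (\<lambda>\<phi>. vac (h *v (\<phi> $ A)))" for A
    by (rule linearI) (simp_all add: matrix_vector_right_distrib matrix_vector_scaleR linear_simps[OF linear_vac])
  then show ?thesis unfolding act_alt[abs_def]
    by (intro linear_compose_sum ballI linear_compose[OF _ linear_foldr_rot_ext, unfolded o_def])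
qed

lemmas act_linear = linear_simps[OF linear_act]

lemma act_vac: "act h (vac \<psi>) = vac (h *v \<psi>)"
proof -
  have "act h (vac \<psi>) = (\<Sum>A\<in>(UNIV :: 'n set set). if A = {} then vac (h *v \<psi>) else 0)"
    unfolding act_alt
    by (intro sum.cong refl) (auto simp: vac_def[of \<psi>] linear_simps[OF linear_vac] linear_simps[OF linear_foldr_rot_ext])
  then show ?thesis by simp
qed

text \<open>Reindexing the sets that contain \<open>k\<close> by removing \<open>k\<close> produces
  the sorted insertions; the other sets contribute squares of anticommuting factors, that is 0.
  Together with \<open>act_vac\<close> this determines \<open>act\<close>.\<close>

lemma act_ext: "act h (\<E> k \<phi>) = rot_ext (spin_Ad \<gamma> h) k (act h \<phi>)"
proof -
  let ?R = "spin_Ad \<gamma> h"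
  let ?F = "\<lambda>A \<psi>. foldr (rot_ext ?R) (sorted_list_of_set A) (vac (h *v \<psi>))"
  have F: "?F A (r *\<^sub>R \<psi>) = r *\<^sub>R ?F A \<psi>" "?F A 0 = 0" for A r \<psi>
    by (simp_all add: matrix_vector_scaleR linear_simps[OF linear_vac] linear_simps[OF linear_foldr_rot_ext])
  have "act h (\<E> k \<phi>) = (\<Sum>A\<in>{A. k \<in> A}. ext_sign k A *\<^sub>R ?F A (\<phi> $ (A - {k})))"
    unfolding act_alt by (rule sum.mono_neutral_cong_right) (auto simp: ext_mult_def F linear_simps[OF linear_vac] linear_simps[OF linear_foldr_rot_ext])
  also have "\<dots> = (\<Sum>A\<in>{A. k \<notin> A}. ext_sign k A *\<^sub>R ?F (insert k A) (\<phi> $ A))"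
    by (rule sum.reindex_bij_witness[where i = "insert k" and j = "\<lambda>A. A - {k}"])
      (auto simp: insert_absorb)
  also have "\<dots> = (\<Sum>A\<in>{A. k \<notin> A}. rot_ext ?R k (?F A (\<phi> $ A)))"
    by (intro sum.cong refl) (simp add: foldr_rot_ext_insort(1) sorted_list_of_set_insert_remove)
  also have "\<dots> = (\<Sum>A\<in>UNIV. rot_ext ?R k (?F A (\<phi> $ A)))"
    by (rule sum.mono_neutral_left) (auto simp: foldr_rot_ext_insort(2))
  finally show ?thesis by (simp add: act_alt linear_simps[OF linear_rot_ext])
qed

text \<open>By induction the claim reduces to plain spinors, where it is the covering relation.
  \<open>act_int\<close> is proved the same way, orthogonality of the rotation entering through
  \<open>int_ext\<close>.\<close>

lemma act_cliff:
  assumes h: "h \<in> spin_group \<gamma>"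
  shows "act h (\<G> k \<phi>) = (\<Sum>i\<in>UNIV. spin_Ad \<gamma> h $ i $ k *\<^sub>R \<G> i (act h \<phi>))"
proof (induction \<phi> rule: twisted_induct)
  case (vac \<psi>)
  have "(h ** \<gamma> k) *v \<psi> = (\<Sum>i\<in>UNIV. spin_Ad \<gamma> h $ i $ k *\<^sub>R (\<gamma> i *v (h *v \<psi>)))"
    using spin_group_props(1)[OF h] unfolding covers_def clv_def
    by (simp add: matrix_vector_mul_assoc[symmetric] sum_matrix_vector scaleR_matrix_vector)
  then show ?case
    by (simp add: cliff_vac act_vac matrix_vector_mul_assoc[symmetric] linear_simps[OF linear_vac])
next
  case (add \<phi> \<phi>')
  then show ?case by (simp add: op_linear act_linear scaleR_add_right sum.distrib)
next
  case (ext m \<phi>)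
  then show ?case
    by (simp add: cliff_ext act_ext rot_ext_def op_linear scaleR_sum_right) (subst sum.swap, simp add: mult.commute)
qed

definition rot_int :: "((real, 'n) vec, 'n) vec \<Rightarrow> 'n \<Rightarrow> ('n, 's) twisted \<Rightarrow> ('n, 's) twisted" where
  "rot_int R a \<psi> = (\<Sum>k\<in>UNIV. R $ k $ a *\<^sub>R \<I> k \<psi>)"

lemma linear_rot_int: "linear (rot_int R a)"
  by (rule linearI) (simp_all add: rot_int_def op_linear scaleR_add_right sum.distrib scaleR_sum_right mult.commute)

lemma rot_int_ext:
  assumes "transpose R ** R = mat 1"
  shows "rot_int R k (rot_ext R m \<phi>) = (if k = m then \<phi> else 0) - rot_ext R m (rot_int R k \<phi>)"
proof -
  have o: "(\<Sum>i\<in>UNIV. R $ i $ k * R $ i $ m) = (if k = m then 1 else 0)"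
    using assms by (simp add: vec_eq_iff matrix_matrix_mult_def transpose_def mat_def)
  have "rot_int R k (rot_ext R m \<phi>) = (\<Sum>i\<in>UNIV. \<Sum>l\<in>UNIV. (R $ i $ k * R $ l $ m) *\<^sub>R ((if i = l then \<phi> else 0) - \<E> l (\<I> i \<phi>)))"
    by (simp add: rot_int_def rot_ext_def op_linear scaleR_sum_right int_ext)
  also have "\<dots> = (\<Sum>i\<in>UNIV. (R $ i $ k * R $ i $ m) *\<^sub>R \<phi>) - (\<Sum>i\<in>UNIV. \<Sum>l\<in>UNIV. (R $ i $ k * R $ l $ m) *\<^sub>R \<E> l (\<I> i \<phi>))"
    by (simp add: scaleR_diff_right sum_subtractf if_distrib[where f = "scaleR _"] cong: if_cong)
  also have "(\<Sum>i\<in>UNIV. (R $ i $ k * R $ i $ m) *\<^sub>R \<phi>) = (if k = m then \<phi> else 0)"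
    unfolding scaleR_sum_left[symmetric] o by simp
  also have "(\<Sum>i\<in>UNIV. \<Sum>l\<in>UNIV. (R $ i $ k * R $ l $ m) *\<^sub>R \<E> l (\<I> i \<phi>)) = rot_ext R m (rot_int R k \<phi>)"
    by (subst sum.swap) (simp add: rot_int_def rot_ext_def op_linear scaleR_sum_right mult.commute)
  finally show ?thesis .
qed

lemma act_int:
  assumes h: "h \<in> spin_group \<gamma>"
  shows "act h (\<I> k \<phi>) = rot_int (spin_Ad \<gamma> h) k (act h \<phi>)"
proof (induction \<phi> rule: twisted_induct)
  case (vac \<psi>)
  then show ?case by (simp add: act_vac act_linear rot_int_def)
next
  case (add \<phi> \<phi>')
  then show ?case by (simp add: op_linear act_linear linear_simps[OF linear_rot_int])
next
  case (ext m \<phi>)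
  then show ?case
    by (simp add: int_ext act_linear act_ext rot_int_ext[OF spin_group_props(2)[OF h]] linear_simps[OF linear_rot_ext])
qed

lemma herm_rot_ext: "herm (rot_ext R k \<phi>) \<psi> = herm \<phi> (rot_int R k \<psi>)" "herm \<phi> (rot_ext R k \<psi>) = herm (rot_int R k \<phi>) \<psi>"
  by (simp_all add: rot_ext_def rot_int_def herm_sum herm_scaleR herm_ext herm_int)

lemma herm_vac: "herm (vac \<psi> :: ('n, 's) twisted) (vac \<psi>') = (\<Sum>a\<in>UNIV. \<psi> $ a * cnj (\<psi>' $ a))"
proof -
  have "herm (vac \<psi> :: ('n, 's) twisted) (vac \<psi>') = (\<Sum>A\<in>(UNIV :: 'n set set). if A = {} then (\<Sum>a\<in>UNIV. \<psi> $ a * cnj (\<psi>' $ a)) else 0)"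
    unfolding herm_def vac_def by (intro sum.cong refl) auto
  then show ?thesis by simp
qed

lemma herm_act:
  assumes h: "h \<in> spin_group \<gamma>"
  shows "herm (act h \<phi>) (act h \<psi>) = herm \<phi> \<psi>"
proof (induction \<phi> arbitrary: \<psi> rule: twisted_induct)
  case (vac \<chi>')
  show ?case
  proof (induction \<psi> rule: twisted_induct)
    case (vac \<psi>)
    have m: "(\<Sum>a\<in>UNIV. (M *v x) $ a * cnj (y $ a)) = (\<Sum>a\<in>UNIV. x $ a * cnj ((madj M *v y) $ a))" for M :: "complex^'s^'s" and x y
      unfolding matrix_vector_mult_def madj_def
      by (simp add: sum_distrib_left sum_distrib_right) (subst sum.swap, simp add: mult_ac)
    show ?case by (simp add: act_vac herm_vac m matrix_vector_mul_assoc spin_group_props(5)[OF h])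
  next
    case (add \<psi> \<psi>')
    then show ?case by (simp add: act_linear herm_add)
  next
    case (ext k \<psi>)
    have "rot_int R k (vac \<xi>) = 0" for R \<xi> by (simp add: rot_int_def)
    then show ?case by (simp add: act_vac act_ext herm_rot_ext herm_eq_0 flip: herm_int)
  qed
next
  case (add \<phi> \<phi>')
  then show ?case by (simp add: act_linear herm_add)
next
  case (ext k \<phi>)
  then show ?case by (simp add: act_ext herm_rot_ext herm_ext flip: act_int[OF h])
qed

text \<open>Each of the two operators in a summand of \<open>\<rho> a\<close> carries one vector
  index and is rotated separately, which conjugates \<open>a\<close> by the rotation.\<close>

lemma act_lie:
  assumes h: "h \<in> spin_group \<gamma>"
  shows "act h (\<rho> a \<phi>) = \<rho> (spin_Ad \<gamma> h ** a ** transpose (spin_Ad \<gamma> h)) (act h \<phi>)"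
proof -
  let ?R = "spin_Ad \<gamma> h"
  let ?f = "\<lambda>p q. (1/4) *\<^sub>R \<G> p (\<G> q (act h \<phi>)) + \<E> q (\<I> p (act h \<phi>))"
  have f: "act h ((1/4) *\<^sub>R \<G> i (\<G> k \<phi>) + \<E> k (\<I> i \<phi>)) = (\<Sum>p\<in>UNIV. \<Sum>q\<in>UNIV. (?R $ p $ i * ?R $ q $ k) *\<^sub>R ?f p q)" for i k
  proof -
    have "act h (\<G> i (\<G> k \<phi>)) = (\<Sum>p\<in>UNIV. \<Sum>q\<in>UNIV. (?R $ p $ i * ?R $ q $ k) *\<^sub>R \<G> p (\<G> q (act h \<phi>)))"
      by (simp add: act_cliff[OF h] op_linear scaleR_sum_right)
    moreover have "act h (\<E> k (\<I> i \<phi>)) = (\<Sum>p\<in>UNIV. \<Sum>q\<in>UNIV. (?R $ p $ i * ?R $ q $ k) *\<^sub>R \<E> q (\<I> p (act h \<phi>)))"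
      by (simp add: act_ext act_int[OF h] rot_ext_def rot_int_def op_linear scaleR_sum_right) (subst sum.swap, simp add: mult.commute)
    ultimately show ?thesis
      by (simp add: act_linear scaleR_add_right sum.distrib scaleR_sum_right mult_ac)
  qed
  have "act h (\<rho> a \<phi>) = (\<Sum>i\<in>UNIV. \<Sum>k\<in>UNIV. \<Sum>p\<in>UNIV. \<Sum>q\<in>UNIV. (a $ k $ i * (?R $ p $ i * ?R $ q $ k)) *\<^sub>R ?f p q)"
    unfolding spin_lie_act_def by (simp only: act_linear(5,6) f scaleR_sum_right scaleR_scaleR)
  also have "\<dots> = (\<Sum>p\<in>UNIV. \<Sum>q\<in>UNIV. \<Sum>i\<in>UNIV. \<Sum>k\<in>UNIV. (a $ k $ i * (?R $ p $ i * ?R $ q $ k)) *\<^sub>R ?f p q)"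
    by (subst (2) sum.swap, subst (1) sum.swap, subst (3) sum.swap, subst (2) sum.swap, rule refl)
  also have "\<dots> = (\<Sum>p\<in>UNIV. \<Sum>q\<in>UNIV. (?R ** a ** transpose ?R) $ q $ p *\<^sub>R ?f p q)"
  proof (intro sum.cong refl)
    fix p q
    have "(?R ** a ** transpose ?R) $ q $ p = (\<Sum>i\<in>UNIV. \<Sum>k\<in>UNIV. a $ k $ i * (?R $ p $ i * ?R $ q $ k))"
      by (simp add: matrix_matrix_mult_def transpose_def sum_distrib_right sum_distrib_left mult_ac)
    then show "(\<Sum>i\<in>UNIV. \<Sum>k\<in>UNIV. (a $ k $ i * (?R $ p $ i * ?R $ q $ k)) *\<^sub>R ?f p q) = (?R ** a ** transpose ?R) $ q $ p *\<^sub>R ?f p q"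
      by (simp only: scaleR_sum_left)
  qed
  finally show ?thesis by (simp add: spin_lie_act_def)
qed

lemma act_wedge:
  assumes h: "h \<in> spin_group \<gamma>"
  shows "act h (Wed \<phi>) = Wed (act h \<phi>)"
proof -
  let ?R = "spin_Ad \<gamma> h"
  have o: "(\<Sum>i\<in>UNIV. ?R $ k $ i * ?R $ l $ i) = (if k = l then 1 else 0)" for k l
    using spin_group_props(3)[OF h] by (simp add: vec_eq_iff matrix_matrix_mult_def transpose_def mat_def)
  have "act h (Wed \<phi>) = (\<Sum>i\<in>UNIV. \<Sum>k\<in>UNIV. \<Sum>l\<in>UNIV. (?R $ k $ i * ?R $ l $ i) *\<^sub>R \<G> k (\<E> l (act h \<phi>)))"
    by (simp add: cliff_wedge_def act_linear act_cliff[OF h] act_ext rot_ext_def op_linear scaleR_sum_right)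
  also have "\<dots> = (\<Sum>k\<in>UNIV. \<Sum>l\<in>UNIV. \<Sum>i\<in>UNIV. (?R $ k $ i * ?R $ l $ i) *\<^sub>R \<G> k (\<E> l (act h \<phi>)))"
    by (subst sum.swap, subst (2) sum.swap, rule refl)
  also have "\<dots> = Wed (act h \<phi>)"
    by (simp only: scaleR_sum_left[symmetric] o) (simp add: cliff_wedge_def if_distrib[where f = "\<lambda>r. r *\<^sub>R _"] cong: if_cong)
  finally show ?thesis .
qed

definition rot_vec :: "complex^'s^'s \<Rightarrow> ('n \<Rightarrow> ('n, 's) twisted) \<Rightarrow> 'n \<Rightarrow> ('n, 's) twisted" where
  "rot_vec h x k = (\<Sum>l\<in>UNIV. spin_Ad \<gamma> h $ k $ l *\<^sub>R act h (x l))"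

lemma spin_act1_nth: "spin_act1 \<gamma> h x $ k = rot_vec h (($) x) k"
  by (simp add: spin_act1_def rot_vec_def)

lemma act_sums:
  assumes h: "h \<in> spin_group \<gamma>"
  shows "act h (gsum x) = gsum (rot_vec h x)" "act h (esum x) = esum (rot_vec h x)" "act h (isum x) = isum (rot_vec h x)"
  unfolding gsum_def esum_def isum_def rot_vec_def
  by (simp_all add: act_linear act_cliff[OF h] act_ext act_int[OF h] rot_ext_def rot_int_def op_linear) (rule sum.swap)+

lemma act_sym:
  assumes h: "h \<in> spin_group \<gamma>"
  shows "act h (symD j x) = symD j (rot_vec h x)" "act h (symM j x) = symM j (rot_vec h x)" "act h (symP j x) = symP j (rot_vec h x)"
  by (simp_all add: symD_def symM_def symP_def symE_def Let_def act_linear act_sums[OF h] act_wedge[OF h])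

lemma herm1_act:
  assumes h: "h \<in> spin_group \<gamma>"
  shows "herm1 (spin_act1 \<gamma> h x) (spin_act1 \<gamma> h y) = herm1 x y"
proof -
  let ?R = "spin_Ad \<gamma> h"
  have o: "(\<Sum>i\<in>UNIV. ?R $ i $ k * ?R $ i $ l) = (if k = l then 1 else 0)" for k l
    using spin_group_props(2)[OF h] by (simp add: vec_eq_iff matrix_matrix_mult_def transpose_def mat_def)
  have "herm1 (spin_act1 \<gamma> h x) (spin_act1 \<gamma> h y) =
      (\<Sum>i\<in>UNIV. \<Sum>k\<in>UNIV. \<Sum>l\<in>UNIV. (?R $ i $ k * ?R $ i $ l) *\<^sub>R herm (x $ k) (y $ l))"
    by (simp add: herm1_def spin_act1_nth rot_vec_def herm_sum herm_scaleR herm_act[OF h] scaleR_sum_right)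
      (rule sum.cong[OF refl], subst sum.swap, simp add: mult.commute)
  also have "\<dots> = (\<Sum>k\<in>UNIV. \<Sum>l\<in>UNIV. \<Sum>i\<in>UNIV. (?R $ i $ k * ?R $ i $ l) *\<^sub>R herm (x $ k) (y $ l))"
    by (subst sum.swap, subst (2) sum.swap, rule refl)
  also have "\<dots> = herm1 x y"
    by (simp only: scaleR_sum_left[symmetric] o) (simp add: herm1_def if_distrib[where f = "\<lambda>r. r *\<^sub>R _"] cong: if_cong)
  finally show ?thesis .
qed

end

section \<open>Infinitesimal action of the spin group\<close>

context spinor_module
begin

section \<open>The real Clifford algebra and its even commutant\<close>

definition gamma_word :: "'n list \<Rightarrow> complex^'s^'s" where
  "gamma_word xs = foldr (\<lambda>i m. \<gamma> i ** m) xs (mat 1)"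

text \<open>The span is over the reals: a real multiple of the identity that is skew-adjoint
  vanishes, an imaginary one need not. The parity \<open>b\<close> keeps out the product of all
  generators, which for odd \<open>n\<close> commutes with every \<open>\<gamma> i\<close> but is
  odd.\<close>

definition clifford_span :: "'n set \<Rightarrow> bool \<Rightarrow> (complex^'s^'s) set" where
  "clifford_span S b = span {gamma_word xs |xs. set xs \<subseteq> S \<and> even (length xs) = b}"

lemma subspace_clifford_span: "subspace (clifford_span S b)"
  by (simp add: clifford_span_def)

lemma clifford_span_induct [consumes 1, case_names word lin]:
  assumes "Y \<in> clifford_span S b"
    and "\<And>xs. set xs \<subseteq> S \<Longrightarrow> even (length xs) = b \<Longrightarrow> P (gamma_word xs)"
    and "subspace {Y. P Y}"
  shows "P Y"
proof -
  have "clifford_span S b \<subseteq> {Y. P Y}"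
    unfolding clifford_span_def by (rule span_minimal) (use assms in auto)
  then show ?thesis using assms(1) by blast
qed

lemma clifford_span_word: "set xs \<subseteq> S \<Longrightarrow> even (length xs) = b \<Longrightarrow> gamma_word xs \<in> clifford_span S b"
  unfolding clifford_span_def by (rule span_base) auto

lemma clifford_span_gamma_mult:
  assumes "Y \<in> clifford_span S b" "i \<in> S"
  shows "\<gamma> i ** Y \<in> clifford_span S (\<not> b)"
  using assms(1)
proof (induction rule: clifford_span_induct)
  case (word xs)
  then have "gamma_word (i # xs) \<in> clifford_span S (\<not> b)" using assms(2) by (intro clifford_span_word) auto
  then show ?case by (simp add: gamma_word_def)
next
  case lin
  show ?case using subspace_clifford_span[of S "\<not> b"]
    by (auto simp: subspace_def matrix_mult_simps)
qed

lemma clifford_span_clv: "Y \<in> clifford_span UNIV b \<Longrightarrow> clv v ** Y \<in> clifford_span UNIV (\<not> b)"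
  unfolding clv_def matrix_mult_simps
  by (intro subspace_sum subspace_scale subspace_clifford_span clifford_span_gamma_mult) auto

lemma clifford_span_mult:
  assumes "Y \<in> clifford_span S True" "Z \<in> clifford_span S True"
  shows "Y ** Z \<in> clifford_span S True"
  using assms(1)
proof (induction rule: clifford_span_induct)
  case (word xs)
  have "set xs \<subseteq> S \<Longrightarrow> gamma_word xs ** Z \<in> clifford_span S (even (length xs))"
  proof (induction xs)
    case Nil
    then show ?case using assms(2) by (simp add: gamma_word_def)
  next
    case (Cons x xs)
    then have "\<gamma> x ** (gamma_word xs ** Z) \<in> clifford_span S (\<not> even (length xs))"
      by (intro clifford_span_gamma_mult) auto
    then show ?case by (simp add: gamma_word_def matrix_mul_assoc)
  qed
  then show ?case using word by simp
next
  case lin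
  show ?case using subspace_clifford_span[of S True]
    by (auto simp: subspace_def matrix_mult_simps)
qed

lemma clifford_span_mat: "mat 1 \<in> clifford_span S True"
  using clifford_span_word[of "[]" S True] by (simp add: gamma_word_def)

text \<open>The adjoint of a product of vectors is the reversed product up to a sign per factor, so
  an even product has its adjoint in the same real span.\<close>

lemma spin_group_span:
  assumes "h \<in> spin_group \<gamma>"
  shows "h \<in> clifford_span UNIV True" "madj h \<in> clifford_span UNIV True"
proof -
  obtain vs where vs: "even (length vs)" "h = foldr (\<lambda>v h. clv v ** h) vs (mat 1)"
    using assms unfolding spin_group_clv by blast
  have *: "foldr (\<lambda>v h. clv v ** h) vs (mat 1) \<in> clifford_span UNIV (even (length vs))" for vs
    by (induction vs) (auto simp: clifford_span_mat clifford_span_clv intro: clifford_span_clv[of _ True, simplified])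
  then show "h \<in> clifford_span UNIV True" using vs by metis
  have "madj (foldr (\<lambda>v h. clv v ** h) vs (mat 1)) = (- 1) ^ length vs *\<^sub>R foldr (\<lambda>v h. clv v ** h) (rev vs) (mat 1)" for vs
  proof (induction vs)
    case (Cons v vs)
    have f: "foldr (\<lambda>v h. clv v ** h) ws m = foldr (\<lambda>v h. clv v ** h) ws (mat 1) ** m" for ws m
      by (induction ws) (auto simp: matrix_mul_assoc)
    show ?case using Cons f[of "rev vs" "clv v"] by (simp add: madj_mult madj_clv matrix_mult_simps)
  qed simp
  then have "madj h = foldr (\<lambda>v h. clv v ** h) (rev vs) (mat 1)" using vs by simp
  then show "madj h \<in> clifford_span UNIV True" using *[of "rev vs"] vs by simp
qed

lemma clifford_span_comm:
  assumes "Y \<in> clifford_span S b" "i \<notin> S"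
  shows "\<gamma> i ** Y = (if b then Y ** \<gamma> i else - (Y ** \<gamma> i))"
  using assms(1)
proof (induction rule: clifford_span_induct)
  case (word xs)
  have "set xs \<subseteq> S \<Longrightarrow> \<gamma> i ** gamma_word xs = (if even (length xs) then gamma_word xs ** \<gamma> i else - (gamma_word xs ** \<gamma> i))"
  proof (induction xs)
    case Nil
    then show ?case by (simp add: gamma_word_def)
  next
    case (Cons x xs)
    then have "i \<noteq> x" using assms(2) by auto
    then have e: "\<gamma> i ** gamma_word (x # xs) = - (\<gamma> x ** (\<gamma> i ** gamma_word xs))"
      using gamma_gamma[of i x] by (simp add: gamma_word_def matrix_mul_assoc matrix_mult_simps)
    have "gamma_word (x # xs) = \<gamma> x ** gamma_word xs" by (simp add: gamma_word_def)
    then show ?case unfolding e using Cons by (auto simp: matrix_mult_simps simp flip: matrix_mul_assoc)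
  qed
  then show ?case using word by simp
next
  case lin
  show ?case by (auto simp: subspace_def matrix_mult_simps)
qed

lemma clifford_span_insert:
  assumes "Y \<in> clifford_span (insert i S) b" "i \<notin> S"
  shows "\<exists>Y0\<in>clifford_span S b. \<exists>Y1\<in>clifford_span S (\<not> b). Y = Y0 + \<gamma> i ** Y1"
  using assms(1)
proof (induction rule: clifford_span_induct)
  case (word xs)
  have "set xs \<subseteq> insert i S \<Longrightarrow> \<exists>Y0\<in>clifford_span S (even (length xs)). \<exists>Y1\<in>clifford_span S (odd (length xs)). gamma_word xs = Y0 + \<gamma> i ** Y1"
  proof (induction xs)
    case Nil
    show ?case
      using clifford_span_mat[of S] subspace_0[OF subspace_clifford_span, of S False]
      by (intro bexI[of _ "mat 1"] bexI[of _ 0]) (simp_all add: gamma_word_def matrix_mult_simps)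
  next
    case (Cons x xs)
    then obtain Y0 Y1 where Y: "Y0 \<in> clifford_span S (even (length xs))" "Y1 \<in> clifford_span S (odd (length xs))"
      "gamma_word xs = Y0 + \<gamma> i ** Y1" by auto
    have w: "gamma_word (x # xs) = \<gamma> x ** Y0 + \<gamma> x ** (\<gamma> i ** Y1)"
      using Y(3) by (simp add: gamma_word_def matrix_mult_simps)
    show ?case
    proof (cases "x = i")
      case True
      have "\<gamma> i ** \<gamma> i = - mat 1"
      proof -
        have "clv (axis i 1) = \<gamma> i" by (simp add: clv_def axis_def if_distrib[where f = "\<lambda>r. r *\<^sub>R _"] cong: if_cong)
        then show ?thesis using clv_clv[of "axis i 1"] by simp
      qed
      then have "gamma_word (x # xs) = - Y1 + \<gamma> i ** Y0"
        unfolding w by (simp add: True matrix_mul_assoc matrix_mult_simps)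
      moreover have "- Y1 \<in> clifford_span S (odd (length xs))"
        using Y(2) subspace_neg subspace_clifford_span by blast
      ultimately show ?thesis using Y(1) by (intro bexI[of _ "- Y1"] bexI[of _ Y0]) auto
    next
      case False
      then have "\<gamma> x ** \<gamma> i = - (\<gamma> i ** \<gamma> x)" using gamma_gamma[of x i] by simp
      then have "gamma_word (x # xs) = \<gamma> x ** Y0 + \<gamma> i ** (- (\<gamma> x ** Y1))"
        unfolding w by (simp add: matrix_mul_assoc matrix_mult_simps)
      moreover have "\<gamma> x ** Y0 \<in> clifford_span S (odd (length xs))" "\<gamma> x ** Y1 \<in> clifford_span S (even (length xs))"
        using clifford_span_gamma_mult[OF Y(1), of x] clifford_span_gamma_mult[OF Y(2), of x] False Cons.prems by auto
      moreover then have "- (\<gamma> x ** Y1) \<in> clifford_span S (even (length xs))"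
        using subspace_neg subspace_clifford_span by blast
      ultimately show ?thesis by (intro bexI[of _ "\<gamma> x ** Y0"] bexI[of _ "- (\<gamma> x ** Y1)"]) auto
    qed
  qed
  then show ?case using word by simp
next
  case lin
  note s = subspace_clifford_span[of S b] subspace_clifford_span[of S "\<not> b"]
  show ?case
    unfolding subspace_def Ball_def mem_Collect_eq
  proof (intro conjI allI impI)
    show "\<exists>Y0\<in>clifford_span S b. \<exists>Y1\<in>clifford_span S (\<not> b). 0 = Y0 + \<gamma> i ** Y1"
      using s[THEN subspace_0] by (auto simp: matrix_mult_simps intro!: bexI[of _ 0])
  next
    fix x y
    assume "\<exists>Y0\<in>clifford_span S b. \<exists>Y1\<in>clifford_span S (\<not> b). x = Y0 + \<gamma> i ** Y1"
      and "\<exists>Y0\<in>clifford_span S b. \<exists>Y1\<in>clifford_span S (\<not> b). y = Y0 + \<gamma> i ** Y1"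
    then obtain Y0 Y1 Z0 Z1 where "Y0 \<in> clifford_span S b" "Y1 \<in> clifford_span S (\<not> b)" "x = Y0 + \<gamma> i ** Y1"
      "Z0 \<in> clifford_span S b" "Z1 \<in> clifford_span S (\<not> b)" "y = Z0 + \<gamma> i ** Z1" by blast
    then show "\<exists>Y0\<in>clifford_span S b. \<exists>Y1\<in>clifford_span S (\<not> b). x + y = Y0 + \<gamma> i ** Y1"
      using s[THEN subspace_add] by (intro bexI[of _ "Y0 + Z0"] bexI[of _ "Y1 + Z1"]) (auto simp: matrix_mult_simps)
  next
    fix x and c :: real
    assume "\<exists>Y0\<in>clifford_span S b. \<exists>Y1\<in>clifford_span S (\<not> b). x = Y0 + \<gamma> i ** Y1"
    then obtain Y0 Y1 where "Y0 \<in> clifford_span S b" "Y1 \<in> clifford_span S (\<not> b)" "x = Y0 + \<gamma> i ** Y1" by blast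
    then show "\<exists>Y0\<in>clifford_span S b. \<exists>Y1\<in>clifford_span S (\<not> b). c *\<^sub>R x = Y0 + \<gamma> i ** Y1"
      using s[THEN subspace_scale] by (intro bexI[of _ "c *\<^sub>R Y0"] bexI[of _ "c *\<^sub>R Y1"]) (auto simp: matrix_mult_simps scaleR_add_right)
  qed
qed

text \<open>The generators in \<open>S\<close> are eliminated one by one: the part \<open>\<gamma> i ** Y1\<close> of \<open>Y\<close> anticommutes with \<open>\<gamma> i\<close>.\<close>

lemma even_commutant:
  fixes Y :: "complex^'s^'s"
  assumes "finite S" "Y \<in> clifford_span S True" "\<And>i. i \<in> S \<Longrightarrow> Y ** \<gamma> i = \<gamma> i ** Y"
  shows "\<exists>r. Y = r *\<^sub>R mat 1"
  using assms
proof (induction S rule: finite_induct)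
  case empty
  have "{gamma_word xs |xs. set xs \<subseteq> {} \<and> even (length xs) = True} \<subseteq> {mat 1}" by (auto simp: gamma_word_def)
  then have "Y \<in> span {mat 1}" using empty(1) span_mono unfolding clifford_span_def by blast
  then show ?case by (auto simp: span_singleton)
next
  case (insert i S)
  obtain Y0 Y1 where Y: "Y0 \<in> clifford_span S True" "Y1 \<in> clifford_span S False" "Y = Y0 + \<gamma> i ** Y1"
    using clifford_span_insert[OF insert.prems(1) insert(2)] by auto
  have c: "\<gamma> i ** Y0 = Y0 ** \<gamma> i" "\<gamma> i ** Y1 = - (Y1 ** \<gamma> i)"
    using clifford_span_comm[OF Y(1) insert(2)] clifford_span_comm[OF Y(2) insert(2)] by simp_all
  have sq: "\<gamma> i ** \<gamma> i = - mat 1"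
  proof -
    have "clv (axis i 1) = \<gamma> i" by (simp add: clv_def axis_def if_distrib[where f = "\<lambda>r. r *\<^sub>R _"] cong: if_cong)
    then show ?thesis using clv_clv[of "axis i 1"] by simp
  qed
  have "Y ** \<gamma> i = Y0 ** \<gamma> i + \<gamma> i ** (Y1 ** \<gamma> i)" unfolding Y(3) by (simp add: matrix_mult_simps matrix_mul_assoc)
  also have "Y1 ** \<gamma> i = - (\<gamma> i ** Y1)" using c(2) by simp
  also have "\<gamma> i ** - (\<gamma> i ** Y1) = Y1" by (simp add: matrix_mult_simps matrix_mul_assoc sq)
  finally have "Y ** \<gamma> i = Y0 ** \<gamma> i + Y1" .
  moreover have "\<gamma> i ** Y = Y0 ** \<gamma> i - Y1" unfolding Y(3) by (simp add: matrix_mult_simps matrix_mul_assoc sq c(1))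
  ultimately have "Y1 = - Y1" using insert.prems(2)[of i] by (simp add: algebra_simps)
  then have "2 *\<^sub>R Y1 = 0" by (metis add.right_inverse scaleR_2)
  then have "Y1 = 0" by (simp only: scaleR_eq_0_iff) simp
  then have "Y = Y0" using Y(3) by (simp add: matrix_mult_simps)
  then show ?case using insert.IH Y(1) insert.prems(2) by blast
qed

section \<open>The lift of skew matrices to the Clifford algebra\<close>

definition spin_lift :: "((real, 'n) vec, 'n) vec \<Rightarrow> complex^'s^'s" where
  "spin_lift a = (\<Sum>i\<in>UNIV. \<Sum>k\<in>UNIV. (a $ k $ i / 4) *\<^sub>R (\<gamma> i ** \<gamma> k))"

lemma vac_eq_iff: "vac x = (vac y :: ('n, 's) twisted) \<longleftrightarrow> x = y"
proof
  have v: "(vac x :: ('n, 's) twisted) $ {} = x" for x by (simp add: vac_def)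
  assume "vac x = (vac y :: ('n, 's) twisted)"
  then show "x = y" using v by metis
qed simp

lemma lie_vac: "\<rho> a (vac \<psi>) = vac (spin_lift a *v \<psi>)"
  by (simp add: spin_lie_act_def spin_lift_def cliff_vac op_linear sum_matrix_vector scaleR_matrix_vector linear_simps[OF linear_vac]
      flip: matrix_vector_mul_assoc)

text \<open>This is \<open>lie_cliff\<close> restricted to forms of degree 0, where the action of
  \<open>a\<close> is multiplication by \<open>spin_lift a\<close>.\<close>

lemma spin_lift_comm:
  assumes "skew a"
  shows "spin_lift a ** \<gamma> j = \<gamma> j ** spin_lift a + clv (\<chi> l. a $ l $ j)"
proof (rule matrix_eq[THEN iffD2], rule allI)
  fix \<psi>
  have "vac ((spin_lift a ** \<gamma> j) *v \<psi>) = (vac ((\<gamma> j ** spin_lift a + clv (\<chi> l. a $ l $ j)) *v \<psi>) :: ('n, 's) twisted)"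
    using lie_cliff[OF assms, of j "vac \<psi>"]
    by (simp add: cliff_vac lie_vac matrix_vector_mult_add_rdistrib linear_simps[OF linear_vac] clv_def sum_matrix_vector scaleR_matrix_vector
        flip: matrix_vector_mul_assoc)
  then show "(spin_lift a ** \<gamma> j) *v \<psi> = (\<gamma> j ** spin_lift a + clv (\<chi> l. a $ l $ j)) *v \<psi>"
    by (simp only: vac_eq_iff)
qed

lemma madj_spin_lift:
  assumes "skew a"
  shows "madj (spin_lift a) = - spin_lift a"
proof -
  have "madj (spin_lift a) = (\<Sum>i\<in>UNIV. \<Sum>k\<in>UNIV. (a $ k $ i / 4) *\<^sub>R (\<gamma> k ** \<gamma> i))"
    by (simp add: spin_lift_def madj_simps madj_mult madj_gamma matrix_mult_simps)
  also have "\<dots> = (\<Sum>i\<in>UNIV. \<Sum>k\<in>UNIV. (a $ i $ k / 4) *\<^sub>R (\<gamma> i ** \<gamma> k))" by (rule sum.swap)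
  also have "\<dots> = (\<Sum>i\<in>UNIV. \<Sum>k\<in>UNIV. - ((a $ k $ i / 4) *\<^sub>R (\<gamma> i ** \<gamma> k)))"
    by (intro sum.cong refl) (subst skewD[OF assms], simp)
  finally show ?thesis by (simp add: spin_lift_def sum_negf)
qed

lemma spin_lift_span: "spin_lift a \<in> clifford_span UNIV True"
proof -
  have "\<gamma> i ** \<gamma> k \<in> clifford_span UNIV True" for i k
    using clifford_span_word[of "[i, k]" UNIV True] by (simp add: gamma_word_def)
  then show ?thesis unfolding spin_lift_def
    by (intro subspace_sum subspace_scale subspace_clifford_span)
qed

end

locale spin_calculus = atlas_manifold A + spinor_module \<gamma>
  for A :: "('m::topological_space, 'n::{finite,linorder}) chart set" and \<gamma> :: "'n \<Rightarrow> complex^'s^'s::finite"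
begin

text \<open>A functional vanishing on \<open>V\<close> vanishes on the derivative, and a subspace is
  the orthogonal complement of its orthogonal complement.\<close>

lemma dir_deriv_subspace:
  fixes f :: "'m \<Rightarrow> 'b::euclidean_space"
  assumes V: "subspace V" and X: "X \<in> tangent_space A p" and f: "smooth_at p f" and W: "open W" "p \<in> W" "\<And>q. q \<in> W \<Longrightarrow> f q \<in> V"
  shows "dir_deriv X f \<in> V"
proof -
  have "dir_deriv X f \<in> V\<^sup>\<bottom>\<^sup>\<bottom>"
  proof -
    have "w \<bullet> dir_deriv X f = 0" if w: "w \<in> V\<^sup>\<bottom>" for w
    proof -
      have z: "w \<bullet> f q = 0" if "q \<in> W" for q
        using w W(3)[OF that] by (auto simp: orthogonal_comp_def orthogonal_def inner_commute)
      have "w \<bullet> dir_deriv X f = dir_deriv X (\<lambda>q. w \<bullet> f q)"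
        by (rule dir_deriv_linear[OF bounded_linear_inner_right X f, symmetric])
      also have "\<dots> = dir_deriv X (\<lambda>q. 0)"
        by (rule dir_deriv_cong(1)[OF X W(1,2) z]) auto
      finally show ?thesis using X by simp
    qed
    then show ?thesis by (auto simp: orthogonal_comp_def orthogonal_def)
  qed
  then show ?thesis using orthogonal_comp_self[OF V] by simp
qed

text \<open>A smooth curve of spin group elements \<open>h\<close> over the rotations \<open>R\<close> has logarithmic derivative
  \<open>spin_lift (dR R\<^sup>T)\<close>: the difference commutes with all \<open>\<gamma> i\<close> and lies in the real even Clifford algebra,
  hence is a real scalar, and it is skew-adjoint.\<close>

context
  fixes X :: "'m tangent" and p :: 'm and W :: "'m set" and h :: "'m \<Rightarrow> complex^'s^'s"
  assumes X: "X \<in> tangent_space A p" and W: "open W" "p \<in> W" and h: "\<And>q. q \<in> W \<Longrightarrow> h q \<in> spin_group \<gamma>"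
    and sh: "smooth_at p h" and sR: "smooth_at p (\<lambda>q. spin_Ad \<gamma> (h q))"
begin

definition logdiff :: "((real, 'n) vec, 'n) vec" where
  "logdiff = dir_deriv X (\<lambda>q. spin_Ad \<gamma> (h q)) ** transpose (spin_Ad \<gamma> (h p))"

lemma smooth_at_entry: "smooth_at p (\<lambda>q. spin_Ad \<gamma> (h q) $ i $ k)"
  using smooth_at_linear[OF bounded_linear_compose[OF bounded_linear_vec_nth bounded_linear_vec_nth] sR, unfolded o_def] .

lemma deriv_entry: "dir_deriv X (\<lambda>q. spin_Ad \<gamma> (h q) $ i $ k) = dir_deriv X (\<lambda>q. spin_Ad \<gamma> (h q)) $ i $ k"
  using dir_deriv_linear[OF bounded_linear_compose[OF bounded_linear_vec_nth bounded_linear_vec_nth] X sR, unfolded o_def] .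

lemma logdiff_nth: "logdiff $ l $ j = (\<Sum>i\<in>UNIV. dir_deriv X (\<lambda>q. spin_Ad \<gamma> (h q)) $ l $ i * spin_Ad \<gamma> (h p) $ j $ i)"
  by (simp add: logdiff_def matrix_matrix_mult_def transpose_def)

lemma skew_logdiff: "skew logdiff"
  unfolding skew_def
proof (intro allI)
  fix k l
  have "dir_deriv X (\<lambda>q. \<Sum>i\<in>UNIV. spin_Ad \<gamma> (h q) $ k $ i * spin_Ad \<gamma> (h q) $ l $ i) = dir_deriv X (\<lambda>q. if k = l then 1 else 0 :: real)"
  proof (rule dir_deriv_cong(1)[OF X W])
    fix q assume "q \<in> W"
    from spin_group_props(3)[OF h[OF this]]
    show "(\<Sum>i\<in>UNIV. spin_Ad \<gamma> (h q) $ k $ i * spin_Ad \<gamma> (h q) $ l $ i) = (if k = l then 1 else 0)"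
      by (simp add: vec_eq_iff matrix_matrix_mult_def transpose_def mat_def)
  qed simp
  also have "\<dots> = 0" using X by (rule dir_deriv_const)
  also have "dir_deriv X (\<lambda>q. \<Sum>i\<in>UNIV. spin_Ad \<gamma> (h q) $ k $ i * spin_Ad \<gamma> (h q) $ l $ i) =
      (\<Sum>i\<in>UNIV. dir_deriv X (\<lambda>q. spin_Ad \<gamma> (h q)) $ k $ i * spin_Ad \<gamma> (h p) $ l $ i + spin_Ad \<gamma> (h p) $ k $ i * dir_deriv X (\<lambda>q. spin_Ad \<gamma> (h q)) $ l $ i)"
    by (subst dir_deriv_sum[OF X]) (auto intro!: smooth_at_bilinear[OF bounded_bilinear_mult] smooth_at_entry
        simp only: dir_deriv_bilinear[OF bounded_bilinear_mult X smooth_at_entry smooth_at_entry] deriv_entry)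
  finally show "logdiff $ k $ l = - logdiff $ l $ k"
    by (simp add: logdiff_nth sum.distrib mult.commute eq_neg_iff_add_eq_0)
qed

lemma spin_deriv: "dir_deriv X h = spin_lift logdiff ** h p"
proof -
  let ?R = "\<lambda>q. spin_Ad \<gamma> (h q)"
  let ?dR = "dir_deriv X ?R"
  note hp = spin_group_props[OF h[OF W(2)]]
  define Z where "Z = dir_deriv X h ** madj (h p)"
  have scol: "smooth_at p (\<lambda>q. clv (\<chi> i. ?R q $ i $ k))" for k
    unfolding clv_def by (simp, intro smooth_at_sum smooth_at_bilinear[OF bounded_bilinear_scaleR] smooth_at_entry smooth_at_const)
  have dcol: "dir_deriv X (\<lambda>q. clv (\<chi> i. ?R q $ i $ k)) = clv (\<chi> i. ?dR $ i $ k)" for k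
  proof -
    have "dir_deriv X (\<lambda>q. \<Sum>i\<in>UNIV. ?R q $ i $ k *\<^sub>R \<gamma> i) = (\<Sum>i\<in>UNIV. ?dR $ i $ k *\<^sub>R \<gamma> i)"
      using X by (subst dir_deriv_sum[OF X]) (auto intro!: smooth_at_bilinear[OF bounded_bilinear_scaleR] smooth_at_entry
        simp: dir_deriv_bilinear[OF bounded_bilinear_scaleR X smooth_at_entry smooth_at_const] deriv_entry)
    then show ?thesis by (simp add: clv_def)
  qed
  \<comment> \<open>Obtained by differentiating the covering relation of \<open>h q\<close> and then
    multiplying by the inverse \<open>madj (h p)\<close>.\<close>
  have comm: "Z ** clv (\<chi> i. ?R p $ i $ k) = clv (\<chi> i. ?dR $ i $ k) + clv (\<chi> i. ?R p $ i $ k) ** Z" for k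
  proof -
    have "dir_deriv X (\<lambda>q. h q ** \<gamma> k) = dir_deriv X (\<lambda>q. clv (\<chi> i. ?R q $ i $ k) ** h q)"
    proof (rule dir_deriv_cong(1)[OF X W])
      show "h q ** \<gamma> k = clv (\<chi> i. ?R q $ i $ k) ** h q" if "q \<in> W" for q
        using spin_group_props(1)[OF h[OF that]] by (simp add: covers_def)
      show "smooth_at p (\<lambda>q. clv (\<chi> i. ?R q $ i $ k) ** h q)"
        by (intro smooth_at_bilinear[OF bounded_bilinear_matrix_mult] scol sh)
    qed
    then have d: "dir_deriv X h ** \<gamma> k = clv (\<chi> i. ?dR $ i $ k) ** h p + clv (\<chi> i. ?R p $ i $ k) ** dir_deriv X h"
      using X by (simp add: dir_deriv_bilinear[OF bounded_bilinear_matrix_mult X] scol sh dcol matrix_mult_simps)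
    have "\<gamma> k ** madj (h p) = madj (h p) ** clv (\<chi> i. ?R p $ i $ k)"
    proof -
      have "madj (h p) ** (h p ** \<gamma> k) ** madj (h p) = madj (h p) ** (clv (\<chi> i. ?R p $ i $ k) ** h p) ** madj (h p)"
        using hp(1) by (simp add: covers_def)
      then show ?thesis using hp(4,5) by (metis matrix_mul_assoc matrix_mul_lid matrix_mul_rid)
    qed
    then have "Z ** clv (\<chi> i. ?R p $ i $ k) = (dir_deriv X h ** \<gamma> k) ** madj (h p)"
      by (simp add: Z_def flip: matrix_mul_assoc)
    also have "\<dots> = clv (\<chi> i. ?dR $ i $ k) ** (h p ** madj (h p)) + clv (\<chi> i. ?R p $ i $ k) ** Z"
      unfolding d Z_def by (simp add: matrix_mult_simps matrix_mul_assoc)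
    finally show ?thesis by (simp add: hp(4))
  qed
  \<comment> \<open>Combining the columns with the entries of row \<open>j\<close> of the rotation
    returns \<open>\<gamma> j\<close> itself, by orthogonality; the derivatives of the columns
    combine to column \<open>j\<close> of \<open>logdiff\<close>.\<close>
  have Zg: "Z ** \<gamma> j = clv (\<chi> l. logdiff $ l $ j) + \<gamma> j ** Z" for j
  proof -
    have "(\<Sum>k\<in>UNIV. ?R p $ j $ k *\<^sub>R (\<chi> i. ?R p $ i $ k)) = axis j 1"
      using hp(3) by (simp add: vec_eq_iff matrix_matrix_mult_def transpose_def mat_def axis_def sum_component)
    moreover have "clv (axis j 1) = \<gamma> j" by (simp add: clv_def axis_def if_distrib[where f = "\<lambda>r. r *\<^sub>R _"] cong: if_cong)
    ultimately have g: "\<gamma> j = (\<Sum>k\<in>UNIV. ?R p $ j $ k *\<^sub>R clv (\<chi> i. ?R p $ i $ k))"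
      by (metis (no_types, lifting) linear_simps(5,6)[OF linear_clv] sum.cong)
    have "(\<Sum>k\<in>UNIV. ?R p $ j $ k *\<^sub>R clv (\<chi> i. ?dR $ i $ k)) = clv (\<Sum>k\<in>UNIV. ?R p $ j $ k *\<^sub>R (\<chi> i. ?dR $ i $ k))"
      by (simp add: linear_simps[OF linear_clv])
    also have "(\<Sum>k\<in>UNIV. ?R p $ j $ k *\<^sub>R (\<chi> i. ?dR $ i $ k)) = (\<chi> l. logdiff $ l $ j)"
      by (simp add: vec_eq_iff logdiff_nth sum_component mult.commute)
    finally have g': "(\<Sum>k\<in>UNIV. ?R p $ j $ k *\<^sub>R clv (\<chi> i. ?dR $ i $ k)) = clv (\<chi> l. logdiff $ l $ j)" .
    have "Z ** (\<Sum>k\<in>UNIV. ?R p $ j $ k *\<^sub>R clv (\<chi> i. ?R p $ i $ k)) =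
        clv (\<chi> l. logdiff $ l $ j) + (\<Sum>k\<in>UNIV. ?R p $ j $ k *\<^sub>R clv (\<chi> i. ?R p $ i $ k)) ** Z"
      unfolding g'[symmetric] by (simp add: matrix_mult_simps comm scaleR_add_right sum.distrib)
    then show ?thesis unfolding g[symmetric] .
  qed
  \<comment> \<open>Differentiate the unitarity relation
    \<open>h q ** madj (h q) = mat 1\<close>.\<close>
  have adj: "madj Z = - Z"
  proof -
    have b: "bounded_linear madj" using linear_madj by (simp add: linear_conv_bounded_linear)
    note lm = smooth_at_linear[OF b sh] dir_deriv_linear[OF b X sh]
    have "dir_deriv X (\<lambda>q. h q ** madj (h q)) = dir_deriv X (\<lambda>q. mat 1)"
      by (rule dir_deriv_cong(1)[OF X W]) (use spin_group_props(4)[OF h] in auto)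
    then have "dir_deriv X h ** madj (h p) + h p ** madj (dir_deriv X h) = 0"
      using X lm by (simp add: dir_deriv_bilinear[OF bounded_bilinear_matrix_mult X sh])
    moreover have "madj (madj (h p)) = h p" by (simp add: madj_def vec_eq_iff)
    ultimately show ?thesis unfolding Z_def madj_mult by (simp add: eq_neg_iff_add_eq_0 add.commute)
  qed
  define Y where "Y = Z - spin_lift logdiff"
  \<comment> \<open>The spin group lies in the fixed real subspace
    \<open>clifford_span UNIV True\<close>, so the derivative stays in it.\<close>
  have "dir_deriv X h \<in> clifford_span UNIV True"
    by (rule dir_deriv_subspace[OF subspace_clifford_span X sh W]) (use h spin_group_span in blast)
  then have "Y \<in> clifford_span UNIV True"
    unfolding Y_def Z_def using spin_group_span(2)[OF h[OF W(2)]]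
    by (intro subspace_diff[OF subspace_clifford_span] clifford_span_mult spin_lift_span)
  moreover have "Y ** \<gamma> i = \<gamma> i ** Y" for i
    unfolding Y_def by (simp add: matrix_mult_simps Zg spin_lift_comm[OF skew_logdiff])
  ultimately obtain r where r: "Y = r *\<^sub>R mat 1" using even_commutant[OF finite, of Y UNIV] by blast
  have "madj Y = - Y" by (simp add: Y_def madj_simps adj madj_spin_lift[OF skew_logdiff])
  then have "r *\<^sub>R (mat 1 :: complex^'s^'s) = - (r *\<^sub>R mat 1)" unfolding r by (simp add: madj_simps)
  then have "(2 * r) *\<^sub>R (mat 1 :: complex^'s^'s) = 0" by (simp only: eq_neg_iff_add_eq_0 scaleR_add_left[symmetric]) simp
  moreover have "mat 1 \<noteq> (0 :: complex^'s^'s)" by (simp add: mat_def vec_eq_iff)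
  ultimately have "Y = 0" unfolding r by simp
  then have "Z ** h p = spin_lift logdiff ** h p" by (simp add: Y_def)
  then show ?thesis by (simp add: Z_def hp(5) flip: matrix_mul_assoc)
qed

text \<open>For plain spinors this is \<open>spin_deriv\<close>. For an exterior product the
  derivative of the rotation is \<open>logdiff\<close> times the rotation, which is exactly the
  correction term of \<open>lie_ext\<close>.\<close>

lemma act_deriv_const: "smooth_at p (\<lambda>q. act (h q) \<phi>) \<and> dir_deriv X (\<lambda>q. act (h q) \<phi>) = \<rho> logdiff (act (h p) \<phi>)"
proof (induction \<phi> rule: twisted_induct)
  case (vac \<psi>)
  have "linear (\<lambda>M. vac (M *v \<psi>) :: ('n, 's) twisted)"
    by (rule linearI) (simp_all add: matrix_vector_mult_add_rdistrib scaleR_matrix_vector linear_simps[OF linear_vac])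
  then have L: "bounded_linear (\<lambda>M. vac (M *v \<psi>) :: ('n, 's) twisted)" by (simp add: linear_conv_bounded_linear)
  show ?case
    using smooth_at_linear[OF L sh] dir_deriv_linear[OF L X sh]
    by (simp add: act_vac lie_vac spin_deriv matrix_vector_mul_assoc)
next
  case (add \<phi> \<phi>')
  then show ?case by (simp add: act_linear lie_linear dir_deriv_add[OF X] smooth_at_add)
next
  case (ext k \<phi>)
  have L: "bounded_linear (\<E> i)" for i using linear_ext_mult by (simp add: linear_conv_bounded_linear)
  have s: "smooth_at p (\<lambda>q. spin_Ad \<gamma> (h q) $ i $ k *\<^sub>R \<E> i (act (h q) \<phi>))" for i
    using ext by (intro smooth_at_bilinear[OF bounded_bilinear_scaleR] smooth_at_entry smooth_at_linear[OF L]) auto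
  have "dir_deriv X (\<lambda>q. act (h q) (\<E> k \<phi>)) =
     (\<Sum>i\<in>UNIV. dir_deriv X (\<lambda>q. spin_Ad \<gamma> (h q)) $ i $ k *\<^sub>R \<E> i (act (h p) \<phi>) + spin_Ad \<gamma> (h p) $ i $ k *\<^sub>R \<E> i (\<rho> logdiff (act (h p) \<phi>)))"
    unfolding act_ext rot_ext_def using ext
    by (subst dir_deriv_sum[OF X s]) (simp_all add: dir_deriv_bilinear[OF bounded_bilinear_scaleR X smooth_at_entry] smooth_at_linear[OF L]
        dir_deriv_linear[OF L X] deriv_entry)
  also have "\<dots> = \<rho> logdiff (act (h p) (\<E> k \<phi>))"
  proof -
    have "logdiff ** spin_Ad \<gamma> (h p) = dir_deriv X (\<lambda>q. spin_Ad \<gamma> (h q))"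
      using spin_group_props(2)[OF h[OF W(2)]] by (simp add: logdiff_def flip: matrix_mul_assoc)
    then have e: "(\<Sum>i\<in>UNIV. spin_Ad \<gamma> (h p) $ i $ k * logdiff $ l $ i) = dir_deriv X (\<lambda>q. spin_Ad \<gamma> (h q)) $ l $ k" for l
      by (auto simp: matrix_matrix_mult_def vec_eq_iff mult.commute)
    have "\<rho> logdiff (act (h p) (\<E> k \<phi>)) = (\<Sum>i\<in>UNIV. spin_Ad \<gamma> (h p) $ i $ k *\<^sub>R \<E> i (\<rho> logdiff (act (h p) \<phi>)))
      + (\<Sum>i\<in>UNIV. \<Sum>l\<in>UNIV. (spin_Ad \<gamma> (h p) $ i $ k * logdiff $ l $ i) *\<^sub>R \<E> l (act (h p) \<phi>))"
      by (simp add: act_ext rot_ext_def lie_linear lie_ext scaleR_add_right sum.distrib scaleR_sum_right)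
    also have "(\<Sum>i\<in>UNIV. \<Sum>l\<in>UNIV. (spin_Ad \<gamma> (h p) $ i $ k * logdiff $ l $ i) *\<^sub>R \<E> l (act (h p) \<phi>)) =
      (\<Sum>l\<in>UNIV. dir_deriv X (\<lambda>q. spin_Ad \<gamma> (h q)) $ l $ k *\<^sub>R \<E> l (act (h p) \<phi>))"
      by (subst sum.swap) (simp add: e flip: scaleR_sum_left)
    finally show ?thesis by (simp add: sum.distrib add.commute)
  qed
  finally show ?case using smooth_at_sum[of UNIV p, OF s] by (simp add: act_ext rot_ext_def)
qed

text \<open>\<open>act\<close> is not linear in \<open>h\<close>, so \<open>f\<close> is expanded in
  the fixed basis and the product rule is applied to its scalar coefficients.\<close>

lemma act_deriv:
  assumes f: "smooth_at p f"
  shows "dir_deriv X (\<lambda>q. act (h q) (f q)) = act (h p) (dir_deriv X f) + \<rho> logdiff (act (h p) (f p))"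
proof -
  have e: "act (h q) (f q) = (\<Sum>b\<in>Basis. (f q \<bullet> b) *\<^sub>R act (h q) b)" for q
    by (subst euclidean_representation[of "f q", symmetric]) (simp add: act_linear)
  have s: "smooth_at p (\<lambda>q. (f q \<bullet> b) *\<^sub>R act (h q) b)" for b
    using act_deriv_const f by (intro smooth_at_bilinear[OF bounded_bilinear_scaleR] smooth_at_inner) auto
  have "dir_deriv X (\<lambda>q. act (h q) (f q)) =
     (\<Sum>b\<in>Basis. (dir_deriv X f \<bullet> b) *\<^sub>R act (h p) b + (f p \<bullet> b) *\<^sub>R \<rho> logdiff (act (h p) b))"
    unfolding e by (subst dir_deriv_sum[OF X s])
      (simp_all add: dir_deriv_bilinear[OF bounded_bilinear_scaleR X smooth_at_inner[OF f]] act_deriv_const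
        dir_deriv_linear[OF bounded_linear_inner_left X f])
  also have "\<dots> = act (h p) (\<Sum>b\<in>Basis. (dir_deriv X f \<bullet> b) *\<^sub>R b) + \<rho> logdiff (act (h p) (\<Sum>b\<in>Basis. (f p \<bullet> b) *\<^sub>R b))"
    by (simp add: act_linear lie_linear sum.distrib)
  finally show ?thesis by (simp add: euclidean_representation)
qed

end

end

section \<open>Frames, connection and curvature\<close>

lemma (in atlas_manifold) coord_tangent_sum:
  assumes c: "c \<in> A" "p \<in> fst c"
  shows "coord_tangent A c p (\<Sum>k\<in>I. a k *\<^sub>R v k) = (\<lambda>f. \<Sum>k\<in>I. a k * coord_tangent A c p (v k) f)"
proof
  fix f show "coord_tangent A c p (\<Sum>k\<in>I. a k *\<^sub>R v k) f = (\<Sum>k\<in>I. a k * coord_tangent A c p (v k) f)"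
  proof (cases "smooth_at p f")
    case True
    from smooth_at_chart_derivative[OF c True]
    have "linear (frechet_derivative (\<lambda>x. f (chart_inv c x)) (at (snd c p)))"
      by (rule has_derivative_linear)
    then show ?thesis using True
      by (simp add: coord_tangent_def smooth_near_iff o_def linear_sum linear_scale)
  qed (simp add: coord_tangent_def smooth_near_iff)
qed

lemma (in atlas_manifold) tangent_sum:
  assumes "finite I" "\<And>k. k \<in> I \<Longrightarrow> X k \<in> tangent_space A p"
  shows "(\<lambda>f. \<Sum>k\<in>I. a k * X k f) \<in> tangent_space A p"
  using assms
proof (induction I rule: finite_induct)
  case (insert k I)
  then show ?case using tangent_add[OF tangent_scale[of "X k" p "a k"], of "\<lambda>f. \<Sum>k\<in>I. a k * X k f"] by simp
qed (simp add: tangent_zero)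

context spinor_module
begin

text \<open>\<open>\<rho> a\<close> acts as a derivation on the two operators in each summand of
  \<open>\<rho> b\<close>; skewness of \<open>a\<close> turns one of the correction sums into
  \<open>- (b ** a)\<close>.\<close>

lemma lie_commutator:
  assumes a: "skew a"
  shows "\<rho> a (\<rho> b \<phi>) - \<rho> b (\<rho> a \<phi>) = \<rho> (a ** b - b ** a) \<phi>"
proof -
  let ?f = "\<lambda>i m \<psi>. (1/4) *\<^sub>R \<G> i (\<G> m \<psi>) + \<E> m (\<I> i \<psi>)"
  have f: "\<rho> a (?f i m \<phi>) = ?f i m (\<rho> a \<phi>) + (\<Sum>l\<in>UNIV. a $ l $ i *\<^sub>R ?f l m \<phi>) + (\<Sum>l\<in>UNIV. a $ l $ m *\<^sub>R ?f i l \<phi>)" for i m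
    by (simp add: lie_linear lie_cliff[OF a] lie_ext lie_int[OF a] op_linear scaleR_add_right sum.distrib scaleR_sum_right mult.commute)
  have r: "\<rho> b \<psi> = (\<Sum>i\<in>UNIV. \<Sum>m\<in>UNIV. b $ m $ i *\<^sub>R ?f i m \<psi>)" for b \<psi>
    unfolding spin_lie_act_def ..
  have "\<rho> a (\<rho> b \<phi>) = (\<Sum>i\<in>UNIV. \<Sum>m\<in>UNIV. b $ m $ i *\<^sub>R \<rho> a (?f i m \<phi>))"
    unfolding r[of b \<phi>] by (simp only: lie_linear(5,6))
  also have "\<dots> = \<rho> b (\<rho> a \<phi>) + (\<Sum>i\<in>UNIV. \<Sum>m\<in>UNIV. \<Sum>l\<in>UNIV. (b $ m $ i * a $ l $ i) *\<^sub>R ?f l m \<phi>)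
      + (\<Sum>i\<in>UNIV. \<Sum>m\<in>UNIV. \<Sum>l\<in>UNIV. (b $ m $ i * a $ l $ m) *\<^sub>R ?f i l \<phi>)"
    unfolding f r[of b "\<rho> a \<phi>"] by (simp only: scaleR_add_right[of "b $ _ $ _"] sum.distrib scaleR_sum_right scaleR_scaleR)
  also have "(\<Sum>i\<in>UNIV. \<Sum>m\<in>UNIV. \<Sum>l\<in>UNIV. (b $ m $ i * a $ l $ i) *\<^sub>R ?f l m \<phi>) = \<rho> (- (b ** a)) \<phi>"
  proof -
    have "(\<Sum>i\<in>UNIV. \<Sum>m\<in>UNIV. \<Sum>l\<in>UNIV. (b $ m $ i * a $ l $ i) *\<^sub>R ?f l m \<phi>) =
        (\<Sum>l\<in>UNIV. \<Sum>m\<in>UNIV. \<Sum>i\<in>UNIV. (b $ m $ i * a $ l $ i) *\<^sub>R ?f l m \<phi>)"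
      by (subst (2) sum.swap, subst (1) sum.swap, subst (2) sum.swap, rule refl)
    also have "\<dots> = (\<Sum>l\<in>UNIV. \<Sum>m\<in>UNIV. (- (b ** a)) $ m $ l *\<^sub>R ?f l m \<phi>)"
    proof (intro sum.cong refl)
      fix l m
      have "(- (b ** a)) $ m $ l = (\<Sum>i\<in>UNIV. b $ m $ i * a $ l $ i)"
        by (simp add: matrix_matrix_mult_def sum_negf[symmetric]) (intro sum.cong refl, subst skewD[OF a], simp)
      then show "(\<Sum>i\<in>UNIV. (b $ m $ i * a $ l $ i) *\<^sub>R ?f l m \<phi>) = (- (b ** a)) $ m $ l *\<^sub>R ?f l m \<phi>"
        by (simp only: scaleR_sum_left)
    qed
    finally show ?thesis unfolding r .
  qed
  also have "(\<Sum>i\<in>UNIV. \<Sum>m\<in>UNIV. \<Sum>l\<in>UNIV. (b $ m $ i * a $ l $ m) *\<^sub>R ?f i l \<phi>) = \<rho> (a ** b) \<phi>"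
  proof -
    have "(\<Sum>i\<in>UNIV. \<Sum>m\<in>UNIV. \<Sum>l\<in>UNIV. (b $ m $ i * a $ l $ m) *\<^sub>R ?f i l \<phi>) =
        (\<Sum>i\<in>UNIV. \<Sum>l\<in>UNIV. \<Sum>m\<in>UNIV. (b $ m $ i * a $ l $ m) *\<^sub>R ?f i l \<phi>)"
      by (rule sum.cong[OF refl], rule sum.swap)
    also have "\<dots> = (\<Sum>i\<in>UNIV. \<Sum>l\<in>UNIV. (a ** b) $ l $ i *\<^sub>R ?f i l \<phi>)"
      by (intro sum.cong refl) (simp add: matrix_matrix_mult_def scaleR_sum_left mult.commute)
    finally show ?thesis unfolding r .
  qed
  finally show ?thesis by (simp add: lie_matrix_linear)
qed

end

text \<open>The arguments range over a set with an addition \<open>pl\<close>, since smooth fields do not form a type of vectors.\<close>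

lemma curvature_polarization:
  fixes T :: "'v \<Rightarrow> 'v \<Rightarrow> 'v \<Rightarrow> 'v \<Rightarrow> real" and pl :: "'v \<Rightarrow> 'v \<Rightarrow> 'v"
  assumes cl: "\<And>x y. x \<in> F \<Longrightarrow> y \<in> F \<Longrightarrow> pl x y \<in> F"
    and add1: "\<And>x x' y z w. \<lbrakk>x \<in> F; x' \<in> F; y \<in> F; z \<in> F; w \<in> F\<rbrakk> \<Longrightarrow> T (pl x x') y z w = T x y z w + T x' y z w"
    and anti1: "\<And>x y z w. \<lbrakk>x \<in> F; y \<in> F; z \<in> F; w \<in> F\<rbrakk> \<Longrightarrow> T x y z w = - T y x z w"
    and anti2: "\<And>x y z w. \<lbrakk>x \<in> F; y \<in> F; z \<in> F; w \<in> F\<rbrakk> \<Longrightarrow> T x y z w = - T x y w z"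
    and bianchi: "\<And>x y z w. \<lbrakk>x \<in> F; y \<in> F; z \<in> F; w \<in> F\<rbrakk> \<Longrightarrow> T x y z w + T y z x w + T z x y w = 0"
    and sec: "\<And>x y. \<lbrakk>x \<in> F; y \<in> F\<rbrakk> \<Longrightarrow> T x y y x = 0"
    and F: "x \<in> F" "y \<in> F" "z \<in> F" "w \<in> F"
  shows "T x y z w = 0"
proof -
  \<comment> \<open>The classical octahedron argument: four Bianchi identities combined with the two
    antisymmetries.\<close>
  have pair: "T x y z w = T z w x y" if "x \<in> F" "y \<in> F" "z \<in> F" "w \<in> F" for x y z w
  proof -
    note F = that
    have "T x y z w + T y z x w + T z x y w = 0" "T y z w x + T z w y x + T w y z x = 0"
      "T z w x y + T w x z y + T x z w y = 0" "T w x y z + T x y w z + T y w x z = 0"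
      using bianchi F by simp_all
    moreover have "T y z w x = - T y z x w" "T z w y x = - T z w x y" "T w x z y = - T w x y z" "T x y w z = - T x y z w"
      "T x z w y = T z x y w" "T y w x z = T w y z x"
      using anti2[of y z w x] anti2[of z w y x] anti2[of w x z y] anti2[of x y w z]
        anti1[of x z w y] anti2[of z x w y] anti1[of y w x z] anti2[of w y x z] F by simp_all
    ultimately show ?thesis by linarith
  qed
  have add4: "T x y z (pl w w') = T x y z w + T x y z w'" if "x \<in> F" "y \<in> F" "z \<in> F" "w \<in> F" "w' \<in> F" for x y z w w'
  proof -
    have "T x y z (pl w w') = - T (pl w w') z x y"
      using pair[of x y z "pl w w'"] anti1[of z "pl w w'" x y] that cl by simp
    also have "\<dots> = T x y z w + T x y z w'"
      using add1[of w w' z x y] pair[of x y z w] pair[of x y z w'] anti1[of z w x y] anti1[of z w' x y] that by simp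
    finally show ?thesis .
  qed
  have s1: "T x y y w = 0" if "x \<in> F" "y \<in> F" "w \<in> F" for x y w
  proof -
    have "T (pl x w) y y (pl x w) = 0" "T (pl x w) y y (pl x w) = T x y y (pl x w) + T w y y (pl x w)"
      "T x y y (pl x w) = T x y y x + T x y y w" "T w y y (pl x w) = T w y y x + T w y y w" "T x y y x = 0" "T w y y w = 0"
      by (intro sec add1 add4 cl that)+
    then have "0 = T x y y w + T w y y x" by linarith
    also have "T w y y x = T x y y w" using pair[of w y y x] anti1[of y x w y] anti2[of x y w y] that by simp
    finally show ?thesis by simp
  qed
  have s2: "T x y z w = - T x z y w" if "x \<in> F" "y \<in> F" "z \<in> F" "w \<in> F" for x y z w
  proof -
    have add2: "T x (pl y z) v w = T x y v w + T x z v w" if "v \<in> F" for v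
      using add1[of y z x v w] anti1[of x _ v w] that \<open>x \<in> F\<close> \<open>y \<in> F\<close> \<open>z \<in> F\<close> \<open>w \<in> F\<close> cl by simp
    have add3: "T x v (pl y z) w = T x v y w + T x v z w" if "v \<in> F" for v
      using add4[of x v w y z] anti2[of x v _ w] that \<open>x \<in> F\<close> \<open>y \<in> F\<close> \<open>z \<in> F\<close> \<open>w \<in> F\<close> cl by simp
    have "T x (pl y z) (pl y z) w = 0" "T x (pl y z) (pl y z) w = T x y (pl y z) w + T x z (pl y z) w"
      "T x y (pl y z) w = T x y y w + T x y z w" "T x z (pl y z) w = T x z y w + T x z z w" "T x y y w = 0" "T x z z w = 0"
      by (intro s1 add2 add3 cl that)+
    then show ?thesis by linarith
  qed
  \<comment> \<open>Polarizing the sectional condition has made \<open>T\<close> skew in the middle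
    pair too, so all three terms of the Bianchi identity are equal.\<close>
  have "T y z x w = T x y z w" using s2[of y z x w] anti1[of y x z w] F by simp
  moreover have "T z x y w = T x y z w" using anti1[of z x y w] s2[of x z y w] F by simp
  ultimately show ?thesis using bianchi[OF F] by simp
qed

locale spin_geometry =
  fixes M :: "('m::{t2_space,second_countable_topology}, 'n::{finite,linorder}, 's::finite, 'i) spin_manifold"
  assumes spin: "is_spin_manifold M"
begin

sublocale spin_calculus "atlas M" "gam M"
  by unfold_locales (use spin in \<open>simp_all add: is_spin_manifold_def\<close>)

abbreviation "A \<equiv> atlas M"
abbreviation "g \<equiv> metric M"
abbreviation "nab \<equiv> lc M"
abbreviation "e \<equiv> frame M"
abbreviation "U \<equiv> cover M"

lemma open_U: "open (U a)" and U_at: "\<exists>a. p \<in> U a"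
  using spin unfolding is_spin_manifold_def by blast+

lemma frame_smooth: "smooth_field A (U a) (e a k)"
  and frame_orthonormal: "p \<in> U a \<Longrightarrow> g p (e a i p) (e a k p) = (if i = k then 1 else 0)"
  using spin unfolding is_spin_manifold_def by blast+

lemma frame_tangent: "p \<in> U a \<Longrightarrow> e a k p \<in> tangent_space A p"
  by (rule smooth_field_tangent[OF frame_smooth])

lemma metric_rules:
  assumes "X \<in> tangent_space A p" "Y \<in> tangent_space A p"
  shows metric_sym: "g p X Y = g p Y X"
    and metric_add: "Z \<in> tangent_space A p \<Longrightarrow> g p (\<lambda>f. X f + Y f) Z = g p X Z + g p Y Z"
    and metric_scale: "g p (\<lambda>f. r * X f) Y = r * g p X Y"
proof -
  have R: "is_riemannian_metric A g" using spin by (simp add: is_spin_manifold_def)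
  show "g p X Y = g p Y X" "g p (\<lambda>f. r * X f) Y = r * g p X Y"
    using R assms unfolding is_riemannian_metric_def by blast+
  show "Z \<in> tangent_space A p \<Longrightarrow> g p (\<lambda>f. X f + Y f) Z = g p X Z + g p Y Z"
    using R assms unfolding is_riemannian_metric_def by blast
qed

lemma metric_smooth:
  "open W \<Longrightarrow> smooth_field A W X \<Longrightarrow> smooth_field A W Y \<Longrightarrow> smooth_fun A W (\<lambda>p. g p (X p) (Y p))"
proof -
  have "is_riemannian_metric A g" using spin by (simp add: is_spin_manifold_def)
  note this[unfolded is_riemannian_metric_def, THEN conjunct2, rule_format]
  then show "open W \<Longrightarrow> smooth_field A W X \<Longrightarrow> smooth_field A W Y \<Longrightarrow> smooth_fun A W (\<lambda>p. g p (X p) (Y p))" .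
qed

lemma metric_sum:
  assumes "\<And>k. k \<in> I \<Longrightarrow> X k \<in> tangent_space A p" "Z \<in> tangent_space A p" "finite I"
  shows "g p (\<lambda>f. \<Sum>k\<in>I. r k * X k f) Z = (\<Sum>k\<in>I. r k * g p (X k) Z)"
  using assms(3,1)
proof (induction I rule: finite_induct)
  case empty
  show ?case using metric_scale[OF assms(2) assms(2), of 0] by simp
next
  case (insert k I)
  have "g p (\<lambda>f. r k * X k f + (\<Sum>k\<in>I. r k * X k f)) Z = g p (\<lambda>f. r k * X k f) Z + g p (\<lambda>f. \<Sum>k\<in>I. r k * X k f) Z"
    using insert assms by (intro metric_add tangent_scale tangent_sum) auto
  then show ?case using insert metric_scale[OF _ assms(2)] by simp
qed

text \<open>In a chart, taking frame components is a left inverse of rebuilding a vector from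
  components, by orthonormality. Both are linear maps of the same finite-dimensional space, so it is
  also a right inverse.\<close>

lemma frame_expansion:
  assumes X: "X \<in> tangent_space A p" and p: "p \<in> U a"
  shows "X = (\<lambda>f. \<Sum>k\<in>UNIV. g p X (e a k p) * e a k p f)"
proof -
  obtain c where c: "c \<in> A" "p \<in> fst c" using chart_at by blast
  let ?ct = "coord_tangent A c p"
  have ct: "?ct v \<in> tangent_space A p" for v using c by (rule coord_tangent_in)
  have "\<forall>k. \<exists>v. e a k p = ?ct v" using tangent_in_chart[OF frame_tangent[OF p] c] by metis
  then obtain E where E: "\<And>k. e a k p = ?ct (E k)" by metis
  obtain v where v: "X = ?ct v" using tangent_in_chart[OF X c] by blast
  define S where "S = (\<lambda>r :: (real, 'n) vec. \<Sum>k\<in>UNIV. r $ k *\<^sub>R E k)"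
  define L where "L = (\<lambda>v. \<chi> k. g p (?ct v) (e a k p))"
  have S: "linear S" unfolding S_def by (rule linearI) (simp_all add: scaleR_add_left sum.distrib scaleR_sum_right)
  have lin2: "?ct (x + y) = (\<lambda>f. ?ct x f + ?ct y f)" "?ct (r *\<^sub>R x) = (\<lambda>f. r * ?ct x f)" for x y r
    using coord_tangent_sum[OF c, where I = "UNIV :: bool set" and a = "\<lambda>_. 1" and v = "\<lambda>b. if b then x else y"]
      coord_tangent_sum[OF c, where I = "{()}" and a = "\<lambda>_. r" and v = "\<lambda>_. x"]
    by (simp_all add: UNIV_bool add.commute)
  have L: "linear L" unfolding L_def
    by (rule linearI) (simp_all add: vec_eq_iff lin2 metric_add[OF ct ct frame_tangent[OF p]] metric_scale[OF ct frame_tangent[OF p]])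
  have ctS: "?ct (S r) = (\<lambda>f. \<Sum>k\<in>UNIV. r $ k * e a k p f)" for r
    unfolding S_def by (simp add: coord_tangent_sum[OF c] E)
  have "L (S r) = r" for r
    by (simp add: vec_eq_iff L_def ctS metric_sum[OF frame_tangent[OF p] frame_tangent[OF p]] frame_orthonormal[OF p]
        if_distrib cong: if_cong)
  then have "L \<circ> S = id" by auto
  then have "S \<circ> L = id" using linear_inverse_left[OF L S] by simp
  then have "S (L v) = v" by (metis comp_apply id_apply)
  then have "X = (\<lambda>f. \<Sum>k\<in>UNIV. L v $ k * e a k p f)" using ctS[of "L v"] v by simp
  then show ?thesis by (simp add: L_def v)
qed

subsection \<open>The Levi-Civita derivative\<close>

context
  fixes W :: "'m set"
  assumes W: "open W"
begin

lemma lc_rules: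
  assumes X: "smooth_field A W X" and Y: "smooth_field A W Y"
  shows nab_smooth: "smooth_field A W (nab X Y)"
    and nab_add_left: "smooth_field A W Z \<Longrightarrow> p \<in> W \<Longrightarrow> nab (\<lambda>q u. X q u + Z q u) Y p = (\<lambda>u. nab X Y p u + nab Z Y p u)"
    and nab_scale_left: "smooth_fun A W f \<Longrightarrow> p \<in> W \<Longrightarrow> nab (\<lambda>q u. f q * X q u) Y p = (\<lambda>u. f p * nab X Y p u)"
    and nab_add_right: "smooth_field A W Z \<Longrightarrow> p \<in> W \<Longrightarrow> nab X (\<lambda>q u. Y q u + Z q u) p = (\<lambda>u. nab X Y p u + nab X Z p u)"
    and nab_scale_right: "smooth_fun A W f \<Longrightarrow> p \<in> W \<Longrightarrow> nab X (\<lambda>q u. f q * Y q u) p = (\<lambda>u. X p f * Y p u + f p * nab X Y p u)"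
    and nab_torsion: "p \<in> W \<Longrightarrow> (\<lambda>u. nab X Y p u - nab Y X p u) = lie_bracket A X Y p"
    and nab_metric: "smooth_field A W Z \<Longrightarrow> p \<in> W \<Longrightarrow> X p (\<lambda>q. g q (Y q) (Z q)) = g p (nab X Y p) (Z p) + g p (Y p) (nab X Z p)"
proof -
  have lc: "is_levi_civita A g nab" using spin by (simp add: is_spin_manifold_def)
  have c: "smooth_fun A W (\<lambda>_. 0 :: real)" by simp
  note l = lc[unfolded is_levi_civita_def, rule_format, OF W X Y]
  show "smooth_field A W (nab X Y)" using l[OF Y c] by blast
  show "smooth_field A W Z \<Longrightarrow> p \<in> W \<Longrightarrow> nab (\<lambda>q u. X q u + Z q u) Y p = (\<lambda>u. nab X Y p u + nab Z Y p u)" using l[OF _ c] by blast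
  show "smooth_fun A W f \<Longrightarrow> p \<in> W \<Longrightarrow> nab (\<lambda>q u. f q * X q u) Y p = (\<lambda>u. f p * nab X Y p u)" using l[OF Y] by blast
  show "smooth_field A W Z \<Longrightarrow> p \<in> W \<Longrightarrow> nab X (\<lambda>q u. Y q u + Z q u) p = (\<lambda>u. nab X Y p u + nab X Z p u)" using l[OF _ c] by blast
  show "smooth_fun A W f \<Longrightarrow> p \<in> W \<Longrightarrow> nab X (\<lambda>q u. f q * Y q u) p = (\<lambda>u. X p f * Y p u + f p * nab X Y p u)" using l[OF Y] by blast
  show "p \<in> W \<Longrightarrow> (\<lambda>u. nab X Y p u - nab Y X p u) = lie_bracket A X Y p" using l[OF Y c] by blast
  show "smooth_field A W Z \<Longrightarrow> p \<in> W \<Longrightarrow> X p (\<lambda>q. g q (Y q) (Z q)) = g p (nab X Y p) (Z p) + g p (Y p) (nab X Z p)" using l[OF _ c] by blast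
qed

text \<open>Locality: a field vanishing on \<open>W\<close> is its product with the function that is \<open>0\<close> on \<open>W\<close> and \<open>1\<close> elsewhere.\<close>

lemma nab_cong:
  assumes X: "smooth_field A W X" and Y: "smooth_field A W Y" and p: "p \<in> W"
  shows nab_cong_right: "(\<And>q. q \<in> W \<Longrightarrow> Y' q = Y q) \<Longrightarrow> nab X Y' p = nab X Y p"
    and nab_cong_left: "(\<And>q. q \<in> W \<Longrightarrow> X' q = X q) \<Longrightarrow> nab X' Y p = nab X Y p"
proof -
  define f where "f = (\<lambda>q. if q \<in> W then 0 else 1 :: real)"
  have f: "smooth_fun A W f" by (rule smooth_fun_cong[OF W, THEN iffD1, of "\<lambda>_. 0"]) (simp_all add: f_def)
  have z: "smooth_field A W Z" if "\<And>q. q \<in> W \<Longrightarrow> Z q = (\<lambda>u. 0)" for Z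
    by (rule smooth_field_cong[OF W _ smooth_field_zero]) (use that in simp)
  have fz: "(\<lambda>q u. f q * Z q u) = Z" if "\<And>q. q \<in> W \<Longrightarrow> Z q = (\<lambda>u. 0)" for Z :: "'m field"
    using that by (auto simp: f_def fun_eq_iff)
  show "nab X Y' p = nab X Y p" if "\<And>q. q \<in> W \<Longrightarrow> Y' q = Y q"
  proof -
    define Z where "Z = (\<lambda>q u. Y' q u - Y q u)"
    have Z: "Z q = (\<lambda>u. 0)" if "q \<in> W" for q using \<open>\<And>q. q \<in> W \<Longrightarrow> Y' q = Y q\<close>[OF that] by (simp add: Z_def)
    have zZ: "smooth_field A W Z" and fZ: "(\<lambda>q u. f q * Z q u) = Z" by (rule z fz, erule Z)+
    have "nab X Z p = nab X (\<lambda>q u. f q * Z q u) p" using fZ by simp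
    also have "\<dots> = (\<lambda>u. 0)"
      unfolding nab_scale_right[OF X zZ f p] using p by (simp add: Z f_def)
    finally have "nab X Z p = (\<lambda>u. 0)" .
    moreover have "(\<lambda>q u. Y q u + Z q u) = Y'" by (simp add: Z_def)
    ultimately show ?thesis using nab_add_right[OF X Y zZ p] by simp
  qed
  show "nab X' Y p = nab X Y p" if "\<And>q. q \<in> W \<Longrightarrow> X' q = X q"
  proof -
    define Z where "Z = (\<lambda>q u. X' q u - X q u)"
    have Z: "Z q = (\<lambda>u. 0)" if "q \<in> W" for q using \<open>\<And>q. q \<in> W \<Longrightarrow> X' q = X q\<close>[OF that] by (simp add: Z_def)
    have zZ: "smooth_field A W Z" and fZ: "(\<lambda>q u. f q * Z q u) = Z" by (rule z fz, erule Z)+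
    have "nab Z Y p = (\<lambda>u. 0)"
      using nab_scale_left[OF zZ Y f p] p unfolding fZ by (simp add: f_def)
    moreover have "(\<lambda>q u. X q u + Z q u) = X'" by (simp add: Z_def)
    ultimately show ?thesis using nab_add_left[OF X Y zZ p] by simp
  qed
qed

lemma nab_zero:
  assumes "smooth_field A W X" "p \<in> W"
  shows "nab X (\<lambda>q u. 0) p = (\<lambda>u. 0)" "nab (\<lambda>q u. 0) X p = (\<lambda>u. 0)"
  using nab_scale_right[OF assms(1,1), of "\<lambda>_. 0" p] nab_scale_left[OF assms(1,1), of "\<lambda>_. 0" p]
    dir_deriv_const[OF smooth_field_tangent[OF assms], of "0 :: real"] assms(2) by (simp_all add: dir_deriv_real)

lemma nab_sum:
  assumes X: "smooth_field A W X" and Y: "\<And>i. i \<in> I \<Longrightarrow> smooth_field A W (Y i)" and f: "\<And>i. i \<in> I \<Longrightarrow> smooth_fun A W (f i)"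
    and p: "p \<in> W" and I: "finite I"
  shows nab_sum_right: "nab X (\<lambda>q u. \<Sum>i\<in>I. f i q * Y i q u) p = (\<lambda>u. \<Sum>i\<in>I. X p (f i) * Y i p u + f i p * nab X (Y i) p u)"
    and nab_sum_left: "nab (\<lambda>q u. \<Sum>i\<in>I. f i q * Y i q u) X p = (\<lambda>u. \<Sum>i\<in>I. f i p * nab (Y i) X p u)"
proof -
  show "nab X (\<lambda>q u. \<Sum>i\<in>I. f i q * Y i q u) p = (\<lambda>u. \<Sum>i\<in>I. X p (f i) * Y i p u + f i p * nab X (Y i) p u)"
    using I Y f
  proof (induction I rule: finite_induct)
    case (insert i I)
    have s: "smooth_field A W (\<lambda>q u. \<Sum>i\<in>I. f i q * Y i q u)" "smooth_field A W (\<lambda>q u. f i q * Y i q u)"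
      using insert.hyps insert.prems by (auto intro!: smooth_field_sum smooth_field_scale)
    show ?case
      using nab_add_right[OF X s(2,1) p] nab_scale_right[OF X _ _ p, of "Y i" "f i"] insert by simp
  qed (simp add: nab_zero[OF X p])
  show "nab (\<lambda>q u. \<Sum>i\<in>I. f i q * Y i q u) X p = (\<lambda>u. \<Sum>i\<in>I. f i p * nab (Y i) X p u)"
    using I Y f
  proof (induction I rule: finite_induct)
    case (insert i I)
    have s: "smooth_field A W (\<lambda>q u. \<Sum>i\<in>I. f i q * Y i q u)" "smooth_field A W (\<lambda>q u. f i q * Y i q u)"
      using insert.hyps insert.prems by (auto intro!: smooth_field_sum smooth_field_scale)
    show ?case
      using nab_add_left[OF s(2) X s(1) p] nab_scale_left[OF _ X _ p, of "Y i" "f i"] insert by simp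
  qed (simp add: nab_zero[OF X p])
qed

text \<open>Since the connection is torsion free, the bracket is a difference of covariant
  derivatives and inherits their smoothness.\<close>

lemma bracket_smooth:
  assumes "smooth_field A W X" "smooth_field A W Y"
  shows "smooth_field A W (lie_bracket A X Y)"
proof (rule smooth_field_cong[OF W])
  show "smooth_field A W (\<lambda>p u. nab X Y p u + (- 1) * nab Y X p u)"
    by (intro smooth_field_add smooth_field_scale nab_smooth assms) auto
  show "(\<lambda>u. nab X Y p u + (- 1) * nab Y X p u) = lie_bracket A X Y p" if "p \<in> W" for p
    using nab_torsion[OF assms that] by simp
qed

end

end

context spinor_module
begin

lemma bounded_bilinear_lie: "bounded_bilinear \<rho>"
proof -
  have "bilinear \<rho>" unfolding bilinear_def using linear_lie linear_lie_matrix by simp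
  then show ?thesis using bilinear_conv_bounded_bilinear by blast
qed

end

context spin_geometry
begin

section \<open>Symmetries of the curvature tensor\<close>

lemma metric_diff:
  assumes "X \<in> tangent_space A p" "Y \<in> tangent_space A p" "Z \<in> tangent_space A p"
  shows "g p (\<lambda>f. X f - Y f) Z = g p X Z - g p Y Z"
  using metric_add[OF assms(1) tangent_scale[OF assms(2), of "- 1"] assms(3)] metric_scale[OF assms(2,3), of "- 1"] by simp

lemma tangent_diff:
  assumes "X \<in> tangent_space A p" "Y \<in> tangent_space A p"
  shows "(\<lambda>f. X f - Y f) \<in> tangent_space A p"
  using tangent_add[OF assms(1) tangent_scale[OF assms(2), of "- 1"]] by simp

lemma tangent_fun_rules:
  assumes "X \<in> tangent_space A p" "smooth_at p (f :: 'm \<Rightarrow> real)" "smooth_at p h"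
  shows "X (\<lambda>q. f q + h q) = X f + X h" "X (\<lambda>q. f q - h q) = X f - X h"
    "X (\<lambda>q. f q * h q) = X f * h p + f p * X h"
proof -
  have m: "smooth_at p (\<lambda>q. - h q)" by (rule smooth_at_linear[OF bounded_linear_minus[OF bounded_linear_ident] assms(3)])
  have "X (\<lambda>q. - h q) = - X h"
    using dir_deriv_linear[OF bounded_linear_minus[OF bounded_linear_ident] assms(1,3)] by (simp add: dir_deriv_real)
  then show "X (\<lambda>q. f q + h q) = X f + X h" "X (\<lambda>q. f q - h q) = X f - X h"
    using dir_deriv_add[OF assms] dir_deriv_add[OF assms(1,2) m] by (simp_all add: dir_deriv_real)
  show "X (\<lambda>q. f q * h q) = X f * h p + f p * X h"
    using dir_deriv_bilinear[OF bounded_bilinear_mult assms] by (simp add: dir_deriv_real)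
qed

lemma tangent_fun_cong:
  fixes f h :: "'m \<Rightarrow> real"
  assumes "X \<in> tangent_space A p" "open W" "p \<in> W" "\<And>q. q \<in> W \<Longrightarrow> f q = h q" "smooth_at p h"
  shows "X f = X h"
  using dir_deriv_cong(1)[OF assms] by (simp add: dir_deriv_real)

context
  fixes W :: "'m set" and p :: 'm
  assumes W: "open W" and p: "p \<in> W"
begin

definition curv4 :: "'m field \<Rightarrow> 'm field \<Rightarrow> 'm field \<Rightarrow> 'm field \<Rightarrow> real" where
  "curv4 X Y Z V = g p (riem_curv A nab X Y Z p) (V p)"

lemma tan: "smooth_field A W X \<Longrightarrow> X p \<in> tangent_space A p"
  by (rule smooth_field_tangent[OF _ p])

lemma nab_tan: "smooth_field A W X \<Longrightarrow> smooth_field A W Y \<Longrightarrow> nab X Y p \<in> tangent_space A p"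
  by (intro tan nab_smooth[OF W])

lemma riem_tangent:
  assumes "smooth_field A W X" "smooth_field A W Y" "smooth_field A W Z"
  shows "riem_curv A nab X Y Z p \<in> tangent_space A p"
  unfolding riem_curv_def
  by (intro tangent_diff tan nab_smooth[OF W] bracket_smooth[OF W] assms)

lemma riem_add1:
  assumes X: "smooth_field A W X" "smooth_field A W X'" and Y: "smooth_field A W Y" and Z: "smooth_field A W Z"
  shows "riem_curv A nab (\<lambda>q u. X q u + X' q u) Y Z p = (\<lambda>u. riem_curv A nab X Y Z p u + riem_curv A nab X' Y Z p u)"
proof -
  let ?X = "\<lambda>q u. X q u + X' q u"
  have XX: "smooth_field A W ?X" by (rule smooth_field_add[OF X])
  note ns = nab_smooth[OF W]
  have 1: "nab ?X (nab Y Z) p = (\<lambda>u. nab X (nab Y Z) p u + nab X' (nab Y Z) p u)"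
    by (rule nab_add_left[OF W X(1) ns[OF Y Z] X(2) p])
  have "nab Y (nab ?X Z) p = nab Y (\<lambda>q u. nab X Z q u + nab X' Z q u) p"
    by (rule nab_cong_right[OF W Y smooth_field_add[OF ns[OF X(1) Z] ns[OF X(2) Z]] p])
      (rule nab_add_left[OF W X(1) Z X(2)])
  also have "\<dots> = (\<lambda>u. nab Y (nab X Z) p u + nab Y (nab X' Z) p u)"
    by (rule nab_add_right[OF W Y ns[OF X(1) Z] ns[OF X(2) Z] p])
  finally have 2: "nab Y (nab ?X Z) p = \<dots>" .
  have b: "lie_bracket A ?X Y q = (\<lambda>u. lie_bracket A X Y q u + lie_bracket A X' Y q u)" if "q \<in> W" for q
    unfolding nab_torsion[OF W XX Y that, symmetric] nab_torsion[OF W X(1) Y that, symmetric] nab_torsion[OF W X(2) Y that, symmetric]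
      nab_add_left[OF W X(1) Y X(2) that] nab_add_right[OF W Y X that] by auto
  note bs = bracket_smooth[OF W]
  have "nab (lie_bracket A ?X Y) Z p = nab (\<lambda>q u. lie_bracket A X Y q u + lie_bracket A X' Y q u) Z p"
    by (rule nab_cong_left[OF W smooth_field_add[OF bs[OF X(1) Y] bs[OF X(2) Y]] Z p b])
  also have "\<dots> = (\<lambda>u. nab (lie_bracket A X Y) Z p u + nab (lie_bracket A X' Y) Z p u)"
    by (rule nab_add_left[OF W bs[OF X(1) Y] Z bs[OF X(2) Y] p])
  finally show ?thesis unfolding riem_curv_def 1 2 by (auto simp: algebra_simps)
qed

lemma bracket_anti: "lie_bracket A Y X = (\<lambda>q u. - 1 * lie_bracket A X Y q u)"
  by (simp add: lie_bracket_def fun_eq_iff)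

lemma riem_anti1:
  assumes "smooth_field A W X" "smooth_field A W Y" "smooth_field A W Z"
  shows "riem_curv A nab Y X Z p = (\<lambda>u. - riem_curv A nab X Y Z p u)"
  using nab_scale_left[OF W bracket_smooth[OF W assms(1,2)] assms(3) _ p, of "\<lambda>_. - 1"]
  unfolding riem_curv_def bracket_anti[of Y X] by (simp add: fun_eq_iff)

lemma lie_bracket_apply:
  "smooth_near A x f \<Longrightarrow> lie_bracket A X Y x f = X x (\<lambda>q. Y q f) - Y x (\<lambda>q. X q f)"
  by (simp add: lie_bracket_def)

text \<open>Each double bracket expands into four third-order terms, and the twelve cancel over the
  cyclic sum. On functions that are not smooth near \<open>p\<close> every bracket is 0 by
  definition.\<close>

lemma jacobi:
  assumes X: "smooth_field A W X" and Y: "smooth_field A W Y" and Z: "smooth_field A W Z"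
  shows "lie_bracket A X (lie_bracket A Y Z) p f + lie_bracket A Y (lie_bracket A Z X) p f + lie_bracket A Z (lie_bracket A X Y) p f = 0"
proof (cases "smooth_near A p f")
  case True
  then obtain V where V: "open V" "p \<in> V" "smooth_fun A V f" unfolding smooth_near_def by blast
  have sub: "smooth_field A (V \<inter> W) X" "smooth_field A (V \<inter> W) Y" "smooth_field A (V \<inter> W) Z"
    using X Y Z by (auto intro: smooth_field_subset)
  have VW: "open (V \<inter> W)" "p \<in> V \<inter> W" using V W p by auto
  have f: "smooth_fun A (V \<inter> W) f" using V(3) by (rule smooth_fun_subset) auto
  have ap: "smooth_fun A (V \<inter> W) (\<lambda>q. X q h)" if "smooth_field A (V \<inter> W) X" "smooth_fun A (V \<inter> W) h" for X h
    by (rule smooth_field_apply[OF that(1) VW(1) order_refl that(2)])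
  have *: "lie_bracket A X (lie_bracket A Y Z) p f =
      X p (\<lambda>q. Y q (\<lambda>r. Z r f)) - X p (\<lambda>q. Z q (\<lambda>r. Y r f)) - Y p (\<lambda>q. Z q (\<lambda>r. X r f)) + Z p (\<lambda>q. Y q (\<lambda>r. X r f))"
    if X: "smooth_field A (V \<inter> W) X" and Y: "smooth_field A (V \<inter> W) Y" and Z: "smooth_field A (V \<inter> W) Z" for X Y Z
  proof -
    have t: "X p \<in> tangent_space A p" by (rule smooth_field_tangent[OF X VW(2)])
    have s: "smooth_at p (\<lambda>q. Y q (\<lambda>r. Z r f))" "smooth_at p (\<lambda>q. Z q (\<lambda>r. Y r f))" "smooth_at p (\<lambda>q. X q f)"
      by (rule smooth_atI[OF ap[OF Y ap[OF Z f]] VW] smooth_atI[OF ap[OF Z ap[OF Y f]] VW] smooth_atI[OF ap[OF X f] VW])+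
    have "X p (\<lambda>q. lie_bracket A Y Z q f) = X p (\<lambda>q. Y q (\<lambda>r. Z r f) - Z q (\<lambda>r. Y r f))"
    proof (rule tangent_fun_cong[OF t VW])
      show "lie_bracket A Y Z q f = Y q (\<lambda>r. Z r f) - Z q (\<lambda>r. Y r f)" if "q \<in> V \<inter> W" for q
        using smooth_atI[OF f VW(1) that] by (simp add: lie_bracket_def smooth_near_iff)
      show "smooth_at p (\<lambda>q. Y q (\<lambda>r. Z r f) - Z q (\<lambda>r. Y r f))"
        by (rule smooth_atI[OF smooth_fun_diff[OF VW(1) ap[OF Y ap[OF Z f]] ap[OF Z ap[OF Y f]]] VW])
    qed
    also have "\<dots> = X p (\<lambda>q. Y q (\<lambda>r. Z r f)) - X p (\<lambda>q. Z q (\<lambda>r. Y r f))"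
      by (rule tangent_fun_rules(2)[OF t s(1,2)])
    finally show ?thesis
      using lie_bracket_apply[OF True, of X "lie_bracket A Y Z"] lie_bracket_apply[OF s(3)[folded smooth_near_iff], of Y Z] by simp
  qed
  show ?thesis using *[OF sub] *[OF sub(2,3,1)] *[OF sub(3,1,2)] by simp
qed (simp add: lie_bracket_def)

text \<open>Absence of torsion rewrites the cyclic sum as the cyclic sum of double brackets, so the
  claim becomes the Jacobi identity.\<close>

lemma riem_bianchi:
  assumes X: "smooth_field A W X" and Y: "smooth_field A W Y" and Z: "smooth_field A W Z"
  shows "riem_curv A nab X Y Z p u + riem_curv A nab Y Z X p u + riem_curv A nab Z X Y p u = 0"
proof -
  note ns = nab_smooth[OF W] and bs = bracket_smooth[OF W]
  have *: "nab X (nab Y Z) p u - nab X (nab Z Y) p u - nab (lie_bracket A Y Z) X p u = lie_bracket A X (lie_bracket A Y Z) p u"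
    if X: "smooth_field A W X" and Y: "smooth_field A W Y" and Z: "smooth_field A W Z" for X Y Z
  proof -
    have "nab X (nab Y Z) p = nab X (\<lambda>q u. nab Z Y q u + lie_bracket A Y Z q u) p"
      by (rule nab_cong_right[OF W X smooth_field_add[OF ns[OF Z Y] bs[OF Y Z]] p])
        (simp flip: nab_torsion[OF W Y Z])
    then have "nab X (nab Y Z) p u - nab X (nab Z Y) p u = nab X (lie_bracket A Y Z) p u"
      using nab_add_right[OF W X ns[OF Z Y] bs[OF Y Z] p] by simp
    then show ?thesis using nab_torsion[OF W X bs[OF Y Z] p, symmetric] by (simp add: fun_eq_iff)
  qed
  show ?thesis
    using *[OF X Y Z] *[OF Y Z X] *[OF Z X Y] jacobi[OF X Y Z, of u] by (simp add: riem_curv_def)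
qed

text \<open>The bracket applied to \<open>g (Z, V)\<close> is computed twice, as a commutator of
  second derivatives and by the metric property. The mixed products are symmetric in
  \<open>X\<close> and \<open>Y\<close> and cancel.\<close>

lemma curv4_anti2:
  assumes X: "smooth_field A W X" and Y: "smooth_field A W Y" and Z: "smooth_field A W Z" and V: "smooth_field A W V"
  shows "curv4 X Y Z V = - curv4 X Y V Z"
proof -
  note ns = nab_smooth[OF W] and bs = bracket_smooth[OF W]
  let ?F = "\<lambda>q. g q (Z q) (V q)"
  have F: "smooth_fun A W ?F" by (rule metric_smooth[OF W Z V])
  have "X p (\<lambda>q. Y q ?F) = g p (nab X (nab Y Z) p) (V p) + g p (nab Y Z p) (nab X V p) + g p (nab X Z p) (nab Y V p) + g p (Z p) (nab X (nab Y V) p)"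
    if X: "smooth_field A W X" and Y: "smooth_field A W Y" for X Y
  proof -
    have s: "smooth_at p (\<lambda>q. g q (nab Y Z q) (V q))" "smooth_at p (\<lambda>q. g q (Z q) (nab Y V q))"
      by (rule smooth_atI[OF _ W p], intro metric_smooth W ns Z V Y)+
    have "X p (\<lambda>q. Y q ?F) = X p (\<lambda>q. g q (nab Y Z q) (V q) + g q (Z q) (nab Y V q))"
      by (rule tangent_fun_cong[OF tan[OF X] W p nab_metric[OF W Y Z V] smooth_at_add[OF s]])
    also have "\<dots> = X p (\<lambda>q. g q (nab Y Z q) (V q)) + X p (\<lambda>q. g q (Z q) (nab Y V q))"
      by (rule tangent_fun_rules(1)[OF tan[OF X] s])
    finally show ?thesis
      using nab_metric[OF W X ns[OF Y Z] V p] nab_metric[OF W X Z ns[OF Y V] p] by simp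
  qed
  from this[OF X Y] this[OF Y X]
  have "lie_bracket A X Y p ?F = g p (nab X (nab Y Z) p) (V p) - g p (nab Y (nab X Z) p) (V p) + g p (Z p) (nab X (nab Y V) p) - g p (Z p) (nab Y (nab X V) p)"
    using smooth_atI[OF F W p] by (simp add: lie_bracket_def smooth_near_iff)
  moreover have "lie_bracket A X Y p ?F = g p (nab (lie_bracket A X Y) Z p) (V p) + g p (Z p) (nab (lie_bracket A X Y) V p)"
    by (rule nab_metric[OF W bs[OF X Y] Z V p])
  moreover have "g p (Z p) T = g p T (Z p)" if "T \<in> tangent_space A p" for T
    by (rule metric_sym[OF tan[OF Z] that])
  moreover have "g p (\<lambda>f. a f - b f - d f) t = g p a t - g p b t - g p d t"
    if "a \<in> tangent_space A p" "b \<in> tangent_space A p" "d \<in> tangent_space A p" "t \<in> tangent_space A p" for a b d t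
    using metric_diff[OF tangent_diff[OF that(1,2)] that(3,4)] metric_diff[OF that(1,2,4)] by simp
  ultimately show ?thesis
    unfolding curv4_def riem_curv_def using X Y Z V by (simp add: tan nab_tan ns bs)
qed

text \<open>The difference from the model tensor has all symmetries of a curvature tensor and
  vanishing sectional values, so it is zero by polarization.\<close>

lemma constant_curvature:
  assumes cc: "has_constant_curvature A g nab c"
    and X: "smooth_field A W X" and Y: "smooth_field A W Y" and Z: "smooth_field A W Z" and V: "smooth_field A W V"
  shows "curv4 X Y Z V = c * (g p (Y p) (Z p) * g p (X p) (V p) - g p (X p) (Z p) * g p (Y p) (V p))"
proof -
  let ?T = "\<lambda>X Y Z V. curv4 X Y Z V - c * (g p (Y p) (Z p) * g p (X p) (V p) - g p (X p) (Z p) * g p (Y p) (V p))"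
  have "?T X Y Z V = 0"
  proof (rule curvature_polarization[where F = "{X. smooth_field A W X}" and pl = "\<lambda>X Y q u. X q u + Y q u" and T = ?T])
    show "(\<lambda>q u. X q u + Y q u) \<in> {X. smooth_field A W X}" if "X \<in> {X. smooth_field A W X}" "Y \<in> {X. smooth_field A W X}" for X Y
      using that smooth_field_add by simp
    show "?T (\<lambda>q u. X q u + X' q u) Y Z V = ?T X Y Z V + ?T X' Y Z V"
      if "X \<in> {X. smooth_field A W X}" "X' \<in> {X. smooth_field A W X}" "Y \<in> {X. smooth_field A W X}" "Z \<in> {X. smooth_field A W X}" "V \<in> {X. smooth_field A W X}" for X X' Y Z V
      using that by (simp add: curv4_def riem_add1 metric_add tan riem_tangent algebra_simps)
    show "?T X Y Z V = - ?T Y X Z V"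
      if "X \<in> {X. smooth_field A W X}" "Y \<in> {X. smooth_field A W X}" "Z \<in> {X. smooth_field A W X}" "V \<in> {X. smooth_field A W X}" for X Y Z V
      using that riem_anti1[of X Y Z] metric_scale[OF riem_tangent[of X Y Z] tan[of V], of "- 1"]
      by (simp add: curv4_def algebra_simps)
    show "?T X Y Z V = - ?T X Y V Z"
      if "X \<in> {X. smooth_field A W X}" "Y \<in> {X. smooth_field A W X}" "Z \<in> {X. smooth_field A W X}" "V \<in> {X. smooth_field A W X}" for X Y Z V
      using that curv4_anti2[of X Y Z V] by (simp add: algebra_simps)
    show "?T X Y Z V + ?T Y Z X V + ?T Z X Y V = 0"
      if "X \<in> {X. smooth_field A W X}" "Y \<in> {X. smooth_field A W X}" "Z \<in> {X. smooth_field A W X}" "V \<in> {X. smooth_field A W X}" for X Y Z V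
    proof -
      have F: "smooth_field A W X" "smooth_field A W Y" "smooth_field A W Z" "smooth_field A W V" using that by auto
      have z: "(\<lambda>u. riem_curv A nab X Y Z p u + riem_curv A nab Y Z X p u + riem_curv A nab Z X Y p u) = (\<lambda>u. 0 * V p u)"
        using riem_bianchi[OF F(1-3)] by auto
      have "curv4 X Y Z V + curv4 Y Z X V + curv4 Z X Y V = 0"
        using metric_add[OF tangent_add[OF riem_tangent riem_tangent] riem_tangent tan, of X Y Z Y Z X Z X Y V]
          metric_add[OF riem_tangent riem_tangent tan, of X Y Z Y Z X V] metric_scale[OF tan tan, of V V 0] F
        unfolding curv4_def z by simp
      then show ?thesis using metric_sym[OF tan tan, of X Y] metric_sym[OF tan tan, of X Z] metric_sym[OF tan tan, of Z Y] F
        by (simp add: algebra_simps)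
    qed
    show "?T X Y Y X = 0" if "X \<in> {X. smooth_field A W X}" "Y \<in> {X. smooth_field A W X}" for X Y
    proof -
      have F: "smooth_field A W X" "smooth_field A W Y" using that by auto
      have "curv4 X Y Y X = c * (g p (X p) (X p) * g p (Y p) (Y p) - (g p (X p) (Y p))\<^sup>2)"
        using cc[unfolded has_constant_curvature_def, rule_format, OF W F p] by (simp add: curv4_def)
      then show ?thesis using metric_sym[OF tan tan, of X Y] F by (simp add: power2_eq_square)
    qed
  qed (use X Y Z V in auto)
  then show ?thesis by simp
qed

end

subsection \<open>Connection matrices\<close>

definition conn :: "'i \<Rightarrow> 'n \<Rightarrow> 'm \<Rightarrow> ((real, 'n) vec, 'n) vec" where
  "conn a k p = (\<chi> l i. g p (nab (e a k) (e a i) p) (e a l p))"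

lemma nab_frame_tangent: "p \<in> U a \<Longrightarrow> nab (e a k) (e a i) p \<in> tangent_space A p"
  by (rule nab_tan[OF open_U _ frame_smooth frame_smooth])

lemma conn_smooth: "smooth_fun A (U a) (conn a k)"
proof -
  have "smooth_fun A (U a) (\<lambda>p. conn a k p $ l $ i)" for l i
    by (simp add: conn_def) (intro metric_smooth nab_smooth open_U frame_smooth)
  then show ?thesis by (intro smooth_fun_vec open_U)
qed

lemma conn_smooth_nth: "smooth_fun A (U a) (\<lambda>p. conn a k p $ l $ i)"
  by (simp add: conn_def) (intro metric_smooth nab_smooth open_U frame_smooth)

lemma skew_conn:
  assumes p: "p \<in> U a"
  shows "skew (conn a k p)"
  unfolding skew_def
proof (intro allI)
  fix l i
  have t: "e a k p \<in> tangent_space A p" by (rule frame_tangent[OF p])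
  have "e a k p (\<lambda>q. g q (e a i q) (e a l q)) = e a k p (\<lambda>q. if i = l then 1 else 0)"
    by (rule tangent_fun_cong[OF t open_U p frame_orthonormal smooth_at_const])
  also have "\<dots> = 0" using dir_deriv_const[OF t, of "if i = l then 1 else 0 :: real"] by (simp add: dir_deriv_real)
  finally have "g p (nab (e a k) (e a i) p) (e a l p) + g p (e a i p) (nab (e a k) (e a l) p) = 0"
    using nab_metric[OF open_U frame_smooth frame_smooth frame_smooth p] by simp
  then show "conn a k p $ l $ i = - conn a k p $ i $ l"
    using metric_sym[OF frame_tangent[OF p] nab_frame_tangent[OF p]] by (simp add: conn_def)
qed

lemma nab_frame: "p \<in> U a \<Longrightarrow> nab (e a k) (e a i) p = (\<lambda>u. \<Sum>l\<in>UNIV. conn a k p $ l $ i * e a l p u)"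
  using frame_expansion[OF nab_frame_tangent] by (simp add: conn_def)

lemma bracket_frame:
  assumes p: "p \<in> U a"
  shows "lie_bracket A (e a i) (e a k) p = (\<lambda>u. \<Sum>l\<in>UNIV. (conn a i p $ l $ k - conn a k p $ l $ i) * e a l p u)"
  using nab_torsion[OF open_U frame_smooth frame_smooth p, symmetric]
  by (simp add: nab_frame[OF p] sum_subtractf algebra_simps)

lemma metric_frame_sum: "p \<in> U a \<Longrightarrow> g p (\<lambda>u. \<Sum>l\<in>UNIV. r l * e a l p u) (e a m p) = r m"
  by (simp add: metric_sum[OF frame_tangent frame_tangent] frame_orthonormal if_distrib cong: if_cong)

text \<open>The second structure equation in a frame whose fields need not commute; the last sum is
  the covariant derivative along their bracket.\<close>

lemma curvature_matrix:
  assumes p: "p \<in> U a"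
  shows "g p (riem_curv A nab (e a i) (e a k) (e a q) p) (e a m p) =
    e a i p (\<lambda>x. conn a k x $ m $ q) - e a k p (\<lambda>x. conn a i x $ m $ q)
    + (conn a i p ** conn a k p - conn a k p ** conn a i p) $ m $ q
    - (\<Sum>l\<in>UNIV. (conn a i p $ l $ k - conn a k p $ l $ i) * conn a l p $ m $ q)"
proof -
  note fs = frame_smooth[of a] and W = open_U[of a]
  have nn: "nab (e a i) (nab (e a k) (e a q)) p = (\<lambda>u. \<Sum>l\<in>UNIV. (e a i p (\<lambda>x. conn a k x $ l $ q) + (conn a i p ** conn a k p) $ l $ q) * e a l p u)" for i k
  proof -
    have "nab (e a i) (nab (e a k) (e a q)) p = nab (e a i) (\<lambda>x u. \<Sum>l\<in>UNIV. conn a k x $ l $ q * e a l x u) p"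
      by (rule nab_cong_right[OF W fs _ p nab_frame]) (intro smooth_field_sum smooth_field_scale fs conn_smooth_nth finite)
    also have "\<dots> = (\<lambda>u. \<Sum>l\<in>UNIV. e a i p (\<lambda>x. conn a k x $ l $ q) * e a l p u + conn a k p $ l $ q * nab (e a i) (e a l) p u)"
      by (rule nab_sum_right[OF W fs fs conn_smooth_nth p finite])
    also have "\<dots> = (\<lambda>u. \<Sum>l\<in>UNIV. (e a i p (\<lambda>x. conn a k x $ l $ q) + (conn a i p ** conn a k p) $ l $ q) * e a l p u)"
    proof
      fix u
      have "(\<Sum>l\<in>UNIV. conn a k p $ l $ q * nab (e a i) (e a l) p u) = (\<Sum>l\<in>UNIV. \<Sum>r\<in>UNIV. conn a i p $ r $ l * conn a k p $ l $ q * e a r p u)"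
        by (simp add: nab_frame[OF p] sum_distrib_left mult_ac)
      also have "\<dots> = (\<Sum>r\<in>UNIV. (conn a i p ** conn a k p) $ r $ q * e a r p u)"
        by (subst sum.swap) (simp add: matrix_matrix_mult_def sum_distrib_right)
      finally show "(\<Sum>l\<in>UNIV. e a i p (\<lambda>x. conn a k x $ l $ q) * e a l p u + conn a k p $ l $ q * nab (e a i) (e a l) p u) =
        (\<Sum>l\<in>UNIV. (e a i p (\<lambda>x. conn a k x $ l $ q) + (conn a i p ** conn a k p) $ l $ q) * e a l p u)"
        by (simp add: sum.distrib distrib_right)
    qed
    finally show ?thesis .
  qed
  let ?t = "\<lambda>x l. conn a i x $ l $ k - conn a k x $ l $ i"
  have st: "smooth_fun A (U a) (\<lambda>x. ?t x l)" for l by (intro smooth_fun_diff conn_smooth_nth W)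
  have "nab (lie_bracket A (e a i) (e a k)) (e a q) p = nab (\<lambda>x u. \<Sum>l\<in>UNIV. ?t x l * e a l x u) (e a q) p"
    by (rule nab_cong_left[OF W _ fs p bracket_frame]) (intro smooth_field_sum smooth_field_scale fs st finite)
  also have "\<dots> = (\<lambda>u. \<Sum>l\<in>UNIV. ?t p l * nab (e a l) (e a q) p u)"
    by (rule nab_sum_left[OF W fs fs st p finite])
  also have "\<dots> = (\<lambda>u. \<Sum>r\<in>UNIV. (\<Sum>l\<in>UNIV. ?t p l * conn a l p $ r $ q) * e a r p u)"
    by (rule ext) (simp add: nab_frame[OF p] sum_distrib_left sum_distrib_right mult.assoc, rule sum.swap)
  finally have "riem_curv A nab (e a i) (e a k) (e a q) p = (\<lambda>u. \<Sum>l\<in>UNIV. (e a i p (\<lambda>x. conn a k x $ l $ q) - e a k p (\<lambda>x. conn a i x $ l $ q)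
    + (conn a i p ** conn a k p - conn a k p ** conn a i p) $ l $ q - (\<Sum>r\<in>UNIV. ?t p r * conn a r p $ l $ q)) * e a l p u)"
    unfolding riem_curv_def nn by (simp add: sum_subtractf[symmetric] algebra_simps)
  then show ?thesis by (simp add: metric_frame_sum[OF p])
qed

text \<open>The sign reflects conventions: the curvature operator of \<open>e_i\<close>,
  \<open>e_k\<close> sends \<open>e_k\<close> to \<open>c e_i\<close>, whereas
  \<open>rot_gen i k\<close> sends \<open>e_i\<close> to \<open>e_k\<close>.\<close>

lemma curvature_rot_gen:
  assumes cc: "has_constant_curvature A g nab c" and p: "p \<in> U a"
  shows "(\<chi> l q. g p (riem_curv A nab (e a i) (e a k) (e a q) p) (e a l p)) = - c *\<^sub>R rot_gen i k"
proof -
  have "g p (riem_curv A nab (e a i) (e a k) (e a q) p) (e a l p) =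
      c * ((if k = q then 1 else 0) * (if i = l then 1 else 0) - (if i = q then 1 else 0) * (if k = l then 1 else 0))" for q l
    using constant_curvature[OF open_U p cc frame_smooth frame_smooth frame_smooth frame_smooth]
    by (simp add: curv4_def[OF open_U p] frame_orthonormal[OF p])
  then show ?thesis by (auto simp: vec_eq_iff rot_gen_def)
qed

subsection \<open>The second covariant derivative\<close>

lemma nabla_nth: "p \<in> U a \<Longrightarrow> nabla M s a p $ k = dir_deriv (e a k p) (s a) + \<rho> (conn a k p) (s a p)"
  by (simp add: nabla_def conn_def)

lemma nabla_smooth_nth:
  assumes s: "smooth_fun A (U a) (s a)"
  shows "smooth_fun A (U a) (\<lambda>p. nabla M s a p $ k)"
proof -
  have "smooth_fun A (U a) (\<lambda>p. dir_deriv (e a k p) (s a) + \<rho> (conn a k p) (s a p))"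
    by (intro smooth_fun_add open_U smooth_fun_dir_deriv[OF frame_smooth] s smooth_fun_bilinear[OF bounded_bilinear_lie] conn_smooth)
  then show ?thesis
    by (rule smooth_fun_cong[OF open_U, THEN iffD1, rotated]) (simp add: nabla_nth)
qed

text \<open>The components of \<open>\<nabla>\<^sup>2\<^sub>l\<^sub>,\<^sub>k s\<close> in the frame over \<open>U a\<close>.\<close>

definition second :: "('i \<Rightarrow> 'm \<Rightarrow> ('n, 's) twisted) \<Rightarrow> 'i \<Rightarrow> 'm \<Rightarrow> 'n \<Rightarrow> 'n \<Rightarrow> ('n, 's) twisted" where
  "second s a p l k = dir_deriv (e a l p) (\<lambda>q. nabla M s a q $ k) + \<rho> (conn a l p) (nabla M s a p $ k)
     + (\<Sum>m\<in>UNIV. conn a l p $ k $ m *\<^sub>R nabla M s a p $ m)"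

lemma dir_deriv_inner_Basis: "b \<in> Basis \<Longrightarrow> dir_deriv X f \<bullet> b = X (\<lambda>q. f q \<bullet> b)"
  by (simp add: dir_deriv_def inner_sum_left inner_Basis if_distrib cong: if_cong)

text \<open>The first-order terms cancel: the bracket of two frame fields is compensated by the
  connection acting on the derivative index. What remains are derivatives, commutator and bracket
  terms of the connection matrices, which form the curvature matrix.\<close>

lemma ricci:
  assumes s: "smooth_fun A (U a) (s a)" and p: "p \<in> U a"
  shows "second s a p l k - second s a p k l =
    \<rho> (\<chi> m q. g p (riem_curv A nab (e a l) (e a k) (e a q) p) (e a m p)) (s a p)"
proof -
  let ?s = "s a p"
  let ?d = "\<lambda>l. dir_deriv (e a l p)"
  have t: "e a l p \<in> tangent_space A p" for l by (rule frame_tangent[OF p])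
  have ss: "smooth_at p (s a)" by (rule smooth_atI[OF s open_U p])
  have sd: "smooth_at p (\<lambda>q. dir_deriv (e a k q) (s a))" for k
    by (rule smooth_atI[OF smooth_fun_dir_deriv[OF frame_smooth open_U s] open_U p])
  have sc: "smooth_at p (conn a k)" for k by (rule smooth_atI[OF conn_smooth open_U p])
  have d1: "?d l (\<lambda>q. nabla M s a q $ k) = ?d l (\<lambda>q. dir_deriv (e a k q) (s a)) + \<rho> (?d l (conn a k)) ?s + \<rho> (conn a k p) (?d l (s a))" for l k
  proof -
    have "?d l (\<lambda>q. nabla M s a q $ k) = ?d l (\<lambda>q. dir_deriv (e a k q) (s a) + \<rho> (conn a k q) (s a q))"
      by (rule dir_deriv_cong(1)[OF t open_U p nabla_nth], assumption) (intro smooth_at_add smooth_at_bilinear[OF bounded_bilinear_lie] sd sc ss)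
    also have "\<dots> = ?d l (\<lambda>q. dir_deriv (e a k q) (s a)) + ?d l (\<lambda>q. \<rho> (conn a k q) (s a q))"
      by (rule dir_deriv_add[OF t sd]) (intro smooth_at_bilinear[OF bounded_bilinear_lie] sc ss)
    finally show ?thesis by (simp add: dir_deriv_bilinear[OF bounded_bilinear_lie t sc ss] add.assoc)
  qed
  have br: "?d l (\<lambda>q. dir_deriv (e a k q) (s a)) - ?d k (\<lambda>q. dir_deriv (e a l q) (s a)) =
      (\<Sum>m\<in>UNIV. (conn a l p $ m $ k - conn a k p $ m $ l) *\<^sub>R ?d m (s a))"
  proof -
    have dd: "?d l (\<lambda>q. dir_deriv (e a k q) (s a)) = (\<Sum>b\<in>Basis. e a l p (\<lambda>q. e a k q (\<lambda>r. s a r \<bullet> b)) *\<^sub>R b)" for l k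
      unfolding dir_deriv_def[of "e a l p"] by (intro sum.cong refl) (simp add: dir_deriv_inner_Basis)
    have "lie_bracket A (e a l) (e a k) p (\<lambda>r. s a r \<bullet> b) = e a l p (\<lambda>q. e a k q (\<lambda>r. s a r \<bullet> b)) - e a k p (\<lambda>q. e a l q (\<lambda>r. s a r \<bullet> b))" for b
      by (rule lie_bracket_apply[OF open_U p]) (simp add: smooth_near_iff smooth_at_inner[OF ss])
    then have "?d l (\<lambda>q. dir_deriv (e a k q) (s a)) - ?d k (\<lambda>q. dir_deriv (e a l q) (s a)) = dir_deriv (lie_bracket A (e a l) (e a k) p) (s a)"
      unfolding dd dir_deriv_def by (simp add: scaleR_diff_left sum_subtractf)
    also have "\<dots> = (\<Sum>m\<in>UNIV. (conn a l p $ m $ k - conn a k p $ m $ l) *\<^sub>R ?d m (s a))"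
      unfolding bracket_frame[OF p] dir_deriv_def
      by (simp add: scaleR_sum_left scaleR_sum_right) (rule sum.swap)
    finally show ?thesis .
  qed
  have m: "(\<Sum>m\<in>UNIV. conn a l p $ k $ m *\<^sub>R nabla M s a p $ m) - (\<Sum>m\<in>UNIV. conn a k p $ l $ m *\<^sub>R nabla M s a p $ m) =
      - (\<Sum>m\<in>UNIV. (conn a l p $ m $ k - conn a k p $ m $ l) *\<^sub>R ?d m (s a)) - (\<Sum>m\<in>UNIV. (conn a l p $ m $ k - conn a k p $ m $ l) *\<^sub>R \<rho> (conn a m p) ?s)"
    unfolding skewD[OF skew_conn[OF p], of l k] skewD[OF skew_conn[OF p], of k l]
    by (simp add: nabla_nth[OF p] sum_negf sum_subtractf sum.distrib scaleR_add_right scaleR_diff_left)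
  have mat: "(\<chi> m q. g p (riem_curv A nab (e a l) (e a k) (e a q) p) (e a m p)) = ?d l (conn a k) - ?d k (conn a l)
      + (conn a l p ** conn a k p - conn a k p ** conn a l p) - (\<Sum>m\<in>UNIV. (conn a l p $ m $ k - conn a k p $ m $ l) *\<^sub>R conn a m p)"
  proof -
    have n: "?d l (conn a k) $ m $ q = e a l p (\<lambda>x. conn a k x $ m $ q)" for l k m q
      using dir_deriv_linear[OF bounded_linear_compose[OF bounded_linear_vec_nth[of q] bounded_linear_vec_nth[of m]] t[of l] sc[of k]]
      by (simp add: dir_deriv_real)
    show ?thesis unfolding vec_eq_iff by (simp add: curvature_matrix[OF p] n sum_component)
  qed
  show ?thesis
    unfolding second_def d1 mat
    using br m lie_commutator[OF skew_conn[OF p], of l "conn a k p" ?s]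
    by (simp add: nabla_nth[OF p] lie_linear lie_matrix_linear algebra_simps)
qed

end

section \<open>Covariance and sections\<close>

context spinor_module
begin

lemma herm_lie:
  assumes "skew a"
  shows "herm (\<rho> a \<phi>) \<psi> = - herm \<phi> (\<rho> a \<psi>)"
proof -
  have "herm (\<rho> a \<phi>) \<psi> = (\<Sum>i\<in>UNIV. \<Sum>k\<in>UNIV. a $ k $ i *\<^sub>R ((1/4) *\<^sub>R herm \<phi> (\<G> k (\<G> i \<psi>)) + herm \<phi> (\<E> i (\<I> k \<psi>))))"
    by (simp add: spin_lie_act_def herm_sum herm_scaleR herm_add herm_cliff herm_ext herm_int)
  also have "\<dots> = (\<Sum>i\<in>UNIV. \<Sum>k\<in>UNIV. a $ i $ k *\<^sub>R ((1/4) *\<^sub>R herm \<phi> (\<G> i (\<G> k \<psi>)) + herm \<phi> (\<E> k (\<I> i \<psi>))))"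
    by (rule sum.swap)
  also have "\<dots> = (\<Sum>i\<in>UNIV. \<Sum>k\<in>UNIV. (- a $ k $ i) *\<^sub>R ((1/4) *\<^sub>R herm \<phi> (\<G> i (\<G> k \<psi>)) + herm \<phi> (\<E> k (\<I> i \<psi>))))"
    by (intro sum.cong refl arg_cong2[where f = scaleR] skewD[OF assms])
  also have "\<dots> = - herm \<phi> (\<rho> a \<psi>)"
    by (simp add: spin_lie_act_def herm_sum herm_scaleR herm_add sum_negf)
  finally show ?thesis .
qed

lemma herm_wedge_Ker: "w \<in> Ker j \<Longrightarrow> herm w (Wed y) = 0"
proof -
  assume w: "w \<in> Ker j"
  have "herm w (Wed y) = cnj (herm (Wed y) w)" by (simp add: herm_def mult.commute)
  then show ?thesis using w by (simp add: herm_wedge KerD herm_eq_0)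
qed

text \<open>Equivariance under the group makes the symbol of a section a section
  (\<open>symbol_section\<close>); infinitesimal equivariance makes it commute with covariant
  differentiation (\<open>nabla_symbol\<close>).\<close>

definition linear_symbol :: "(('n \<Rightarrow> ('n, 's) twisted) \<Rightarrow> ('n, 's) twisted) \<Rightarrow> bool" where
  "linear_symbol L \<longleftrightarrow> linear (\<lambda>x :: ('n, 's) twisted1. L (($) x)) \<and>
     (\<forall>a x. skew a \<longrightarrow> \<rho> a (L x) = L (\<lambda>k. \<rho> a (x k) + (\<Sum>l\<in>UNIV. a $ k $ l *\<^sub>R x l))) \<and>
     (\<forall>h x. h \<in> spin_group \<gamma> \<longrightarrow> act h (L x) = L (rot_vec h x))"

lemma linear_symbol_sym: "linear_symbol (symD j)" "linear_symbol (symM j)" "linear_symbol (symP j)"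
proof -
  have l: "linear (\<lambda>x :: ('n, 's) twisted1. gsum (($) x))" "linear (\<lambda>x :: ('n, 's) twisted1. esum (($) x))"
    "linear (\<lambda>x :: ('n, 's) twisted1. isum (($) x))"
    unfolding gsum_def esum_def isum_def
    by (rule linearI; simp add: op_linear sum.distrib scaleR_sum_right)+
  have "linear (\<lambda>x. symD j (($) x))" "linear (\<lambda>x. symM j (($) x))" "linear (\<lambda>x. symP j (($) x))"
    unfolding symD_def symM_def symP_def symE_def Let_def
    by (rule linearI; simp add: linear_simps[OF l(1)] linear_simps[OF l(2)] linear_simps[OF l(3)] op_linear
        scaleR_add_right algebra_simps)+
  then show "linear_symbol (symD j)" "linear_symbol (symM j)" "linear_symbol (symP j)"
    unfolding linear_symbol_def using lie_sym act_sym by simp_all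
qed

end

context spin_geometry
begin

section \<open>Change of local trivialization\<close>

abbreviation "tr \<equiv> transition M"
abbreviation "\<gamma> \<equiv> gam M"

lemma transition_spin: "p \<in> U a \<Longrightarrow> p \<in> U b \<Longrightarrow> tr a b p \<in> spin_group \<gamma>"
  and transition_frame: "p \<in> U a \<Longrightarrow> p \<in> U b \<Longrightarrow> e b k p = (\<lambda>f. \<Sum>i\<in>UNIV. spin_Ad \<gamma> (tr a b p) $ i $ k * e a i p f)"
  and transition_smooth: "smooth_fun A (U a \<inter> U b) (tr a b)"
  using spin unfolding is_spin_manifold_def by blast+

text \<open>The rotation entries are inner products of two smooth frames, which yields their
  smoothness without analysing the definite description \<open>spin_Ad\<close>.\<close>

lemma spin_Ad_nth: "p \<in> U a \<Longrightarrow> p \<in> U b \<Longrightarrow> spin_Ad \<gamma> (tr a b p) $ i $ k = g p (e b k p) (e a i p)"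
  by (subst transition_frame[of p a b k]) (simp_all add: metric_frame_sum)

lemma spin_Ad_smooth:
  shows "smooth_fun A (U a \<inter> U b) (\<lambda>p. spin_Ad \<gamma> (tr a b p) $ i $ k)"
    and "smooth_fun A (U a \<inter> U b) (\<lambda>p. spin_Ad \<gamma> (tr a b p))"
proof -
  have o: "open (U a \<inter> U b)" using open_U by blast
  have "smooth_fun A (U a \<inter> U b) (\<lambda>p. g p (e b k p) (e a i p))" for i k
    by (intro metric_smooth o smooth_field_subset[OF frame_smooth]) auto
  then have *: "smooth_fun A (U a \<inter> U b) (\<lambda>p. spin_Ad \<gamma> (tr a b p) $ i $ k)" for i k
    by (rule smooth_fun_cong[OF o, THEN iffD1, rotated]) (simp add: spin_Ad_nth)
  then show "smooth_fun A (U a \<inter> U b) (\<lambda>p. spin_Ad \<gamma> (tr a b p) $ i $ k)" by simp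
  show "smooth_fun A (U a \<inter> U b) (\<lambda>p. spin_Ad \<gamma> (tr a b p))"
    by (intro smooth_fun_vec o *)
qed

text \<open>The gauge transformation law. \<open>\<Omega>\<close> is the connection along the field
  of the second frame in terms of the first; differentiating the rotated frame adds the derivative
  of the rotation, whose product with the transpose is \<open>logdiff\<close>.\<close>

lemma conn_transition:
  assumes p: "p \<in> U a" "p \<in> U b"
  defines "R \<equiv> spin_Ad \<gamma> (tr a b p)"
  shows "R ** conn b k p ** transpose R = logdiff (e b k p) p (tr a b) + (\<Sum>i\<in>UNIV. R $ i $ k *\<^sub>R conn a i p)"
proof -
  let ?W = "U a \<inter> U b"
  have W: "open ?W" "p \<in> ?W" using open_U p by auto
  have fs: "smooth_field A ?W (e a i)" "smooth_field A ?W (e b i)" for i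
    by (auto intro: smooth_field_subset[OF frame_smooth])
  define dR where "dR = dir_deriv (e b k p) (\<lambda>q. spin_Ad \<gamma> (tr a b q))"
  define \<Omega> where "\<Omega> = (\<Sum>i\<in>UNIV. R $ i $ k *\<^sub>R conn a i p)"
  have t: "e b k p \<in> tangent_space A p" by (rule frame_tangent[OF p(2)])
  have dRn: "e b k p (\<lambda>q. spin_Ad \<gamma> (tr a b q) $ i $ l) = dR $ i $ l" for i l
    using dir_deriv_linear[OF bounded_linear_compose[OF bounded_linear_vec_nth[of l] bounded_linear_vec_nth[of i]] t
        smooth_atI[OF spin_Ad_smooth(2) W]]
    by (simp add: dir_deriv_real dR_def)
  have na: "nab (e b k) (e a m) p = (\<lambda>u. \<Sum>r\<in>UNIV. \<Omega> $ r $ m * e a r p u)" for m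
  proof -
    have "nab (e b k) (e a m) p = nab (\<lambda>q u. \<Sum>j\<in>UNIV. spin_Ad \<gamma> (tr a b q) $ j $ k * e a j q u) (e a m) p"
      by (rule nab_cong_left[OF W(1) _ fs(1) W(2)])
        (auto intro!: smooth_field_sum smooth_field_scale fs spin_Ad_smooth transition_frame)
    also have "\<dots> = (\<lambda>u. \<Sum>j\<in>UNIV. R $ j $ k * nab (e a j) (e a m) p u)"
      unfolding R_def by (rule nab_sum_left[OF W(1) fs(1) fs(1) spin_Ad_smooth(1) W(2) finite])
    also have "\<dots> = (\<lambda>u. \<Sum>r\<in>UNIV. \<Omega> $ r $ m * e a r p u)"
      by (rule ext) (simp add: nab_frame[OF p(1)] \<Omega>_def sum_component sum_distrib_left sum_distrib_right mult.assoc, rule sum.swap)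
    finally show ?thesis .
  qed
  have nb: "nab (e b k) (e b i) p = (\<lambda>u. \<Sum>r\<in>UNIV. (dR + \<Omega> ** R) $ r $ i * e a r p u)" for i
  proof -
    have "nab (e b k) (e b i) p = nab (e b k) (\<lambda>q u. \<Sum>m\<in>UNIV. spin_Ad \<gamma> (tr a b q) $ m $ i * e a m q u) p"
      by (rule nab_cong_right[OF W(1) fs(2) _ W(2)])
        (auto intro!: smooth_field_sum smooth_field_scale fs spin_Ad_smooth transition_frame)
    also have "\<dots> = (\<lambda>u. \<Sum>m\<in>UNIV. dR $ m $ i * e a m p u + R $ m $ i * nab (e b k) (e a m) p u)"
      unfolding dRn[symmetric] R_def by (rule nab_sum_right[OF W(1) fs(2) fs(1) spin_Ad_smooth(1) W(2) finite])
    also have "\<dots> = (\<lambda>u. \<Sum>r\<in>UNIV. (dR + \<Omega> ** R) $ r $ i * e a r p u)"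
    proof
      fix u
      have "(\<Sum>m\<in>UNIV. R $ m $ i * nab (e b k) (e a m) p u) = (\<Sum>m\<in>UNIV. \<Sum>r\<in>UNIV. \<Omega> $ r $ m * R $ m $ i * e a r p u)"
        by (simp add: na sum_distrib_left mult_ac)
      also have "\<dots> = (\<Sum>r\<in>UNIV. (\<Omega> ** R) $ r $ i * e a r p u)"
        by (subst sum.swap) (simp add: matrix_matrix_mult_def sum_distrib_right)
      finally show "(\<Sum>m\<in>UNIV. dR $ m $ i * e a m p u + R $ m $ i * nab (e b k) (e a m) p u) =
          (\<Sum>r\<in>UNIV. (dR + \<Omega> ** R) $ r $ i * e a r p u)"
        by (simp add: sum.distrib distrib_right)
    qed
    finally show ?thesis .
  qed
  have "conn b k p = transpose R ** (dR + \<Omega> ** R)"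
  proof -
    have "conn b k p $ l $ i = (\<Sum>r\<in>UNIV. R $ r $ l * (dR + \<Omega> ** R) $ r $ i)" for l i
    proof -
      have "conn b k p $ l $ i = g p (e b l p) (\<lambda>u. \<Sum>r\<in>UNIV. (dR + \<Omega> ** R) $ r $ i * e a r p u)"
        unfolding nb[symmetric] using metric_sym[OF frame_tangent nab_frame_tangent, OF p(2) p(2), of l k i] by (simp add: conn_def)
      also have "\<dots> = (\<Sum>r\<in>UNIV. R $ r $ l * g p (e a r p) (\<lambda>u. \<Sum>r\<in>UNIV. (dR + \<Omega> ** R) $ r $ i * e a r p u))"
        unfolding transition_frame[OF p, of l] R_def[symmetric]
        by (rule metric_sum[OF frame_tangent[OF p(1)] tangent_sum[OF finite frame_tangent[OF p(1)]] finite])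
      also have "\<dots> = (\<Sum>r\<in>UNIV. R $ r $ l * (dR + \<Omega> ** R) $ r $ i)"
      proof (intro sum.cong refl arg_cong2[where f = "(*)"])
        fix r
        have "g p (e a r p) (\<lambda>u. \<Sum>r\<in>UNIV. (dR + \<Omega> ** R) $ r $ i * e a r p u) = g p (\<lambda>u. \<Sum>r\<in>UNIV. (dR + \<Omega> ** R) $ r $ i * e a r p u) (e a r p)"
          by (rule metric_sym[OF frame_tangent[OF p(1)] tangent_sum[OF finite frame_tangent[OF p(1)]]])
        then show "g p (e a r p) (\<lambda>u. \<Sum>r\<in>UNIV. (dR + \<Omega> ** R) $ r $ i * e a r p u) = (dR + \<Omega> ** R) $ r $ i"
          by (simp only: metric_frame_sum[OF p(1)])
      qed
      finally show ?thesis .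
    qed
    then show ?thesis by (simp add: vec_eq_iff matrix_matrix_mult_def transpose_def)
  qed
  moreover have "R ** transpose R = mat 1" using spin_group_props(3)[OF transition_spin[OF p]] by (simp add: R_def)
  ultimately have "R ** conn b k p ** transpose R = (dR + \<Omega> ** R) ** transpose R"
    by (simp add: matrix_mul_assoc)
  also have "\<dots> = dR ** transpose R + \<Omega> ** (R ** transpose R)"
    unfolding matrix_mul_assoc by (simp add: vec_eq_iff matrix_matrix_mult_def[of "_ + _"] matrix_matrix_mult_def[of _ "transpose R"] sum.distrib distrib_right)
  finally show ?thesis
    using \<open>R ** transpose R = mat 1\<close> logdiff_def[OF t W(1) W(2) transition_spin smooth_atI[OF transition_smooth W] smooth_atI[OF spin_Ad_smooth(2) W]]
    by (simp add: dR_def R_def \<Omega>_def)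
qed

text \<open>The inhomogeneous term of the connection matrices is matched by the derivative of the
  transition function acting on the section, both given by \<open>logdiff\<close>. Orthogonality
  then inverts the rotation of the derivative index.\<close>

lemma nabla_transition:
  assumes s: "smooth_fun A (U a) (s a)" "smooth_fun A (U b) (s b)"
    and st: "\<And>q. q \<in> U a \<inter> U b \<Longrightarrow> s a q = act (tr a b q) (s b q)"
    and p: "p \<in> U a" "p \<in> U b"
  shows "nabla M s a p = spin_act1 \<gamma> (tr a b p) (nabla M s b p)"
proof -
  let ?W = "U a \<inter> U b" and ?R = "spin_Ad \<gamma> (tr a b p)"
  have W: "open ?W" "p \<in> ?W" using open_U p by auto
  have h: "\<And>q. q \<in> ?W \<Longrightarrow> tr a b q \<in> spin_group \<gamma>" using transition_spin by simp
  note hp = spin_group_props[OF h[OF W(2)]]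
  have sb: "smooth_at p (s b)" and sa: "smooth_at p (s a)" using smooth_atI s open_U p by blast+
  note sm = smooth_atI[OF transition_smooth W] smooth_atI[OF spin_Ad_smooth(2) W]
  have *: "act (tr a b p) (nabla M s b p $ k) = (\<Sum>i\<in>UNIV. ?R $ i $ k *\<^sub>R nabla M s a p $ i)" for k
  proof -
    let ?X = "e b k p"
    have t: "?X \<in> tangent_space A p" by (rule frame_tangent[OF p(2)])
    have "(\<Sum>i\<in>UNIV. ?R $ i $ k *\<^sub>R dir_deriv (e a i p) (s a)) = dir_deriv ?X (s a)"
      unfolding transition_frame[OF p] dir_deriv_def
      by (simp add: scaleR_sum_left scaleR_sum_right) (rule sum.swap)
    also have "dir_deriv ?X (s a) = dir_deriv ?X (\<lambda>q. act (tr a b q) (s b q))"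
      by (rule dir_deriv_cong(1)[OF t W _ sa, symmetric]) (use st in auto)
    also have "\<dots> = act (tr a b p) (dir_deriv ?X (s b)) + \<rho> (logdiff ?X p (tr a b)) (act (tr a b p) (s b p))"
      by (rule act_deriv[OF t W h sm sb])
    finally have "(\<Sum>i\<in>UNIV. ?R $ i $ k *\<^sub>R nabla M s a p $ i) =
       act (tr a b p) (dir_deriv ?X (s b)) + \<rho> (logdiff ?X p (tr a b) + (\<Sum>i\<in>UNIV. ?R $ i $ k *\<^sub>R conn a i p)) (s a p)"
      using st[OF W(2)] by (simp add: nabla_nth[OF p(1)] scaleR_add_right sum.distrib lie_matrix_linear)
    also have "\<dots> = act (tr a b p) (nabla M s b p $ k)"
      using st[OF W(2)] by (simp add: nabla_nth[OF p(2)] act_linear act_lie[OF h[OF W(2)]] conn_transition[OF p])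
    finally show ?thesis ..
  qed
  have o: "(\<Sum>k\<in>UNIV. ?R $ l $ k * ?R $ i $ k) = (if l = i then 1 else 0)" for l i
    using hp(3) by (simp add: vec_eq_iff matrix_matrix_mult_def transpose_def mat_def)
  have "spin_act1 \<gamma> (tr a b p) (nabla M s b p) $ l = nabla M s a p $ l" for l
  proof -
    have "spin_act1 \<gamma> (tr a b p) (nabla M s b p) $ l = (\<Sum>k\<in>UNIV. \<Sum>i\<in>UNIV. (?R $ l $ k * ?R $ i $ k) *\<^sub>R nabla M s a p $ i)"
      by (simp add: spin_act1_nth rot_vec_def * scaleR_sum_right)
    also have "\<dots> = (\<Sum>i\<in>UNIV. (\<Sum>k\<in>UNIV. ?R $ l $ k * ?R $ i $ k) *\<^sub>R nabla M s a p $ i)"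
      by (subst sum.swap) (simp add: scaleR_sum_left)
    finally show ?thesis by (simp add: o if_distrib[where f = "\<lambda>r. r *\<^sub>R _"] cong: if_cong)
  qed
  then show ?thesis by (simp add: vec_eq_iff)
qed

section \<open>Sections and the action of symbols on them\<close>

abbreviation "Sec j \<equiv> sections M (bundle_E M (Ker j))"
abbreviation "Sec1 j \<equiv> sections M (bundle_ET M (Ker j))"

lemma SecD:
  assumes "s \<in> Sec j"
  shows "p \<notin> U a \<Longrightarrow> s a p = 0" "smooth_fun A (U a) (s a)" "p \<in> U a \<Longrightarrow> s a p \<in> Ker j"
    "p \<in> U a \<Longrightarrow> p \<in> U b \<Longrightarrow> s a p = act (tr a b p) (s b p)"
proof -
  note * = assms[unfolded sections_def bundle_E_def mem_Collect_eq fibre.simps]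
  show "p \<notin> U a \<Longrightarrow> s a p = 0" "smooth_fun A (U a) (s a)" "p \<in> U a \<Longrightarrow> s a p \<in> Ker j"
    using * by blast+
  show "p \<in> U a \<Longrightarrow> p \<in> U b \<Longrightarrow> s a p = act (tr a b p) (s b p)"
    using * by blast
qed

lemma SecI:
  assumes "\<And>a p. p \<notin> U a \<Longrightarrow> s a p = 0" "\<And>a. smooth_fun A (U a) (s a)" "\<And>a p. p \<in> U a \<Longrightarrow> s a p \<in> Ker j"
    "\<And>a b p. p \<in> U a \<Longrightarrow> p \<in> U b \<Longrightarrow> s a p = act (tr a b p) (s b p)"
  shows "s \<in> Sec j"
  unfolding sections_def bundle_E_def mem_Collect_eq fibre.simps
  using assms by blast

lemma Sec1D:
  assumes "x \<in> Sec1 j"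
  shows "p \<notin> U a \<Longrightarrow> x a p = 0" "smooth_fun A (U a) (x a)" "p \<in> U a \<Longrightarrow> x a p \<in> fibre1 (Ker j)"
    "p \<in> U a \<Longrightarrow> p \<in> U b \<Longrightarrow> x a p = spin_act1 \<gamma> (tr a b p) (x b p)"
proof -
  note * = assms[unfolded sections_def bundle_ET_def mem_Collect_eq fibre.simps]
  show "p \<notin> U a \<Longrightarrow> x a p = 0" "smooth_fun A (U a) (x a)" "p \<in> U a \<Longrightarrow> x a p \<in> fibre1 (Ker j)"
    using * by blast+
  show "p \<in> U a \<Longrightarrow> p \<in> U b \<Longrightarrow> x a p = spin_act1 \<gamma> (tr a b p) (x b p)"
    using * by blast
qed

lemma Sec1I:
  assumes "\<And>a p. p \<notin> U a \<Longrightarrow> x a p = 0" "\<And>a. smooth_fun A (U a) (x a)" "\<And>a p. p \<in> U a \<Longrightarrow> x a p \<in> fibre1 (Ker j)"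
    "\<And>a b p. p \<in> U a \<Longrightarrow> p \<in> U b \<Longrightarrow> x a p = spin_act1 \<gamma> (tr a b p) (x b p)"
  shows "x \<in> Sec1 j"
  unfolding sections_def bundle_ET_def mem_Collect_eq fibre.simps
  using assms by blast

lemma nabla_Ker:
  assumes s: "s \<in> Sec j" and p: "p \<in> U a"
  shows "nabla M s a p $ k \<in> Ker j"
proof -
  have "dir_deriv (e a k p) (s a) \<in> Ker j"
    by (rule dir_deriv_subspace[OF subspace_Ker frame_tangent[OF p] smooth_atI[OF SecD(2)[OF s] open_U p] open_U p SecD(3)[OF s]])
  then show ?thesis unfolding nabla_nth[OF p]
    by (intro Ker_scale Ker_lie skew_conn[OF p] SecD(3)[OF s p])
qed

lemma nabla_section:
  assumes s: "s \<in> Sec j"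
  shows "nabla M s \<in> Sec1 j"
proof (rule Sec1I)
  fix a b p
  show "p \<notin> U a \<Longrightarrow> nabla M s a p = 0" by (simp add: nabla_def vec_eq_iff)
  show "smooth_fun A (U a) (nabla M s a)"
    by (intro smooth_fun_vec open_U nabla_smooth_nth SecD(2)[OF s])
  show "p \<in> U a \<Longrightarrow> nabla M s a p \<in> fibre1 (Ker j)"
    using nabla_Ker[OF s] by (simp add: fibre1_def)
  assume p: "p \<in> U a" "p \<in> U b"
  show "nabla M s a p = spin_act1 \<gamma> (tr a b p) (nabla M s b p)"
    by (rule nabla_transition[OF SecD(2)[OF s] SecD(2)[OF s] _ p]) (use SecD(4)[OF s] in blast)
qed

lemma symbol_section:
  assumes L: "linear_symbol L" and K: "\<And>x. (\<And>k. x k \<in> Ker j) \<Longrightarrow> L x \<in> Ker i" and x: "x \<in> Sec1 j"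
  shows "(\<lambda>a p. L (($) (x a p))) \<in> Sec i"
proof (rule SecI)
  have lin: "linear (\<lambda>x :: ('n, 's) twisted1. L (($) x))" using L by (simp add: linear_symbol_def)
  fix a b p
  show "p \<notin> U a \<Longrightarrow> L (($) (x a p)) = 0" using Sec1D(1)[OF x] linear_0[OF lin] by simp
  show "smooth_fun A (U a) (\<lambda>p. L (($) (x a p)))"
    by (rule smooth_fun_linear[OF _ open_U Sec1D(2)[OF x]]) (use lin in \<open>simp add: linear_conv_bounded_linear\<close>)
  show "p \<in> U a \<Longrightarrow> L (($) (x a p)) \<in> Ker i" by (rule K) (use Sec1D(3)[OF x] in \<open>auto simp: fibre1_def\<close>)
  assume p: "p \<in> U a" "p \<in> U b"
  have "($) (x a p) = rot_vec (tr a b p) (($) (x b p))"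
    using Sec1D(4)[OF x p] by (simp add: fun_eq_iff spin_act1_nth)
  then show "L (($) (x a p)) = act (tr a b p) (L (($) (x b p)))"
    using L transition_spin[OF p] by (simp add: linear_symbol_def)
qed

text \<open>Equivariance carries the connection through \<open>L\<close> to both factors of the
  tensor product, where it joins the derivative to form \<open>second\<close>.\<close>

lemma nabla_symbol:
  assumes L: "linear_symbol L" and s: "smooth_fun A (U a) (s a)" and p: "p \<in> U a"
  shows "nabla M (\<lambda>a p. L (($) (nabla M s a p))) a p $ l = L (second s a p l)"
proof -
  have lin: "linear (\<lambda>x :: ('n, 's) twisted1. L (($) x))" using L by (simp add: linear_symbol_def)
  then have bl: "bounded_linear (\<lambda>x :: ('n, 's) twisted1. L (($) x))" by (simp add: linear_conv_bounded_linear)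
  have sn: "smooth_fun A (U a) (nabla M s a)" by (intro smooth_fun_vec open_U nabla_smooth_nth s)
  have t: "e a l p \<in> tangent_space A p" by (rule frame_tangent[OF p])
  have sp: "smooth_at p (nabla M s a)" by (rule smooth_atI[OF sn open_U p])
  define x where "x = dir_deriv (e a l p) (nabla M s a)"
  have xk: "x $ k = dir_deriv (e a l p) (\<lambda>q. nabla M s a q $ k)" for k
    using dir_deriv_linear[OF bounded_linear_vec_nth t sp] by (simp add: x_def)
  define y where "y = (\<chi> k. \<rho> (conn a l p) (nabla M s a p $ k) + (\<Sum>m\<in>UNIV. conn a l p $ k $ m *\<^sub>R nabla M s a p $ m))"
  have "nabla M (\<lambda>a p. L (($) (nabla M s a p))) a p $ l = L (($) x) + \<rho> (conn a l p) (L (($) (nabla M s a p)))"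
    by (simp add: nabla_nth[OF p] dir_deriv_linear[OF bl t sp] x_def)
  also have "\<rho> (conn a l p) (L (($) (nabla M s a p))) = L (($) y)"
    using L skew_conn[OF p] unfolding linear_symbol_def y_def by (simp add: vec_nth_lambda)
  also have "L (($) x) + L (($) y) = L (($) (x + y))" by (rule linear_add[OF lin, symmetric])
  also have "($) (x + y) = second s a p l"
    by (simp add: fun_eq_iff second_def xk y_def add.assoc)
  finally show ?thesis .
qed

lemma second_Ker:
  assumes s: "s \<in> Sec j" and p: "p \<in> U a"
  shows "second s a p l k \<in> Ker j"
proof -
  have "dir_deriv (e a l p) (\<lambda>q. nabla M s a q $ k) \<in> Ker j"
    by (rule dir_deriv_subspace[OF subspace_Ker frame_tangent[OF p] smooth_atI[OF nabla_smooth_nth[where s = s and a = a, OF SecD(2)[OF s]] open_U p] open_U p])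
      (rule nabla_Ker[OF s])
  then show ?thesis unfolding second_def
    by (intro Ker_scale Ker_lie skew_conn[OF p] nabla_Ker[OF s p])
qed

lemma symbol2:
  assumes "linear_symbol L" and s: "s \<in> Sec j" and "p \<in> U a"
  shows "L' (($) (nabla M (\<lambda>a p. L (($) (nabla M s a p))) a p)) = L' (\<lambda>l. L (second s a p l))"
proof -
  have "($) (nabla M (\<lambda>a p. L (($) (nabla M s a p))) a p) = (\<lambda>l. L (second s a p l))"
    using nabla_symbol[where s = s and a = a, OF assms(1) SecD(2)[OF s] assms(3)] by (simp add: fun_eq_iff)
  then show ?thesis by simp
qed

subsection \<open>Divergences\<close>

text \<open>The divergence of the frame field with index \<open>k\<close>, as the trace of its
  covariant derivative.\<close>

definition frame_div :: "'i \<Rightarrow> 'n \<Rightarrow> 'm \<Rightarrow> real" where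
  "frame_div a k p = (\<Sum>l\<in>UNIV. conn a l p $ l $ k)"

definition Div :: "'i \<Rightarrow> ('n \<Rightarrow> 'm \<Rightarrow> ('n, 's) twisted) \<Rightarrow> 'm \<Rightarrow> ('n, 's) twisted" where
  "Div a V p = (\<Sum>k\<in>UNIV. dir_deriv (e a k p) (V k) + \<rho> (conn a k p) (V k p) + frame_div a k p *\<^sub>R V k p)"

text \<open>The equivariant family \<open>F\<close> is parallel: its correction terms sum, by
  skewness of the connection, to minus the divergence terms, so only \<open>F\<close> applied to the
  covariant derivative remains.\<close>

lemma Div_op:
  assumes lin: "\<And>k. linear (F k)"
    and eq: "\<And>a k \<phi>. skew a \<Longrightarrow> \<rho> a (F k \<phi>) = F k (\<rho> a \<phi>) + (\<Sum>l\<in>UNIV. a $ l $ k *\<^sub>R F l \<phi>)"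
    and s: "smooth_fun A (U a) (s a)" and p: "p \<in> U a"
  shows "Div a (\<lambda>k q. F k (s a q)) p = (\<Sum>k\<in>UNIV. F k (nabla M s a p $ k))"
proof -
  have sp: "smooth_at p (s a)" by (rule smooth_atI[OF s open_U p])
  have bl: "bounded_linear (F k)" for k using lin by (simp add: linear_conv_bounded_linear)
  have "(\<Sum>k\<in>UNIV. \<Sum>l\<in>UNIV. conn a k p $ l $ k *\<^sub>R F l (s a p)) = (\<Sum>l\<in>UNIV. (\<Sum>k\<in>UNIV. conn a k p $ l $ k) *\<^sub>R F l (s a p))"
    by (subst sum.swap) (simp add: scaleR_sum_left)
  also have "\<dots> = - (\<Sum>l\<in>UNIV. frame_div a l p *\<^sub>R F l (s a p))"
    by (simp add: frame_div_def sum_negf[symmetric] skewD[OF skew_conn[OF p], of _ l l for l])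
      (intro sum.cong refl, subst skewD[OF skew_conn[OF p]], simp add: sum_negf)
  finally show ?thesis
    unfolding Div_def eq[OF skew_conn[OF p]]
    by (simp add: dir_deriv_linear[OF bl frame_tangent[OF p] sp] sum.distrib nabla_nth[OF p] linear_add[OF lin])
qed

lemma Div_nabla:
  assumes p: "p \<in> U a"
  shows "Div a (\<lambda>k q. nabla M s a q $ k) p = (\<Sum>k\<in>UNIV. second s a p k k)"
proof -
  have "(\<Sum>k\<in>UNIV. frame_div a k p *\<^sub>R nabla M s a p $ k) = (\<Sum>k\<in>UNIV. \<Sum>m\<in>UNIV. conn a k p $ k $ m *\<^sub>R nabla M s a p $ m)"
    unfolding frame_div_def scaleR_sum_left by (rule sum.swap)
  then show ?thesis by (simp add: Div_def second_def sum.distrib)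
qed

text \<open>Pointwise integration by parts: the right-hand side is the divergence of the complex
  vector field with components \<open>herm (s a p) (V k p)\<close>. The connection terms cancel
  because \<open>\<rho>\<close> is skew-Hermitian.\<close>

lemma herm_nabla:
  assumes s: "smooth_fun A (U a) (s a)" and V: "\<And>k. smooth_fun A (U a) (V k)" and p: "p \<in> U a"
  shows "(\<Sum>k\<in>UNIV. herm (nabla M s a p $ k) (V k p)) + herm (s a p) (Div a V p) =
    (\<Sum>k\<in>UNIV. dir_deriv (e a k p) (\<lambda>q. herm (s a q) (V k q)) + frame_div a k p *\<^sub>R herm (s a p) (V k p))"
proof -
  have "dir_deriv (e a k p) (\<lambda>q. herm (s a q) (V k q)) = herm (dir_deriv (e a k p) (s a)) (V k p) + herm (s a p) (dir_deriv (e a k p) (V k))" for k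
    by (rule dir_deriv_bilinear[OF bounded_bilinear_herm frame_tangent[OF p] smooth_atI[OF s open_U p] smooth_atI[OF V open_U p]])
  then show ?thesis
    by (simp add: nabla_nth[OF p] Div_def herm_add herm_sum herm_scaleR herm_lie[OF skew_conn[OF p]] sum.distrib sum_subtractf)
qed

end

section \<open>Integration\<close>

lemma smooth_on_extend_zero:
  fixes f :: "'a::euclidean_space \<Rightarrow> 'b::real_normed_vector"
  assumes \<Omega>: "open \<Omega>" and K: "compact K" "K \<subseteq> \<Omega>" and f: "smooth_on \<Omega> f" "\<And>x. x \<in> \<Omega> - K \<Longrightarrow> f x = 0"
  shows "smooth_on UNIV (\<lambda>x. if x \<in> \<Omega> then f x else 0)"
proof (rule smooth_on_local)
  fix x :: 'a
  have oK: "open (- K)" using K(1) compact_imp_closed by blast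
  show "\<exists>T. open T \<and> x \<in> T \<and> smooth_on T (\<lambda>x. if x \<in> \<Omega> then f x else 0)"
  proof (cases "x \<in> \<Omega>")
    case True
    have "smooth_on \<Omega> (\<lambda>x. if x \<in> \<Omega> then f x else 0)"
      by (rule smooth_on_cong[OF \<Omega>, THEN iffD1, OF _ f(1)]) simp
    then show ?thesis using True \<Omega> by blast
  next
    case False
    have "smooth_on (- K) (\<lambda>x. if x \<in> \<Omega> then f x else 0)"
      by (rule smooth_on_cong[OF oK, THEN iffD1, OF _ smooth_on_const[of _ 0]]) (use f(2) in auto)
    then show ?thesis using False K oK by blast
  qed
qed

lemma integrable_lborel_compact_support:
  fixes f :: "'a::euclidean_space \<Rightarrow> 'b::{banach, second_countable_topology}"
  assumes "continuous_on UNIV f" "compact K" "\<And>x. x \<notin> K \<Longrightarrow> f x = 0"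
  shows "integrable lborel f"
proof -
  have "integrable lborel (\<lambda>x. indicator K x *\<^sub>R f x)"
    by (rule borel_integrable_compact[OF assms(2)]) (use assms(1) continuous_on_subset in blast)
  moreover have "(\<lambda>x. indicator K x *\<^sub>R f x) = f" using assms(3) by (auto simp: indicator_def)
  ultimately show ?thesis by simp
qed

lemma integral_lborel_translate:
  fixes f :: "'a::euclidean_space \<Rightarrow> real"
  assumes "f \<in> borel_measurable borel"
  shows "(LINT x|lborel. f (c + x)) = (LINT x|lborel. f x)"
  using integral_distr[of "(+) c" lborel borel f] assms by (simp add: lborel_distr_plus)

lemma integrable_lborel_translate:
  fixes f :: "'a::euclidean_space \<Rightarrow> real"
  assumes "f \<in> borel_measurable borel"
  shows "integrable lborel (\<lambda>x. f (c + x)) \<longleftrightarrow> integrable lborel f"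
  using integrable_distr_eq[of "(+) c" lborel borel f] assms by (simp add: lborel_distr_plus)

text \<open>The integral of a difference quotient vanishes by translation invariance; pass to the limit.\<close>

lemma integral_derivative_eq_0:
  fixes F :: "'a::euclidean_space \<Rightarrow> real"
  assumes F: "smooth_on UNIV F" and K: "compact K" "\<And>x. x \<notin> K \<Longrightarrow> F x = 0"
  shows "integrable lborel (\<lambda>x. frechet_derivative F (at x) v)"
    and "(LINT x|lborel. frechet_derivative F (at x) v) = 0"
proof -
  let ?D = "\<lambda>x. frechet_derivative F (at x) v"
  have cF: "continuous_on UNIV F" and cD: "continuous_on UNIV ?D"
    using smooth_on_continuous[OF F] smooth_on_continuous[OF smooth_on_derivative[OF F]] by auto
  have oK: "open (- K)" using K(1) compact_imp_closed by blast
  have D: "(F has_derivative frechet_derivative F (at x)) (at x)" for x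
    by (rule smooth_on_has_derivative[OF F UNIV_I])
  have D0: "?D x = 0" if "x \<notin> K" for x
  proof -
    have "(F has_derivative (\<lambda>_. 0)) (at x)"
      by (rule has_derivative_transform_within_open[OF has_derivative_const oK]) (use that K(2) in auto)
    then show ?thesis using frechet_derivative_at by metis
  qed
  show intD: "integrable lborel ?D"
    by (rule integrable_lborel_compact_support[OF cD K(1) D0])
  obtain B where B: "\<And>x. norm (?D x) \<le> B" "B \<ge> 0"
  proof -
    have "compact (?D ` K)" using K(1) cD by (intro compact_continuous_image) (auto intro: continuous_on_subset)
    then have "bounded (?D ` K)" by (rule compact_imp_bounded)
    then obtain B where B: "\<And>y. y \<in> ?D ` K \<Longrightarrow> norm y \<le> B" unfolding bounded_iff by blast
    have "norm (?D x) \<le> max B 0" for x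
    proof (cases "x \<in> K")
      case True
      then show ?thesis using B[of "?D x"] by fastforce
    next
      case False
      then show ?thesis using D0[OF False] by simp
    qed
    then show ?thesis using that[of "max B 0"] by simp
  qed
  \<comment> \<open>All difference quotients with step at most 1 are supported in this set, which
    makes a constant times its indicator an integrable majorant.\<close>
  define K1 where "K1 = (\<lambda>(y, s). y - s *\<^sub>R v) ` (K \<times> {0..1::real})"
  have K1: "compact K1" unfolding K1_def
    by (intro compact_continuous_image compact_Times K(1) compact_Icc) (auto intro!: continuous_intros simp: case_prod_beta)
  define t where "t = (\<lambda>i :: nat. inverse (real (Suc i)))"
  have t: "0 < t i" "t i \<le> 1" for i by (auto simp: t_def field_simps)
  have tlim: "t \<longlonglongrightarrow> 0" unfolding t_def by (rule LIMSEQ_inverse_real_of_nat)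
  define q where "q = (\<lambda>i x. (F (t i *\<^sub>R v + x) - F x) / t i)"
  have mF: "F \<in> borel_measurable borel" by (rule borel_measurable_continuous_onI[OF cF])
  have intF: "integrable lborel F" by (rule integrable_lborel_compact_support[OF cF K])
  have line: "((\<lambda>s. F (s *\<^sub>R v + x)) has_real_derivative ?D (s *\<^sub>R v + x)) (at s)" for x s
  proof -
    have "((\<lambda>s. s *\<^sub>R v + x) has_derivative (\<lambda>h. h *\<^sub>R v)) (at s)" by (auto intro!: derivative_eq_intros)
    from has_derivative_compose[OF this D]
    have "((\<lambda>s. F (s *\<^sub>R v + x)) has_derivative (\<lambda>h. frechet_derivative F (at (s *\<^sub>R v + x)) (h *\<^sub>R v))) (at s)" .
    moreover have "frechet_derivative F (at (s *\<^sub>R v + x)) (h *\<^sub>R v) = ?D (s *\<^sub>R v + x) * h" for h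
      using linear_scale[OF has_derivative_linear[OF D]] by (simp add: mult.commute)
    ultimately show ?thesis by (simp add: has_field_derivative_def)
  qed
  have qlim: "(\<lambda>i. q i x) \<longlonglongrightarrow> ?D x" for x
  proof -
    have "((\<lambda>h. (F (h *\<^sub>R v + x) - F x) / h) \<longlongrightarrow> ?D x) (at 0)"
      using line[of x 0] by (simp add: DERIV_def)
    moreover have "filterlim t (at 0) sequentially"
      using tlim t(1) by (auto simp: filterlim_at intro!: always_eventually) (metis less_irrefl)
    ultimately show ?thesis unfolding q_def by (rule filterlim_compose)
  qed
  have qb: "norm (q i x) \<le> B * indicator K1 x" for i x
  proof (cases "x \<in> K1")
    case True
    obtain z where z: "F (t i *\<^sub>R v + x) - F (0 *\<^sub>R v + x) = (t i - 0) * ?D (z *\<^sub>R v + x)"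
      using MVT2[of 0 "t i" "\<lambda>s. F (s *\<^sub>R v + x)" "\<lambda>s. ?D (s *\<^sub>R v + x)"] line t(1)[of i] by metis
    then have "q i x = ?D (z *\<^sub>R v + x)" using t(1)[of i] by (simp add: q_def)
    then show ?thesis using True B(1) by simp
  next
    case False
    have "x \<notin> K"
    proof
      assume "x \<in> K"
      then have "(\<lambda>(y, s). y - s *\<^sub>R v) (x, 0) \<in> K1" unfolding K1_def by (intro imageI) auto
      then show False using False by simp
    qed
    moreover have "t i *\<^sub>R v + x \<notin> K"
    proof
      assume "t i *\<^sub>R v + x \<in> K"
      then have "(\<lambda>(y, s). y - s *\<^sub>R v) (t i *\<^sub>R v + x, t i) \<in> K1" unfolding K1_def using t[of i] by (intro imageI) auto
      then show False using False by simp
    qed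
    ultimately show ?thesis using K(2) False by (simp add: q_def)
  qed
  have intB: "integrable lborel (\<lambda>x. B * indicator K1 x)"
    using borel_integrable_compact[OF K1, of "\<lambda>x. 1 :: real"] by simp
  have q0: "(LINT x|lborel. q i x) = 0" for i
    using integral_lborel_translate[OF mF, of "t i *\<^sub>R v"] integrable_lborel_translate[OF mF, of "t i *\<^sub>R v"] intF
    by (simp add: q_def)
  have "(\<lambda>i. LINT x|lborel. q i x) \<longlonglongrightarrow> (LINT x|lborel. ?D x)"
  proof (rule integral_dominated_convergence[OF _ _ intB])
    show "?D \<in> borel_measurable lborel" using borel_measurable_continuous_onI[OF cD] by simp
    have "continuous_on UNIV (q i)" for i
      unfolding q_def using t(1)[of i] by (intro continuous_intros continuous_on_compose2[OF cF]) auto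
    from borel_measurable_continuous_onI[OF this] show "q i \<in> borel_measurable lborel" for i by simp
  qed (use qlim qb in auto)
  then show "(LINT x|lborel. ?D x) = 0" unfolding q0 using LIMSEQ_unique tendsto_const by blast
qed

lemma integral_continuous_nonneg_eq_0:
  fixes f :: "'a::euclidean_space \<Rightarrow> real"
  assumes f: "continuous_on UNIV f" "integrable lborel f" "\<And>x. 0 \<le> f x" and z: "(LINT x|lborel. f x) = 0"
  shows "f x = 0"
proof (rule ccontr)
  assume "f x \<noteq> 0"
  then have x: "x \<in> {x. 0 < f x}" using f(3)[of x] by simp
  have "AE x in lborel. f x = 0" using integral_nonneg_eq_0_iff_AE[OF f(2)] f(3) z by simp
  then have "AE x in lborel. x \<notin> {x. 0 < f x}" by eventually_elim simp
  moreover have o: "open {x. 0 < f x}" by (rule open_Collect_less[OF continuous_on_const f(1)])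
  ultimately have "{x. 0 < f x} \<in> null_sets lborel"
    using AE_iff_null_sets[of "{x. 0 < f x}" lborel] by auto
  then have "negligible {x. 0 < f x}" using negligible_iff_null_sets null_sets_completionI by blast
  then show False using open_not_negligible[OF o] x by blast
qed

subsection \<open>The derivative of the determinant\<close>

lemma has_derivative_det_identity:
  fixes N :: "'a::real_normed_vector \<Rightarrow> real^'n^'n::finite"
  assumes N: "\<And>i k. ((\<lambda>x. N x $ i $ k) has_derivative (\<lambda>h. N' h $ i $ k)) (at x)" and 1: "N x = mat 1"
  shows "((\<lambda>x. det (N x)) has_derivative (\<lambda>h. trace (N' h))) (at x)"
proof -
  let ?P = "{p. p permutes (UNIV :: 'n set)}"
  have "((\<lambda>x. \<Sum>p\<in>?P. of_int (sign p) * (\<Prod>i\<in>UNIV. N x $ i $ p i)) has_derivative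
      (\<lambda>h. \<Sum>p\<in>?P. of_int (sign p) * (\<Sum>i\<in>UNIV. N' h $ i $ p i * (\<Prod>j\<in>UNIV - {i}. N x $ j $ p j)))) (at x)"
    by (intro has_derivative_sum has_derivative_mult_right has_derivative_prod N)
  moreover have "(\<Sum>p\<in>?P. of_int (sign p) * (\<Sum>i\<in>UNIV. N' h $ i $ p i * (\<Prod>j\<in>UNIV - {i}. N x $ j $ p j))) = trace (N' h)" for h
  proof -
    have z: "(\<Prod>j\<in>UNIV - {i}. N x $ j $ p j) = 0" if p: "p permutes UNIV" "p \<noteq> id" for p :: "'n \<Rightarrow> 'n" and i
    proof -
      have "\<exists>j. j \<noteq> i \<and> p j \<noteq> j"
      proof (rule ccontr)
        assume "\<not> ?thesis"
        then have *: "\<And>j. j \<noteq> i \<Longrightarrow> p j = j" by blast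
        moreover have "p i = i" using permutes_inj[OF p(1)] * by (metis injD)
        ultimately show False using p(2) by (metis eq_id_iff)
      qed
      then obtain j where "j \<noteq> i" "p j \<noteq> j" by blast
      then show ?thesis using 1 by (intro prod_zero) (auto simp: mat_def intro!: bexI[of _ j])
    qed
    have "(\<Sum>p\<in>?P. of_int (sign p) * (\<Sum>i\<in>UNIV. N' h $ i $ p i * (\<Prod>j\<in>UNIV - {i}. N x $ j $ p j))) =
        (\<Sum>p\<in>{id}. of_int (sign p) * (\<Sum>i\<in>UNIV. N' h $ i $ p i * (\<Prod>j\<in>UNIV - {i}. N x $ j $ p j)))"
      by (rule sum.mono_neutral_right) (auto simp: permutes_id z)
    also have "\<dots> = trace (N' h)" by (simp add: sign_id trace_def 1 mat_def)
    finally show ?thesis .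
  qed
  ultimately show ?thesis by (simp add: det_def[of "N _", abs_def])
qed

text \<open>Jacobi's formula: multiplication by the fixed inverse reduces it to differentiation at
  the identity matrix.\<close>

lemma has_derivative_det:
  fixes M :: "'a::real_normed_vector \<Rightarrow> real^'n^'n::finite"
  assumes M: "\<And>i k. ((\<lambda>x. M x $ i $ k) has_derivative (\<lambda>h. M' h $ i $ k)) (at x)" and inv: "J ** M x = mat 1"
  shows "((\<lambda>x. det (M x)) has_derivative (\<lambda>h. det (M x) * trace (J ** M' h))) (at x)"
proof -
  have d: "det J * det (M x) = 1" using inv det_mul[of J "M x"] by simp
  have "((\<lambda>x. (J ** M x) $ i $ k) has_derivative (\<lambda>h. (J ** M' h) $ i $ k)) (at x)" for i k
    unfolding matrix_matrix_mult_def by (simp, intro has_derivative_sum has_derivative_mult_right M)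
  then have "((\<lambda>x. det (J ** M x)) has_derivative (\<lambda>h. trace (J ** M' h))) (at x)"
    by (rule has_derivative_det_identity[where N = "\<lambda>x. J ** M x"]) (rule inv)
  from has_derivative_mult_right[OF this, of "det (M x)"]
  have "((\<lambda>y. det (M y) * (det J * det (M x))) has_derivative (\<lambda>h. det (M x) * trace (J ** M' h))) (at x)"
    by (simp only: det_mul mult_ac)
  then show ?thesis by (simp add: d)
qed

lemma smooth_on_prod:
  fixes f :: "'i \<Rightarrow> 'a::euclidean_space \<Rightarrow> real"
  assumes "open S" "\<And>i. i \<in> I \<Longrightarrow> smooth_on S (f i)"
  shows "smooth_on S (\<lambda>x. \<Prod>i\<in>I. f i x)"
  using assms(2)
proof (induction I rule: infinite_finite_induct)
  case (insert i I)
  then show ?case by (simp add: smooth_on_bilinear[OF bounded_bilinear_mult assms(1)])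
qed auto

lemma smooth_on_sum:
  assumes "open S" "\<And>i. i \<in> I \<Longrightarrow> smooth_on S (f i)"
  shows "smooth_on S (\<lambda>x. \<Sum>i\<in>I. f i x)"
  using assms unfolding smooth_on_def by (auto intro: k_smooth_on_sum)

lemma smooth_on_det:
  fixes M :: "'a::euclidean_space \<Rightarrow> real^'n^'n::finite"
  assumes "open S" "\<And>i k. smooth_on S (\<lambda>x. M x $ i $ k)"
  shows "smooth_on S (\<lambda>x. det (M x))"
  unfolding det_def
  by (intro smooth_on_sum smooth_on_bilinear[OF bounded_bilinear_mult] smooth_on_prod assms smooth_on_const)

lemma smooth_on_abs: "smooth_on (- {0}) (abs :: real \<Rightarrow> real)"
proof (rule smooth_on_local)
  fix x :: real assume "x \<in> - {0}"
  then consider "x > 0" | "x < 0" by fastforce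
  then show "\<exists>T. open T \<and> x \<in> T \<and> smooth_on T (abs :: real \<Rightarrow> real)"
  proof cases
    case 1
    have "smooth_on {0<..} (abs :: real \<Rightarrow> real)"
      by (rule smooth_on_cong[THEN iffD1, OF _ _ smooth_on_ident]) auto
    then show ?thesis using 1 by (intro exI[of _ "{0<..}"]) auto
  next
    case 2
    have "smooth_on {..<0} (abs :: real \<Rightarrow> real)"
      by (rule smooth_on_cong[THEN iffD1, OF _ _ smooth_on_linear[OF bounded_linear_minus[OF bounded_linear_ident] _ smooth_on_ident]]) auto
    then show ?thesis using 2 by (intro exI[of _ "{..<0}"]) auto
  qed
qed

lemma continuous_on_extend_zero:
  assumes "open \<Omega>" "closed K" "K \<subseteq> \<Omega>" "continuous_on \<Omega> f" "\<And>x. x \<in> \<Omega> - K \<Longrightarrow> f x = 0"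
  shows "continuous_on UNIV (\<lambda>x. if x \<in> \<Omega> then f x else 0)"
proof -
  have "continuous_on \<Omega> (\<lambda>x. if x \<in> \<Omega> then f x else 0)"
    by (rule continuous_on_cong[THEN iffD1, OF refl _ assms(4)]) simp
  moreover have "continuous_on (- K) (\<lambda>x. if x \<in> \<Omega> then f x else 0)"
    by (rule continuous_on_cong[THEN iffD1, OF refl _ continuous_on_const[of _ 0]]) (use assms(5) in auto)
  ultimately have "continuous_on (\<Omega> \<union> - K) (\<lambda>x. if x \<in> \<Omega> then f x else 0)"
    using assms(1,2) by (intro continuous_on_open_Un) auto
  moreover have "\<Omega> \<union> - K = UNIV" using assms(3) by blast
  ultimately show ?thesis by simp
qed

context spin_geometry
begin

subsection \<open>The Riemannian volume in a chart\<close>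

definition coord_frame :: "('m, 'n) chart \<Rightarrow> 'i \<Rightarrow> 'm \<Rightarrow> ((real, 'n) vec, 'n) vec" where
  "coord_frame c a p = (\<chi> i k. e a k p (\<lambda>q. snd c q $ i))"

context
  fixes c :: "('m, 'n) chart" and a :: 'i
  assumes c: "c \<in> A"
begin

lemma coord_smooth_at:
  assumes "p \<in> fst c"
  shows "smooth_at p (\<lambda>q. snd c q $ i)"
  by (rule smooth_at_linear[OF bounded_linear_vec_nth smooth_atI[OF smooth_fun_chart[OF c chart(1)[OF c] order_refl] chart(1)[OF c] assms]])

lemma coord_tangent_coord:
  assumes p: "p \<in> fst c"
  shows "coord_tangent A c p v (\<lambda>q. snd c q $ i) = v $ i"
proof -
  have "((\<lambda>x. x $ i) has_derivative (\<lambda>h. h $ i)) (at (snd c p))"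
    by (rule bounded_linear_imp_has_derivative[OF bounded_linear_vec_nth])
  then have "((\<lambda>x. snd c (chart_inv c x) $ i) has_derivative (\<lambda>h. h $ i)) (at (snd c p))"
    by (rule has_derivative_transform_within_open[OF _ chart(2)[OF c]]) (use p c in auto)
  from fun_cong[OF frechet_derivative_at[OF this], of v] show ?thesis
    using dir_deriv_coord[OF c p coord_smooth_at[OF p], of v i] by (simp add: dir_deriv_real)
qed

lemma frame_coord:
  assumes p: "p \<in> fst c" "p \<in> U a"
  shows "e a k p = coord_tangent A c p (column k (coord_frame c a p))"
proof -
  obtain v where v: "e a k p = coord_tangent A c p v" using tangent_in_chart[OF frame_tangent[OF p(2)] c p(1)] by blast
  have "column k (coord_frame c a p) = v"
    by (simp add: vec_eq_iff column_def coord_frame_def v coord_tangent_coord[OF p(1)])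
  then show ?thesis using v by simp
qed

lemma frame_smooth_fun:
  assumes "smooth_fun A (U a) f" "p \<in> fst c" "p \<in> U a"
  shows "e a k p f = frechet_derivative (\<lambda>x. f (chart_inv c x)) (at (snd c p)) (column k (coord_frame c a p))"
  using dir_deriv_coord[OF c assms(2) smooth_atI[OF assms(1) open_U assms(3)]] by (simp add: frame_coord[OF assms(2,3)] dir_deriv_real)

text \<open>With \<open>E\<close> the coordinate matrix of the orthonormal frame and
  \<open>G\<close> the Gram matrix of the coordinate vectors, \<open>transpose E ** (G ** E)\<close>
  is the identity; take determinants.\<close>

lemma det_gram:
  assumes p: "p \<in> fst c" "p \<in> U a"
  defines "G \<equiv> (\<chi> i k. g p (coord_tangent A c p (axis i 1)) (coord_tangent A c p (axis k 1)))"
  shows "det (coord_frame c a p) \<noteq> 0" "sqrt (det G) = inverse \<bar>det (coord_frame c a p)\<bar>"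
proof -
  let ?E = "coord_frame c a p" and ?t = "\<lambda>i. coord_tangent A c p (axis i 1)"
  have t: "?t i \<in> tangent_space A p" for i by (rule coord_tangent_in[OF c p(1)])
  have "column k ?E = (\<Sum>i\<in>UNIV. ?E $ i $ k *\<^sub>R axis i 1)" for k
    by (simp add: vec_eq_iff column_def axis_def if_distrib cong: if_cong)
  then have ee: "e a k p = (\<lambda>f. \<Sum>i\<in>UNIV. ?E $ i $ k * ?t i f)" for k
    using coord_tangent_sum[OF c p(1)] by (simp add: frame_coord[OF p])
  have g1: "g p (e a k p) X = (\<Sum>i\<in>UNIV. ?E $ i $ k * g p (?t i) X)" if "X \<in> tangent_space A p" for k X
    by (subst ee, rule metric_sum) (use t that in auto)
  have "(transpose ?E ** (G ** ?E)) $ k $ l = mat 1 $ k $ l" for k l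
  proof -
    have "g p (e a k p) (e a l p) = (\<Sum>i\<in>UNIV. ?E $ i $ k * g p (e a l p) (?t i))"
      using g1[OF frame_tangent[OF p(2)]] metric_sym[OF t frame_tangent[OF p(2)]] by simp
    also have "\<dots> = (\<Sum>i\<in>UNIV. ?E $ i $ k * (\<Sum>m\<in>UNIV. ?E $ m $ l * g p (?t i) (?t m)))"
      using g1[OF t] metric_sym[OF t t] by simp
    also have "\<dots> = (transpose ?E ** (G ** ?E)) $ k $ l"
      by (simp add: matrix_matrix_mult_def transpose_def G_def mult.commute)
    finally show ?thesis by (simp add: frame_orthonormal[OF p(2)] mat_def)
  qed
  then have "transpose ?E ** (G ** ?E) = mat 1" by (simp add: vec_eq_iff)
  then have "det (transpose ?E ** (G ** ?E)) = 1" by simp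
  then have d: "det ?E * (det G * det ?E) = 1" by (simp add: det_mul)
  then show n: "det ?E \<noteq> 0" by auto
  with d have "det G = (inverse \<bar>det ?E\<bar>)\<^sup>2" by (simp add: field_simps power2_eq_square)
  then show "sqrt (det G) = inverse \<bar>det ?E\<bar>" by simp
qed

lemma coord_frame_smooth: "smooth_fun A (fst c \<inter> U a) (\<lambda>p. coord_frame c a p $ i $ k)"
  unfolding coord_frame_def
  by (simp, rule smooth_field_apply[OF frame_smooth])
    (use chart(1)[OF c] open_U in \<open>auto intro!: smooth_fun_linear[OF bounded_linear_vec_nth] smooth_fun_chart[OF c]\<close>)

abbreviation "Dom \<equiv> snd c ` (fst c \<inter> U a)"
abbreviation "dens x \<equiv> inverse \<bar>det (coord_frame c a (chart_inv c x))\<bar>"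

lemma open_dom: "open Dom" by (rule open_chart_image[OF c open_U])

lemma dom_inv: "x \<in> Dom \<Longrightarrow> chart_inv c x \<in> fst c" "x \<in> Dom \<Longrightarrow> chart_inv c x \<in> U a" "x \<in> Dom \<Longrightarrow> snd c (chart_inv c x) = x"
  using c by auto

lemma coord_frame_smooth_on: "smooth_on Dom (\<lambda>x. coord_frame c a (chart_inv c x) $ i $ k)"
  using coord_frame_smooth c unfolding smooth_fun_alt by fastforce

lemma dens_smooth: "smooth_on Dom (\<lambda>x. dens x)"
proof -
  have d: "smooth_on Dom (\<lambda>x. det (coord_frame c a (chart_inv c x)))"
    by (intro smooth_on_det open_dom coord_frame_smooth_on)
  have o: "open (- {0 :: real})" by auto
  have "smooth_on Dom (\<lambda>x. \<bar>det (coord_frame c a (chart_inv c x))\<bar>)"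
    by (rule smooth_on_compose[OF open_dom o _ d smooth_on_abs]) (use det_gram(1) dom_inv in auto)
  moreover have "(\<lambda>x. \<bar>det (coord_frame c a (chart_inv c x))\<bar>) ` Dom \<subseteq> - {0}"
    using det_gram(1) dom_inv by auto
  ultimately show ?thesis using smooth_on_compose[OF open_dom o _ _ smooth_on_inverse] by blast
qed

text \<open>The volume formula becomes an equality of measures, to which change of variables
  applies. The inverse chart is made total by an arbitrary value off \<open>Dom\<close>, where the
  weight is 0.\<close>

lemma vol_density:
  "density (vol M) (\<lambda>p. ennreal (indicator (fst c \<inter> U a) p)) =
   distr (density lborel (\<lambda>x. ennreal (if x \<in> Dom then dens x else 0))) borel (\<lambda>x. if x \<in> Dom then chart_inv c x else undefined)"
  (is "?L = distr (density lborel ?w) borel ?\<phi>")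
proof -
  have v: "is_riemannian_volume A g (vol M)" using spin by (simp add: is_spin_manifold_def)
  have sv: "sets (vol M) = sets borel" using v by (simp add: is_riemannian_volume_def)
  have bO: "fst c \<inter> U a \<in> sets borel" using chart(1)[OF c] open_U by auto
  have bd: "Dom \<in> sets borel" using open_dom by auto
  have ci: "continuous_on Dom (chart_inv c)"
    using chart(3)[OF c] by (auto simp: homeomorphism_def intro: continuous_on_subset)
  have mphi: "?\<phi> \<in> borel_measurable borel"
    by (rule borel_measurable_continuous_on_if[OF bd ci]) simp
  have mw: "(\<lambda>x. if x \<in> Dom then dens x else 0) \<in> borel_measurable borel"
    by (rule borel_measurable_continuous_on_if[OF bd smooth_on_continuous[OF dens_smooth]]) simp
  show ?thesis
  proof (rule measure_eqI)
    fix B assume "B \<in> sets ?L"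
    then have B: "B \<in> sets borel" by (simp add: sv)
    have "emeasure ?L B = (\<integral>\<^sup>+p. ennreal (indicator (fst c \<inter> U a) p) * indicator B p \<partial>vol M)"
      by (rule emeasure_density) (use B bO sv in \<open>auto simp: measurable_cong_sets[OF sv refl]\<close>)
    also have "\<dots> = (\<integral>\<^sup>+p. indicator (fst c \<inter> U a \<inter> B) p \<partial>vol M)"
      by (intro nn_integral_cong) (auto simp: indicator_def)
    also have "\<dots> = emeasure (vol M) (fst c \<inter> U a \<inter> B)"
      using B bO by (simp add: sv)
    also have "\<dots> = (\<integral>\<^sup>+x. indicator (snd c ` (fst c \<inter> U a \<inter> B)) x *
          (let p = inv_into (fst c) (snd c) x in
           ennreal (sqrt (det (\<chi> i k. g p (coord_tangent A c p (axis i 1)) (coord_tangent A c p (axis k 1))))))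
          \<partial>lborel)"
    proof -
      have "fst c \<inter> U a \<inter> B \<in> sets borel" using B bO by auto
      from v[unfolded is_riemannian_volume_def, THEN conjunct2, rule_format, OF c this]
      show ?thesis by blast
    qed
    also have "\<dots> = (\<integral>\<^sup>+x. ?w x * indicator (?\<phi> -` B) x \<partial>lborel)"
    proof (rule nn_integral_cong)
      fix x
      show "indicator (snd c ` (fst c \<inter> U a \<inter> B)) x *
          (let p = inv_into (fst c) (snd c) x in
           ennreal (sqrt (det (\<chi> i k. g p (coord_tangent A c p (axis i 1)) (coord_tangent A c p (axis k 1)))))) =
          ?w x * indicator (?\<phi> -` B) x"
      proof (cases "x \<in> Dom")
        case True
        have "x \<in> snd c ` (fst c \<inter> U a \<inter> B) \<longleftrightarrow> chart_inv c x \<in> B"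
        proof
          assume "chart_inv c x \<in> B"
          then have "snd c (chart_inv c x) \<in> snd c ` (fst c \<inter> U a \<inter> B)" using dom_inv[OF True] by blast
          then show "x \<in> snd c ` (fst c \<inter> U a \<inter> B)" using dom_inv(3)[OF True] by simp
        qed (use c in auto)
        then show ?thesis using True det_gram(2)[OF dom_inv(1,2)[OF True]] by (simp add: Let_def indicator_def)
      next
        case False
        then have "x \<notin> snd c ` (fst c \<inter> U a \<inter> B)" by blast
        then show ?thesis using False by (auto simp: indicator_def)
      qed
    qed
    also have "\<dots> = emeasure (density lborel ?w) (?\<phi> -` B)"
      by (rule emeasure_density[symmetric]) (use mw measurable_sets_borel[OF mphi B] in auto)
    also have "\<dots> = emeasure (distr (density lborel ?w) borel ?\<phi>) B"
      using emeasure_distr[of ?\<phi> "density lborel ?w" borel B] mphi B by simp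
    finally show "emeasure ?L B = emeasure (distr (density lborel ?w) borel ?\<phi>) B" .
  qed (simp add: sv)
qed

lemma vol_chart:
  fixes h :: "'m \<Rightarrow> 'b::{banach, second_countable_topology}"
  assumes K: "compact K" "K \<subseteq> fst c \<inter> U a" and h: "continuous_on (fst c \<inter> U a) h" "\<And>p. p \<notin> K \<Longrightarrow> h p = 0"
  shows "integrable (vol M) h" "(LINT p|vol M. h p) = (LINT x|lborel. (if x \<in> Dom then dens x *\<^sub>R h (chart_inv c x) else 0))"
    and "continuous_on UNIV (\<lambda>x. if x \<in> Dom then dens x *\<^sub>R h (chart_inv c x) else 0)"
    and "integrable lborel (\<lambda>x. if x \<in> Dom then dens x *\<^sub>R h (chart_inv c x) else 0)"
proof -
  let ?w = "\<lambda>x. if x \<in> Dom then dens x else 0"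
  let ?\<phi> = "\<lambda>x. if x \<in> Dom then chart_inv c x else undefined"
  let ?h = "\<lambda>x. if x \<in> Dom then dens x *\<^sub>R h (chart_inv c x) else 0"
  let ?I = "indicator (fst c \<inter> U a) :: 'm \<Rightarrow> real"
  have v: "is_riemannian_volume A g (vol M)" using spin by (simp add: is_spin_manifold_def)
  have sv: "sets (vol M) = sets borel" using v by (simp add: is_riemannian_volume_def)
  note mc = measurable_cong_sets[OF sv refl]
  have bO: "fst c \<inter> U a \<in> sets borel" using chart(1)[OF c] open_U by auto
  have bd: "Dom \<in> sets borel" using open_dom by auto
  have ci: "continuous_on Dom (chart_inv c)"
    using chart(3)[OF c] by (auto simp: homeomorphism_def intro: continuous_on_subset)
  have cs: "continuous_on (fst c) (snd c)" using chart(3)[OF c] by (simp add: homeomorphism_def)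
  have mphi: "?\<phi> \<in> borel_measurable borel"
    by (rule borel_measurable_continuous_on_if[OF bd ci]) simp
  have mw: "?w \<in> borel_measurable borel"
    by (rule borel_measurable_continuous_on_if[OF bd smooth_on_continuous[OF dens_smooth]]) simp
  have w0: "0 \<le> ?w x" for x by simp
  have hO: "h = (\<lambda>p. if p \<in> fst c \<inter> U a then h p else 0)" using K(2) h(2) by (auto simp: fun_eq_iff)
  have mh: "h \<in> borel_measurable borel"
    by (subst hO, rule borel_measurable_continuous_on_if[OF bO h(1)]) simp
  have hI: "(\<lambda>p. ?I p *\<^sub>R h p) = h" using K(2) h(2) by (auto simp: fun_eq_iff indicator_def)
  have hh: "(\<lambda>x. ?w x *\<^sub>R h (?\<phi> x)) = ?h" by auto
  define K' where "K' = snd c ` K"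
  have K': "compact K'" unfolding K'_def using K by (intro compact_continuous_image continuous_on_subset[OF cs]) auto
  have K'd: "K' \<subseteq> Dom" unfolding K'_def using K by blast
  have out: "h (chart_inv c x) = 0" if "x \<in> Dom - K'" for x
  proof (rule h(2))
    show "chart_inv c x \<notin> K"
    proof
      assume "chart_inv c x \<in> K"
      then have "snd c (chart_inv c x) \<in> K'" by (simp add: K'_def)
      then show False using that dom_inv(3) by simp
    qed
  qed
  have "continuous_on Dom (\<lambda>x. dens x *\<^sub>R h (chart_inv c x))"
    by (intro continuous_on_scaleR smooth_on_continuous[OF dens_smooth] continuous_on_compose2[OF h(1) ci]) (use dom_inv in auto)
  then show ch: "continuous_on UNIV ?h"
    by (rule continuous_on_extend_zero[OF open_dom compact_imp_closed[OF K'] K'd]) (simp add: out)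
  show ih: "integrable lborel ?h"
    by (rule integrable_lborel_compact_support[OF ch K']) (use out in auto)
  have 1: "integrable (density (vol M) (\<lambda>p. ennreal (?I p))) h \<longleftrightarrow> integrable (vol M) h"
    "integral\<^sup>L (density (vol M) (\<lambda>p. ennreal (?I p))) h = integral\<^sup>L (vol M) h"
    using integrable_density[of h "vol M" ?I] integral_density[of h "vol M" ?I] mh bO by (simp_all add: mc hI)
  have 2: "integrable (density lborel (\<lambda>x. ennreal (?w x))) (\<lambda>x. h (?\<phi> x)) \<longleftrightarrow> integrable lborel ?h"
    "integral\<^sup>L (density lborel (\<lambda>x. ennreal (?w x))) (\<lambda>x. h (?\<phi> x)) = integral\<^sup>L lborel ?h"
    unfolding hh[symmetric]
    by (rule integrable_density integral_density; use measurable_compose[OF mphi mh] mw w0 in simp)+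
  have 3: "integrable (distr (density lborel (\<lambda>x. ennreal (?w x))) borel ?\<phi>) h \<longleftrightarrow> integrable (density lborel (\<lambda>x. ennreal (?w x))) (\<lambda>x. h (?\<phi> x))"
    "integral\<^sup>L (distr (density lborel (\<lambda>x. ennreal (?w x))) borel ?\<phi>) h = integral\<^sup>L (density lborel (\<lambda>x. ennreal (?w x))) (\<lambda>x. h (?\<phi> x))"
    by (rule integrable_distr_eq integral_distr; use mphi mh in simp)+
  show "integrable (vol M) h" using 1(1) 2(1) 3(1) ih by (simp add: vol_density)
  show "integral\<^sup>L (vol M) h = integral\<^sup>L lborel ?h" using 1(2) 2(2) 3(2) by (simp add: vol_density)
qed

text \<open>The classical formula for the divergence as a weighted coordinate divergence.
  Differentiating the density gives a trace by Jacobi's formula, and the brackets of frame fields,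
  written in coordinates, identify the rest with \<open>frame_div\<close>.\<close>

lemma div_coord:
  fixes f :: "'m \<Rightarrow> real"
  assumes f: "smooth_fun A (U a) f" and x: "x \<in> Dom"
  defines "p \<equiv> chart_inv c x"
  shows "(\<Sum>i\<in>UNIV. frechet_derivative (\<lambda>y. dens y * (coord_frame c a (chart_inv c y) $ i $ k * f (chart_inv c y))) (at x) (axis i 1)) =
    dens x * (e a k p f + frame_div a k p * f p)"
proof -
  let ?M = "\<lambda>y. coord_frame c a (chart_inv c y)"
  let ?f = "\<lambda>y. f (chart_inv c y)"
  have p: "p \<in> fst c" "p \<in> U a" and px: "snd c p = x" using dom_inv[OF x] by (auto simp: p_def)
  define D where "D = (\<lambda>h. \<chi> i l. frechet_derivative (\<lambda>y. ?M y $ i $ l) (at x) h)"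
  define Df where "Df = frechet_derivative ?f (at x)"
  have DM: "((\<lambda>y. ?M y $ i $ l) has_derivative (\<lambda>h. D h $ i $ l)) (at x)" for i l
    using smooth_on_has_derivative[OF coord_frame_smooth_on x, of i l] by (simp add: D_def)
  have lD: "linear (\<lambda>h. D h $ i $ l)" for i l using DM by (rule has_derivative_linear)
  have fO: "smooth_fun A (fst c \<inter> U a) f" using f by (auto intro: smooth_fun_subset)
  then have "smooth_on Dom ?f" using c unfolding smooth_fun_alt by fastforce
  then have DF: "(?f has_derivative Df) (at x)" unfolding Df_def by (rule smooth_on_has_derivative[OF _ x])
  have ef: "e a l p f = Df (column l (?M x))" for l
    using frame_smooth_fun[OF f p] by (simp add: Df_def px p_def[symmetric])
  have d: "det (?M x) \<noteq> 0" using det_gram(1)[OF p] by (simp add: p_def)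
  then obtain J where J: "?M x ** J = mat 1" "J ** ?M x = mat 1" by (metis invertible_def invertible_det_nz)
  \<comment> \<open>The logarithmic derivative of the determinant of the frame matrix; the density
    varies with the opposite sign.\<close>
  define \<tau> where "\<tau> = (\<lambda>h. trace (J ** D h))"
  have Ddet: "((\<lambda>y. det (?M y)) has_derivative (\<lambda>h. det (?M x) * \<tau> h)) (at x)"
    unfolding \<tau>_def by (rule has_derivative_det[OF DM J(2)])
  have "(norm has_derivative (\<lambda>h. h \<bullet> sgn (det (?M x)))) (at (det (?M x)))"
    using has_derivative_norm[OF d] .
  from has_derivative_compose[OF Ddet this]
  have "((\<lambda>y. \<bar>det (?M y)\<bar>) has_derivative (\<lambda>h. \<bar>det (?M x)\<bar> * \<tau> h)) (at x)"
    by (simp add: abs_sgn mult_ac)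
  from Deriv.has_derivative_inverse[OF _ this]
  have "((\<lambda>y. dens y) has_derivative (\<lambda>h. - (dens x * (\<bar>det (?M x)\<bar> * \<tau> h) * dens x))) (at x)"
    using d by simp
  moreover have "- (dens x * (\<bar>det (?M x)\<bar> * \<tau> h) * dens x) = - dens x * \<tau> h" for h
    using d by (simp add: field_simps)
  ultimately have Dw: "((\<lambda>y. dens y) has_derivative (\<lambda>h. - dens x * \<tau> h)) (at x)" by (simp only:)
  have "((\<lambda>y. dens y * (?M y $ i $ k * ?f y)) has_derivative
      (\<lambda>h. dens x * (?M x $ i $ k * Df h + D h $ i $ k * ?f x) + (- dens x * \<tau> h) * (?M x $ i $ k * ?f x))) (at x)" for i
    by (intro has_derivative_mult Dw DM DF)
  from frechet_derivative_at[OF this, symmetric]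
  have fd: "frechet_derivative (\<lambda>y. dens y * (?M y $ i $ k * ?f y)) (at x) h =
      dens x * (?M x $ i $ k * Df h + D h $ i $ k * ?f x - \<tau> h * ?M x $ i $ k * ?f x)" for i h
    by (simp add: algebra_simps)
  have col: "column l (?M x) = (\<Sum>i\<in>UNIV. ?M x $ i $ l *\<^sub>R axis i 1)" for l
    by (simp add: vec_eq_iff column_def axis_def if_distrib cong: if_cong)
  have lf: "linear Df" using DF by (rule has_derivative_linear)
  have "linear (\<lambda>h. det (?M x) * \<tau> h)" using Ddet by (rule has_derivative_linear)
  then have "linear \<tau>" using d by (simp add: linear_iff distrib_left[symmetric] mult.left_commute[of _ "det _"])
  then have s\<tau>: "(\<Sum>i\<in>UNIV. \<tau> (axis i 1) * ?M x $ i $ k) = \<tau> (column k (?M x))"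
    by (simp add: col linear_sum linear_scale mult.commute)
  have sf: "(\<Sum>i\<in>UNIV. ?M x $ i $ k * Df (axis i 1)) = Df (column k (?M x))"
    by (simp add: col linear_sum[OF lf] linear_scale[OF lf])
  have M_dir: "e a l p (\<lambda>q. e a m q (\<lambda>q. snd c q $ i)) = D (column l (?M x)) $ i $ m" for l m i
  proof -
    have o: "open (fst c \<inter> U a)" using chart(1)[OF c] open_U by blast
    have "smooth_at p (\<lambda>q. coord_frame c a q $ i $ m)"
      by (rule smooth_atI[OF coord_frame_smooth o]) (use p in blast)
    from dir_deriv_coord[OF c p(1) this, of "column l (?M x)"]
    show ?thesis by (simp add: coord_frame_def[symmetric] dir_deriv_real frame_coord[OF p] px p_def[symmetric] D_def)
      (simp add: coord_frame_def)
  qed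
  \<comment> \<open>Multiplying the coordinates of the bracket by the inverse frame matrix extracts
    its frame components; the diagonal entry of the skew connection matrix drops out.\<close>
  have br: "(\<Sum>i\<in>UNIV. J $ l $ i * (D (column l (?M x)) $ i $ k - D (column k (?M x)) $ i $ l)) = conn a l p $ l $ k" for l
  proof -
    have "D (column l (?M x)) $ i $ k - D (column k (?M x)) $ i $ l =
        (\<Sum>m\<in>UNIV. ?M x $ i $ m * (conn a l p $ m $ k - conn a k p $ m $ l))" for i
    proof -
      have "smooth_near A p (\<lambda>q. snd c q $ i)" using coord_smooth_at[OF p(1)] by (simp add: smooth_near_iff)
      from lie_bracket_apply[OF open_U p(2) this, of "e a l" "e a k"] show ?thesis
        by (simp add: M_dir bracket_frame[OF p(2)]) (simp add: coord_frame_def p_def mult.commute)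
    qed
    then have "(\<Sum>i\<in>UNIV. J $ l $ i * (D (column l (?M x)) $ i $ k - D (column k (?M x)) $ i $ l)) =
        (\<Sum>m\<in>UNIV. (J ** ?M x) $ l $ m * (conn a l p $ m $ k - conn a k p $ m $ l))"
      by (simp add: matrix_matrix_mult_def sum_distrib_left sum_distrib_right mult.assoc) (rule sum.swap)
    also have "\<dots> = conn a l p $ l $ k - conn a k p $ l $ l"
      by (simp add: J mat_def if_distrib if_distribR cong: if_cong)
    also have "conn a k p $ l $ l = 0" using skewD[OF skew_conn[OF p(2)], of k l l] by simp
    finally show ?thesis by simp
  qed
  have "(\<Sum>l\<in>UNIV. \<Sum>i\<in>UNIV. J $ l $ i * D (column l (?M x)) $ i $ k) = (\<Sum>i\<in>UNIV. D (axis i 1) $ i $ k)"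
  proof -
    have "(\<Sum>l\<in>UNIV. J $ l $ i * D (column l (?M x)) $ i $ k) = D (axis i 1) $ i $ k" for i
    proof -
      have "(\<Sum>l\<in>UNIV. J $ l $ i *\<^sub>R column l (?M x)) = axis i 1"
      proof (rule vec_eq_iff[THEN iffD2], rule allI)
        fix m
        have "(?M x ** J) $ m $ i = mat 1 $ m $ i" by (simp add: J)
        then show "(\<Sum>l\<in>UNIV. J $ l $ i *\<^sub>R column l (?M x)) $ m = axis i 1 $ m"
          by (simp add: matrix_matrix_mult_def column_def mat_def axis_def mult.commute)
      qed
      then show ?thesis using linear_sum[OF lD[of i k], of "\<lambda>l. J $ l $ i *\<^sub>R column l (?M x)" UNIV]
        by (simp add: linear_scale[OF lD])
    qed
    then show ?thesis by (subst sum.swap) simp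
  qed
  moreover have "(\<Sum>l\<in>UNIV. \<Sum>i\<in>UNIV. J $ l $ i * D (column k (?M x)) $ i $ l) = \<tau> (column k (?M x))"
    by (simp add: \<tau>_def trace_def matrix_matrix_mult_def)
  ultimately have fdiv: "frame_div a k p = (\<Sum>i\<in>UNIV. D (axis i 1) $ i $ k) - \<tau> (column k (?M x))"
    by (simp add: frame_div_def br[symmetric] right_diff_distrib sum_subtractf)
  have "(\<Sum>i\<in>UNIV. frechet_derivative (\<lambda>y. dens y * (?M y $ i $ k * ?f y)) (at x) (axis i 1)) =
      dens x * ((\<Sum>i\<in>UNIV. ?M x $ i $ k * Df (axis i 1)) + (\<Sum>i\<in>UNIV. D (axis i 1) $ i $ k) * ?f x
        - (\<Sum>i\<in>UNIV. \<tau> (axis i 1) * ?M x $ i $ k) * ?f x)"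
    by (simp add: fd sum_distrib_left[symmetric] sum.distrib sum_subtractf sum_distrib_right)
  also have "\<dots> = dens x * (e a k p f + frame_div a k p * f p)"
    unfolding sf s\<tau> ef fdiv by (simp add: p_def algebra_simps)
  finally show ?thesis .
qed

text \<open>In the chart the integrand is a sum of partial derivatives of the functions
  \<open>F i\<close>, smooth on the whole space after extension by zero. The cutoff to
  \<open>K\<close> is there because the frame is meaningful only on \<open>U a\<close>.\<close>

lemma integral_divergence_real:
  fixes f :: "'m \<Rightarrow> real"
  assumes f: "smooth_fun A (U a) f" and K: "compact K" "K \<subseteq> fst c \<inter> U a" "\<And>p. p \<notin> K \<Longrightarrow> f p = 0"
  shows "(LINT p|vol M. (if p \<in> K then e a k p f + frame_div a k p * f p else 0)) = 0"
    and "integrable (vol M) (\<lambda>p. if p \<in> K then e a k p f + frame_div a k p * f p else 0)"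
    and "p \<in> U a - K \<Longrightarrow> e a k p f = 0"
proof -
  let ?h = "\<lambda>p. e a k p f + frame_div a k p * f p"
  have oK: "open (- K)" using K(1) compact_imp_closed by blast
  show z: "e a k p f = 0" if "p \<in> U a - K" for p
  proof -
    have t: "e a k p \<in> tangent_space A p" using that by (auto intro: frame_tangent)
    have "e a k p f = e a k p (\<lambda>q. 0)"
      by (rule tangent_fun_cong[OF t oK]) (use that K(3) in auto)
    then show ?thesis using dir_deriv_const[OF t, of "0 :: real"] by (simp add: dir_deriv_real)
  qed
  \<comment> \<open>Cutting off at \<open>U a\<close> instead changes nothing, since
    \<open>f\<close> and its derivatives vanish on the rest of \<open>U a\<close>; the integrand is
    then visibly smooth there.\<close>
  have hK: "(\<lambda>p. if p \<in> K then ?h p else 0) = (\<lambda>p. if p \<in> U a then ?h p else 0)"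
    using K z by (auto simp: fun_eq_iff)
  have "smooth_fun A (U a) ?h"
    unfolding frame_div_def
    by (intro smooth_fun_add smooth_fun_mult smooth_fun_sum smooth_field_apply[OF frame_smooth] conn_smooth_nth open_U f order_refl)
  then have "smooth_fun A (fst c \<inter> U a) ?h" by (auto intro: smooth_fun_subset)
  then have "continuous_on (fst c \<inter> U a) ?h" by (rule smooth_fun_continuous[rotated]) (use chart(1)[OF c] open_U in blast)
  then have ch: "continuous_on (fst c \<inter> U a) (\<lambda>p. if p \<in> K then ?h p else 0)"
    unfolding hK by (rule continuous_on_cong[THEN iffD1, rotated 2]) auto
  note v = vol_chart[OF K(1,2) ch]
  show "integrable (vol M) (\<lambda>p. if p \<in> K then ?h p else 0)" by (rule v(1)) simp
  define F where "F = (\<lambda>i x. if x \<in> Dom then dens x * (coord_frame c a (chart_inv c x) $ i $ k * f (chart_inv c x)) else 0)"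
  have K': "compact (snd c ` K)" "snd c ` K \<subseteq> Dom"
    using K chart(3)[OF c] by (auto simp: homeomorphism_def intro!: compact_continuous_image intro: continuous_on_subset)
  have out: "f (chart_inv c x) = 0" if "x \<in> Dom - snd c ` K" for x
  proof (rule K(3))
    show "chart_inv c x \<notin> K" using that dom_inv(3)[of x] by (metis DiffD1 DiffD2 imageI)
  qed
  have fO: "smooth_fun A (fst c \<inter> U a) f" using f by (auto intro: smooth_fun_subset)
  then have sf: "smooth_on Dom (\<lambda>x. f (chart_inv c x))" using c unfolding smooth_fun_alt by fastforce
  have F: "smooth_on UNIV (F i)" for i
    unfolding F_def
    by (rule smooth_on_extend_zero[OF open_dom K'])
      (use out in \<open>auto intro!: smooth_on_bilinear[OF bounded_bilinear_mult open_dom] dens_smooth coord_frame_smooth_on sf\<close>)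
  have F0: "F i x = 0" if "x \<notin> snd c ` K" for i x using out that by (auto simp: F_def)
  have "(LINT p|vol M. (if p \<in> K then ?h p else 0)) =
      (LINT x|lborel. (if x \<in> Dom then dens x *\<^sub>R (if chart_inv c x \<in> K then ?h (chart_inv c x) else 0) else 0))"
    by (rule v(2)) simp
  also have "\<dots> = (LINT x|lborel. (\<Sum>i\<in>UNIV. frechet_derivative (F i) (at x) (axis i 1)))"
  proof (rule Bochner_Integration.integral_cong[OF refl])
    fix x :: "(real, 'n) vec"
    show "(if x \<in> Dom then dens x *\<^sub>R (if chart_inv c x \<in> K then ?h (chart_inv c x) else 0) else 0) =
        (\<Sum>i\<in>UNIV. frechet_derivative (F i) (at x) (axis i 1))"
    proof (cases "x \<in> Dom")
      case True
      have "frechet_derivative (F i) (at x) =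
          frechet_derivative (\<lambda>y. dens y * (coord_frame c a (chart_inv c y) $ i $ k * f (chart_inv c y))) (at x)" for i
      proof (rule frechet_derivative_at[symmetric, THEN sym])
        show "((\<lambda>y. dens y * (coord_frame c a (chart_inv c y) $ i $ k * f (chart_inv c y))) has_derivative frechet_derivative (F i) (at x)) (at x)"
          by (rule has_derivative_transform_within_open[OF smooth_on_has_derivative[OF F UNIV_I] open_dom True]) (simp add: F_def)
      qed
      moreover have "(if chart_inv c x \<in> K then ?h (chart_inv c x) else 0) = ?h (chart_inv c x)"
        using fun_cong[OF hK, of "chart_inv c x"] dom_inv(2)[OF True] by simp
      ultimately show ?thesis using True div_coord[OF f True, of k] by simp
    next
      case False
      have o: "open (- (snd c ` K))" using K'(1) compact_imp_closed by blast
      have "(F i has_derivative (\<lambda>_. 0)) (at x)" for i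
        by (rule has_derivative_transform_within_open[OF has_derivative_const o, of _ "0 :: real"]) (use False K'(2) F0 in auto)
      from frechet_derivative_at[OF this] have "frechet_derivative (F i) (at x) h = 0" for i h by metis
      then show ?thesis using False by simp
    qed
  qed
  also have "\<dots> = (\<Sum>i\<in>UNIV. LINT x|lborel. frechet_derivative (F i) (at x) (axis i 1))"
    by (rule Bochner_Integration.integral_sum) (rule integral_derivative_eq_0(1)[OF F K'(1) F0])
  also have "\<dots> = 0" by (simp add: integral_derivative_eq_0(2)[OF F K'(1) F0])
  finally show "(LINT p|vol M. (if p \<in> K then ?h p else 0)) = 0" .
qed

lemma integral_divergence:
  fixes f :: "'m \<Rightarrow> complex"
  assumes f: "smooth_fun A (U a) f" and K: "compact K" "K \<subseteq> fst c \<inter> U a" "\<And>p. p \<notin> K \<Longrightarrow> f p = 0"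
  shows "(LINT p|vol M. (if p \<in> K then dir_deriv (e a k p) f + frame_div a k p *\<^sub>R f p else 0)) = 0"
    and "integrable (vol M) (\<lambda>p. if p \<in> K then dir_deriv (e a k p) f + frame_div a k p *\<^sub>R f p else 0)"
    and "p \<in> U a - K \<Longrightarrow> dir_deriv (e a k p) f = 0"
proof -
  let ?h = "\<lambda>p. if p \<in> K then dir_deriv (e a k p) f + frame_div a k p *\<^sub>R f p else 0"
  let ?R = "\<lambda>r p. if p \<in> K then e a k p r + frame_div a k p * r p else 0 :: real"
  have r: "smooth_fun A (U a) (\<lambda>p. Re (f p))" "smooth_fun A (U a) (\<lambda>p. Im (f p))"
    using smooth_fun_linear[OF bounded_linear_Re open_U f] smooth_fun_linear[OF bounded_linear_Im open_U f] by auto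
  have z: "p \<notin> K \<Longrightarrow> Re (f p) = 0" "p \<notin> K \<Longrightarrow> Im (f p) = 0" for p using K(3) by auto
  have i: "dir_deriv X f = complex_of_real (X (\<lambda>q. Re (f q))) + \<i> * complex_of_real (X (\<lambda>q. Im (f q)))" for X
    by (simp add: dir_deriv_def Basis_complex_def complex_eq_iff inner_complex_def)
  show "dir_deriv (e a k p) f = 0" if "p \<in> U a - K"
    using integral_divergence_real(3)[OF r(1) K(1,2) z(1) that] integral_divergence_real(3)[OF r(2) K(1,2) z(2) that] by (simp add: i)
  have h: "?h = (\<lambda>p. complex_of_real (?R (\<lambda>q. Re (f q)) p) + \<i> * complex_of_real (?R (\<lambda>q. Im (f q)) p))"
    by (auto simp: fun_eq_iff i complex_eq_iff)
  note R = integral_divergence_real[OF r(1) K(1,2) z(1), where k = k] and I = integral_divergence_real[OF r(2) K(1,2) z(2), where k = k]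
  have ii: "integrable (vol M) (\<lambda>p. complex_of_real (?R (\<lambda>q. Re (f q)) p))" "integrable (vol M) (\<lambda>p. \<i> * complex_of_real (?R (\<lambda>q. Im (f q)) p))"
    using R(2) I(2) by auto
  show "integrable (vol M) ?h" unfolding h using ii by (rule Bochner_Integration.integrable_add)
  show "integral\<^sup>L (vol M) ?h = 0" unfolding h using R(1) I(1) by (simp add: Bochner_Integration.integral_add[OF ii])
qed

end

end

section \<open>Formal adjoints\<close>

context spin_geometry
begin

lemma Sec_mult:
  assumes s: "s \<in> Sec j" and r: "smooth_fun A UNIV \<beta>"
  shows "(\<lambda>a p. \<beta> p *\<^sub>R s a p) \<in> Sec j"
proof (rule SecI)
  show "smooth_fun A (U a) (\<lambda>p. \<beta> p *\<^sub>R s a p)" for a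
    by (rule smooth_fun_scaleR[OF open_U smooth_fun_subset[OF r subset_UNIV] SecD(2)[OF s]])
  show "\<beta> p *\<^sub>R s a p = act (tr a b p) (\<beta> p *\<^sub>R s b p)" if "p \<in> U a" "p \<in> U b" for a b p
    using SecD(4)[OF s that] by (simp add: act_linear)
qed (simp_all add: SecD(1)[OF s] Ker_scale SecD(3)[OF s])

lemma Sec_diff:
  assumes "s \<in> Sec j" "t \<in> Sec j"
  shows "(\<lambda>a p. s a p - t a p) \<in> Sec j"
proof (rule SecI)
  show "smooth_fun A (U a) (\<lambda>p. s a p - t a p)" for a
    by (rule smooth_fun_diff[OF open_U SecD(2)[OF assms(1)] SecD(2)[OF assms(2)]])
  show "s a p - t a p = act (tr a b p) (s b p - t b p)" if "p \<in> U a" "p \<in> U b" for a b p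
    using SecD(4)[OF assms(1) that] SecD(4)[OF assms(2) that] by (simp add: act_linear)
qed (simp_all add: SecD(1)[OF assms(1)] SecD(1)[OF assms(2)] Ker_scale SecD(3)[OF assms(1)] SecD(3)[OF assms(2)])

lemma value_at_cover: "\<exists>a. p \<in> U a \<and> (\<forall>s. value_at M s p = s a p)"
  unfolding value_at_def using someI_ex[OF U_at[of p]] by blast

lemma herm_value_at:
  assumes "s \<in> Sec j" "t \<in> Sec j" "p \<in> U a"
  shows "herm (value_at M s p) (value_at M t p) = herm (s a p) (t a p)"
proof -
  obtain b where b: "p \<in> U b" "\<And>s :: 'i \<Rightarrow> 'm \<Rightarrow> ('n, 's) twisted. value_at M s p = s b p"
    using value_at_cover[of p] by blast
  show ?thesis
    unfolding b(2) SecD(4)[OF assms(1) b(1) assms(3)] SecD(4)[OF assms(2) b(1) assms(3)]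
    by (rule herm_act[OF transition_spin[OF b(1) assms(3)]])
qed

lemma nabla_add:
  assumes "smooth_fun A (U a) (s a)" "smooth_fun A (U a) (t a)" "p \<in> U a"
  shows "nabla M (\<lambda>a p. s a p + t a p) a p $ k = nabla M s a p $ k + nabla M t a p $ k"
  using dir_deriv_add[OF frame_tangent[OF assms(3)] smooth_atI[OF assms(1) open_U assms(3)] smooth_atI[OF assms(2) open_U assms(3)]]
  by (simp add: nabla_nth[OF assms(3)] lie_linear)

lemma nabla_outside:
  assumes K: "closed K" "\<And>q. q \<notin> K \<Longrightarrow> s a q = 0" and p: "p \<notin> K"
  shows "nabla M s a p = 0"
proof (cases "p \<in> U a")
  case True
  have o: "open (- K)" using K(1) by auto
  have t: "e a k p \<in> tangent_space A p" for k by (rule frame_tangent[OF True])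
  have "dir_deriv (e a k p) (s a) = dir_deriv (e a k p) (\<lambda>q. 0)" for k
    by (rule dir_deriv_cong(1)[OF t o]) (use p K(2) in auto)
  then have "nabla M s a p $ k = 0" for k
    using K(2)[OF p] by (simp add: nabla_nth[OF True] lie_linear dir_deriv_const[OF t])
  then show ?thesis by (simp add: vec_eq_iff)
qed (simp add: nabla_def vec_eq_iff)

lemma bump_exists:
  assumes "open W" "p \<in> W"
  shows "\<exists>\<beta> c K V. smooth_fun A UNIV \<beta> \<and> (\<forall>q. 0 \<le> \<beta> q) \<and> c \<in> A \<and> compact K \<and> K \<subseteq> W \<inter> fst c \<and>
    (\<forall>q. q \<notin> K \<longrightarrow> \<beta> q = (0 :: real)) \<and> open V \<and> p \<in> V \<and> (\<forall>q\<in>V. \<beta> q = 1)"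
  by (rule smooth_bump_at[OF assms compact_imp_closed], assumption, intro exI conjI allI ballI impI) blast+

lemma integrable_herm:
  assumes c: "c \<in> A" and K: "compact K" "K \<subseteq> fst c \<inter> U a" and s: "s \<in> Sec j" and t: "t \<in> Sec j"
    and z: "\<And>a p. p \<notin> K \<Longrightarrow> s a p = 0"
  shows "integrable (vol M) (\<lambda>p. herm (value_at M s p) (value_at M t p))"
proof (rule vol_chart(1)[OF c K])
  have "smooth_fun A (fst c \<inter> U a) (\<lambda>p. herm (s a p) (t a p))"
    by (rule smooth_fun_subset[OF smooth_fun_bilinear[OF bounded_bilinear_herm open_U SecD(2)[OF s] SecD(2)[OF t]]]) simp
  then have "continuous_on (fst c \<inter> U a) (\<lambda>p. herm (s a p) (t a p))"
    by (rule smooth_fun_continuous[rotated]) (use chart(1)[OF c] open_U in blast)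
  then show "continuous_on (fst c \<inter> U a) (\<lambda>p. herm (value_at M s p) (value_at M t p))"
    by (rule continuous_on_cong[THEN iffD1, rotated 2]) (use herm_value_at[OF s t] in auto)
  show "herm (value_at M s p) (value_at M t p) = 0" if "p \<notin> K" for p
    using z[OF that] by (simp add: value_at_def herm_eq_0)
qed

text \<open>Test with the difference times a bump function. The integrand is the bump times the
  squared norm of the difference, continuous and nonnegative, so a vanishing integral forces it to
  vanish.\<close>

lemma section_eqI:
  assumes u: "u \<in> Sec j" and v: "v \<in> Sec j"
    and eq: "\<And>s. s \<in> Sec j \<Longrightarrow> compact (support s) \<Longrightarrow>
      (LINT p|vol M. herm (value_at M s p) (value_at M u p)) = (LINT p|vol M. herm (value_at M s p) (value_at M v p))"
  shows "u = v"
proof (rule ext, rule ext)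
  fix a p
  define d where "d = (\<lambda>a p. u a p - v a p)"
  have d: "d \<in> Sec j" unfolding d_def by (rule Sec_diff[OF u v])
  show "u a p = v a p"
  proof (cases "p \<in> U a")
    case False
    then show ?thesis using SecD(1)[OF u] SecD(1)[OF v] by simp
  next
    case p: True
    obtain \<beta> :: "'m \<Rightarrow> real" and K V c where b: "smooth_fun A UNIV \<beta>" "\<And>q. 0 \<le> \<beta> q" "c \<in> A" "compact K" "K \<subseteq> U a \<inter> fst c"
      "\<And>q. q \<notin> K \<Longrightarrow> \<beta> q = 0" "open V" "p \<in> V" "\<And>q. q \<in> V \<Longrightarrow> \<beta> q = 1"
      using bump_exists[OF open_U p] by blast
    have KO: "K \<subseteq> fst c \<inter> U a" using b(5) by blast
    have pK: "p \<in> K" using b(6)[of p] b(8,9) by fastforce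
    then have pc: "p \<in> fst c" using KO by blast
    define s where "s = (\<lambda>a p. \<beta> p *\<^sub>R d a p)"
    have s: "s \<in> Sec j" unfolding s_def by (rule Sec_mult[OF d b(1)])
    have s0: "s a p = 0" if "p \<notin> K" for a p using b(6)[OF that] by (simp add: s_def)
    have cK: "closed K" using b(4) compact_imp_closed by blast
    have "support s \<subseteq> K" unfolding support_def by (rule closure_minimal[OF _ cK]) (use s0 in blast)
    then have "compact (support s)" using b(4) by (metis closed_Int_compact closed_closure inf.absorb1 support_def)
    from eq[OF s this]
    have "(LINT p|vol M. herm (value_at M s p) (value_at M u p) - herm (value_at M s p) (value_at M v p)) = 0"
      using integrable_herm[OF b(3,4) KO s u s0] integrable_herm[OF b(3,4) KO s v s0] by simp
    then have z: "(LINT p|vol M. herm (value_at M s p) (value_at M d p)) = 0"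
      by (simp add: d_def value_at_def herm_diff)
    define h where "h = (\<lambda>p. Re (herm (value_at M s p) (value_at M d p)))"
    have hz: "(LINT p|vol M. h p) = 0"
      unfolding h_def using z integral_Re[OF integrable_herm[OF b(3,4) KO s d s0]] by simp
    have ha: "h q = \<beta> q * (d b q \<bullet> d b q)" if "q \<in> U b" for q b
      unfolding h_def herm_value_at[OF s d that] by (simp add: s_def herm_scaleR Re_herm)
    have h0: "h q = 0" if "q \<notin> K" for q using s0[OF that] by (simp add: h_def value_at_def herm_eq_0)
    have "smooth_fun A (fst c \<inter> U a) (\<lambda>q. \<beta> q * (d a q \<bullet> d a q))"
      by (rule smooth_fun_subset[OF smooth_fun_mult[OF open_U smooth_fun_subset[OF b(1) subset_UNIV]
            smooth_fun_bilinear[OF bounded_bilinear_inner open_U SecD(2)[OF d] SecD(2)[OF d]]]]) simp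
    then have "continuous_on (fst c \<inter> U a) (\<lambda>q. \<beta> q * (d a q \<bullet> d a q))"
      by (rule smooth_fun_continuous[rotated]) (use chart(1)[OF b(3)] open_U in blast)
    then have ch: "continuous_on (fst c \<inter> U a) h"
      by (rule continuous_on_cong[THEN iffD1, rotated 2]) (use ha in auto)
    note v = vol_chart[OF b(3,4) KO ch h0]
    have nn: "0 \<le> h q" for q
    proof -
      obtain b where "q \<in> U b" using U_at by blast
      then show ?thesis using ha b(2) by simp
    qed
    let ?H = "\<lambda>x. if x \<in> Dom c a then dens c a x *\<^sub>R h (chart_inv c x) else 0"
    have "?H (snd c p) = 0"
      by (rule integral_continuous_nonneg_eq_0[OF v(3,4)]) (use v(2) hz nn in auto)
    moreover have "snd c p \<in> Dom c a" using pc p by blast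
    ultimately have "h p = 0" using det_gram(1)[OF b(3) pc p] b(3) pc by simp
    then have "d a p = 0" using ha[OF p] b(8,9) by simp
    then show ?thesis by (simp add: d_def)
  qed
qed

text \<open>The integral of a divergence vanishes for sections supported in a compact subset of a chart domain; a
  bump function splits off one chart at a time from a section with compact support.\<close>

lemma formal_adjoint_eqI:
  fixes G :: "('s, 'w::real_normed_vector) fibre"
  assumes inv: "\<And>s a b p. s \<in> Sec j \<Longrightarrow> p \<in> U a \<Longrightarrow> p \<in> U b \<Longrightarrow> fib_herm G (P s a p) (t a p) = fib_herm G (P s b p) (t b p)"
    and H: "\<And>s a p. s \<in> Sec j \<Longrightarrow> p \<in> U a \<Longrightarrow> fib_herm G (P s a p) (t a p) = (\<Sum>k\<in>UNIV. herm (nabla M s a p $ k) (V a k p))"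
    and V: "\<And>a k. smooth_fun A (U a) (V a k)"
    and u: "u \<in> Sec j"
    and Du: "\<And>a p w. w \<in> Ker j \<Longrightarrow> p \<in> U a \<Longrightarrow> herm w (u a p) = - herm w (Div a (V a) p)"
  shows "formal_adjoint M (bundle_E M (Ker j)) G P t = u"
proof -
  let ?L = "\<lambda>s p. fib_herm G (value_at M (P s) p) (value_at M t p)"
  let ?R = "\<lambda>s p. herm (value_at M s p) (value_at M u p)"
  have L: "?L s p = (\<Sum>k\<in>UNIV. herm (nabla M s a p $ k) (V a k p))" if "s \<in> Sec j" "p \<in> U a" for s a p
  proof -
    obtain b where b: "p \<in> U b" "\<And>s :: 'i \<Rightarrow> 'm \<Rightarrow> 'w. value_at M s p = s b p"
      using someI_ex[OF U_at[of p]] by (auto simp: value_at_def)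
    then show ?thesis using inv[OF that(1) b(1) that(2)] H[OF that] by simp
  qed
  \<comment> \<open>Integrability is part of the property, as Bochner integrals default to 0 and
    would otherwise not be additive.\<close>
  define adj where "adj = (\<lambda>s. integrable (vol M) (?L s) \<and> integrable (vol M) (?R s) \<and>
    (LINT p|vol M. ?L s p) = (LINT p|vol M. ?R s p))"
  have loc: "adj s" if s: "s \<in> Sec j" and c: "c \<in> A" and K: "compact K" "K \<subseteq> fst c \<inter> U a" and z: "\<And>a p. p \<notin> K \<Longrightarrow> s a p = 0"
    for s c a K
  proof -
    have cK: "closed K" using K(1) compact_imp_closed by blast
    have R: "integrable (vol M) (?R s)" by (rule integrable_herm[OF c K s u z])
    define D where "D = (\<lambda>k p. if p \<in> K then dir_deriv (e a k p) (\<lambda>q. herm (s a q) (V a k q)) + frame_div a k p *\<^sub>R herm (s a p) (V a k p) else 0)"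
    have f: "smooth_fun A (U a) (\<lambda>q. herm (s a q) (V a k q))" for k
      by (rule smooth_fun_bilinear[OF bounded_bilinear_herm open_U SecD(2)[OF s] V])
    have D: "integrable (vol M) (D k)" "(LINT p|vol M. D k p) = 0" for k
      unfolding D_def using integral_divergence(1,2)[OF c f K] z by (simp_all add: herm_eq_0)
    have LR: "?L s = (\<lambda>p. ?R s p + (\<Sum>k\<in>UNIV. D k p))"
    proof
      fix p
      show "?L s p = ?R s p + (\<Sum>k\<in>UNIV. D k p)"
      proof (cases "p \<in> K")
        case True
        then have p: "p \<in> U a" using K by blast
        show ?thesis
          using herm_nabla[where s = s and a = a, OF SecD(2)[OF s] V p] Du[OF SecD(3)[OF s p] p] True
          by (simp add: L[OF s p] herm_value_at[OF s u p] D_def algebra_simps)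
      next
        case False
        obtain b where b: "p \<in> U b" using U_at by blast
        have "nabla M s b p = 0" by (rule nabla_outside[OF cK z False])
        moreover have "?R s p = 0" using z[OF False] by (simp add: value_at_def herm_eq_0)
        ultimately show ?thesis using False by (simp add: L[OF s b] D_def herm_eq_0)
      qed
    qed
    have iD: "integrable (vol M) (\<lambda>p. \<Sum>k\<in>UNIV. D k p)" using D(1) by simp
    show ?thesis
      unfolding adj_def LR using R iD D by (simp add: Bochner_Integration.integral_sum[OF D(1)])
  qed
  have add: "adj (\<lambda>a p. s1 a p + s2 a p)" if s: "s1 \<in> Sec j" "s2 \<in> Sec j" "(\<lambda>a p. s1 a p + s2 a p) \<in> Sec j" and a: "adj s1" "adj s2" for s1 s2
  proof -
    have "?L (\<lambda>a p. s1 a p + s2 a p) = (\<lambda>p. ?L s1 p + ?L s2 p)"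
    proof
      fix p obtain a where p: "p \<in> U a" using U_at by blast
      show "?L (\<lambda>a p. s1 a p + s2 a p) p = ?L s1 p + ?L s2 p"
        by (simp add: L[OF s(1) p] L[OF s(2) p] L[OF s(3) p] nabla_add[where s = s1 and t = s2 and a = a, OF SecD(2)[OF s(1)] SecD(2)[OF s(2)] p] herm_add sum.distrib)
    qed
    moreover have "?R (\<lambda>a p. s1 a p + s2 a p) = (\<lambda>p. ?R s1 p + ?R s2 p)" by (simp add: value_at_def herm_add)
    ultimately show ?thesis using a unfolding adj_def by simp
  qed
  define good where "good = (\<lambda>(\<beta> :: 'm \<Rightarrow> real, V). smooth_fun A UNIV \<beta> \<and> (\<forall>q\<in>V. \<beta> q = 1) \<and>
    (\<exists>c a K. c \<in> A \<and> compact K \<and> K \<subseteq> fst c \<inter> U a \<and> (\<forall>q. q \<notin> K \<longrightarrow> \<beta> q = 0)))"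
  have fin: "adj s" if "finite F" "\<And>b. b \<in> F \<Longrightarrow> good b" "s \<in> Sec j" "\<And>a p. p \<notin> (\<Union>b\<in>F. snd b) \<Longrightarrow> s a p = 0" for F s
    using that
  proof (induction F arbitrary: s rule: finite_induct)
    case empty
    then have s0: "s a p = 0" for a p by simp
    have "?L s p = 0" for p
    proof -
      obtain a where p: "p \<in> U a" using U_at by blast
      have "nabla M s a p = 0" by (rule nabla_outside[of "{}"]) (simp_all add: s0)
      then show ?thesis by (simp add: L[OF empty.prems(2) p] herm_eq_0)
    qed
    moreover have "?R s p = 0" for p using s0 by (simp add: value_at_def herm_eq_0)
    ultimately show ?case by (simp add: adj_def)
  next
    case (insert b F)
    obtain \<beta> V where b: "b = (\<beta>, V)" by fastforce
    with insert.prems(1)[of b] obtain c a K where r: "smooth_fun A UNIV \<beta>" "\<And>q. q \<in> V \<Longrightarrow> \<beta> q = 1"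
      "c \<in> A" "compact K" "K \<subseteq> fst c \<inter> U a" "\<And>q. q \<notin> K \<Longrightarrow> \<beta> q = 0" by (auto simp: good_def)
    have r': "smooth_fun A UNIV (\<lambda>p. 1 - \<beta> p)" by (intro smooth_fun_diff smooth_fun_const r open_UNIV)
    have s1: "(\<lambda>a p. \<beta> p *\<^sub>R s a p) \<in> Sec j" by (rule Sec_mult[OF insert.prems(2) r(1)])
    have s2: "(\<lambda>a p. (1 - \<beta> p) *\<^sub>R s a p) \<in> Sec j" by (rule Sec_mult[OF insert.prems(2) r'])
    have a1: "adj (\<lambda>a p. \<beta> p *\<^sub>R s a p)" by (rule loc[OF s1 r(3,4,5)]) (simp add: r(6))
    have a2: "adj (\<lambda>a p. (1 - \<beta> p) *\<^sub>R s a p)"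
    proof (rule insert.IH[OF _ s2])
      show "(1 - \<beta> p) *\<^sub>R s a p = 0" if "p \<notin> (\<Union>b\<in>F. snd b)" for a p
      proof (cases "p \<in> V")
        case False
        then show ?thesis using insert.prems(3)[of p a] that by (simp add: b)
      qed (simp add: r(2))
    qed (use insert.prems(1) in blast)
    have eq: "(\<lambda>a p. \<beta> p *\<^sub>R s a p + (1 - \<beta> p) *\<^sub>R s a p) = s" by (simp add: fun_eq_iff scaleR_add_left[symmetric])
    show ?case using add[OF s1 s2 _ a1 a2] insert.prems(2) unfolding eq by blast
  qed
  have all: "adj s" if s: "s \<in> Sec j" and S: "compact (support s)" for s
  proof -
    have "\<exists>b. good b \<and> open (snd b) \<and> p \<in> snd b" for p
    proof -
      obtain a where a: "p \<in> U a" using U_at by blast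
      obtain \<beta> :: "'m \<Rightarrow> real" and K V c where b: "smooth_fun A UNIV \<beta>" "\<And>q. 0 \<le> \<beta> q" "c \<in> A" "compact K" "K \<subseteq> U a \<inter> fst c"
        "\<And>q. q \<notin> K \<Longrightarrow> \<beta> q = 0" "open V" "p \<in> V" "\<And>q. q \<in> V \<Longrightarrow> \<beta> q = 1"
        using bump_exists[OF open_U a] by blast
      have "good (\<beta>, V)" unfolding good_def using b by blast
      then show ?thesis using b(7,8) by (intro exI[of _ "(\<beta>, V)"]) simp
    qed
    then obtain B where B: "\<And>p. good (B p) \<and> open (snd (B p)) \<and> p \<in> snd (B p)" by metis
    obtain C where C: "C \<subseteq> support s" "finite C" "support s \<subseteq> (\<Union>p\<in>C. snd (B p))"
    proof (rule compactE_image[OF S, of "support s" "\<lambda>p. snd (B p)"])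
      show "open (snd (B p))" for p using B by blast
      show "support s \<subseteq> (\<Union>p\<in>support s. snd (B p))" using B by blast
    qed
    show ?thesis
    proof (rule fin[OF _ _ s])
      show "finite (B ` C)" using C(2) by simp
      show "s a p = 0" if "p \<notin> (\<Union>b\<in>B ` C. snd b)" for a p
      proof (rule ccontr)
        assume "s a p \<noteq> 0"
        then have "p \<in> {p. \<exists>a. s a p \<noteq> 0}" by blast
        then have "p \<in> support s" unfolding support_def by (rule closure_subset[THEN subsetD])
        then show False using C(3) that by blast
      qed
    qed (use B in auto)
  qed
  show ?thesis
    unfolding formal_adjoint_def
  proof (rule the_equality)
    show "u \<in> Sec j \<and> (\<forall>s\<in>Sec j. compact (support s) \<longrightarrow>
        (LINT p|vol M. fib_herm G (value_at M (P s) p) (value_at M t p)) =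
        (LINT p|vol M. fib_herm (bundle_E M (Ker j)) (value_at M s p) (value_at M u p)))"
      using u all by (simp add: adj_def bundle_E_def)
    fix v assume v: "v \<in> Sec j \<and> (\<forall>s\<in>Sec j. compact (support s) \<longrightarrow>
        (LINT p|vol M. fib_herm G (value_at M (P s) p) (value_at M t p)) =
        (LINT p|vol M. fib_herm (bundle_E M (Ker j)) (value_at M s p) (value_at M v p)))"
    show "v = u"
    proof (rule section_eqI[OF _ u])
      fix s assume s: "s \<in> Sec j" "compact (support s)"
      show "(LINT p|vol M. herm (value_at M s p) (value_at M v p)) = (LINT p|vol M. herm (value_at M s p) (value_at M u p))"
        using v[THEN conjunct2, rule_format, OF s] all[OF s] by (simp add: adj_def bundle_E_def)
    qed (use v in blast)
  qed
qed

end

section \<open>The identities\<close>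

context spin_geometry
begin

lemma Sec_add:
  assumes "s \<in> Sec j" "t \<in> Sec j"
  shows "(\<lambda>a p. s a p + t a p) \<in> Sec j"
proof (rule SecI)
  show "smooth_fun A (U a) (\<lambda>p. s a p + t a p)" for a
    by (rule smooth_fun_add[OF open_U SecD(2)[OF assms(1)] SecD(2)[OF assms(2)]])
  show "s a p + t a p = act (tr a b p) (s b p + t b p)" if "p \<in> U a" "p \<in> U b" for a b p
    using SecD(4)[OF assms(1) that] SecD(4)[OF assms(2) that] by (simp add: act_linear)
qed (simp_all add: SecD(1)[OF assms(1)] SecD(1)[OF assms(2)] Ker_scale SecD(3)[OF assms(1)] SecD(3)[OF assms(2)])

lemma Sec_zero: "(\<lambda>a p. 0) \<in> Sec j"
  by (rule SecI) (simp_all add: Ker_scale act_linear)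

definition gradient_op :: "(('n \<Rightarrow> ('n, 's) twisted) \<Rightarrow> ('n, 's) twisted) \<Rightarrow> ('i \<Rightarrow> 'm \<Rightarrow> ('n, 's) twisted) \<Rightarrow> 'i \<Rightarrow> 'm \<Rightarrow> ('n, 's) twisted" where
  "gradient_op L s = (\<lambda>a p. L (($) (nabla M s a p)))"

lemma gradient_op_section:
  assumes s: "s \<in> Sec j"
  shows "2 * j \<le> CARD('n) \<Longrightarrow> gradient_op (symD j) s \<in> Sec j"
    and "j = Suc i \<Longrightarrow> gradient_op (symM j) s \<in> Sec i"
    and "2 * j < CARD('n) \<Longrightarrow> gradient_op (symP j) s \<in> Sec (Suc j)"
proof -
  show "2 * j \<le> CARD('n) \<Longrightarrow> gradient_op (symD j) s \<in> Sec j"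
    unfolding gradient_op_def by (rule symbol_section[OF linear_symbol_sym(1) symD_Ker nabla_section[OF s]])
  show "gradient_op (symM j) s \<in> Sec i" if "j = Suc i"
    unfolding gradient_op_def that
    by (rule symbol_section[OF linear_symbol_sym(2) symM_Ker nabla_section[OF s[unfolded that]]])
  show "2 * j < CARD('n) \<Longrightarrow> gradient_op (symP j) s \<in> Sec (Suc j)"
    unfolding gradient_op_def by (rule symbol_section[OF linear_symbol_sym(3) symP_Ker nabla_section[OF s]])
qed

lemma gradient_op2:
  assumes "linear_symbol L" "linear_symbol L'" "s \<in> Sec j"
  shows "p \<in> U a \<Longrightarrow> gradient_op L' (gradient_op L s) a p = L' (\<lambda>l. L (second s a p l))"
    and "p \<notin> U a \<Longrightarrow> gradient_op L' t a p = 0"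
proof -
  show "p \<in> U a \<Longrightarrow> gradient_op L' (gradient_op L s) a p = L' (\<lambda>l. L (second s a p l))"
    unfolding gradient_op_def by (rule symbol2[OF assms(1,3)])
  have "linear (\<lambda>x :: ('n, 's) twisted1. L' (($) x))" using assms(2) by (simp add: linear_symbol_def)
  from linear_0[OF this] show "p \<notin> U a \<Longrightarrow> gradient_op L' t a p = 0"
    by (simp add: gradient_op_def nabla_def zero_vec_def)
qed

lemma second_commutator:
  assumes "has_constant_curvature A g nab c" "s \<in> Sec j" "p \<in> U a"
  shows "second s a p l k - second s a p k l = - c *\<^sub>R \<rho> (rot_gen l k) (s a p)"
  using ricci[where s = s and a = a, OF SecD(2)[OF assms(2)] assms(3), of l k] curvature_rot_gen[OF assms(1,3), of l k]
  by (simp add: lie_matrix_linear)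

lemma curv_endo_constant_curvature:
  assumes "has_constant_curvature A g nab c" "s \<in> Sec j"
  shows "(1/2) *\<^sub>R curv_endo M s a p =
    ((real j * (real CARD('n) - real j + 1) + real CARD('n) * (real CARD('n) - 1) / 8) * c) *\<^sub>R s a p"
proof (cases "p \<in> U a")
  case True
  have "curv_endo M s a p = - c *\<^sub>R (\<Sum>i\<in>UNIV. \<Sum>k\<in>UNIV. \<rho> (rot_gen i k) (\<rho> (rot_gen i k) (s a p)))"
    by (simp add: curv_endo_def curvature_rot_gen[OF assms(1) True] lie_matrix_linear lie_linear scaleR_sum_right sum_negf)
  also have "\<dots> = (2 * ((real j * (real CARD('n) - real j + 1) + real CARD('n) * (real CARD('n) - 1) / 8) * c)) *\<^sub>R s a p"
    unfolding rot_sum_lie[OF SecD(3)[OF assms(2) True]] by (simp only: scaleR_scaleR minus_mult_minus mult_ac)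
  finally show ?thesis by simp
next
  case False
  then show ?thesis using SecD(1)[OF assms(2)] by (simp add: curv_endo_def lie_linear)
qed

lemma adjoint_nabla:
  assumes cc: "has_constant_curvature A g nab c" and s: "s \<in> Sec j" and j: "2 * j \<le> CARD('n)"
  shows "formal_adjoint M (bundle_E M (Ker j)) (bundle_ET M (Ker j)) (nabla M) (nabla M s) =
    (\<lambda>a p. if p \<in> U a then - (\<Sum>k\<in>UNIV. second s a p k k) else 0)" (is "_ = ?u")
proof (rule formal_adjoint_eqI[where V = "\<lambda>a k p. nabla M s a p $ k"])
  fix t a b p assume t: "t \<in> Sec j" and p: "p \<in> U a"
  show "fib_herm (bundle_ET M (Ker j)) (nabla M t a p) (nabla M s a p) = (\<Sum>k\<in>UNIV. herm (nabla M t a p $ k) (nabla M s a p $ k))"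
    by (simp add: bundle_ET_def herm1_def)
  assume p': "p \<in> U b"
  show "fib_herm (bundle_ET M (Ker j)) (nabla M t a p) (nabla M s a p) = fib_herm (bundle_ET M (Ker j)) (nabla M t b p) (nabla M s b p)"
    unfolding Sec1D(4)[OF nabla_section[OF t] p p'] Sec1D(4)[OF nabla_section[OF s] p p']
    by (simp add: bundle_ET_def herm1_act[OF transition_spin[OF p p']])
next
  show "smooth_fun A (U a) (\<lambda>p. nabla M s a p $ k)" for a k by (rule nabla_smooth_nth[OF SecD(2)[OF s]])
next
  \<comment> \<open>Smoothness and transition behaviour of \<open>?u\<close> are not checked
    directly: by \<open>weitzenboeck1\<close> it is a combination of composed gradients and of
    \<open>s\<close>, which are sections.\<close>
  define r where "r = (real CARD('n) * (real CARD('n) - 1) / 4 + real j) * c"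
  define v where "v = (if j = 0 then \<lambda>a p. 0 else gradient_op (symP (j - 1)) (gradient_op (symM j) s))"
  have v: "v \<in> Sec j"
  proof (cases j)
    case (Suc i)
    have "gradient_op (symP i) (gradient_op (symM (Suc i)) s) \<in> Sec (Suc i)"
      by (rule gradient_op_section(3)[OF gradient_op_section(2)[OF s[unfolded Suc] refl]]) (use j Suc in simp)
    then show ?thesis by (simp add: v_def Suc)
  qed (simp add: v_def Sec_zero)
  have c: "smooth_fun A UNIV (\<lambda>p. - r)" by simp
  let ?w = "\<lambda>a p. (gradient_op (symD j) (gradient_op (symD j) s) a p + v a p) + (- r) *\<^sub>R s a p"
  have "?w \<in> Sec j"
    by (intro Sec_add Sec_mult[OF s c] v gradient_op_section(1) s j)
  moreover have "?w = ?u"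
  proof (rule ext, rule ext)
    fix a p
    show "?w a p = ?u a p"
    proof (cases "p \<in> U a")
      case True
      have "v a p = (if j = 0 then 0 else symP (j - 1) (\<lambda>l. symM j (second s a p l)))"
        using gradient_op2(1)[OF linear_symbol_sym(2,3) s True] by (simp add: v_def)
      then show ?thesis
        using weitzenboeck1[OF SecD(3)[OF s True] second_Ker[OF s True] second_commutator[OF cc s True] j] True
          gradient_op2(1)[OF linear_symbol_sym(1,1) s True]
        by (simp add: r_def algebra_simps)
    next
      case False
      have "gradient_op (symD j) (gradient_op (symD j) s) a p = 0"
        by (rule gradient_op2(2)[OF linear_symbol_sym(1,1) s False])
      then show ?thesis using False SecD(1)[OF v False] SecD(1)[OF s False] by simp
    qed
  qed
  ultimately show "?u \<in> Sec j" by simp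
next
  fix a p w assume "p \<in> U a"
  then show "herm w (?u a p) = - herm w (Div a (\<lambda>k p. nabla M s a p $ k) p)"
    by (simp add: Div_nabla herm_minus)
qed

text \<open>The adjoint symbol of \<open>symM\<close> is the multiple \<open>F\<close> of exterior
  multiplication, and minus its divergence agrees with \<open>symP\<close> up to terms in the image
  of \<open>Wed\<close>, which pairing with the kernel removes. For \<open>adjoint_symP\<close> the
  roles are exchanged.\<close>

lemma adjoint_symM:
  assumes t: "t \<in> Sec i" and i: "2 * Suc i \<le> CARD('n)"
  shows "formal_adjoint M (bundle_E M (Ker (Suc i))) (bundle_E M (Ker i)) (gradient_op (symM (Suc i))) t = gradient_op (symP i) t"
proof -
  define r where "r = 2 / sqrt (real CARD('n) - 2 * real i)"
  define F where "F = (\<lambda>k x. r *\<^sub>R \<E> k x)"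
  have lF: "linear (F k)" for k unfolding F_def by (rule linearI) (simp_all add: op_linear scaleR_add_right)
  have rho_F: "\<rho> a (F k \<phi>) = F k (\<rho> a \<phi>) + (\<Sum>l\<in>UNIV. a $ l $ k *\<^sub>R F l \<phi>)" for a k \<phi>
    by (simp add: F_def lie_linear lie_ext scaleR_add_right scaleR_sum_right mult.commute)
  show ?thesis
  proof (rule formal_adjoint_eqI[where V = "\<lambda>a k p. F k (t a p)"])
    fix s a b p assume s: "s \<in> Sec (Suc i)" and p: "p \<in> U a"
    show "fib_herm (bundle_E M (Ker i)) (gradient_op (symM (Suc i)) s a p) (t a p) = (\<Sum>k\<in>UNIV. herm (nabla M s a p $ k) (F k (t a p)))"
      by (simp add: bundle_E_def gradient_op_def symM_def isum_def F_def r_def herm_scaleR herm_sum herm_int scaleR_sum_right)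
    assume p': "p \<in> U b"
    show "fib_herm (bundle_E M (Ker i)) (gradient_op (symM (Suc i)) s a p) (t a p) = fib_herm (bundle_E M (Ker i)) (gradient_op (symM (Suc i)) s b p) (t b p)"
      unfolding SecD(4)[OF gradient_op_section(2)[OF s refl] p p'] SecD(4)[OF t p p']
      by (simp add: bundle_E_def herm_act[OF transition_spin[OF p p']])
  next
    show "smooth_fun A (U a) (\<lambda>p. F k (t a p))" for a k
      by (rule smooth_fun_linear[OF _ open_U SecD(2)[OF t]]) (use lF in \<open>simp add: linear_conv_bounded_linear\<close>)
  next
    show "gradient_op (symP i) t \<in> Sec (Suc i)" by (rule gradient_op_section(3)[OF t]) (use i in simp)
  next
    fix a p w assume p: "p \<in> U a" and w: "w \<in> Ker (Suc i)"
    have "Div a (\<lambda>k p. F k (t a p)) p = (\<Sum>k\<in>UNIV. F k (nabla M t a p $ k))"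
      by (rule Div_op[where s = t and a = a, OF lF rho_F SecD(2)[OF t] p])
    then show "herm w (gradient_op (symP i) t a p) = - herm w (Div a (\<lambda>k p. F k (t a p)) p)"
      by (simp add: gradient_op_def symP_def symE_def Let_def esum_def F_def r_def herm_scaleR herm_add herm_diff herm_sum
          herm_wedge_Ker[OF w] herm_minus scaleR_sum_right sum_negf)
  qed
qed

lemma adjoint_symP:
  assumes t: "t \<in> Sec (Suc j)" and j: "2 * Suc j \<le> CARD('n)"
  shows "formal_adjoint M (bundle_E M (Ker j)) (bundle_E M (Ker (Suc j))) (gradient_op (symP j)) t = gradient_op (symM (Suc j)) t"
proof -
  define r where "r = - 2 / sqrt (real CARD('n) - 2 * real j)"
  define F where "F = (\<lambda>k x. r *\<^sub>R \<I> k x)"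
  have lF: "linear (F k)" for k unfolding F_def by (rule linearI) (simp_all add: op_linear scaleR_add_right)
  have rho_F: "skew a \<Longrightarrow> \<rho> a (F k \<phi>) = F k (\<rho> a \<phi>) + (\<Sum>l\<in>UNIV. a $ l $ k *\<^sub>R F l \<phi>)" for a k \<phi>
    by (simp add: F_def lie_linear lie_int scaleR_add_right scaleR_sum_right mult.commute)
  show ?thesis
  proof (rule formal_adjoint_eqI[where V = "\<lambda>a k p. F k (t a p)"])
    fix s a b p assume s: "s \<in> Sec j" and p: "p \<in> U a"
    have z: "herm (Wed y) (t a p) = 0" for y
      using SecD(3)[OF t p] by (simp add: herm_wedge KerD herm_eq_0)
    show "fib_herm (bundle_E M (Ker (Suc j))) (gradient_op (symP j) s a p) (t a p) = (\<Sum>k\<in>UNIV. herm (nabla M s a p $ k) (F k (t a p)))"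
      by (simp add: bundle_E_def gradient_op_def symP_def symE_def Let_def esum_def F_def r_def herm_scaleR herm_sum herm_add herm_diff
          herm_ext scaleR_sum_right z sum_negf herm_minus)
    assume p': "p \<in> U b"
    have PS: "gradient_op (symP j) s \<in> Sec (Suc j)" by (rule gradient_op_section(3)[OF s]) (use j in simp)
    show "fib_herm (bundle_E M (Ker (Suc j))) (gradient_op (symP j) s a p) (t a p) = fib_herm (bundle_E M (Ker (Suc j))) (gradient_op (symP j) s b p) (t b p)"
      unfolding SecD(4)[OF PS p p'] SecD(4)[OF t p p']
      by (simp add: bundle_E_def herm_act[OF transition_spin[OF p p']])
  next
    show "smooth_fun A (U a) (\<lambda>p. F k (t a p))" for a k
      by (rule smooth_fun_linear[OF _ open_U SecD(2)[OF t]]) (use lF in \<open>simp add: linear_conv_bounded_linear\<close>)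
  next
    show "gradient_op (symM (Suc j)) t \<in> Sec j" by (rule gradient_op_section(2)[OF t refl])
  next
    fix a p w assume p: "p \<in> U a" and w: "w \<in> Ker j"
    have "Div a (\<lambda>k p. F k (t a p)) p = (\<Sum>k\<in>UNIV. F k (nabla M t a p $ k))"
      by (rule Div_op[where s = t and a = a, OF lF rho_F SecD(2)[OF t] p])
    then show "herm w (gradient_op (symM (Suc j)) t a p) = - herm w (Div a (\<lambda>k p. F k (t a p)) p)"
      by (simp add: gradient_op_def symM_def isum_def F_def r_def herm_scaleR herm_sum herm_minus scaleR_sum_right sum_negf)
  qed
qed

text \<open>Covers the convention that the gradient lowering the index is zero at index 0.\<close>

lemma adjoint_zero: "formal_adjoint M (bundle_E M (Ker j)) (bundle_E M (Ker i)) (\<lambda>s a p. 0) (\<lambda>a p. 0) = (\<lambda>a p. 0)"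
  by (rule formal_adjoint_eqI[where V = "\<lambda>a k p. 0"])
    (simp_all add: bundle_E_def herm_eq_0 Sec_zero[unfolded bundle_E_def] Div_def lie_linear dir_deriv_const[OF frame_tangent])

end

text \<open>The gradients agree with their explicit symbols only on sections of the right bundle,
  which is all that the definition of the adjoint tests.\<close>

lemma formal_adjoint_cong:
  "(\<And>s. s \<in> sections M F \<Longrightarrow> P s = P' s) \<Longrightarrow> formal_adjoint M F G P t = formal_adjoint M F G P' t"
  unfolding formal_adjoint_def by (intro arg_cong[where f = The] ext) auto

context spin_geometry
begin

section \<open>The gradients of the statement as explicit operators\<close>

context
  fixes W P0 Pp Pm
  assumes W: "\<And>k. k \<le> CARD('n) div 2 \<Longrightarrow> W k = Ker k"
    and proj: "are_gradient_projections \<gamma> W P0 Pp Pm"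
begin

lemma nabla_fibre1: "s \<in> Sec k \<Longrightarrow> nabla M s a p \<in> fibre1 (Ker k)"
  by (cases "p \<in> U a") (auto simp: fibre1_def nabla_Ker, simp add: nabla_def Ker_scale)

lemma grad_D_eq:
  assumes k: "k \<le> CARD('n) div 2" and s: "s \<in> Sec k"
  shows "grad_D M P0 k s = gradient_op (symD k) s"
proof (rule ext, rule ext)
  fix a p
  note x = nabla_fibre1[OF s, of a p]
  show "grad_D M P0 k s a p = gradient_op (symD k) s a p"
  proof (cases "2 * k = CARD('n)")
    case True
    then show ?thesis by (simp add: grad_D_def gradient_op_def symD_middle[OF x True])
  next
    case False
    then have k2: "2 * k < CARD('n)" using k by linarith
    from proj k2 obtain r where r: "is_component_projection \<gamma> (Ker k) (Ker k) (P0 k)" "r > 0"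
      "\<forall>x\<in>fibre1 (Ker k). orth_proj (Ker k) (dirac_symbol \<gamma> x) = r *\<^sub>R P0 k x"
      unfolding are_gradient_projections_def W[OF k, symmetric] by blast
    have "sqrt ((real CARD('n) + 2) * (real CARD('n) - 2 * real k) / (real CARD('n) - 2 * real k + 2)) *\<^sub>R P0 k (nabla M s a p) =
        symD k (($) (nabla M s a p))"
      by (rule projection_symD[OF r(1,2) _ _ x]) (use r(3) k2 in auto)
    then show ?thesis using False by (simp add: grad_D_def gradient_op_def Let_def)
  qed
qed

lemma grad_Tp_eq:
  assumes k: "k < CARD('n) div 2" and s: "s \<in> Sec k"
  shows "grad_Tp M Pp k s = gradient_op (symP k) s"
proof (rule ext, rule ext)
  fix a p
  have k': "k \<le> CARD('n) div 2" "Suc k \<le> CARD('n) div 2" using k by auto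
  from proj k obtain r where r: "is_component_projection \<gamma> (W k) (W (k + 1)) (Pp k)" "r > 0"
    "\<forall>x\<in>fibre1 (W k). orth_proj (W (k + 1)) (dirac_symbol \<gamma> (\<chi> l. Wed (x $ l))) = r *\<^sub>R Pp k x"
    unfolding are_gradient_projections_def by blast
  have "(2 * sqrt ((real k + 1) / (real CARD('n) - 2 * real k))) *\<^sub>R Pp k (nabla M s a p) = symP k (($) (nabla M s a p))"
    by (rule projection_symP[OF _ r(2) _ _ nabla_fibre1[OF s]]) (use r k in \<open>auto simp: W[OF k'(1)] W[OF k'(2)]\<close>)
  then show "grad_Tp M Pp k s a p = gradient_op (symP k) s a p"
    using k by (simp add: grad_Tp_def gradient_op_def Let_def)
qed

lemma grad_Tm_eq:
  assumes k: "Suc i \<le> CARD('n) div 2" and s: "s \<in> Sec (Suc i)"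
  shows "grad_Tm M Pm (Suc i) s = gradient_op (symM (Suc i)) s"
proof (rule ext, rule ext)
  fix a p
  have k': "i \<le> CARD('n) div 2" using k by auto
  have "Suc i \<in> {1..CARD('n) div 2}" using k by simp
  with proj obtain r where r: "is_component_projection \<gamma> (W (Suc i)) (W (Suc i - 1)) (Pm (Suc i))" "r > 0"
    "\<forall>x\<in>fibre1 (W (Suc i)). orth_proj (Wed ` W (Suc i - 1)) (dirac_symbol \<gamma> x) = r *\<^sub>R Wed (Pm (Suc i) x)"
    unfolding are_gradient_projections_def by blast
  have "(2 * sqrt ((real CARD('n) - 2 * real (Suc i) + 1) * (real CARD('n) - real (Suc i) + 2) /
      ((real CARD('n) - 2 * real (Suc i) + 3) * (real CARD('n) - 2 * real (Suc i) + 2)))) *\<^sub>R Pm (Suc i) (nabla M s a p) =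
      symM (Suc i) (($) (nabla M s a p))"
    by (rule projection_symM[OF _ r(2) _ _ nabla_fibre1[OF s]]) (use r k in \<open>auto simp: W[OF k'] W[OF k]\<close>)
  then show "grad_Tm M Pm (Suc i) s a p = gradient_op (symM (Suc i)) s a p"
    by (simp only: grad_Tm_def gradient_op_def Let_def) simp
qed

end

end

theorem theorem19:
  fixes M :: "('m::{t2_space,second_countable_topology}, 'n::{finite,linorder}, 's::finite, 'i) spin_manifold"
    and c n :: real and j :: nat
    and W :: "nat \<Rightarrow> ('n, 's) twisted set"
    and P0 Pp Pm :: "nat \<Rightarrow> ('n, 's) twisted1 \<Rightarrow> ('n, 's) twisted"
  defines "n \<equiv> real CARD('n)"
  defines "\<Gamma> \<equiv> \<lambda>k. sections M (bundle_E M (W k))"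
    and "\<Delta> \<equiv> std_laplacian M W"
    and "D \<equiv> grad_D M P0" and "Tp \<equiv> grad_Tp M Pp" and "Tm \<equiv> grad_Tm M Pm"
    and "adj \<equiv> \<lambda>k l. formal_adjoint M (bundle_E M (W k)) (bundle_E M (W l))"
  assumes dim: "CARD('n) \<ge> 3"
    and spin: "is_spin_manifold M"
    and curv: "has_constant_curvature (atlas M) (metric M) (lc M) c"
    and module: "\<And>k. k \<le> CARD('n) div 2 \<Longrightarrow> is_delta_module (gam M) k (W k)"
    and embed: "\<And>k. k \<le> CARD('n) div 2 \<Longrightarrow> W k = cliff_kernel (gam M) k"
    and proj: "are_gradient_projections (gam M) W P0 Pp Pm"
    and j: "j \<le> CARD('n) div 2"
  shows
    "(\<forall>s\<in>\<Gamma> j. \<forall>a p. \<Delta> j s a p =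
        D j (D j s) a p + adj j (j - 1) (Tm j) (Tm j s) a p
        + ((j * (n - j) - n * (n - 1) / 8) * c) *\<^sub>R s a p)
   \<and> (CARD('n) - 2 * j \<notin> {0, 1} \<longrightarrow>
      (\<forall>s\<in>\<Gamma> j. \<forall>a p. \<Delta> j s a p =
        - ((n - 2 * j + 1) / (n - 2 * j - 1)) *\<^sub>R adj j (j + 1) (Tp j) (Tp j s) a p
        + ((n - 2 * j + 2)\<^sup>2 / (n - 2 * j)\<^sup>2) *\<^sub>R D j (D j s) a p
        + (((real j - 1) * (n - j + 1) - n * (n - 1) / 8) * c) *\<^sub>R s a p))
   \<and> (j \<ge> 1 \<longrightarrow>
      (\<forall>s\<in>\<Gamma> (j - 1). \<forall>a p. D j (Tp (j - 1) s) a p =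
        ((n - 2 * j) / (n - 2 * j + 2)) *\<^sub>R Tp (j - 1) (D (j - 1) s) a p))
   \<and> (j + 1 \<le> CARD('n) div 2 \<longrightarrow>
      (\<forall>s\<in>\<Gamma> j. \<forall>a p. Tp (j + 1) (Tp j s) a p = 0))
   \<and> (j \<ge> 1 \<longrightarrow>
      (\<forall>s\<in>\<Gamma> j. \<forall>a p. Tm (j - 1) (Tm j s) a p = 0))
   \<and> (j \<ge> 1 \<longrightarrow>
      (\<forall>s\<in>\<Gamma> (j - 1). \<forall>a p. Tp (j - 1) s a p = adj j (j - 1) (Tm j) s a p))"
proof -
  interpret spin_geometry M by unfold_locales (rule spin)
  note gD = grad_D_eq[OF embed proj] and gP = grad_Tp_eq[OF embed proj] and gM = grad_Tm_eq[OF embed proj]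
  note L = linear_symbol_sym
  have G: "\<Gamma> k = Sec k" if "k \<le> CARD('n) div 2" for k by (simp add: \<Gamma>_def embed[OF that])
  have j2: "2 * j \<le> CARD('n)" using j by linarith
  have half: "2 * k \<le> CARD('n)" if "k \<le> CARD('n) div 2" for k using that by linarith
  have DS: "gradient_op (symD k) s \<in> Sec k" if "s \<in> Sec k" "k \<le> CARD('n) div 2" for s k
    by (rule gradient_op_section(1)[OF that(1) half[OF that(2)]])
  have DD: "D k s = gradient_op (symD k) s" if "s \<in> Sec k" "k \<le> CARD('n) div 2" for s k
    unfolding D_def by (rule gD[OF _ that(2,1)])
  have PP: "Tp k s = gradient_op (symP k) s" if "s \<in> Sec k" "k < CARD('n) div 2" for s k
    unfolding Tp_def by (rule gP[OF _ that(2,1)])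
  have MM: "Tm (Suc i) s = gradient_op (symM (Suc i)) s" if "s \<in> Sec (Suc i)" "Suc i \<le> CARD('n) div 2" for s i
    unfolding Tm_def by (rule gM[OF _ that(2,1)])
  have M0: "Tm 0 s = (\<lambda>a p. 0)" for s by (simp add: Tm_def grad_Tm_def fun_eq_iff)
  have aM: "adj (Suc i) i (Tm (Suc i)) t = gradient_op (symP i) t" if "t \<in> Sec i" "Suc i \<le> CARD('n) div 2" for t i
  proof -
    have "i \<le> CARD('n) div 2" using that by simp
    then have "adj (Suc i) i (Tm (Suc i)) t =
        formal_adjoint M (bundle_E M (Ker (Suc i))) (bundle_E M (Ker i)) (gradient_op (symM (Suc i))) t"
      unfolding adj_def using that(2) by (simp add: embed, intro formal_adjoint_cong MM)
    then show ?thesis using adjoint_symM[OF that(1) half[OF that(2)]] by simp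
  qed
  have aP: "adj k (k + 1) (Tp k) t = gradient_op (symM (Suc k)) t" if "t \<in> Sec (Suc k)" "Suc k \<le> CARD('n) div 2" for t k
  proof -
    have "k \<le> CARD('n) div 2" "k < CARD('n) div 2" using that by simp_all
    then have "adj k (k + 1) (Tp k) t =
        formal_adjoint M (bundle_E M (Ker k)) (bundle_E M (Ker (Suc k))) (gradient_op (symP k)) t"
      unfolding adj_def using that(2) by (simp add: embed, intro formal_adjoint_cong PP)
    then show ?thesis using adjoint_symP[OF that(1) half[OF that(2)]] by simp
  qed
  have lap: "\<Delta> j s a p = (if p \<in> U a then - (\<Sum>k\<in>UNIV. second s a p k k) else 0) +
      ((real j * (n - real j + 1) + n * (n - 1) / 8) * c) *\<^sub>R s a p" if s: "s \<in> Sec j" for s a p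
    by (simp add: \<Delta>_def std_laplacian_def embed[OF j] adjoint_nabla[OF curv s j2] curv_endo_constant_curvature[OF curv s] n_def)
  note H = second_Ker and R = second_commutator[OF curv]
  note out = gradient_op2(2)[OF L(1)]
  have "\<Delta> j s a p = D j (D j s) a p + adj j (j - 1) (Tm j) (Tm j s) a p + ((j * (n - j) - n * (n - 1) / 8) * c) *\<^sub>R s a p"
    if s: "s \<in> Sec j" for s a p
  proof -
    have Ds: "D j (D j s) = gradient_op (symD j) (gradient_op (symD j) s)"
      using DD[OF s j] DD[OF DS[OF s j] j] by simp
    define v where "v = adj j (j - 1) (Tm j) (Tm j s)"
    have v: "v a p = (if p \<in> U a then if j = 0 then 0 else symP (j - 1) (\<lambda>l. symM j (second s a p l)) else 0)"
    proof (cases j)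
      \<comment> \<open>Truncated subtraction makes the target index \<open>j - 1\<close> equal to
        0, and the adjoint is that of the zero operator.\<close>
      case 0
      have "v = (\<lambda>a p. 0)"
        unfolding v_def adj_def using adjoint_zero[of 0 0] by (simp add: 0 M0[abs_def] embed)
      then show ?thesis by (simp add: 0)
    next
      case (Suc i)
      have si: "s \<in> Sec (Suc i)" "Suc i \<le> CARD('n) div 2" using s j Suc by auto
      have "v = gradient_op (symP i) (gradient_op (symM (Suc i)) s)"
        unfolding v_def Suc diff_Suc_1 MM[OF si] by (rule aM[OF gradient_op_section(2)[OF si(1) refl] si(2)])
      then show ?thesis
        using gradient_op2(1)[OF L(2,3) si(1)] gradient_op2(2)[OF L(3,3) si(1)] by (simp add: Suc)
    qed
    show ?thesis
    proof (cases "p \<in> U a")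
      case True
      \<comment> \<open>The curvature endomorphism splits into the constant absorbed by
        \<open>weitzenboeck1\<close> and the zeroth-order term of the claim.\<close>
      have "(real j * (n - real j + 1) + n * (n - 1) / 8) * c =
          (n * (n - 1) / 4 + real j) * c + (real j * (n - real j) - n * (n - 1) / 8) * c"
        by (simp add: field_simps)
      then show ?thesis
        using weitzenboeck1[OF SecD(3)[OF s True] H[OF s True] R[OF s True] j2] True
        unfolding lap[OF s] v_def[symmetric] v Ds gradient_op2(1)[OF L(1,1) s True]
        by (simp add: n_def scaleR_add_left add.assoc[symmetric])
    next
      case False
      show ?thesis unfolding lap[OF s] v_def[symmetric] v Ds
        using False gradient_op2(2)[OF L(1,1) s False] SecD(1)[OF s False] by simp
    qed
  qed
  moreover have "\<Delta> j s a p =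
        - ((n - 2 * j + 1) / (n - 2 * j - 1)) *\<^sub>R adj j (j + 1) (Tp j) (Tp j s) a p
        + ((n - 2 * j + 2)\<^sup>2 / (n - 2 * j)\<^sup>2) *\<^sub>R D j (D j s) a p
        + (((real j - 1) * (n - j + 1) - n * (n - 1) / 8) * c) *\<^sub>R s a p"
    if s: "s \<in> Sec j" and nj: "CARD('n) - 2 * j \<notin> {0, 1}" for s a p
  proof -
    have j3: "2 * j + 2 \<le> CARD('n)" "2 * j < CARD('n)" "Suc j \<le> CARD('n) div 2" "j < CARD('n) div 2" using nj j by auto
    have Ds: "D j (D j s) = gradient_op (symD j) (gradient_op (symD j) s)"
      using DD[OF s j] DD[OF DS[OF s j] j] by simp
    have A: "adj j (j + 1) (Tp j) (Tp j s) = gradient_op (symM (Suc j)) (gradient_op (symP j) s)"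
      unfolding PP[OF s j3(4)] by (rule aP[OF gradient_op_section(3)[OF s j3(2)] j3(3)])
    show ?thesis
    proof (cases "p \<in> U a")
      case True
      \<comment> \<open>The same splitting with the constant of
        \<open>weitzenboeck2\<close>.\<close>
      have "(real j * (n - real j + 1) + n * (n - 1) / 8) * c =
          (n * (n - 1) / 4 + n - real j + 1) * c + ((real j - 1) * (n - real j + 1) - n * (n - 1) / 8) * c"
        by (simp add: field_simps)
      then show ?thesis
        using weitzenboeck2[OF SecD(3)[OF s True] H[OF s True] R[OF s True] j3(1)] True
        unfolding lap[OF s] Ds A gradient_op2(1)[OF L(1,1) s True] gradient_op2(1)[OF L(3,2) s True]
        by (simp add: n_def scaleR_add_left add.assoc[symmetric])
    next
      case False
      show ?thesis unfolding lap[OF s] Ds A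
        using False gradient_op2(2)[OF L(1,1) s False] gradient_op2(2)[OF L(2,2) s False] SecD(1)[OF s False] by simp
    qed
  qed
  moreover have "D j (Tp (j - 1) s) a p = ((n - 2 * j) / (n - 2 * j + 2)) *\<^sub>R Tp (j - 1) (D (j - 1) s) a p"
    if s: "s \<in> Sec (j - 1)" and j1: "j \<ge> 1" for s a p
  proof -
    obtain i where i: "j = Suc i" using j1 by (cases j) auto
    have si: "s \<in> Sec i" "i < CARD('n) div 2" "i \<le> CARD('n) div 2" "Suc i \<le> CARD('n) div 2" "2 * i < CARD('n)" "2 * Suc i \<le> CARD('n)"
      using s j i by auto
    have e: "D j (Tp (j - 1) s) = gradient_op (symD (Suc i)) (gradient_op (symP i) s)"
      "Tp (j - 1) (D (j - 1) s) = gradient_op (symP i) (gradient_op (symD i) s)"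
      unfolding i diff_Suc_1 PP[OF si(1,2)] DD[OF si(1,3)]
      by (rule DD[OF gradient_op_section(3)[OF si(1,5)] si(4)] PP[OF DS[OF si(1,3)] si(2)])+
    show ?thesis
    proof (cases "p \<in> U a")
      case True
      show ?thesis
        unfolding e gradient_op2(1)[OF L(3,1) si(1) True] gradient_op2(1)[OF L(1,3) si(1) True]
          sym_DP[OF SecD(3)[OF si(1) True] H[OF si(1) True] R[OF si(1) True] si(6)] by (simp add: i n_def)
    next
      case False
      show ?thesis unfolding e
        using gradient_op2(2)[OF L(1,1) si(1) False] gradient_op2(2)[OF L(3,3) si(1) False] by simp
    qed
  qed
  moreover have "Tp (j + 1) (Tp j s) a p = 0" if s: "s \<in> Sec j" and j1: "j + 1 \<le> CARD('n) div 2" for s a p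
  \<comment> \<open>At the top index the outer gradient is zero by definition; the symbol identity
    is needed only below it.\<close>
  proof (cases "j + 1 = CARD('n) div 2")
    case True
    then show ?thesis by (simp add: Tp_def grad_Tp_def)
  next
    case False
    then have j3: "j < CARD('n) div 2" "Suc j < CARD('n) div 2" "2 * j < CARD('n)" "2 * Suc j < CARD('n)" using j1 by auto
    have e: "Tp (j + 1) (Tp j s) = gradient_op (symP (Suc j)) (gradient_op (symP j) s)"
      using PP[OF s j3(1)] PP[OF gradient_op_section(3)[OF s j3(3)] j3(2)] by simp
    show ?thesis
    proof (cases "p \<in> U a")
      case True
      show ?thesis
        unfolding e gradient_op2(1)[OF L(3,3) s True]
        by (rule sym_PP[OF SecD(3)[OF s True] H[OF s True] R[OF s True] j3(4)])
    next
      case False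
      show ?thesis unfolding e by (rule gradient_op2(2)[OF L(3,3) s False])
    qed
  qed
  moreover have "Tm (j - 1) (Tm j s) a p = 0" if s: "s \<in> Sec j" and j1: "j \<ge> 1" for s a p
  \<comment> \<open>For \<open>j = 1\<close> the outer gradient has index 0 and is zero by
    definition.\<close>
  proof (cases "j = 1")
    case True
    then show ?thesis by (simp add: M0)
  next
    case False
    then obtain i where i: "j = Suc (Suc i)" using j1 by (metis One_nat_def not_less_eq_eq old.nat.exhaust le_0_eq)
    have si: "s \<in> Sec (Suc (Suc i))" "Suc (Suc i) \<le> CARD('n) div 2" "Suc i \<le> CARD('n) div 2" using s j i by auto
    have e: "Tm (j - 1) (Tm j s) = gradient_op (symM (Suc i)) (gradient_op (symM (Suc (Suc i))) s)"
      unfolding i diff_Suc_1 MM[OF si(1,2)] by (rule MM[OF gradient_op_section(2)[OF si(1) refl] si(3)])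
    show ?thesis
    proof (cases "p \<in> U a")
      case True
      show ?thesis
        unfolding e gradient_op2(1)[OF L(2,2) si(1) True]
        by (rule sym_MM[OF SecD(3)[OF si(1) True] R[OF si(1) True]])
    next
      case False
      show ?thesis unfolding e by (rule gradient_op2(2)[OF L(2,2) s False])
    qed
  qed
  moreover have "Tp (j - 1) s a p = adj j (j - 1) (Tm j) s a p" if s: "s \<in> Sec (j - 1)" and j1: "j \<ge> 1" for s a p
  proof -
    obtain i where i: "j = Suc i" using j1 by (cases j) auto
    have si: "s \<in> Sec i" "i < CARD('n) div 2" "Suc i \<le> CARD('n) div 2" using s j i by auto
    show ?thesis unfolding i diff_Suc_1 PP[OF si(1,2)] aM[OF si(1,3)] ..
  qed
  moreover have "j - 1 \<le> CARD('n) div 2" using j by simp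
  ultimately show ?thesis unfolding G[OF j] G[OF \<open>j - 1 \<le> CARD('n) div 2\<close>] by blast
qed

end
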